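(* Let $d\in\mathbb N$, let $n_1,\dots,n_d\ge2$ be integers, let $I=\prod_{k=1}^d\{0,1,\dots,n_k-1\}$, and let $r\in\mathbb N$ with $1\le r\le(\prod_{k=1}^dn_k)-1$. Suppose that the sets $I^{(j)}\subset I$ ($j\ge1$) are chosen independently, each according to the uniform distribution on the collection of subsets $I'\subset I$ with $\#(I\setminus I')=r$. Consider the non-autonomous fractal $d$-cube $(\Phi^{(j)})_{j\ge1}$, $\Phi^{(j)}=\{f_{\mathbf i}\}_{\mathbf i\in I^{(j)}}$, on $X=[0,1]^d$ with limit set $J$. Then: ($d$.1) If $r<d$, then $J$ is connected and locally connected. ($d$.2) If $k\in\{1,\dots,d\}$ satisfies $r<\prod_{\ell\ne k}n_\ell$, then $J$ contains a line segment which connects the face $x_k=0$ to the opposite face $x_k=1$. ($d$.3) If $k\in\{1,\dots,d\}$ satisfies $r\ge\prod_{\ell\ne k}n_\ell$, then almost surely every connected component $C$ of $J$ has its projection $\pi_k(C)$ onto the $x_k$-coordinate equal to a single point. ($d$.4) If $r\ge\prod_{\ell\ne k}n_\ell$ for every $k=1,\dots,d$, then almost surely $J$ is totally disconnected. Moreover, in the planar case $d=2$, $J$ satisfies $\check H_q(J)=0$ for every $q\ge2$, and the following hold. (2.1) If $r=1$, then $\check H_0(J)\cong\mathbb Z$. In addition: (a) if $n_1=n_2=2$, then $\check H_1(J)=0$ almost surely; (b) if $(n_1,n_2)\ne(2,2)$, then $$\lim_{k\to\infty}\frac1k\log\big(\mathrm{rank}\,H_1(\mathcal N_{0,k})\big)=\log(n_1n_2-r)$$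 almost surely. (2.2) If $2\le r<\min\{n_1,n_2\}$, then almost surely $$\lim_{k\to\infty}\frac1k\log\big(\mathrm{rank}\,H_0(\mathcal N_{0,k})\big)=\log(n_1n_2-r)\quad\text{and}\quad\lim_{k\to\infty}\frac1k\log\big(\mathrm{rank}\,H_1(\mathcal N_{0,k})\big)=\log(n_1n_2-r).$$ (2.3) If $n_1\le r<n_2$ (resp. $n_2\le r<n_1$), then almost surely every connected component of $J$ is a horizontal (resp. vertical) line segment, possibly degenerate to a single point, and at least one component has length $1$. (2.4) If $r\ge\max\{n_1,n_2\}$, then almost surely $J$ is totally disconnected. Furthermore, still for $d=2$, for all $k>0$ and $q\ge0$ the homology group $H_q(\mathcal N_{0,k})$ is free, and hence isomorphic to the cohomology group $H^q(\mathcal N_{0,k})$.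
   Context: For $\mathbf i=(i_1,\dots,i_d)\in I$ let $f_{\mathbf i}\colon[0,1]^d\to[0,1]^d$, $f_{\mathbf i}(x_1,\dots,x_d)=\big(\tfrac{x_1+i_1}{n_1},\dots,\tfrac{x_d+i_d}{n_d}\big)$. Given non-empty subsets $I^{(j)}\subset I$, the limit set of $(\Phi^{(j)})_{j\ge1}$ is $J=\Pi(\prod_{j\ge1}I^{(j)})$, where the coding map $\Pi$ is defined by $\{\Pi(\mathbf i_1,\mathbf i_2,\dots)\}=\bigcap_{j\ge1}f_{\mathbf i_1}\circ\cdots\circ f_{\mathbf i_j}(X)$. For $j\ge0$, $J_j$ is the limit set of the shifted system $(\Phi^{(j+k)})_{k\ge1}$, so $J_0=J$. For $0\le j<k$ and $v=(\mathbf i_{j+1},\dots,\mathbf i_k)\in I^{(j+1)}\times\cdots\times I^{(k)}$ put $f_v=f_{\mathbf i_{j+1}}\circ\cdots\circ f_{\mathbf i_k}$. The nerve $\mathcal N_{j,k}$ is the abstract simplicial complex with vertex set $I^{(j+1)}\times\cdots\times I^{(k)}$, in which a set $\{v_0,\dots,v_q\}$ of mutually distinct vertices is a simplex iff $\bigcap_{p=0}^qf_{v_p}(J_k)\ne\emptyset$. $H_q$ and $H^q$ denote simplicial homology and cohomology with $\mathbb Z$ coefficients. $\check H_q(Y)=\varprojlim_{\mathfrak U}H_q(N(\mathfrak U))$ is integral Čech homology, where $\mathfrak U$ runs over the finite open coverings of $Y$ ordered by refinement and $N(\mathfrak U)$ is the nerve. $\pi_k\colon\mathbb R^d\to\mathbb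 R$ is the projection onto the $k$th coordinate. For $d=1$ the empty product $\prod_{\ell\ne k}n_\ell$ equals $1$. *)

theory Defs
  imports "HOL-Probability.Probability" "HOL-Algebra.Free_Abelian_Groups"
begin

section \<open>Non-autonomous fractal cubes\<close>

definition digit_set :: "nat^'d \<Rightarrow> (nat^'d) set"
  where "digit_set n = {i. \<forall>k. i $ k < n $ k}"

definition cube_map :: "nat^'d \<Rightarrow> nat^'d \<Rightarrow> real^'d \<Rightarrow> real^'d"
  where "cube_map n i x = (\<chi> k. (x $ k + real (i $ k)) / real (n $ k))"

text \<open>For a word \<open>v = [i\<^sub>1, \<dots>, i\<^sub>m]\<close> this is the composition of the maps of
  \<open>i\<^sub>1, \<dots>, i\<^sub>m\<close>, the map of \<open>i\<^sub>m\<close> being applied first.\<close>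
definition word_map :: "nat^'d \<Rightarrow> (nat^'d) list \<Rightarrow> real^'d \<Rightarrow> real^'d"
  where "word_map n v = foldr (\<lambda>i g. cube_map n i \<circ> g) v id"

text \<open>Sequences of digits and of digit sets are indexed from 1; their value at 0 is never used.
  The box \<open>cbox 0 1\<close> is the unit cube.\<close>
definition coding_map :: "nat^'d \<Rightarrow> (nat \<Rightarrow> nat^'d) \<Rightarrow> real^'d"
  where "coding_map n i =
    (THE x. (\<Inter>j\<in>{1..}. word_map n (map i [1..<Suc j]) ` cbox 0 1) = {x})"

definition limit_set :: "nat^'d \<Rightarrow> (nat \<Rightarrow> (nat^'d) set) \<Rightarrow> (real^'d) set"
  where "limit_set n S = coding_map n ` (\<Pi>\<^sub>E j\<in>{1..}. S j)"

definition shifted_limit_set :: "nat^'d \<Rightarrow> (nat \<Rightarrow> (nat^'d) set) \<Rightarrow> nat \<Rightarrow> (real^'d) set"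
  where "shifted_limit_set n S j = limit_set n (\<lambda>k. S (j + k))"

text \<open>The possible values of the random digit sets.\<close>
definition digit_subsets :: "nat^'d \<Rightarrow> nat \<Rightarrow> (nat^'d) set set"
  where "digit_subsets n r = {A. A \<subseteq> digit_set n \<and> card (digit_set n - A) = r}"

definition totally_disconnected :: "'a::topological_space set \<Rightarrow> bool"
  where "totally_disconnected X \<longleftrightarrow> (\<forall>C\<in>components X. \<exists>x. C = {x})"


section \<open>Simplicial homology and cohomology\<close>

text \<open>An abstract simplicial complex is represented by the set of its (finite, non-empty)
  simplices.\<close>
definition nerve_complex :: "'v set \<Rightarrow> ('v \<Rightarrow> 'a set) \<Rightarrow> 'v set set"
  where "nerve_complex A F = {s. s \<subseteq> A \<and> finite s \<and> s \<noteq> {} \<and> (\<Inter>v\<in>s. F v) \<noteq> {}}"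

definition fractal_nerve ::
    "nat^'d \<Rightarrow> (nat \<Rightarrow> (nat^'d) set) \<Rightarrow> nat \<Rightarrow> nat \<Rightarrow> (nat^'d) list set set"
  where "fractal_nerve n S j k =
    nerve_complex (listset (map S [Suc j..<Suc k]))
                  (\<lambda>v. word_map n v ` shifted_limit_set n S k)"

text \<open>Simplices are oriented by a linear ordering of the vertices, fixed once and for all on
  each type. Up to isomorphism, homology and cohomology do not depend on it.\<close>
definition vertex_less :: "'v \<Rightarrow> 'v \<Rightarrow> bool"
  where "vertex_less u v \<longleftrightarrow> (u, v) \<in> (SOME R. strict_linear_order R)"

definition chain_group :: "'v set set \<Rightarrow> nat \<Rightarrow> ('v set \<Rightarrow>\<^sub>0 int) monoid"
  where "chain_group K q = free_Abelian_group {s \<in> K. card s = Suc q}"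

text \<open>On a simplex with vertices \<open>v\<^sub>0 < \<dots> < v\<^sub>q\<close>, the vertex \<open>v\<^sub>i\<close> has exactly
  \<open>i\<close> predecessors, so its opposite face gets the usual sign \<open>(-1)^i\<close>.\<close>
definition boundary_map :: "nat \<Rightarrow> ('v set \<Rightarrow>\<^sub>0 int) \<Rightarrow> ('v set \<Rightarrow>\<^sub>0 int)"
  where "boundary_map q c = (if q = 0 then 0 else
    frag_extend (\<lambda>s. \<Sum>v\<in>s. frag_cmul ((-1) ^ card {u\<in>s. vertex_less u v}) (frag_of (s - {v}))) c)"

definition cycle_group :: "'v set set \<Rightarrow> nat \<Rightarrow> ('v set \<Rightarrow>\<^sub>0 int) monoid"
  where "cycle_group K q =
    (chain_group K q)\<lparr>carrier := {c \<in> carrier (chain_group K q). boundary_map q c = 0}\<rparr>"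

definition boundaries :: "'v set set \<Rightarrow> nat \<Rightarrow> ('v set \<Rightarrow>\<^sub>0 int) set"
  where "boundaries K q = boundary_map (Suc q) ` carrier (chain_group K (Suc q))"

definition simplicial_homology :: "nat \<Rightarrow> 'v set set \<Rightarrow> ('v set \<Rightarrow>\<^sub>0 int) set monoid"
  where "simplicial_homology q K = cycle_group K q Mod boundaries K q"

text \<open>The integral cochains are the homomorphisms from the chain group to the integers
  (extended by \<open>undefined\<close> outside the chain group), with pointwise addition.\<close>
definition cochain_group :: "'v set set \<Rightarrow> nat \<Rightarrow> (('v set \<Rightarrow>\<^sub>0 int) \<Rightarrow> int) monoid"
  where "cochain_group K q =
    (product_group (carrier (chain_group K q)) (\<lambda>_. integer_group))
      \<lparr>carrier := hom (chain_group K q) integer_group \<inter> extensional (carrier (chain_group K q))\<rparr>"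

definition coboundary_map ::
    "'v set set \<Rightarrow> nat \<Rightarrow> (('v set \<Rightarrow>\<^sub>0 int) \<Rightarrow> int) \<Rightarrow> (('v set \<Rightarrow>\<^sub>0 int) \<Rightarrow> int)"
  where "coboundary_map K q \<phi> =
    (\<lambda>c\<in>carrier (chain_group K (Suc q)). \<phi> (boundary_map (Suc q) c))"

definition cocycle_group :: "'v set set \<Rightarrow> nat \<Rightarrow> (('v set \<Rightarrow>\<^sub>0 int) \<Rightarrow> int) monoid"
  where "cocycle_group K q =
    (cochain_group K q)\<lparr>carrier :=
      kernel (cochain_group K q) (cochain_group K (Suc q)) (coboundary_map K q)\<rparr>"

definition coboundaries :: "'v set set \<Rightarrow> nat \<Rightarrow> (('v set \<Rightarrow>\<^sub>0 int) \<Rightarrow> int) set"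
  where "coboundaries K q = (if q = 0 then {\<one>\<^bsub>cochain_group K 0\<^esub>}
    else coboundary_map K (q - 1) ` carrier (cochain_group K (q - 1)))"

definition simplicial_cohomology ::
    "nat \<Rightarrow> 'v set set \<Rightarrow> (('v set \<Rightarrow>\<^sub>0 int) \<Rightarrow> int) set monoid"
  where "simplicial_cohomology q K = cocycle_group K q Mod coboundaries K q"

text \<open>The exponent counts the inversions of \<open>f\<close> on \<open>s\<close>, so the sign is that of the
  permutation sorting the images of the vertices; simplices that \<open>f\<close> collapses go to 0.\<close>
definition simplicial_chain_map ::
    "('v \<Rightarrow> 'w) \<Rightarrow> ('v set \<Rightarrow>\<^sub>0 int) \<Rightarrow> ('w set \<Rightarrow>\<^sub>0 int)"
  where "simplicial_chain_map f = frag_extend (\<lambda>s. if inj_on f s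
    then frag_cmul ((-1) ^ card {(u, v) \<in> s \<times> s. vertex_less u v \<and> vertex_less (f v) (f u)})
           (frag_of (f ` s))
    else 0)"

text \<open>The homomorphism into the homology of \<open>L\<close> induced by a simplicial map \<open>f\<close>; the
  image below is a singleton since \<open>f\<close> preserves boundaries.\<close>
definition simplicial_hom_induced ::
    "nat \<Rightarrow> 'w set set \<Rightarrow> ('v \<Rightarrow> 'w) \<Rightarrow> ('v set \<Rightarrow>\<^sub>0 int) set \<Rightarrow> ('w set \<Rightarrow>\<^sub>0 int) set"
  where "simplicial_hom_induced q L f X =
    the_elem ((\<lambda>c. boundaries L q #>\<^bsub>cycle_group L q\<^esub> simplicial_chain_map f c) ` X)"


section \<open>Integral Cech homology\<close>

definition finite_open_covers :: "'a topology \<Rightarrow> 'a set set set"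
  where "finite_open_covers X = {\<U>. finite \<U> \<and> (\<forall>U\<in>\<U>. openin X U) \<and> \<Union>\<U> = topspace X}"

text \<open>\<open>\<V>\<close> refines \<open>\<U>\<close> iff such a \<open>p\<close> exists. All these \<open>p\<close> are contiguous as maps
  of nerves and hence induce the same map in homology.\<close>
definition refinement_projection :: "('a set \<Rightarrow> 'a set) \<Rightarrow> 'a set set \<Rightarrow> 'a set set \<Rightarrow> bool"
  where "refinement_projection p \<V> \<U> \<longleftrightarrow> (\<forall>V\<in>\<V>. p V \<in> \<U> \<and> V \<subseteq> p V)"

definition cech_homology :: "nat \<Rightarrow> 'a topology \<Rightarrow> ('a set set \<Rightarrow> ('a set set \<Rightarrow>\<^sub>0 int) set) monoid"
  where "cech_homology q X =
    (let P = product_group (finite_open_covers X)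
               (\<lambda>\<U>. simplicial_homology q (nerve_complex \<U> id))
     in P\<lparr>carrier := {x \<in> carrier P.
           \<forall>\<U>\<in>finite_open_covers X. \<forall>\<V>\<in>finite_open_covers X. \<forall>p.
             refinement_projection p \<V> \<U> \<longrightarrow>
             simplicial_hom_induced q (nerve_complex \<U> id) p (x \<V>) = x \<U>}\<rparr>)"


section \<open>Rank and freeness of abelian groups\<close>

definition int_independent :: "('a, 'b) monoid_scheme \<Rightarrow> 'a set \<Rightarrow> bool"
  where "int_independent G B \<longleftrightarrow> finite B \<and> B \<subseteq> carrier G \<and>
    (\<forall>a :: 'a \<Rightarrow> int. (\<Otimes>\<^bsub>G\<^esub>x\<in>B. x [^]\<^bsub>G\<^esub> a x) = \<one>\<^bsub>G\<^esub> \<longrightarrow> (\<forall>x\<in>B. a x = 0))"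

text \<open>Only meaningful for groups of finite rank, such as the homology groups of finite
  complexes.\<close>
definition abelian_rank :: "('a, 'b) monoid_scheme \<Rightarrow> nat"
  where "abelian_rank G = Sup {card B | B. int_independent G B}"

text \<open>It is no restriction to take the basis inside \<open>G\<close>.\<close>
definition free_abelian :: "('a, 'b) monoid_scheme \<Rightarrow> bool"
  where "free_abelian G \<longleftrightarrow> (\<exists>B\<subseteq>carrier G. G \<cong> free_Abelian_group B)"

end

theory Submission
  imports Defs
begin

text \<open>
  Everything rests on two properties of a realisation of the digit sets. Each of them is
  \<^emph>\<open>regular\<close>: at every level exactly \<open>r\<close> of the digits are missing. Almost all of them are
  \<^emph>\<open>recurrent\<close>: whatever pair of digit sets is prescribed, it shows up at two consecutive levels
  \<open>j, j + 1\<close> with \<open>j\<close> between roughly \<open>k - k / m\<close> and \<open>k\<close>, for every \<open>m\<close> and all large \<open>k\<close>. A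
  window of length proportional to \<open>k\<close> misses the pair with exponentially small probability, so
  this is the lemma of Borel and Cantelli (\<open>AE_recurrent\<close>). The rest of the argument is
  deterministic.

  Few missing digits. A box of the grid from which fewer points are removed than it has dimensions
  stays connected (\<open>subgrid_connected\<close>), and if \<open>r\<close> is smaller than the number of grid lines in
  direction \<open>k\<close>, one such line is complete. Complete lines at all levels combine to a segment
  of the limit set across the whole cube (\<open>regular_segment\<close>). For \<open>r\<close> below the dimension both
  facts apply: neighbouring cells meet at the two ends of such segments, so all finite
  approximations of the limit set are connected, and so is their intersection; the small
  connected pieces of level \<open>k\<close> then give local connectedness.

  Many missing digits. If \<open>r\<close> is at least the number of digits with \<open>k\<close>th entry 0, recurrence
  produces infinitely many levels at which all of those are missing. Such a level leaves
  gaps in the \<open>k\<close>th coordinate at an arbitrarily fine scale, hence no component of the limit set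
  can move in that coordinate (\<open>recurrent_projection\<close>).

  Nerves in the plane. The cells of level \<open>k\<close> sit at integer points, and cells that meet
  differ by at most 1 in each coordinate. Remove the lexicographically last cell: its neighbours
  are at most four cells, and its link has no homology above degree 0. Deleting cells one after the
  other shows that the homology of the nerve vanishes above degree 1 and is torsion-free
  (\<open>planar_complex_homology\<close>). Torsion-freeness makes homology free and isomorphic to
  cohomology; this is proved with adapted bases instead of the universal coefficient theorem
  (\<open>torsion_free_homology\<close>). The pieces of level \<open>k\<close> form arbitrarily fine closed
  coverings of the limit set, and closed coverings can be thickened to open ones with the same
  nerve; so vanishing homology of all nerves gives vanishing Cech homology
  (\<open>cech_trivial_of_nerves\<close>).

  Growth of the ranks. Let \<open>v\<close> be the number of digits that remain at each level. The rank of
  \<open>H\<^sub>0\<close> is at most the number \<open>v ^ k\<close> of cells. Recurrence excludes points of the limit sets at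
  corners of the cube, so that the nerve is a graph whose edges join cells with a common side;
  thus the rank of \<open>H\<^sub>1\<close> is at most \<open>2 * v ^ k\<close>. For the lower bounds, take a level \<open>j\<close> close to
  \<open>k\<close> at which the digit set is a convenient one. If it contains a two-by-two block of digits, each of
  the \<open>v ^ (j - 1)\<close> words in front of it contributes a four-cycle to the nerve, and these
  blocks survive up to level \<open>k\<close> as long as \<open>4 * r\<close> is less than the number of digits
  (\<open>has_block_step\<close>). If instead it isolates a cell from all its neighbours at level \<open>j + 1\<close>, each of these
  words contributes a component (\<open>isolated_corner_cell\<close>). Since \<open>j\<close> is
  at least \<open>k - k / m - 1\<close>, both ranks grow at the exponential rate \<open>ln v\<close>.

  Halving both sides with \<open>r = 1\<close> is the exception: then \<open>v = 3\<close>, blocks are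
  impossible, and by induction on the level the graph of cells with a common side is a forest
  (\<open>cell_graph_acyclic\<close>), whence the first Cech homology group vanishes.
\<close>

section \<open>Integral chains, boundaries and simplicial maps\<close>

definition before_sign :: "'v \<Rightarrow> 'v \<Rightarrow> int"
  where "before_sign u v = (if vertex_less u v then - 1 else 1)"

definition face_sign :: "'v set \<Rightarrow> 'v \<Rightarrow> int"
  where "face_sign s v = (\<Prod>u\<in>s. before_sign u v)"

text \<open>The sign of the permutation that sorts the images of the vertices of \<open>s\<close>. Products over all
  pairs, instead of powers of \<open>- 1\<close>, make the signs multiplicative in \<open>s\<close>.\<close>
definition inversion_sign :: "('v \<Rightarrow> 'w) \<Rightarrow> 'v set \<Rightarrow> int"
  where "inversion_sign f s =
    (\<Prod>u\<in>s. \<Prod>v\<in>s. if vertex_less u v \<and> vertex_less (f v) (f u) then - 1 else 1)"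

text \<open>The boundary that also lowers vertices to the empty simplex. On chains of dimension at least 1
  it is the simplicial boundary; in dimension 0 it is the augmentation. One formula in all
  degrees spares case distinctions in the arguments with links.\<close>
definition bd :: "('v set \<Rightarrow>\<^sub>0 int) \<Rightarrow> ('v set \<Rightarrow>\<^sub>0 int)"
  where "bd = frag_extend (\<lambda>s. \<Sum>v\<in>s. frag_cmul (face_sign s v) (frag_of (s - {v})))"

lemma vertex_less_strict_linear_order: "strict_linear_order {(u, v). vertex_less u (v::'v)}"
proof -
  obtain r :: "'v rel" where "well_order_on UNIV r"
    using well_order_on by blast
  then have "strict_linear_order (r - Id)"
    by (simp add: strict_linear_order_on_diff_Id well_order_on_def)
  then have "strict_linear_order (SOME R :: 'v rel. strict_linear_order R)"
    by (rule someI)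
  then show ?thesis
    by (simp add: vertex_less_def)
qed

lemma vertex_less_irrefl [simp]: "\<not> vertex_less u u"
  and vertex_less_asym: "vertex_less u v \<Longrightarrow> \<not> vertex_less v u"
  and vertex_less_total: "u \<noteq> v \<Longrightarrow> vertex_less u v \<or> vertex_less v u"
  using vertex_less_strict_linear_order[where 'v = 'a]
  by (auto simp: strict_linear_order_on_def irrefl_def trans_def total_on_def)

lemma before_sign_self [simp]: "before_sign u u = 1"
  by (simp add: before_sign_def)

lemma before_sign_sq [simp]: "before_sign u v * before_sign u v = 1"
  by (simp add: before_sign_def)

lemma before_sign_antisym: "u \<noteq> v \<Longrightarrow> before_sign v u = - before_sign u v"
  using vertex_less_total[of u v] vertex_less_asym[of u v] by (auto simp: before_sign_def)

lemma prod_sq_one: "(\<And>x. x \<in> A \<Longrightarrow> f x * f x = (1::int)) \<Longrightarrow> prod f A * prod f A = 1"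
  by (simp flip: prod.distrib)

lemma face_sign_sq [simp]: "face_sign s v * face_sign s v = 1"
  unfolding face_sign_def by (rule prod_sq_one) simp

lemma face_sign_sq_left [simp]: "face_sign s v * (face_sign s v * x) = x"
  by (simp flip: mult.assoc)

lemma inversion_sign_sq [simp]: "inversion_sign f s * inversion_sign f s = 1"
  unfolding inversion_sign_def by (intro prod_sq_one) simp

lemma face_sign_remove: "finite s \<Longrightarrow> u \<in> s \<Longrightarrow> face_sign s v = before_sign u v * face_sign (s - {u}) v"
  unfolding face_sign_def by (simp add: prod.remove)

lemma face_sign_insert: "finite s \<Longrightarrow> u \<notin> s \<Longrightarrow> face_sign (insert u s) v = before_sign u v * face_sign s v"
  unfolding face_sign_def by simp

lemma neg_one_pow_card: "finite A \<Longrightarrow> (- 1 :: int) ^ card {x \<in> A. P x} = (\<Prod>x\<in>A. if P x then - 1 else 1)"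
  by (simp flip: prod.inter_filter)

lemma face_sign_eq_power: "finite s \<Longrightarrow> (- 1) ^ card {u \<in> s. vertex_less u v} = face_sign s v"
  unfolding face_sign_def before_sign_def by (rule neg_one_pow_card)

lemma inversion_sign_eq_power:
  assumes "finite s"
  shows "(- 1) ^ card {(u, v) \<in> s \<times> s. vertex_less u v \<and> vertex_less (f v) (f u)} = inversion_sign f s"
proof -
  have "{(u, v) \<in> s \<times> s. vertex_less u v \<and> vertex_less (f v) (f u)}
      = {x \<in> s \<times> s. vertex_less (fst x) (snd x) \<and> vertex_less (f (snd x)) (f (fst x))}"
    by auto
  then show ?thesis
    using assms neg_one_pow_card[of "s \<times> s" "\<lambda>x. vertex_less (fst x) (snd x) \<and> vertex_less (f (snd x)) (f (fst x))"]
    by (simp add: inversion_sign_def prod.cartesian_product case_prod_unfold)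
qed

lemma inversion_sign_remove:
  assumes s: "finite s" "x \<in> s" and inj: "\<And>u. u \<in> s - {x} \<Longrightarrow> f u \<noteq> f x"
  shows "inversion_sign f s = inversion_sign f (s - {x}) *
    (\<Prod>u\<in>s - {x}. before_sign u x * before_sign (f u) (f x))"
proof -
  define t where "t = s - {x}"
  have st: "s = insert x t" and t: "finite t" "x \<notin> t"
    using s by (auto simp: t_def)
  let ?i = "\<lambda>u v. if vertex_less u v \<and> vertex_less (f v) (f u) then - 1 else (1::int)"
  have "inversion_sign f s = (\<Prod>v\<in>t. ?i x v) * ((\<Prod>u\<in>t. ?i u x) * (\<Prod>u\<in>t. \<Prod>v\<in>t. ?i u v))"
    unfolding inversion_sign_def st using t by (simp add: prod.distrib)
  also have "\<dots> = (\<Prod>u\<in>t. \<Prod>v\<in>t. ?i u v) * (\<Prod>u\<in>t. ?i x u * ?i u x)"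
    by (simp add: prod.distrib mult_ac)
  also have "(\<Prod>u\<in>t. ?i x u * ?i u x) = (\<Prod>u\<in>t. before_sign u x * before_sign (f u) (f x))"
  proof (rule prod.cong)
    fix u assume u: "u \<in> t"
    then have "u \<noteq> x" "f u \<noteq> f x"
      using t inj by (auto simp: t_def)
    then show "?i x u * ?i u x = before_sign u x * before_sign (f u) (f x)"
      using vertex_less_total[of u x] vertex_less_total[of "f u" "f x"]
        vertex_less_asym[of u x] vertex_less_asym[of "f u" "f x"]
      by (auto simp: before_sign_def)
  qed simp
  finally show ?thesis
    by (simp add: inversion_sign_def t_def)
qed

text \<open>The identity of signs behind the naturality of the boundary: passing to a face and then
  sorting, or sorting and then passing to a face, differ only in the pairs that involve the
  removed vertex.\<close>
lemma inversion_sign_face: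
  assumes "finite s" "x \<in> s" "inj_on f s"
  shows "inversion_sign f s * face_sign (f ` s) (f x) = inversion_sign f (s - {x}) * face_sign s x"
proof -
  have "(\<Prod>u\<in>s - {x}. before_sign u x * before_sign (f u) (f x))
      = face_sign (s - {x}) x * face_sign (f ` (s - {x})) (f x)"
    using assms(3) by (simp add: face_sign_def prod.distrib prod.reindex inj_on_diff)
  moreover have "face_sign (s - {x}) x = face_sign s x"
    using assms by (simp add: face_sign_remove[of s x x])
  moreover have "f ` (s - {x}) = f ` s - {f x}"
    using assms by (auto simp: inj_on_def)
  moreover have "face_sign (f ` s - {f x}) (f x) = face_sign (f ` s) (f x)"
    using assms by (simp add: face_sign_remove[of "f ` s" "f x" "f x"])
  moreover have "f u \<noteq> f x" if "u \<in> s - {x}" for u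
    using that assms by (auto simp: inj_on_def)
  ultimately have "inversion_sign f s = inversion_sign f (s - {x}) * (face_sign s x * face_sign (f ` s) (f x))"
    using inversion_sign_remove[OF assms(1,2), of f] by simp
  then show ?thesis
    by (simp add: mult.assoc)
qed

lemma bd_0 [simp]: "bd 0 = 0" and bd_add: "bd (a + b) = bd a + bd b" and bd_diff: "bd (a - b) = bd a - bd b"
  and bd_minus: "bd (- a) = - bd a" and bd_cmul: "bd (frag_cmul m a) = frag_cmul m (bd a)"
  by (simp_all add: bd_def frag_extend_add frag_extend_diff frag_extend_minus frag_extend_cmul)

lemma bd_sum: "bd (sum f A) = (\<Sum>x\<in>A. bd (f x))"
  by (induction A rule: infinite_finite_induct) (auto simp: bd_add)

lemma bd_of: "bd (frag_of s) = (\<Sum>v\<in>s. frag_cmul (face_sign s v) (frag_of (s - {v})))"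
  by (simp add: bd_def)

lemma frag_linear_ext:
  assumes "\<And>s. s \<in> Poly_Mapping.keys c \<Longrightarrow> F (frag_of s) = G (frag_of s)"
    and F: "F 0 = 0" "\<And>a b. F (a - b) = F a - F b" and G: "G 0 = 0" "\<And>a b. G (a - b) = G a - G b"
  shows "F c = (G c :: 'b::ab_group_add)"
proof -
  have "Poly_Mapping.keys c \<subseteq> Poly_Mapping.keys c"
    by simp
  then show ?thesis
    by (induction c rule: frag_induction) (use assms in auto)
qed

text \<open>Deleting two vertices in either order gives the same face with opposite signs.\<close>
lemma bd_bd_of: "bd (bd (frag_of s)) = 0"
proof (cases "finite s")
  case True
  let ?g = "\<lambda>v u. frag_cmul (face_sign s v * face_sign (s - {v}) u) (frag_of (s - {v} - {u}))"
  let ?P = "{(v, u) \<in> s \<times> s. v \<noteq> u}"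
  have fin: "finite ?P"
    by (rule finite_subset[of _ "s \<times> s"]) (use True in auto)
  have "bd (bd (frag_of s)) = (\<Sum>v\<in>s. \<Sum>u\<in>s - {v}. ?g v u)"
    by (simp add: bd_of bd_sum bd_cmul frag_cmul_sum)
  also have "\<dots> = (\<Sum>(v, u)\<in>Sigma s (\<lambda>v. s - {v}). ?g v u)"
    by (rule sum.Sigma) (use True in auto)
  also have "Sigma s (\<lambda>v. s - {v}) = ?P"
    by auto
  finally have eq: "bd (bd (frag_of s)) = (\<Sum>(v, u)\<in>?P. ?g v u)" .
  have anti: "?g u v = - ?g v u" if "(v, u) \<in> ?P" for u v
  proof -
    have uv: "u \<in> s" "v \<in> s" "u \<noteq> v"
      using that by auto
    have "face_sign s u = before_sign v u * face_sign (s - {v}) u"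
      and "face_sign s v = before_sign u v * face_sign (s - {u}) v"
      using uv True face_sign_remove[of s v u] face_sign_remove[of s u v] by auto
    then have "face_sign s u * face_sign (s - {u}) v = - (face_sign s v * face_sign (s - {v}) u)"
      using before_sign_antisym[of u v] uv by (simp add: mult_ac)
    moreover have "s - {u} - {v} = s - {v} - {u}"
      by auto
    ultimately show ?thesis
      by (simp only: minus_frag_cmul)
  qed
  have swap: "(\<Sum>(v, u)\<in>?P. ?g v u) = (\<Sum>(v, u)\<in>?P. ?g u v)"
    by (rule sum.reindex_bij_witness[where i = prod.swap and j = prod.swap]) auto
  also have "\<dots> = (\<Sum>(v, u)\<in>?P. - ?g v u)"
    by (rule sum.cong) (use anti in auto)
  also have "\<dots> = - (\<Sum>(v, u)\<in>?P. ?g v u)"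
    by (simp add: sum_negf case_prod_unfold del: minus_frag_cmul)
  finally have swapneg: "(\<Sum>(v, u)\<in>?P. ?g v u) = - (\<Sum>(v, u)\<in>?P. ?g v u)" .
  have "X = - X \<Longrightarrow> X = 0" if "X = (\<Sum>(v, u)\<in>?P. ?g v u)" for X
    by (rule poly_mapping_eqI) (metis equal_neg_zero lookup_uminus lookup_zero)
  then have "X = 0" if "X = (\<Sum>(v, u)\<in>?P. ?g v u)" for X
    using that swapneg by blast
  then show ?thesis
    unfolding eq by blast
qed (simp add: bd_of)

lemma bd_bd [simp]: "bd (bd c) = 0"
  by (rule frag_linear_ext[where F = "\<lambda>c. bd (bd c)" and G = "\<lambda>_. 0"]) (auto simp: bd_bd_of bd_diff)

lemma boundary_map_eq_bd:
  assumes "q \<noteq> 0" "\<And>s. s \<in> Poly_Mapping.keys c \<Longrightarrow> finite s"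
  shows "boundary_map q c = bd c"
  unfolding boundary_map_def bd_def using assms
  by (auto intro!: frag_extend_eq simp: face_sign_eq_power)

abbreviation pushforward :: "('v \<Rightarrow> 'w) \<Rightarrow> ('v set \<Rightarrow>\<^sub>0 int) \<Rightarrow> ('w set \<Rightarrow>\<^sub>0 int)"
  where "pushforward \<equiv> simplicial_chain_map"

lemma pushforward_0 [simp]: "pushforward f 0 = 0"
  and pushforward_add: "pushforward f (a + b) = pushforward f a + pushforward f b"
  and pushforward_diff: "pushforward f (a - b) = pushforward f a - pushforward f b"
  and pushforward_cmul: "pushforward f (frag_cmul m a) = frag_cmul m (pushforward f a)"
  by (simp_all add: simplicial_chain_map_def frag_extend_add frag_extend_diff frag_extend_cmul)

lemma pushforward_sum: "pushforward f (sum g A) = (\<Sum>x\<in>A. pushforward f (g x))"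
  by (induction A rule: infinite_finite_induct) (auto simp: pushforward_add)

lemma pushforward_of: "finite s \<Longrightarrow> pushforward f (frag_of s) =
    (if inj_on f s then frag_cmul (inversion_sign f s) (frag_of (f ` s)) else 0)"
  using inversion_sign_eq_power[of s f] by (simp add: simplicial_chain_map_def)

text \<open>If the map is not injective on the simplex, only the two faces that omit one of two
  vertices with equal images survive on the right, and they cancel. If three vertices or two
  pairs of them are identified, no face survives.\<close>
lemma bd_pushforward_of:
  assumes s: "finite s"
  shows "bd (pushforward f (frag_of s)) = pushforward f (bd (frag_of s))"
proof (cases "inj_on f s")
  case True
  have "bd (pushforward f (frag_of s))
      = (\<Sum>w\<in>f ` s. frag_cmul (inversion_sign f s * face_sign (f ` s) w) (frag_of (f ` s - {w})))"
    using s True by (simp add: pushforward_of bd_cmul bd_of frag_cmul_sum)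
  also have "\<dots> = (\<Sum>v\<in>s. frag_cmul (inversion_sign f s * face_sign (f ` s) (f v)) (frag_of (f ` s - {f v})))"
    using True by (simp add: sum.reindex)
  also have "\<dots> = (\<Sum>v\<in>s. frag_cmul (face_sign s v * inversion_sign f (s - {v})) (frag_of (f ` (s - {v}))))"
  proof (rule sum.cong)
    fix v assume v: "v \<in> s"
    have "f ` (s - {v}) = f ` s - {f v}"
      using True v by (auto simp: inj_on_def)
    then show "frag_cmul (inversion_sign f s * face_sign (f ` s) (f v)) (frag_of (f ` s - {f v}))
        = frag_cmul (face_sign s v * inversion_sign f (s - {v})) (frag_of (f ` (s - {v})))"
      using inversion_sign_face[OF s v True] by (simp add: mult.commute)
  qed simp
  also have "\<dots> = pushforward f (bd (frag_of s))"
    using s True by (simp add: bd_of pushforward_sum pushforward_cmul pushforward_of inj_on_diff)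
  finally show ?thesis .
next
  case False
  then obtain x y where xy: "x \<in> s" "y \<in> s" "x \<noteq> y" "f x = f y"
    by (auto simp: inj_on_def)
  let ?h = "\<lambda>v. frag_cmul (face_sign s v) (pushforward f (frag_of (s - {v})))"
  have "pushforward f (bd (frag_of s)) = (\<Sum>v\<in>s. ?h v)"
    by (simp add: bd_of pushforward_sum pushforward_cmul)
  also have "\<dots> = (\<Sum>v\<in>{x, y}. ?h v)"
  proof (rule sum.mono_neutral_right)
    have "\<not> inj_on f (s - {v})" if "v \<noteq> x" "v \<noteq> y" for v
      using xy that by (auto simp: inj_on_def)
    then show "\<forall>v\<in>s - {x, y}. ?h v = 0"
      using s by (simp add: pushforward_of)
  qed (use s xy in auto)
  also have "\<dots> = ?h x + ?h y"
    using xy by simp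
  also have "\<dots> = 0"
  proof (cases "inj_on f (s - {x})")
    case inj: True
    define t where "t = s - {x, y}"
    have ty: "s - {x} - {y} = t" "s - {y} - {x} = t" and ft: "finite t"
      using xy s by (auto simp: t_def)
    have ny: "f u \<noteq> f y" if "u \<in> t" for u
      using inj that xy by (auto simp: t_def inj_on_def)
    have "inj_on f t"
      using inj by (rule inj_on_subset) (auto simp: t_def)
    moreover have sx: "s - {x} = insert y t" "s - {y} = insert x t" and "x \<notin> t"
      using xy by (auto simp: t_def)
    ultimately have injy: "inj_on f (s - {y})"
      unfolding sx(2) inj_on_insert using ny xy(4) by (metis Diff_iff imageE)
    let ?p = "\<lambda>z. \<Prod>u\<in>t. before_sign u z * before_sign (f u) (f y)"
    have 1: "inversion_sign f (s - {x}) = inversion_sign f t * ?p y"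
      using inversion_sign_remove[of "s - {x}" y f] s xy ny by (simp add: ty)
    have 2: "inversion_sign f (s - {y}) = inversion_sign f t * ?p x"
      using inversion_sign_remove[of "s - {y}" x f] s xy ny by (simp add: ty)
    have fs: "face_sign s x = before_sign y x * face_sign t x" "face_sign s y = before_sign x y * face_sign t y"
    proof -
      have "face_sign s x = face_sign (s - {x}) x" "face_sign s y = face_sign (s - {y}) y"
        using s xy by (simp_all add: face_sign_remove[of s x x] face_sign_remove[of s y y])
      then show "face_sign s x = before_sign y x * face_sign t x" "face_sign s y = before_sign x y * face_sign t y"
        using s xy face_sign_remove[of "s - {x}" y x] face_sign_remove[of "s - {y}" x y] ty by auto
    qed
    have "face_sign s x * inversion_sign f (s - {x}) = - (face_sign s y * inversion_sign f (s - {y}))"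
      unfolding 1 2 fs prod.distrib unfolding face_sign_def using before_sign_antisym[of x y] xy
      by (simp add: mult_ac)
    moreover have "f ` (s - {x}) = f ` (s - {y})"
      unfolding sx using xy(4) by simp
    ultimately show ?thesis
      using s inj injy by (simp add: pushforward_of flip: frag_cmul_distrib)
  next
    case ninj: False
    have "\<not> inj_on f (s - {y})"
    proof
      assume iy: "inj_on f (s - {y})"
      have "inj_on f (s - {x})"
      proof (rule inj_onI)
        fix a b assume "a \<in> s - {x}" "b \<in> s - {x}" "f a = f b"
        then show "a = b"
          using iy xy unfolding inj_on_def by (metis Diff_iff singletonD insertI1 singleton_iff)
      qed
      with ninj show False ..
    qed
    with ninj s show ?thesis
      by (simp add: pushforward_of)
  qed
  finally show ?thesis
    using False s by (simp add: pushforward_of)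
qed

lemma bd_pushforward:
  assumes "\<And>s. s \<in> Poly_Mapping.keys c \<Longrightarrow> finite s"
  shows "bd (pushforward f c) = pushforward f (bd c)"
  by (rule frag_linear_ext[where F = "\<lambda>c. bd (pushforward f c)" and G = "\<lambda>c. pushforward f (bd c)"])
     (auto simp: bd_pushforward_of assms bd_diff pushforward_diff)

section \<open>Pure subgroups of finitely generated free abelian groups\<close>

definition additive_on :: "('a::ab_group_add) set \<Rightarrow> ('a \<Rightarrow> 'b::ab_group_add) \<Rightarrow> bool"
  where "additive_on X \<phi> \<longleftrightarrow> (\<forall>x\<in>X. \<forall>y\<in>X. \<phi> (x - y) = \<phi> x - \<phi> y)"

definition add_subgroup :: "('a::ab_group_add) set \<Rightarrow> bool"
  where "add_subgroup X \<longleftrightarrow> 0 \<in> X \<and> (\<forall>x\<in>X. \<forall>y\<in>X. x - y \<in> X)"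

definition frags :: "'a set \<Rightarrow> ('a \<Rightarrow>\<^sub>0 int) set"
  where "frags F = {c. Poly_Mapping.keys c \<subseteq> F}"

definition lincomb :: "(('a \<Rightarrow>\<^sub>0 int) \<Rightarrow> int) \<Rightarrow> ('a \<Rightarrow>\<^sub>0 int) set \<Rightarrow> 'a \<Rightarrow>\<^sub>0 int"
  where "lincomb a B = (\<Sum>b\<in>B. frag_cmul (a b) b)"

text \<open>\<open>B\<close> represents a basis of the quotient of \<open>X\<close> by \<open>A\<close>.\<close>
definition basis_mod :: "('a \<Rightarrow>\<^sub>0 int) set \<Rightarrow> ('a \<Rightarrow>\<^sub>0 int) set \<Rightarrow> ('a \<Rightarrow>\<^sub>0 int) set \<Rightarrow> bool"
  where "basis_mod A X B \<longleftrightarrow> finite B \<and> B \<subseteq> X \<and> (\<forall>x\<in>X. \<exists>a. x - lincomb a B \<in> A)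
    \<and> (\<forall>a. lincomb a B \<in> A \<longrightarrow> (\<forall>b\<in>B. a b = 0))"

text \<open>For \<open>A \<subseteq> X\<close>: the quotient of \<open>X\<close> by \<open>A\<close> is torsion-free.\<close>
definition pure_in :: "('a \<Rightarrow>\<^sub>0 int) set \<Rightarrow> ('a \<Rightarrow>\<^sub>0 int) set \<Rightarrow> bool"
  where "pure_in A X \<longleftrightarrow> (\<forall>x\<in>X. \<forall>m. m \<noteq> 0 \<longrightarrow> frag_cmul m x \<in> A \<longrightarrow> x \<in> A)"

lemma add_subgroup_0: "add_subgroup X \<Longrightarrow> 0 \<in> X"
  and add_subgroup_diff: "add_subgroup X \<Longrightarrow> x \<in> X \<Longrightarrow> y \<in> X \<Longrightarrow> x - y \<in> X"
  by (auto simp: add_subgroup_def)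

lemma add_subgroup_minus: "add_subgroup X \<Longrightarrow> x \<in> X \<Longrightarrow> - x \<in> X"
  using add_subgroup_diff[of X 0 x] add_subgroup_0[of X] by simp

lemma add_subgroup_add: "add_subgroup X \<Longrightarrow> x \<in> X \<Longrightarrow> y \<in> X \<Longrightarrow> x + y \<in> X"
  using add_subgroup_diff[of X x "- y"] add_subgroup_minus[of X y] by simp

lemma add_subgroup_cmul: "add_subgroup X \<Longrightarrow> x \<in> X \<Longrightarrow> frag_cmul m x \<in> X"
proof (induction m rule: int_induct[where k = 0])
  case (step1 i)
  then show ?case
    by (simp add: frag_cmul_distrib add_subgroup_add)
next
  case (step2 i)
  then show ?case
    by (simp add: frag_cmul_diff_distrib add_subgroup_diff)
qed (simp add: add_subgroup_0)

lemma add_subgroup_sum: "add_subgroup X \<Longrightarrow> (\<And>i. i \<in> I \<Longrightarrow> f i \<in> X) \<Longrightarrow> sum f I \<in> X"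
  by (induction I rule: infinite_finite_induct) (auto simp: add_subgroup_0 add_subgroup_add)

lemma add_subgroup_lincomb: "add_subgroup X \<Longrightarrow> B \<subseteq> X \<Longrightarrow> lincomb a B \<in> X"
  unfolding lincomb_def by (intro add_subgroup_sum add_subgroup_cmul) auto

lemma lincomb_diff: "lincomb a B - lincomb a' B = lincomb (\<lambda>b. a b - a' b) B"
  by (simp add: lincomb_def sum_subtractf frag_cmul_diff_distrib)

lemma add_subgroup_frags [simp]: "add_subgroup (frags F)"
  using keys_diff by (fastforce simp: add_subgroup_def frags_def)

lemma additive_on_0: "additive_on X \<phi> \<Longrightarrow> x \<in> X \<Longrightarrow> \<phi> 0 = 0"
  unfolding additive_on_def by (metis diff_self)

lemma additive_on_minus: "additive_on X \<phi> \<Longrightarrow> add_subgroup X \<Longrightarrow> x \<in> X \<Longrightarrow> \<phi> (- x) = - \<phi> x"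
  unfolding additive_on_def by (metis add_subgroup_0 diff_0 diff_self)

lemma additive_on_add:
  assumes "additive_on X \<phi>" "add_subgroup X" "x \<in> X" "y \<in> X"
  shows "\<phi> (x + y) = \<phi> x + \<phi> y"
proof -
  have "\<phi> (x - (- y)) = \<phi> x - \<phi> (- y)"
    using assms add_subgroup_minus[of X y] unfolding additive_on_def by blast
  then show ?thesis
    using assms additive_on_minus[of X \<phi> y] by simp
qed

lemma additive_on_sum:
  assumes "additive_on X \<phi>" "add_subgroup X" "\<And>i. i \<in> I \<Longrightarrow> f i \<in> X"
  shows "\<phi> (sum f I) = (\<Sum>i\<in>I. \<phi> (f i))"
  using assms(3)
proof (induction I rule: infinite_finite_induct)
  case (insert i I)
  then show ?case
    using additive_on_add[OF assms(1,2), of "f i" "sum f I"] add_subgroup_sum[OF assms(2), of I f] by auto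
qed (use additive_on_0[OF assms(1) add_subgroup_0[OF assms(2)]] in simp_all)

lemma additive_on_cmul:
  assumes "additive_on X \<phi>" "add_subgroup X" "x \<in> X"
  shows "\<phi> (frag_cmul m x) = m * \<phi> x"
proof (induction m rule: int_induct[where k = 0])
  case base
  show ?case
    using assms additive_on_0 by auto
next
  case (step1 i)
  then show ?case
    using assms additive_on_add[OF assms(1,2), of "frag_cmul i x" x] add_subgroup_cmul[of X x i]
    by (simp add: frag_cmul_distrib distrib_right)
next
  case (step2 i)
  then show ?case
    using assms add_subgroup_cmul[of X x i]
    by (simp add: frag_cmul_diff_distrib left_diff_distrib additive_on_def)
qed

lemma lookup_frags: "c \<in> frags F \<Longrightarrow> s \<notin> F \<Longrightarrow> Poly_Mapping.lookup c s = 0"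
  by (auto simp: frags_def in_keys_iff)

lemma frags_insertD:
  assumes "c \<in> frags (insert s F)" "Poly_Mapping.lookup c s = 0"
  shows "c \<in> frags F"
  using assms by (auto simp: frags_def in_keys_iff subset_iff)

text \<open>Integral elimination: a coordinate \<open>s\<close> in which some member of the family does not vanish
  is cleared from the others by cross multiplication, which leaves one vector fewer in one
  dimension fewer.\<close>
lemma integer_dependence:
  assumes "finite F" "finite T" "card F < card T" "\<And>t. t \<in> T \<Longrightarrow> f t \<in> frags F"
  shows "\<exists>a. (\<exists>t\<in>T. a t \<noteq> 0) \<and> (\<Sum>t\<in>T. frag_cmul (a t) (f t)) = 0"
  using assms
proof (induction F arbitrary: T f rule: finite_induct)
  case empty
  then have "T \<noteq> {}" "\<And>t. t \<in> T \<Longrightarrow> f t = 0"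
    by (auto simp: frags_def)
  then show ?case
    by (intro exI[of _ "\<lambda>_. 1"]) auto
next
  case (insert s F)
  show ?case
  proof (cases "\<forall>t\<in>T. Poly_Mapping.lookup (f t) s = 0")
    case True
    then show ?thesis
      using insert.prems insert.hyps by (intro insert.IH) (auto intro: frags_insertD)
  next
    case False
    then obtain t0 where t0: "t0 \<in> T" "Poly_Mapping.lookup (f t0) s \<noteq> 0"
      by auto
    define d where "d = Poly_Mapping.lookup (f t0) s"
    define g where "g t = frag_cmul d (f t) - frag_cmul (Poly_Mapping.lookup (f t) s) (f t0)" for t
    have "g t \<in> frags F" if "t \<in> T" for t
    proof (rule frags_insertD)
      show "g t \<in> frags (insert s F)"
        unfolding g_def using insert.prems(3) that t0(1)
        by (intro add_subgroup_diff add_subgroup_cmul) auto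
      show "Poly_Mapping.lookup (g t) s = 0"
        by (simp add: g_def d_def lookup_minus)
    qed
    moreover have "card F < card (T - {t0})" "finite (T - {t0})"
      using insert.prems(1,2) insert.hyps t0(1) by auto
    ultimately obtain a where a: "\<exists>t\<in>T - {t0}. a t \<noteq> 0" "(\<Sum>t\<in>T - {t0}. frag_cmul (a t) (g t)) = 0"
      using insert.IH[of "T - {t0}" g] by (metis (no_types, lifting) DiffD1)
    define e where "e = (\<Sum>t\<in>T - {t0}. a t * Poly_Mapping.lookup (f t) s)"
    define a' where "a' t = (if t = t0 then - e else d * a t)" for t
    have "(\<Sum>t\<in>T. frag_cmul (a' t) (f t))
        = frag_cmul (- e) (f t0) + (\<Sum>t\<in>T - {t0}. frag_cmul (d * a t) (f t))"
      using insert.prems(1) t0(1) by (simp add: sum.remove[of T t0] a'_def)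
    also have "\<dots> = (\<Sum>t\<in>T - {t0}. frag_cmul (a t) (g t))"
      by (rule poly_mapping_eqI)
         (simp add: g_def e_def lookup_add lookup_minus lookup_sum algebra_simps
           sum_subtractf sum_distrib_left sum_distrib_right)
    finally have "(\<Sum>t\<in>T. frag_cmul (a' t) (f t)) = 0"
      using a(2) by simp
    moreover have "\<exists>t\<in>T. a' t \<noteq> 0"
      using a(1) t0(2) by (auto simp: a'_def d_def)
    ultimately show ?thesis
      by blast
  qed
qed

text \<open>An element without nonzero multiple in \<open>A\<close> is separated from \<open>A\<close> by an integral
  functional. As in Gaussian elimination, some \<open>a \<in> A\<close> with nonzero entry at \<open>s\<close> is used
  to project \<open>frags (insert s F)\<close> onto \<open>frags F\<close>, up to a factor; the functional for the smaller
  index set is composed with this projection.\<close>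
lemma integral_separation:
  assumes "finite F" "add_subgroup A" "A \<subseteq> frags F" "x \<in> frags F"
    and "\<And>m. m \<noteq> 0 \<Longrightarrow> frag_cmul m x \<notin> A"
  shows "\<exists>\<phi>::_ \<Rightarrow> int. additive_on UNIV \<phi> \<and> (\<forall>a\<in>A. \<phi> a = 0) \<and> \<phi> x \<noteq> 0"
  using assms
proof (induction F arbitrary: A x rule: finite_induct)
  case empty
  then have "frag_cmul 1 x \<in> A"
    using add_subgroup_0 by (auto simp: frags_def)
  then show ?case
    using empty.prems(4)[of 1] by simp
next
  case (insert s F)
  show ?case
  proof (cases "\<forall>a\<in>A. Poly_Mapping.lookup a s = 0")
    case True
    show ?thesis
    proof (cases "Poly_Mapping.lookup x s = 0")
      case x0: True
      show ?thesis
        using True x0 insert.prems by (intro insert.IH) (auto intro: frags_insertD)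
    next
      case False
      then show ?thesis
        using True by (intro exI[of _ "\<lambda>c. Poly_Mapping.lookup c s"]) (auto simp: additive_on_def lookup_minus)
    qed
  next
    case False
    then obtain a where a: "a \<in> A" "Poly_Mapping.lookup a s \<noteq> 0"
      by auto
    (* clears the entry at s with a multiple of a; the price is the factor lookup a s *)
    define h where "h y = frag_cmul (Poly_Mapping.lookup a s) y - frag_cmul (Poly_Mapping.lookup y s) a" for y
    have h_diff: "h (y - z) = h y - h z" for y z
    proof (rule poly_mapping_eqI)
      have look: "Poly_Mapping.lookup (h y) k
          = Poly_Mapping.lookup a s * Poly_Mapping.lookup y k - Poly_Mapping.lookup y s * Poly_Mapping.lookup a k" for y k
        by (simp add: h_def lookup_minus)
      show "Poly_Mapping.lookup (h (y - z)) k = Poly_Mapping.lookup (h y - h z) k" for k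
        unfolding lookup_minus look by (simp add: algebra_simps)
    qed
    have h_F: "h y \<in> frags F" if "y \<in> frags (insert s F)" for y
    proof (rule frags_insertD)
      show "h y \<in> frags (insert s F)"
        unfolding h_def using that a insert.prems(2) by (intro add_subgroup_diff add_subgroup_cmul) auto
    qed (simp add: h_def lookup_minus)
    have hA: "h y \<in> A" if "y \<in> A" for y
      unfolding h_def using that a insert.prems(1) by (intro add_subgroup_diff add_subgroup_cmul)
    have notin: "frag_cmul m (h x) \<notin> A \<inter> frags F" if "m \<noteq> 0" for m
    proof
      assume "frag_cmul m (h x) \<in> A \<inter> frags F"
      then have "frag_cmul m (h x) + frag_cmul (m * Poly_Mapping.lookup x s) a \<in> A"
        using add_subgroup_add[OF insert.prems(1) _ add_subgroup_cmul[OF insert.prems(1) a(1)]] by blast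
      also have "frag_cmul m (h x) + frag_cmul (m * Poly_Mapping.lookup x s) a
          = frag_cmul (m * Poly_Mapping.lookup a s) x"
        by (rule poly_mapping_eqI) (simp add: h_def lookup_add lookup_minus algebra_simps)
      finally show False
        using insert.prems(4) that a by simp
    qed
    have "\<exists>\<phi>::_ \<Rightarrow> int. additive_on UNIV \<phi> \<and> (\<forall>a\<in>A \<inter> frags F. \<phi> a = 0) \<and> \<phi> (h x) \<noteq> 0"
    proof (rule insert.IH)
      show "add_subgroup (A \<inter> frags F)"
        using insert.prems(1) add_subgroup_frags[of F] unfolding add_subgroup_def by blast
    qed (use notin h_F insert.prems in auto)
    then obtain \<phi> :: "_ \<Rightarrow> int" where \<phi>: "additive_on UNIV \<phi>" "\<And>a. a \<in> A \<inter> frags F \<Longrightarrow> \<phi> a = 0" "\<phi> (h x) \<noteq> 0"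
      by auto
    show ?thesis
      using \<phi> hA h_F insert.prems(2)
      by (intro exI[of _ "\<lambda>y. \<phi> (h y)"]) (auto simp: additive_on_def h_diff)
  qed
qed

text \<open>The image of a functional is an ideal of the integers, hence generated by the smallest
  positive value.\<close>
lemma additive_image_principal:
  fixes \<phi> :: "'a::ab_group_add \<Rightarrow> int"
  assumes Y: "add_subgroup Y" and \<phi>: "additive_on Y \<phi>" and x: "x \<in> Y" "\<phi> x \<noteq> 0"
  obtains y where "y \<in> Y" "\<phi> y \<noteq> 0" "\<And>z. z \<in> Y \<Longrightarrow> \<phi> y dvd \<phi> z"
proof -
  define P where "P m \<longleftrightarrow> m > 0 \<and> (\<exists>y\<in>Y. \<phi> y = int m)" for m
  have "\<exists>m. P m"
  proof (cases "\<phi> x > 0")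
    case True
    then show ?thesis
      using x by (intro exI[of _ "nat (\<phi> x)"]) (auto simp: P_def)
  next
    case False
    then show ?thesis
      using x add_subgroup_minus[OF Y x(1)] additive_on_minus[OF \<phi> Y x(1)]
      by (intro exI[of _ "nat (- \<phi> x)"]) (auto simp: P_def)
  qed
  then have P: "P (LEAST m. P m)" and least: "\<And>m. P m \<Longrightarrow> (LEAST m. P m) \<le> m"
    by (auto intro: LeastI_ex Least_le)
  define d where "d = (LEAST m. P m)"
  obtain y where y: "y \<in> Y" "\<phi> y = int d" and d: "d > 0"
    using P by (auto simp: P_def d_def)
  have mul: "k \<in> Y \<Longrightarrow> \<exists>w\<in>Y. \<phi> w = m * \<phi> k" for m :: int and k
  proof (induction m rule: int_induct[where k = 0])
    case base
    then show ?case
      using add_subgroup_0[OF Y] additive_on_0[OF \<phi>] by auto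
  next
    case (step1 i)
    then show ?case
      using add_subgroup_add[OF Y] additive_on_add[OF \<phi> Y] by (metis distrib_right mult_1)
  next
    case (step2 i)
    then show ?case
      using add_subgroup_diff[OF Y] \<phi> unfolding additive_on_def by (metis left_diff_distrib mult_1)
  qed
  have "int d dvd \<phi> z" if z: "z \<in> Y" for z
  proof (rule ccontr)
    assume "\<not> int d dvd \<phi> z"
    then have pos: "\<phi> z mod int d > 0"
      using d by (simp add: dvd_eq_mod_eq_0 le_neq_trans)
    obtain w where w: "w \<in> Y" "\<phi> w = (\<phi> z div int d) * int d"
      using mul[OF y(1)] y(2) by metis
    have "\<phi> (z - w) = \<phi> z mod int d"
      using \<phi> z w by (simp add: additive_on_def minus_div_mult_eq_mod)
    then have "P (nat (\<phi> z mod int d))"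
      using pos add_subgroup_diff[OF Y z w(1)] by (auto simp: P_def)
    then have "d \<le> nat (\<phi> z mod int d)"
      using least by (simp add: d_def)
    moreover have "\<phi> z mod int d < int d"
      using d by simp
    ultimately show False
      using pos by linarith
  qed
  then show thesis
    using that[of y] y d by simp
qed

text \<open>Take a subgroup \<open>Y\<close> between \<open>A\<close> and \<open>X\<close> such that \<open>X\<close> modulo \<open>Y\<close> has a basis of maximal
  cardinality. If \<open>Y\<close> were larger than \<open>A\<close>, a functional that vanishes on \<open>A\<close> but not on \<open>Y\<close> would
  exist by purity, and an element of \<open>Y\<close> at which it attains a generator of its image could be
  added to the basis, \<open>Y\<close> being replaced by the kernel.\<close>
theorem pure_subgroup_basis:
  assumes F: "finite F" and X: "add_subgroup X" "X \<subseteq> frags F"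
    and A: "add_subgroup A" "A \<subseteq> X" and pure: "pure_in A X"
  obtains B where "basis_mod A X B"
proof -
  define P where "P B \<longleftrightarrow> (\<exists>Y. add_subgroup Y \<and> A \<subseteq> Y \<and> Y \<subseteq> X \<and> basis_mod Y X B)" for B
  have bound: "card B < Suc (card F)" if PB: "P B" for B
  proof (rule ccontr)
    assume "\<not> card B < Suc (card F)"
    moreover obtain Y where Y: "add_subgroup Y" "basis_mod Y X B"
      using PB by (auto simp: P_def)
    moreover have "b \<in> frags F" if "b \<in> B" for b
      using Y that X(2) by (auto simp: basis_mod_def)
    ultimately obtain a where "\<exists>b\<in>B. a b \<noteq> 0" "lincomb a B = 0"
      using integer_dependence[of F B "\<lambda>b. b"] F unfolding basis_mod_def lincomb_def
      by (metis not_less_eq le_neq_implies_less linorder_not_less)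
    then show False
      using Y add_subgroup_0[of Y] by (auto simp: basis_mod_def)
  qed
  have "P {}"
    using X A by (auto simp: P_def basis_mod_def lincomb_def intro!: exI[of _ X])
  then obtain B where "P B" and max: "\<And>B'. P B' \<Longrightarrow> card B' \<le> card B"
    using ex_has_greatest_nat[of P "{}" card "Suc (card F)"] bound by blast
  then obtain Y where Y: "add_subgroup Y" "A \<subseteq> Y" "Y \<subseteq> X" and B: "basis_mod Y X B"
    by (auto simp: P_def)
  have "Y \<subseteq> A"
  proof
    fix x assume x: "x \<in> Y"
    show "x \<in> A"
    proof (rule ccontr)
      assume "x \<notin> A"
      then have nt: "frag_cmul m x \<notin> A" if "m \<noteq> 0" for m
        using pure that x Y(3) by (auto simp: pure_in_def)
      have "A \<subseteq> frags F" "x \<in> frags F"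
        using A(2) X(2) Y(3) x by auto
      from integral_separation[OF F A(1) this nt]
      obtain \<phi> :: "_ \<Rightarrow> int" where \<phi>: "additive_on UNIV \<phi>" "\<And>a. a \<in> A \<Longrightarrow> \<phi> a = 0" "\<phi> x \<noteq> 0"
        by auto
      then have \<phi>Y: "additive_on Y \<phi>"
        by (auto simp: additive_on_def)
      obtain y where y: "y \<in> Y" "\<phi> y \<noteq> 0" and dvd: "\<And>z. z \<in> Y \<Longrightarrow> \<phi> y dvd \<phi> z"
        using additive_image_principal[OF Y(1) \<phi>Y x \<phi>(3)] by blast
      define Y' where "Y' = {z \<in> Y. \<phi> z = 0}"
      have "y \<notin> B"
      proof
        assume "y \<in> B"
        then have "lincomb (\<lambda>b. if b = y then 1 else 0) B = (\<Sum>b\<in>B. if b = y then b else 0)"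
          unfolding lincomb_def by (intro sum.cong) auto
        also have "\<dots> = y"
          using \<open>y \<in> B\<close> B by (simp add: basis_mod_def)
        finally have "lincomb (\<lambda>b. if b = y then 1 else 0) B \<in> Y"
          using y(1) by simp
        moreover have ind: "\<And>a. lincomb a B \<in> Y \<Longrightarrow> (\<forall>b\<in>B. a b = 0)"
          using B by (simp add: basis_mod_def)
        ultimately have "\<forall>b\<in>B. (if b = y then 1 else 0 :: int) = 0"
          by blast
        then have "(1::int) = 0"
          using \<open>y \<in> B\<close> by (auto dest!: bspec[where x = y])
        then show False
          by simp
      qed
      have fin: "finite B"
        using B by (simp add: basis_mod_def)
      have ins: "lincomb a (insert y B) = frag_cmul (a y) y + lincomb a B" for a
        using fin \<open>y \<notin> B\<close> by (simp add: lincomb_def)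
      have upd: "lincomb (a(y := c)) B = lincomb a B" for a c
        unfolding lincomb_def by (rule sum.cong) (use \<open>y \<notin> B\<close> in auto)
      have sub: "add_subgroup Y'"
        using Y(1) \<phi>Y additive_on_0[OF \<phi>Y y(1)] by (auto simp: add_subgroup_def Y'_def additive_on_def)
      have "basis_mod Y' X (insert y B)"
        unfolding basis_mod_def
      proof (intro conjI ballI allI impI)
        fix z assume "z \<in> X"
        then obtain a where a: "z - lincomb a B \<in> Y"
          using B by (auto simp: basis_mod_def)
        then obtain c where c: "\<phi> (z - lincomb a B) = \<phi> y * c"
          using dvd by blast
        have cy: "frag_cmul c y \<in> Y"
          using Y(1) y(1) by (rule add_subgroup_cmul)
        have "\<phi> (z - lincomb a B - frag_cmul c y) = 0"
          using \<phi>Y a cy c additive_on_cmul[OF \<phi>Y Y(1) y(1)] by (simp add: additive_on_def)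
        then have "z - lincomb a B - frag_cmul c y \<in> Y'"
          using a cy Y(1) by (simp add: Y'_def add_subgroup_diff)
        moreover have "z - lincomb (a(y := c)) (insert y B) = z - lincomb a B - frag_cmul c y"
          unfolding ins upd by (simp add: algebra_simps)
        ultimately show "\<exists>a. z - lincomb a (insert y B) \<in> Y'"
          by metis
      next
        fix a b assume a: "lincomb a (insert y B) \<in> Y'" and b: "b \<in> insert y B"
        have ay: "frag_cmul (a y) y \<in> Y"
          using Y(1) y(1) by (rule add_subgroup_cmul)
        have "lincomb a (insert y B) - frag_cmul (a y) y \<in> Y"
          using a ay Y(1) by (auto simp: Y'_def intro: add_subgroup_diff)
        then have "lincomb a B \<in> Y"
          by (simp add: ins)
        then have aB: "\<And>b. b \<in> B \<Longrightarrow> a b = 0"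
          using B by (auto simp: basis_mod_def)
        then have "lincomb a B = 0"
          by (simp add: lincomb_def)
        then have "\<phi> (frag_cmul (a y) y) = 0"
          using a by (simp add: ins Y'_def)
        then show "a b = 0"
          using b aB y(2) additive_on_cmul[OF \<phi>Y Y(1) y(1)] by auto
      qed (use fin y B Y in \<open>auto simp: basis_mod_def\<close>)
      then have "P (insert y B)"
        using sub Y \<phi>(2) by (auto simp: P_def Y'_def intro!: exI[of _ Y'])
      then show False
        using max[of "insert y B"] fin \<open>y \<notin> B\<close> by simp
    qed
  qed
  then show thesis
    using that[of B] B Y by auto
qed

text \<open>The coordinates of an element with respect to a basis modulo \<open>A\<close> are unique, hence additive.\<close>
lemma basis_mod_coordinates:
  assumes A: "add_subgroup A" and X: "add_subgroup X" and B: "basis_mod A X B"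
  obtains \<kappa> where "\<And>x. x \<in> X \<Longrightarrow> x - lincomb (\<kappa> x) B \<in> A"
    and "\<And>x a b. x - lincomb a B \<in> A \<Longrightarrow> x \<in> X \<Longrightarrow> b \<in> B \<Longrightarrow> \<kappa> x b = a b"
    and "\<And>b. b \<in> B \<Longrightarrow> additive_on X (\<lambda>x. \<kappa> x b)"
proof -
  obtain \<kappa> where \<kappa>: "\<And>x. x \<in> X \<Longrightarrow> x - lincomb (\<kappa> x) B \<in> A"
    using B unfolding basis_mod_def by metis
  have uniq: "\<kappa> x b = a b" if "x - lincomb a B \<in> A" "x \<in> X" "b \<in> B" for x a b
  proof -
    have "(x - lincomb a B) - (x - lincomb (\<kappa> x) B) \<in> A"
      using A that(1) \<kappa>[OF that(2)] by (rule add_subgroup_diff)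
    then have "lincomb (\<lambda>b. \<kappa> x b - a b) B \<in> A"
      by (simp flip: lincomb_diff)
    then have "\<forall>b\<in>B. \<kappa> x b - a b = 0"
      using B unfolding basis_mod_def by (elim conjE allE) (rule mp)
    then show ?thesis
      using that by auto
  qed
  have "additive_on X (\<lambda>x. \<kappa> x b)" if "b \<in> B" for b
    unfolding additive_on_def
  proof (intro ballI)
    fix x y assume xy: "x \<in> X" "y \<in> X"
    have "(x - lincomb (\<kappa> x) B) - (y - lincomb (\<kappa> y) B) \<in> A"
      using A \<kappa>[OF xy(1)] \<kappa>[OF xy(2)] by (rule add_subgroup_diff)
    then have "(x - y) - lincomb (\<lambda>b. \<kappa> x b - \<kappa> y b) B \<in> A"
      by (simp add: algebra_simps flip: lincomb_diff)
    then show "\<kappa> (x - y) b = \<kappa> x b - \<kappa> y b"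
      by (rule uniq) (use xy X that in \<open>auto intro: add_subgroup_diff\<close>)
  qed
  then show thesis
    using that[of \<kappa>] \<kappa> uniq by blast
qed

text \<open>A torsion-free quotient has a basis, so the extension splits: subtract from an element the
  combination of basis vectors that represents it modulo \<open>A\<close>.\<close>
lemma pure_subgroup_retraction:
  assumes F: "finite F" and X: "add_subgroup X" "X \<subseteq> frags F"
    and A: "add_subgroup A" "A \<subseteq> X" and pure: "pure_in A X"
  obtains \<rho> where "additive_on X \<rho>" "\<And>x. x \<in> X \<Longrightarrow> \<rho> x \<in> A" "\<And>x. x \<in> A \<Longrightarrow> \<rho> x = x"
proof -
  obtain B where B: "basis_mod A X B"
    using pure_subgroup_basis[OF assms] by blast
  then obtain \<kappa> where \<kappa>: "\<And>x. x \<in> X \<Longrightarrow> x - lincomb (\<kappa> x) B \<in> A"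
    and uniq: "\<And>x a b. x - lincomb a B \<in> A \<Longrightarrow> x \<in> X \<Longrightarrow> b \<in> B \<Longrightarrow> \<kappa> x b = a b"
    and add: "\<And>b. b \<in> B \<Longrightarrow> additive_on X (\<lambda>x. \<kappa> x b)"
    using basis_mod_coordinates[OF A(1) X(1)] by blast
  have lin: "lincomb (\<kappa> (x - y)) B = lincomb (\<kappa> x) B - lincomb (\<kappa> y) B" if "x \<in> X" "y \<in> X" for x y
    unfolding lincomb_diff unfolding lincomb_def
    by (rule sum.cong) (use add that in \<open>auto simp: additive_on_def\<close>)
  have "lincomb (\<kappa> x) B = 0" if "x \<in> A" for x
    using uniq[of x "\<lambda>_. 0"] that A(2) by (auto simp: lincomb_def)
  then show thesis
    using that[of "\<lambda>x. x - lincomb (\<kappa> x) B"] \<kappa> lin by (auto simp: additive_on_def algebra_simps)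
qed

section \<open>Quotients of chain groups: rank and freeness\<close>

definition frag_group :: "('a \<Rightarrow>\<^sub>0 int) set \<Rightarrow> ('a \<Rightarrow>\<^sub>0 int) monoid"
  where "frag_group X = \<lparr>carrier = X, monoid.mult = (+), one = 0\<rparr>"

lemma frag_group_simps [simp]:
  "carrier (frag_group X) = X" "x \<otimes>\<^bsub>frag_group X\<^esub> y = x + y" "\<one>\<^bsub>frag_group X\<^esub> = 0"
  by (simp_all add: frag_group_def)

lemma frag_group_comm_group:
  assumes "add_subgroup X" shows "comm_group (frag_group X)"
proof (rule comm_groupI)
  fix x assume "x \<in> carrier (frag_group X)"
  then show "\<exists>y\<in>carrier (frag_group X). y \<otimes>\<^bsub>frag_group X\<^esub> x = \<one>\<^bsub>frag_group X\<^esub>"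
    using add_subgroup_minus[OF assms] by (intro bexI[of _ "- x"]) auto
qed (use assms in \<open>auto simp: add_subgroup_0 add_subgroup_add algebra_simps\<close>)

lemma frag_group_inv:
  assumes "add_subgroup X" "x \<in> X" shows "inv\<^bsub>frag_group X\<^esub> x = - x"
proof -
  interpret comm_group "frag_group X"
    by (rule frag_group_comm_group[OF assms(1)])
  show ?thesis
    using assms add_subgroup_minus[OF assms(1,2)] by (intro inv_equality) auto
qed

definition coset_of :: "('a \<Rightarrow>\<^sub>0 int) set \<Rightarrow> ('a \<Rightarrow>\<^sub>0 int) \<Rightarrow> ('a \<Rightarrow>\<^sub>0 int) set"
  where "coset_of A x = (\<lambda>a. a + x) ` A"

lemma mem_coset_of: "y \<in> coset_of A x \<longleftrightarrow> y - x \<in> A"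
  by (auto simp: coset_of_def image_iff algebra_simps intro: bexI[of _ "y - x"])

lemma coset_of_0 [simp]: "coset_of A 0 = A"
  by (simp add: coset_of_def)

lemma coset_of_eq_iff:
  assumes "add_subgroup A" shows "coset_of A x = coset_of A y \<longleftrightarrow> x - y \<in> A"
proof
  assume "coset_of A x = coset_of A y"
  moreover have "x \<in> coset_of A x"
    using assms by (simp add: mem_coset_of add_subgroup_0)
  ultimately show "x - y \<in> A"
    by (simp add: mem_coset_of)
next
  assume xy: "x - y \<in> A"
  have "z - x \<in> A \<longleftrightarrow> z - y \<in> A" for z
    using add_subgroup_add[OF assms _ xy, of "z - x"] add_subgroup_diff[OF assms _ xy, of "z - y"] by auto
  then show "coset_of A x = coset_of A y"
    by (simp add: set_eq_iff mem_coset_of)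
qed

lemma r_coset_frag_group: "A #>\<^bsub>frag_group X\<^esub> x = coset_of A x"
  by (auto simp: r_coset_def coset_of_def)

locale quotient_pair =
  fixes A X :: "('a \<Rightarrow>\<^sub>0 int) set"
  assumes X: "add_subgroup X" and A: "add_subgroup A" and AX: "A \<subseteq> X"
begin

sublocale XG: comm_group "frag_group X"
  using X by (rule frag_group_comm_group)

lemma normal_A: "normal A (frag_group X)"
proof (rule XG.normal_iff_subgroup[THEN iffD2])
  show "subgroup A (frag_group X)"
    using A AX frag_group_inv[OF X] add_subgroup_minus[OF A]
    by (auto intro!: XG.subgroupI simp: add_subgroup_add add_subgroup_0 subset_iff)
       (use add_subgroup_0[OF A] in auto)
qed

lemma comm_group_quotient: "comm_group (frag_group X Mod A)"
  using XG.abelian_FactGroup normal_A normal_imp_subgroup by blast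

lemma carrier_quotient: "carrier (frag_group X Mod A) = coset_of A ` X"
  by (auto simp: FactGroup_def RCOSETS_def r_coset_frag_group)

lemma one_quotient: "\<one>\<^bsub>frag_group X Mod A\<^esub> = A"
  by (simp add: FactGroup_def)

lemma mult_quotient: "x \<in> X \<Longrightarrow> y \<in> X \<Longrightarrow>
    coset_of A x \<otimes>\<^bsub>frag_group X Mod A\<^esub> coset_of A y = coset_of A (x + y)"
  using normal.rcos_sum[OF normal_A, of x y] by (simp add: FactGroup_def r_coset_frag_group)

lemma int_pow_quotient:
  assumes x: "x \<in> X"
  shows "coset_of A x [^]\<^bsub>frag_group X Mod A\<^esub> (m::int) = coset_of A (frag_cmul m x)"
proof -
  interpret Q: comm_group "frag_group X Mod A"
    by (rule comm_group_quotient)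
  have c: "coset_of A x \<in> carrier (frag_group X Mod A)"
    using x by (auto simp: carrier_quotient)
  have i: "inv\<^bsub>frag_group X Mod A\<^esub> (coset_of A x) = coset_of A (- x)"
    using x add_subgroup_minus[OF X x] by (intro Q.inv_equality) (auto simp: carrier_quotient mult_quotient one_quotient simp del: mult_FactGroup)
  show ?thesis
  proof (induction m rule: int_induct[where k = 0])
    case base
    then show ?case
      by (simp add: one_quotient)
  next
    case (step1 m)
    then show ?case
      using x Q.int_pow_mult[OF c, of m 1] add_subgroup_cmul[OF X x, of m] c
      by (simp add: mult_quotient frag_cmul_distrib del: mult_FactGroup)
  next
    case (step2 m)
    have "coset_of A x [^]\<^bsub>frag_group X Mod A\<^esub> (m - 1) = coset_of A (frag_cmul m x) \<otimes>\<^bsub>frag_group X Mod A\<^esub> coset_of A (- x)"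
      using step2 Q.int_pow_mult[OF c, of m "-1"] c i Q.int_pow_neg[OF c, of 1] by simp
    then show ?case
      using x add_subgroup_cmul[OF X x, of m] add_subgroup_minus[OF X x]
      by (simp add: mult_quotient frag_cmul_diff_distrib del: mult_FactGroup)
  qed
qed

lemma finprod_quotient:
  assumes "finite T" "\<And>t. t \<in> T \<Longrightarrow> f t \<in> X"
  shows "(\<Otimes>\<^bsub>frag_group X Mod A\<^esub>t\<in>T. coset_of A (f t)) = coset_of A (sum f T)"
proof -
  interpret Q: comm_group "frag_group X Mod A"
    by (rule comm_group_quotient)
  show ?thesis
    using assms
  proof (induction T rule: finite_induct)
    case empty
    then show ?case
      by (simp add: one_quotient)
  next
    case (insert t T)
    then show ?case
      using add_subgroup_sum[OF X, of T f]
      by (subst Q.finprod_insert) (auto simp: carrier_quotient mult_quotient simp del: mult_FactGroup)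
  qed
qed

text \<open>A dependence between representatives in \<open>X\<close> is inherited by their classes.\<close>
lemma int_independent_card_le:
  assumes F: "finite F" "X \<subseteq> frags F" and ind: "int_independent (frag_group X Mod A) T"
  shows "card T \<le> card F"
proof (rule ccontr)
  assume "\<not> card T \<le> card F"
  have fin: "finite T" and car: "T \<subseteq> coset_of A ` X"
    using ind unfolding int_independent_def carrier_quotient by blast+
  define rep where "rep t = (SOME x. x \<in> X \<and> t = coset_of A x)" for t
  have rep: "rep t \<in> X \<and> t = coset_of A (rep t)" if "t \<in> T" for t
    unfolding rep_def by (rule someI_ex) (use that car in blast)
  have "\<exists>a. (\<exists>t\<in>T. a t \<noteq> 0) \<and> (\<Sum>t\<in>T. frag_cmul (a t) (rep t)) = 0"
    by (rule integer_dependence[OF F(1) fin]) (use \<open>\<not> card T \<le> card F\<close> rep F(2) in auto)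
  then obtain a where a: "\<exists>t\<in>T. a t \<noteq> 0" "(\<Sum>t\<in>T. frag_cmul (a t) (rep t)) = 0"
    by blast
  interpret Q: comm_group "frag_group X Mod A"
    by (rule comm_group_quotient)
  have "(\<Otimes>\<^bsub>frag_group X Mod A\<^esub>t\<in>T. t [^]\<^bsub>frag_group X Mod A\<^esub> a t)
      = (\<Otimes>\<^bsub>frag_group X Mod A\<^esub>t\<in>T. coset_of A (frag_cmul (a t) (rep t)))"
  proof (rule Q.finprod_cong', simp_all)
    show "(\<lambda>t. coset_of A (frag_cmul (a t) (rep t))) \<in> T \<rightarrow> carrier (frag_group X Mod A)"
      using rep add_subgroup_cmul[OF X] by (auto simp: carrier_quotient)
    show "t [^]\<^bsub>frag_group X Mod A\<^esub> a t = coset_of A (frag_cmul (a t) (rep t))" if "t \<in> T" for t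
      using int_pow_quotient[of "rep t" "a t"] rep[OF that] by simp
  qed
  also have "\<dots> = coset_of A (\<Sum>t\<in>T. frag_cmul (a t) (rep t))"
    using fin rep add_subgroup_cmul[OF X] by (intro finprod_quotient) auto
  also have "\<dots> = \<one>\<^bsub>frag_group X Mod A\<^esub>"
    by (simp add: a one_quotient)
  finally have "\<forall>t\<in>T. a t = 0"
    using ind unfolding int_independent_def by blast
  then show False
    using a(1) by blast
qed

lemma abelian_rank_le:
  assumes "finite F" "X \<subseteq> frags F"
  shows "abelian_rank (frag_group X Mod A) \<le> card F"
proof -
  have "int_independent (frag_group X Mod A) {}"
    by (simp add: int_independent_def)
  then show ?thesis
    unfolding abelian_rank_def using int_independent_card_le[OF assms]
    by (intro cSup_least) auto
qed

text \<open>Elements that are independent modulo \<open>A\<close> bound the rank from below. The hypothesis forces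
  distinct indices to have distinct classes.\<close>
lemma abelian_rank_ge:
  assumes F: "finite F" "X \<subseteq> frags F" and T: "finite T" and f: "\<And>t. t \<in> T \<Longrightarrow> f t \<in> X"
    and ind: "\<And>a t. (\<Sum>t\<in>T. frag_cmul (a t) (f t)) \<in> A \<Longrightarrow> t \<in> T \<Longrightarrow> a t = 0"
  shows "card T \<le> abelian_rank (frag_group X Mod A)"
proof -
  interpret Q: comm_group "frag_group X Mod A"
    by (rule comm_group_quotient)
  let ?c = "\<lambda>t. coset_of A (f t)"
  have inj: "inj_on ?c T"
  proof (rule inj_onI, rule ccontr)
    fix s t assume st: "s \<in> T" "t \<in> T" "?c s = ?c t" "s \<noteq> t"
    define a where "a = (\<lambda>u. if u = s then 1 else if u = t then - 1 else (0::int))"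
    have "(\<Sum>u\<in>T. frag_cmul (a u) (f u)) = (\<Sum>u\<in>{s, t}. frag_cmul (a u) (f u))"
      by (rule sum.mono_neutral_right[OF T]) (use st in \<open>simp_all add: a_def\<close>)
    also have "\<dots> = f s - f t"
      using st by (simp add: a_def)
    also have "\<dots> \<in> A"
      using st coset_of_eq_iff[OF A] by blast
    finally have "a s = 0"
      by (rule ind) (use st in simp)
    then show False
      by (simp add: a_def)
  qed
  have "int_independent (frag_group X Mod A) (?c ` T)"
    unfolding int_independent_def
  proof (intro conjI allI impI ballI)
    fix a :: "_ \<Rightarrow> int" and x
    assume prod: "(\<Otimes>\<^bsub>frag_group X Mod A\<^esub>x\<in>?c ` T. x [^]\<^bsub>frag_group X Mod A\<^esub> a x) = \<one>\<^bsub>frag_group X Mod A\<^esub>"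
      and x: "x \<in> ?c ` T"
    have "(\<Otimes>\<^bsub>frag_group X Mod A\<^esub>x\<in>?c ` T. x [^]\<^bsub>frag_group X Mod A\<^esub> a x)
        = (\<Otimes>\<^bsub>frag_group X Mod A\<^esub>t\<in>T. ?c t [^]\<^bsub>frag_group X Mod A\<^esub> a (?c t))"
    proof (rule Q.finprod_reindex[OF _ inj])
      show "(\<lambda>x. x [^]\<^bsub>frag_group X Mod A\<^esub> a x) \<in> ?c ` T \<rightarrow> carrier (frag_group X Mod A)"
      proof (rule funcsetI)
        fix y assume "y \<in> ?c ` T"
        then have "y \<in> carrier (frag_group X Mod A)"
          using f by (auto simp: carrier_quotient)
        then show "y [^]\<^bsub>frag_group X Mod A\<^esub> a y \<in> carrier (frag_group X Mod A)"
          by (rule Q.int_pow_closed)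
      qed
    qed
    also have "\<dots> = (\<Otimes>\<^bsub>frag_group X Mod A\<^esub>t\<in>T. coset_of A (frag_cmul (a (?c t)) (f t)))"
      using f add_subgroup_cmul[OF X]
      by (intro Q.finprod_cong') (auto simp: int_pow_quotient carrier_quotient)
    also have "\<dots> = coset_of A (\<Sum>t\<in>T. frag_cmul (a (?c t)) (f t))"
      using T f add_subgroup_cmul[OF X] by (intro finprod_quotient) auto
    finally have "coset_of A (\<Sum>t\<in>T. frag_cmul (a (?c t)) (f t)) = coset_of A 0"
      using prod by (simp add: one_quotient)
    then have "(\<Sum>t\<in>T. frag_cmul (a (?c t)) (f t)) \<in> A"
      using coset_of_eq_iff[OF A] by (metis diff_zero)
    then show "a x = 0"
      using ind[of "\<lambda>t. a (?c t)"] x by auto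
  qed (use T f in \<open>auto simp: carrier_quotient\<close>)
  then have "card (?c ` T) \<in> {card B |B. int_independent (frag_group X Mod A) B}"
    by blast
  then have "card (?c ` T) \<le> abelian_rank (frag_group X Mod A)"
    unfolding abelian_rank_def using int_independent_card_le[OF F]
    by (intro cSup_upper bdd_aboveI[of _ "card F"]) auto
  then show ?thesis
    using inj by (simp add: card_image)
qed

end

text \<open>Homomorphisms to the integers that are jointly onto the lattice spanned by \<open>B\<close>
  identify the quotient by their common kernel with the free abelian group on \<open>B\<close>. It is applied both to
  homology, with coordinates, and to cohomology, with evaluations.\<close>
lemma coordinate_hom_iso:
  assumes H: "comm_group H" and h: "\<And>b. b \<in> B \<Longrightarrow> h b \<in> hom H integer_group" and B: "finite B"
    and surj: "\<And>y. y \<in> frags B \<Longrightarrow> \<exists>x\<in>carrier H. \<forall>b\<in>B. h b x = Poly_Mapping.lookup y b"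
    and ker: "N = {x \<in> carrier H. \<forall>b\<in>B. h b x = 0}"
  shows "H Mod N \<cong> free_Abelian_group B \<and> Group.group (H Mod N)"
proof -
  let ?g = "\<lambda>x. \<Sum>b\<in>B. frag_cmul (h b x) (frag_of b)"
  have look: "Poly_Mapping.lookup (?g x) b = (if b \<in> B then h b x else 0)" for x b
    using B by (simp add: lookup_sum if_distrib cong: if_cong)
  have keys: "?g x \<in> frags B" for x
    by (intro add_subgroup_sum add_subgroup_frags add_subgroup_cmul) (auto simp: frags_def)
  have "group_hom H (free_Abelian_group B) ?g"
    unfolding group_hom_def group_hom_axioms_def
  proof (intro conjI)
    show "Group.group H"
      using H by (simp add: comm_group_def)
    show "?g \<in> hom H (free_Abelian_group B)"
    proof (rule homI)
      fix x y assume "x \<in> carrier H" "y \<in> carrier H"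
      then show "?g (x \<otimes>\<^bsub>H\<^esub> y) = ?g x \<otimes>\<^bsub>free_Abelian_group B\<^esub> ?g y"
        using h by (simp add: hom_def frag_cmul_distrib sum.distrib)
    qed (use keys in \<open>auto simp: frags_def\<close>)
  qed simp
  then interpret gh: group_hom H "free_Abelian_group B" ?g .
  have "?g ` carrier H = carrier (free_Abelian_group B)"
  proof
    show "carrier (free_Abelian_group B) \<subseteq> ?g ` carrier H"
    proof
      fix y assume "y \<in> carrier (free_Abelian_group B)"
      then have y: "y \<in> frags B"
        by (simp add: frags_def)
      then obtain x where x: "x \<in> carrier H" "\<And>b. b \<in> B \<Longrightarrow> h b x = Poly_Mapping.lookup y b"
        using surj by blast
      have "?g x = y"
        by (rule poly_mapping_eqI, subst look) (use x y in \<open>auto simp: lookup_frags\<close>)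
      then show "y \<in> ?g ` carrier H"
        using x by blast
    qed
  qed (use keys in \<open>auto simp: frags_def\<close>)
  then have "H Mod kernel H (free_Abelian_group B) ?g \<cong> free_Abelian_group B"
    by (rule gh.FactGroup_iso)
  moreover have "Group.group (H Mod kernel H (free_Abelian_group B) ?g)"
    by (rule normal.factorgroup_is_group[OF gh.normal_kernel])
  moreover have "?g x = 0 \<longleftrightarrow> (\<forall>b\<in>B. h b x = 0)" for x
  proof
    assume "?g x = 0"
    then have "Poly_Mapping.lookup (?g x) b = 0" for b
      by simp
    then show "\<forall>b\<in>B. h b x = 0"
      unfolding look by metis
  qed simp
  then have "kernel H (free_Abelian_group B) ?g = N"
    unfolding kernel_def ker one_free_Abelian_group by blast
  ultimately show ?thesis
    by (simp only: simp_thms)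
qed

context quotient_pair begin

lemma quotient_iso_free:
  assumes "basis_mod A X B"
  shows "frag_group X Mod A \<cong> free_Abelian_group B"
proof -
  obtain \<kappa> where \<kappa>: "\<And>x. x \<in> X \<Longrightarrow> x - lincomb (\<kappa> x) B \<in> A"
    and uniq: "\<And>x a b. x - lincomb a B \<in> A \<Longrightarrow> x \<in> X \<Longrightarrow> b \<in> B \<Longrightarrow> \<kappa> x b = a b"
    and add: "\<And>b. b \<in> B \<Longrightarrow> additive_on X (\<lambda>x. \<kappa> x b)"
    using basis_mod_coordinates[OF A X assms] by blast
  have B: "finite B" "B \<subseteq> X"
    using assms by (auto simp: basis_mod_def)
  have "frag_group X Mod A \<cong> free_Abelian_group B \<and> Group.group (frag_group X Mod A)"
  proof (rule coordinate_hom_iso[where h = "\<lambda>b x. \<kappa> x b"])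
    show "(\<lambda>x. \<kappa> x b) \<in> hom (frag_group X) integer_group" if "b \<in> B" for b
      using additive_on_add[OF add[OF that] X] by (auto simp: hom_def)
    show "\<exists>x\<in>carrier (frag_group X). \<forall>b\<in>B. \<kappa> x b = Poly_Mapping.lookup y b" for y
      using uniq[of "lincomb (Poly_Mapping.lookup y) B" "Poly_Mapping.lookup y"] add_subgroup_lincomb[OF X B(2)]
        add_subgroup_0[OF A]
      by (intro bexI[of _ "lincomb (Poly_Mapping.lookup y) B"]) auto
    show "A = {x \<in> carrier (frag_group X). \<forall>b\<in>B. \<kappa> x b = 0}"
    proof (intro equalityI subsetI)
      fix x assume "x \<in> A"
      then show "x \<in> {x \<in> carrier (frag_group X). \<forall>b\<in>B. \<kappa> x b = 0}"
        using uniq[of x "\<lambda>_. 0"] AX by (auto simp: lincomb_def)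
    next
      fix x assume "x \<in> {x \<in> carrier (frag_group X). \<forall>b\<in>B. \<kappa> x b = 0}"
      then show "x \<in> A"
        using \<kappa>[of x] by (simp add: lincomb_def)
    qed
  qed (rule XG.comm_group_axioms B(1))+
  then show ?thesis ..
qed

lemma quotient_free_abelian:
  assumes B: "basis_mod A X B"
  shows "free_abelian (frag_group X Mod A)"
proof -
  have "inj_on (coset_of A) B"
  proof (rule inj_onI, rule ccontr)
    fix x y assume xy: "x \<in> B" "y \<in> B" "coset_of A x = coset_of A y" "x \<noteq> y"
    let ?a = "\<lambda>u. if u = x then 1 else if u = y then - 1 else (0::int)"
    have "finite B"
      using B by (simp add: basis_mod_def)
    then have "lincomb ?a B = (\<Sum>u\<in>{x, y}. frag_cmul (?a u) u)"
      unfolding lincomb_def by (rule sum.mono_neutral_right) (use xy in simp_all)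
    also have "\<dots> = x - y"
      using xy by simp
    also have "\<dots> \<in> A"
      using xy coset_of_eq_iff[OF A] by blast
    finally have "\<forall>b\<in>B. ?a b = 0"
      using B unfolding basis_mod_def by (elim conjE allE) (rule mp)
    then have "?a x = 0"
      using xy(1) by (rule bspec)
    then show False
      by simp
  qed
  then have "B \<approx> coset_of A ` B"
    unfolding eqpoll_def by (blast intro: bij_betw_imageI)
  then have "frag_group X Mod A \<cong> free_Abelian_group (coset_of A ` B)"
    using quotient_iso_free[OF B] isomorphic_free_Abelian_groups iso_trans by blast
  moreover have "coset_of A ` B \<subseteq> carrier (frag_group X Mod A)"
    using B by (auto simp: carrier_quotient basis_mod_def)
  ultimately show ?thesis
    unfolding free_abelian_def by blast
qed

end

section \<open>Homology and cohomology of a finite complex\<close>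

text \<open>The index counts vertices: simplices with \<open>m\<close> vertices have dimension \<open>m - 1\<close>, and \<open>m = 0\<close>
  is the empty simplex.\<close>
definition simplices :: "'v set set \<Rightarrow> nat \<Rightarrow> 'v set set"
  where "simplices K m = {s \<in> K. card s = m}"

definition cycles :: "'v set set \<Rightarrow> nat \<Rightarrow> ('v set \<Rightarrow>\<^sub>0 int) set"
  where "cycles K q = {c \<in> frags (simplices K (Suc q)). boundary_map q c = 0}"

locale finite_complex =
  fixes K :: "'v set set"
  assumes finite_K: "finite K" and finite_simplex: "s \<in> K \<Longrightarrow> finite s"
    and face_closed: "s \<in> K \<Longrightarrow> t \<subseteq> s \<Longrightarrow> t \<noteq> {} \<Longrightarrow> t \<in> K"
begin

lemma finite_simplices: "finite (simplices K m)"
  using finite_K by (simp add: simplices_def)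

lemma chain_finite: "c \<in> frags (simplices K m) \<Longrightarrow> s \<in> Poly_Mapping.keys c \<Longrightarrow> finite s"
  unfolding frags_def simplices_def by (blast intro: finite_simplex)

lemma boundary_map_Suc: "c \<in> frags (simplices K m) \<Longrightarrow> boundary_map (Suc q) c = bd c"
  by (rule boundary_map_eq_bd) (auto dest: chain_finite)

lemma bd_chain:
  assumes "c \<in> frags (simplices K (Suc (Suc q)))"
  shows "bd c \<in> frags (simplices K (Suc q))"
proof -
  have "s - {v} \<in> simplices K (Suc q)" if "s \<in> Poly_Mapping.keys c" "v \<in> s" for s v
  proof -
    have "s \<in> simplices K (Suc (Suc q))"
      using that assms by (auto simp: frags_def)
    then have s: "s \<in> K" "card s = Suc (Suc q)" "finite s"
      by (simp_all add: simplices_def finite_simplex)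
    then have "card (s - {v}) = Suc q"
      using that by simp
    moreover from this have "s - {v} \<noteq> {}"
      by force
    then have "s - {v} \<in> K"
      using s(1) by (rule_tac face_closed[of s]) auto
    ultimately show ?thesis
      by (simp add: simplices_def)
  qed
  then show ?thesis
    unfolding bd_def frag_extend_def
    by (intro add_subgroup_sum add_subgroup_cmul add_subgroup_frags) (auto simp: frags_def)
qed

lemma boundaries_eq: "boundaries K q = bd ` frags (simplices K (Suc (Suc q)))"
proof -
  have "carrier (chain_group K (Suc q)) = frags (simplices K (Suc (Suc q)))"
    by (auto simp: chain_group_def frags_def simplices_def)
  then show ?thesis
    unfolding boundaries_def by (auto simp: boundary_map_Suc)
qed

lemma boundary_boundary: "c \<in> frags (simplices K (Suc (Suc q))) \<Longrightarrow> boundary_map q (bd c) = 0"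
  by (cases q) (simp_all add: boundary_map_Suc[OF bd_chain], simp add: boundary_map_def)

lemma boundaries_subset_cycles: "boundaries K q \<subseteq> cycles K q"
  by (auto simp: boundaries_eq cycles_def bd_chain boundary_boundary)

lemma add_subgroup_cycles: "add_subgroup (cycles K q)"
  unfolding add_subgroup_def
proof (intro conjI ballI)
  show "0 \<in> cycles K q"
    by (simp add: cycles_def boundary_map_def add_subgroup_0)
  fix x y assume "x \<in> cycles K q" "y \<in> cycles K q"
  then show "x - y \<in> cycles K q"
    by (simp add: cycles_def boundary_map_def frag_extend_diff add_subgroup_diff split: if_splits)
qed

lemma add_subgroup_boundaries: "add_subgroup (boundaries K q)"
  unfolding add_subgroup_def boundaries_eq
proof (intro conjI ballI)
  show "0 \<in> bd ` frags (simplices K (Suc (Suc q)))"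
    by (rule image_eqI[of _ _ 0]) (simp_all add: add_subgroup_0)
  fix x y assume "x \<in> bd ` frags (simplices K (Suc (Suc q)))" "y \<in> bd ` frags (simplices K (Suc (Suc q)))"
  then obtain a b where "x = bd a" "y = bd b" "a \<in> frags (simplices K (Suc (Suc q)))" "b \<in> frags (simplices K (Suc (Suc q)))"
    by auto
  then show "x - y \<in> bd ` frags (simplices K (Suc (Suc q)))"
    by (intro image_eqI[of _ _ "a - b"]) (simp_all add: bd_diff add_subgroup_diff)
qed

lemma cycle_group_eq: "cycle_group K q = frag_group (cycles K q)"
  unfolding cycle_group_def chain_group_def free_Abelian_group_def frag_group_def cycles_def
  by (simp add: frags_def simplices_def)

lemma homology_eq: "simplicial_homology q K = frag_group (cycles K q) Mod boundaries K q"
  by (simp add: simplicial_homology_def cycle_group_eq)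

lemma quotient_pair_homology: "quotient_pair (boundaries K q) (cycles K q)"
  by unfold_locales (rule add_subgroup_cycles add_subgroup_boundaries boundaries_subset_cycles)+

lemma cycles_subset: "cycles K q \<subseteq> frags (simplices K (Suc q))"
  by (auto simp: cycles_def)

text \<open>The boundary takes values in a torsion-free group.\<close>
lemma cycles_pure: "pure_in (cycles K q) (frags (simplices K (Suc q)))"
  by (simp add: pure_in_def cycles_def boundary_map_def frag_extend_cmul)

lemma homology_rank_le: "abelian_rank (simplicial_homology q K) \<le> card (simplices K (Suc q))"
  unfolding homology_eq
  by (rule quotient_pair.abelian_rank_le[OF quotient_pair_homology finite_simplices cycles_subset])

lemma homology_rank_ge:
  assumes "finite T" "\<And>t. t \<in> T \<Longrightarrow> f t \<in> cycles K q"
    and "\<And>a t. (\<Sum>t\<in>T. frag_cmul (a t) (f t)) \<in> boundaries K q \<Longrightarrow> t \<in> T \<Longrightarrow> a t = 0"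
  shows "card T \<le> abelian_rank (simplicial_homology q K)"
  unfolding homology_eq
  by (rule quotient_pair.abelian_rank_ge[OF quotient_pair_homology finite_simplices cycles_subset, of T f q])
     (fact assms)+

lemma chain_group_carrier: "carrier (chain_group K q) = frags (simplices K (Suc q))"
  by (auto simp: chain_group_def frags_def simplices_def)

lemma hom_chain_group_iff:
  "\<phi> \<in> hom (chain_group K q) integer_group \<longleftrightarrow> additive_on (frags (simplices K (Suc q))) \<phi>"
proof
  assume hom: "\<phi> \<in> hom (chain_group K q) integer_group"
  show "additive_on (frags (simplices K (Suc q))) \<phi>"
    unfolding additive_on_def
  proof (intro ballI)
    fix x y assume "x \<in> frags (simplices K (Suc q))" "y \<in> frags (simplices K (Suc q))"
    moreover from this have "x - y \<in> frags (simplices K (Suc q))"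
      by (simp add: add_subgroup_diff)
    moreover have "\<forall>a\<in>frags (simplices K (Suc q)). \<forall>b\<in>frags (simplices K (Suc q)). \<phi> (a + b) = \<phi> a + \<phi> b"
      using hom unfolding hom_def chain_group_carrier by (simp add: chain_group_def)
    ultimately have "\<phi> ((x - y) + y) = \<phi> (x - y) + \<phi> y"
      by blast
    then show "\<phi> (x - y) = \<phi> x - \<phi> y"
      by simp
  qed
next
  assume "additive_on (frags (simplices K (Suc q))) \<phi>"
  then show "\<phi> \<in> hom (chain_group K q) integer_group"
    unfolding hom_def chain_group_carrier
    by (simp add: chain_group_def additive_on_add)
qed

lemma cocycle_group_carrier:
  "carrier (cocycle_group K q) = {\<phi> \<in> extensional (frags (simplices K (Suc q))).
     additive_on (frags (simplices K (Suc q))) \<phi> \<and> (\<forall>b\<in>boundaries K q. \<phi> b = 0)}"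
proof -
  have "coboundary_map K q \<phi> = \<one>\<^bsub>cochain_group K (Suc q)\<^esub> \<longleftrightarrow> (\<forall>b\<in>boundaries K q. \<phi> b = 0)" for \<phi>
  proof -
    have "coboundary_map K q \<phi> = \<one>\<^bsub>cochain_group K (Suc q)\<^esub>
        \<longleftrightarrow> (\<forall>c\<in>carrier (chain_group K (Suc q)). \<phi> (boundary_map (Suc q) c) = 0)"
      by (simp add: coboundary_map_def cochain_group_def product_group_def restrict_def fun_eq_iff) metis
    then show ?thesis
      by (auto simp: boundaries_def)
  qed
  then show ?thesis
    by (auto simp: cocycle_group_def kernel_def cochain_group_def hom_chain_group_iff chain_group_carrier)
qed

lemma cocycle_group_mult:
  "x \<otimes>\<^bsub>cocycle_group K q\<^esub> y = (\<lambda>c\<in>frags (simplices K (Suc q)). x c + y c)"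
  by (simp add: cocycle_group_def cochain_group_def product_group_def chain_group_carrier)

lemma cocycle_group_one: "\<one>\<^bsub>cocycle_group K q\<^esub> = (\<lambda>c\<in>frags (simplices K (Suc q)). 0)"
  by (simp add: cocycle_group_def cochain_group_def product_group_def chain_group_carrier)

lemma boundaries_subset_chains: "boundaries K q \<subseteq> frags (simplices K (Suc q))"
  using boundaries_subset_cycles cycles_subset by blast

lemma additive_on_restrict:
  "add_subgroup X \<Longrightarrow> additive_on X \<phi> \<Longrightarrow> additive_on X (restrict \<phi> X)"
  by (auto simp: additive_on_def add_subgroup_diff)

lemma comm_group_cocycle: "comm_group (cocycle_group K q)"
proof -
  let ?C = "frags (simplices K (Suc q))"
  have C: "add_subgroup ?C"
    by simp
  have sub: "\<And>b. b \<in> boundaries K q \<Longrightarrow> b \<in> ?C"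
    using boundaries_subset_chains by blast
  show ?thesis
  proof (rule comm_groupI)
    fix x y assume "x \<in> carrier (cocycle_group K q)" "y \<in> carrier (cocycle_group K q)"
    then show "x \<otimes>\<^bsub>cocycle_group K q\<^esub> y \<in> carrier (cocycle_group K q)"
      by (simp add: cocycle_group_carrier cocycle_group_mult additive_on_def sub add_subgroup_diff)
  next
    show "\<one>\<^bsub>cocycle_group K q\<^esub> \<in> carrier (cocycle_group K q)"
      by (simp add: cocycle_group_carrier cocycle_group_one additive_on_def sub add_subgroup_diff)
  next
    fix x assume x: "x \<in> carrier (cocycle_group K q)"
    then show "\<one>\<^bsub>cocycle_group K q\<^esub> \<otimes>\<^bsub>cocycle_group K q\<^esub> x = x"
      by (auto simp: cocycle_group_carrier cocycle_group_mult cocycle_group_one fun_eq_iff extensional_def)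
    show "\<exists>y\<in>carrier (cocycle_group K q). y \<otimes>\<^bsub>cocycle_group K q\<^esub> x = \<one>\<^bsub>cocycle_group K q\<^esub>"
      using x by (intro bexI[of _ "\<lambda>c\<in>?C. - x c"])
         (simp_all add: cocycle_group_carrier cocycle_group_mult cocycle_group_one additive_on_def fun_eq_iff
            sub add_subgroup_diff)
  qed (auto simp: cocycle_group_mult fun_eq_iff)
qed

text \<open>A functional on chains that kills the cycles is a functional on the boundaries of the next
  lower degree. It extends to all chains there because purity of the boundaries provides a
  retraction onto them.\<close>
lemma extend_from_boundaries:
  assumes tf: "pure_in (boundaries K q) (cycles K q)"
    and \<phi>: "additive_on (frags (simplices K (Suc (Suc q)))) (\<phi> :: _ \<Rightarrow> int)"
    and 0: "\<And>z. z \<in> cycles K (Suc q) \<Longrightarrow> \<phi> z = 0"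
  obtains \<psi> where "additive_on (frags (simplices K (Suc q))) \<psi>"
    "\<And>c. c \<in> frags (simplices K (Suc (Suc q))) \<Longrightarrow> \<psi> (bd c) = \<phi> c"
proof -
  let ?C = "frags (simplices K (Suc q))" and ?C' = "frags (simplices K (Suc (Suc q)))"
  have "pure_in (boundaries K q) ?C"
    unfolding pure_in_def
  proof (intro ballI allI impI)
    fix x and m :: int assume x: "x \<in> ?C" "m \<noteq> 0" "frag_cmul m x \<in> boundaries K q"
    then have "frag_cmul m x \<in> cycles K q"
      using boundaries_subset_cycles by blast
    then have "x \<in> cycles K q"
      using x cycles_pure[of q] unfolding pure_in_def by blast
    then show "x \<in> boundaries K q"
      using x tf unfolding pure_in_def by blast
  qed
  then obtain \<rho> where \<rho>: "additive_on ?C \<rho>" "\<And>x. x \<in> ?C \<Longrightarrow> \<rho> x \<in> boundaries K q"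
    "\<And>x. x \<in> boundaries K q \<Longrightarrow> \<rho> x = x"
    using pure_subgroup_retraction[OF finite_simplices add_subgroup_frags order_refl
        add_subgroup_boundaries boundaries_subset_chains] by blast
  define pre where "pre b = (SOME c. c \<in> ?C' \<and> bd c = b)" for b
  have pre: "pre b \<in> ?C' \<and> bd (pre b) = b" if "b \<in> boundaries K q" for b
    unfolding pre_def by (rule someI_ex) (use that in \<open>auto simp: boundaries_eq\<close>)
  have eq: "\<phi> c = \<phi> c'" if "c \<in> ?C'" "c' \<in> ?C'" "bd c = bd c'" for c c'
  proof -
    have "c - c' \<in> cycles K (Suc q)"
      using that boundary_map_Suc[OF add_subgroup_diff[OF add_subgroup_frags that(1,2)]]
        add_subgroup_diff[OF add_subgroup_frags that(1,2)] by (simp add: cycles_def bd_diff)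
    then have "\<phi> (c - c') = 0"
      by (rule 0)
    then show ?thesis
      using \<phi> that by (simp add: additive_on_def)
  qed
  have "additive_on ?C (\<lambda>x. \<phi> (pre (\<rho> x)))"
    unfolding additive_on_def
  proof (intro ballI)
    fix x y assume xy: "x \<in> ?C" "y \<in> ?C"
    have p: "pre (\<rho> x) \<in> ?C'" "pre (\<rho> y) \<in> ?C'" "bd (pre (\<rho> x)) = \<rho> x" "bd (pre (\<rho> y)) = \<rho> y"
      using xy \<rho>(2) pre by auto
    have "\<phi> (pre (\<rho> (x - y))) = \<phi> (pre (\<rho> x) - pre (\<rho> y))"
    proof (rule eq)
      have "\<rho> (x - y) \<in> boundaries K q"
        using xy \<rho>(2) add_subgroup_diff[OF add_subgroup_frags] by blast
      then show "pre (\<rho> (x - y)) \<in> ?C'" "bd (pre (\<rho> (x - y))) = bd (pre (\<rho> x) - pre (\<rho> y))"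
        using pre[of "\<rho> (x - y)"] \<rho>(1) xy p by (simp_all add: bd_diff additive_on_def)
    qed (use p in \<open>simp add: add_subgroup_diff\<close>)
    then show "\<phi> (pre (\<rho> (x - y))) = \<phi> (pre (\<rho> x)) - \<phi> (pre (\<rho> y))"
      using \<phi> p by (simp add: additive_on_def)
  qed
  moreover have "\<phi> (pre (\<rho> (bd c))) = \<phi> c" if "c \<in> ?C'" for c
  proof -
    have "bd c \<in> boundaries K q"
      using that by (auto simp: boundaries_eq)
    then show ?thesis
      using pre[of "bd c"] \<rho>(3)[of "bd c"] that by (rule_tac eq) simp_all
  qed
  ultimately show thesis
    using that by blast
qed

text \<open>A cochain that vanishes on cycles is a coboundary if homology is torsion-free. This is the
  vanishing of the torsion term in the universal coefficient theorem.\<close>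
lemma coboundaries_eq:
  assumes tf: "\<And>q. pure_in (boundaries K q) (cycles K q)"
  shows "coboundaries K q = {\<phi> \<in> carrier (cocycle_group K q). \<forall>z\<in>cycles K q. \<phi> z = 0}"
proof (cases q)
  case 0
  have "cycles K 0 = frags (simplices K (Suc 0))"
    by (auto simp: cycles_def boundary_map_def)
  then have "{\<phi> \<in> carrier (cocycle_group K q). \<forall>z\<in>cycles K q. \<phi> z = 0}
      = {\<phi> \<in> carrier (cocycle_group K q). \<phi> = \<one>\<^bsub>cocycle_group K q\<^esub>}"
    using 0 by (auto simp: cocycle_group_carrier cocycle_group_one fun_eq_iff extensional_def)
  also have "\<dots> = {\<one>\<^bsub>cocycle_group K q\<^esub>}"
    using comm_group_cocycle[of q] by (auto simp: comm_group_def group_def intro: monoid.one_closed)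
  finally show ?thesis
    using 0 by (simp add: coboundaries_def cocycle_group_def)
next
  case (Suc p)
  let ?C = "frags (simplices K (Suc q))" and ?D = "frags (simplices K (Suc p))"
  have bdD: "bd c \<in> ?D" if "c \<in> ?C" for c
    using bd_chain[of c p] that Suc by simp
  have carr: "carrier (cochain_group K p) = {\<psi> \<in> extensional ?D. additive_on ?D \<psi>}"
    by (auto simp: cochain_group_def hom_chain_group_iff chain_group_carrier)
  have cob: "coboundary_map K p \<psi> = (\<lambda>c\<in>?C. \<psi> (bd c))" for \<psi>
    unfolding coboundary_map_def chain_group_carrier Suc by (simp add: fun_eq_iff boundary_map_Suc restrict_def)
  show ?thesis
  proof (intro equalityI subsetI)
    fix \<phi> assume "\<phi> \<in> coboundaries K q"
    then obtain \<psi> where \<psi>: "additive_on ?D \<psi>" "\<phi> = (\<lambda>c\<in>?C. \<psi> (bd c))"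
      using Suc by (auto simp: coboundaries_def carr cob)
    have \<psi>0: "\<psi> 0 = 0"
      using additive_on_0[OF \<psi>(1)] add_subgroup_0[OF add_subgroup_frags] by blast
    have z: "\<phi> z = 0" if "z \<in> cycles K q" for z
    proof -
      have "z \<in> ?C" "bd z = 0"
          using that Suc boundary_map_Suc[of z "Suc q" p] by (simp_all add: cycles_def)
      then show ?thesis
        using \<psi> \<psi>0 by simp
    qed
    moreover have "\<phi> \<in> carrier (cocycle_group K q)"
    proof -
      have "additive_on ?C \<phi>"
        using \<psi>(1) by (simp add: \<psi>(2) additive_on_def bd_diff bdD add_subgroup_diff)
      moreover have "\<forall>b\<in>boundaries K q. \<phi> b = 0"
        using z boundaries_subset_cycles[of q] by blast
      ultimately show ?thesis
        by (simp add: cocycle_group_carrier \<psi>(2))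
    qed
    ultimately show "\<phi> \<in> {\<phi> \<in> carrier (cocycle_group K q). \<forall>z\<in>cycles K q. \<phi> z = 0}"
      by simp
  next
    fix \<phi> assume \<phi>: "\<phi> \<in> {\<phi> \<in> carrier (cocycle_group K q). \<forall>z\<in>cycles K q. \<phi> z = 0}"
    then obtain \<psi> where \<psi>: "additive_on ?D \<psi>" "\<And>c. c \<in> ?C \<Longrightarrow> \<psi> (bd c) = \<phi> c"
    proof -
      have "additive_on (frags (simplices K (Suc (Suc p)))) \<phi>" "\<And>z. z \<in> cycles K (Suc p) \<Longrightarrow> \<phi> z = 0"
        using \<phi> Suc by (simp_all add: cocycle_group_carrier)
      from extend_from_boundaries[OF tf this] show ?thesis
        using that Suc by blast
    qed
    have "restrict \<psi> ?D \<in> carrier (cochain_group K p)"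
      using \<psi>(1) by (simp add: carr additive_on_restrict)
    moreover have "coboundary_map K p (restrict \<psi> ?D) = \<phi>"
      using \<phi> by (auto simp: cob fun_eq_iff cocycle_group_carrier extensional_def \<psi>(2) bdD)
    ultimately show "\<phi> \<in> coboundaries K q"
      using Suc by (auto simp: coboundaries_def)
  qed
qed

text \<open>A basis \<open>B\<close> of the cycles modulo boundaries serves both groups. Coordinates with respect to \<open>B\<close>
  identify homology with the free group on \<open>B\<close>. Evaluation at the elements of \<open>B\<close> does the same for
  cohomology: it is onto because coordinates extend from cycles to all chains along a
  retraction, and its kernel consists of the cochains that vanish on all cycles, that is, of the
  coboundaries.\<close>
theorem torsion_free_homology:
  assumes tf: "\<And>q. pure_in (boundaries K q) (cycles K q)"
  shows "free_abelian (simplicial_homology q K)"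
    and "simplicial_homology q K \<cong> simplicial_cohomology q K"
proof -
  interpret Q: quotient_pair "boundaries K q" "cycles K q"
    by (rule quotient_pair_homology)
  obtain B where B: "basis_mod (boundaries K q) (cycles K q) B"
    using pure_subgroup_basis[OF finite_simplices add_subgroup_cycles cycles_subset
        add_subgroup_boundaries boundaries_subset_cycles tf] by blast
  then have finB: "finite B" and BZ: "B \<subseteq> cycles K q"
    by (auto simp: basis_mod_def)
  show "free_abelian (simplicial_homology q K)"
    unfolding homology_eq using B by (rule Q.quotient_free_abelian)
  obtain \<kappa> where \<kappa>: "\<And>x. x \<in> cycles K q \<Longrightarrow> x - lincomb (\<kappa> x) B \<in> boundaries K q"
    and uniq: "\<And>x a b. x - lincomb a B \<in> boundaries K q \<Longrightarrow> x \<in> cycles K q \<Longrightarrow> b \<in> B \<Longrightarrow> \<kappa> x b = a b"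
    and add: "\<And>b. b \<in> B \<Longrightarrow> additive_on (cycles K q) (\<lambda>x. \<kappa> x b)"
    using basis_mod_coordinates[OF add_subgroup_boundaries add_subgroup_cycles B] by blast
  let ?C = "frags (simplices K (Suc q))"
  obtain \<rho> where \<rho>: "additive_on ?C \<rho>" "\<And>x. x \<in> ?C \<Longrightarrow> \<rho> x \<in> cycles K q" "\<And>x. x \<in> cycles K q \<Longrightarrow> \<rho> x = x"
    using pure_subgroup_retraction[OF finite_simplices add_subgroup_frags order_refl
        add_subgroup_cycles cycles_subset cycles_pure] by blast
  have "cocycle_group K q Mod coboundaries K q \<cong> free_Abelian_group B \<and>
      Group.group (cocycle_group K q Mod coboundaries K q)"
  proof (rule coordinate_hom_iso[where h = "\<lambda>b \<phi>. \<phi> b"])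
    show "(\<lambda>\<phi>. \<phi> b) \<in> hom (cocycle_group K q) integer_group" if "b \<in> B" for b
      using that BZ cycles_subset[of q] by (auto simp: hom_def cocycle_group_mult)
    show "\<exists>\<phi>\<in>carrier (cocycle_group K q). \<forall>b\<in>B. \<phi> b = Poly_Mapping.lookup y b" for y
    proof (intro bexI ballI)
      let ?\<phi> = "\<lambda>c\<in>?C. \<Sum>b\<in>B. Poly_Mapping.lookup y b * \<kappa> (\<rho> c) b"
      have \<kappa>0: "\<kappa> z b = 0" if "z \<in> boundaries K q" "b \<in> B" for z b
        using that uniq[of z "\<lambda>_. 0"] boundaries_subset_cycles[of q] by (auto simp: lincomb_def)
      have "\<kappa> (\<rho> (x - y)) b = \<kappa> (\<rho> x) b - \<kappa> (\<rho> y) b" if "x \<in> ?C" "y \<in> ?C" "b \<in> B" for x y b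
        using add[OF that(3)] \<rho>(1) \<rho>(2)[OF that(1)] \<rho>(2)[OF that(2)] that(1,2) unfolding additive_on_def by metis
      then have "additive_on ?C (\<lambda>c. \<Sum>b\<in>B. Poly_Mapping.lookup y b * \<kappa> (\<rho> c) b)"
        by (simp add: additive_on_def right_diff_distrib sum_subtractf)
      then have "additive_on ?C ?\<phi>"
        by (rule additive_on_restrict[rotated]) simp
      moreover have "?\<phi> c = 0" if "c \<in> boundaries K q" for c
      proof -
        have "\<rho> c = c" "c \<in> ?C"
          using that \<rho>(3) boundaries_subset_cycles[of q] cycles_subset[of q] by auto
        then show ?thesis
          using \<kappa>0[OF that] by simp
      qed
      ultimately show "?\<phi> \<in> carrier (cocycle_group K q)"
        by (simp add: cocycle_group_carrier)
      fix b assume b: "b \<in> B"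
      have "\<kappa> b b' = (if b' = b then 1 else 0)" if "b' \<in> B" for b'
      proof (rule uniq)
        have "lincomb (\<lambda>b'. if b' = b then 1 else 0) B = (\<Sum>b'\<in>B. if b' = b then b' else 0)"
          unfolding lincomb_def by (intro sum.cong) auto
        then show "b - lincomb (\<lambda>b'. if b' = b then 1 else 0) B \<in> boundaries K q"
          using b finB add_subgroup_0[OF add_subgroup_boundaries] by simp
      qed (use b that BZ in auto)
      then have "(\<Sum>b'\<in>B. Poly_Mapping.lookup y b' * \<kappa> b b') = (\<Sum>b'\<in>B. if b' = b then Poly_Mapping.lookup y b' else 0)"
        by (intro sum.cong) auto
      moreover have "b \<in> ?C" "\<rho> b = b"
        using b BZ cycles_subset[of q] \<rho>(3) by auto
      ultimately show "?\<phi> b = Poly_Mapping.lookup y b"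
        using finB b by simp
    qed
    show "coboundaries K q = {\<phi> \<in> carrier (cocycle_group K q). \<forall>b\<in>B. \<phi> b = 0}"
      unfolding coboundaries_eq[OF tf]
    proof (intro equalityI subsetI)
      fix \<phi> assume "\<phi> \<in> {\<phi> \<in> carrier (cocycle_group K q). \<forall>b\<in>B. \<phi> b = 0}"
      then have \<phi>: "\<phi> \<in> carrier (cocycle_group K q)" "\<And>b. b \<in> B \<Longrightarrow> \<phi> b = 0"
        by auto
      then have ad: "additive_on ?C \<phi>" and b0: "\<And>b. b \<in> boundaries K q \<Longrightarrow> \<phi> b = 0"
        by (auto simp: cocycle_group_carrier)
      have "\<phi> z = 0" if z: "z \<in> cycles K q" for z
      proof -
        have BC: "B \<subseteq> ?C" and zC: "z \<in> ?C"
          using BZ z cycles_subset[of q] by auto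
        have "\<phi> (lincomb (\<kappa> z) B) = (\<Sum>b\<in>B. \<phi> (frag_cmul (\<kappa> z b) b))"
          unfolding lincomb_def using BC
          by (intro additive_on_sum[OF ad]) (auto intro: add_subgroup_cmul)
        also have "\<dots> = (\<Sum>b\<in>B. \<kappa> z b * \<phi> b)"
          using BC by (intro sum.cong refl additive_on_cmul[OF ad]) auto
        finally have "\<phi> (lincomb (\<kappa> z) B) = 0"
          using \<phi>(2) by simp
        moreover have "\<phi> (z - lincomb (\<kappa> z) B) = \<phi> z - \<phi> (lincomb (\<kappa> z) B)"
          using ad zC add_subgroup_lincomb[OF add_subgroup_frags BC] by (auto simp: additive_on_def)
        moreover have "\<phi> (z - lincomb (\<kappa> z) B) = 0"
          by (rule b0[OF \<kappa>[OF z]])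
        ultimately show ?thesis
          by simp
      qed
      then show "\<phi> \<in> {\<phi> \<in> carrier (cocycle_group K q). \<forall>z\<in>cycles K q. \<phi> z = 0}"
        using \<phi>(1) by simp
    qed (use BZ in auto)
  qed (rule comm_group_cocycle finB)+
  moreover have "frag_group (cycles K q) Mod boundaries K q \<cong> free_Abelian_group B"
    by (rule Q.quotient_iso_free[OF B])
  ultimately show "simplicial_homology q K \<cong> simplicial_cohomology q K"
    unfolding homology_eq simplicial_cohomology_def
    using iso_trans group.iso_sym by blast
qed

end

section \<open>Deleting a vertex of a complex\<close>

text \<open>For chains on simplices with \<open>m\<close> vertices, so this concerns reduced homology in degree
  \<open>m - 1\<close>.\<close>
definition acyclic_at :: "'v set set \<Rightarrow> nat \<Rightarrow> bool"
  where "acyclic_at K m \<longleftrightarrow> (\<forall>z\<in>frags (simplices K m). bd z = 0 \<longrightarrow> z \<in> bd ` frags (simplices K (Suc m)))"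

text \<open>The index counts vertices again: this is about homology in degree \<open>m - 1\<close>.\<close>
definition torsion_free_at :: "'v set set \<Rightarrow> nat \<Rightarrow> bool"
  where "torsion_free_at K m \<longleftrightarrow> (\<forall>z\<in>frags (simplices K m). \<forall>k. k \<noteq> 0 \<longrightarrow>
    frag_cmul k z \<in> bd ` frags (simplices K (Suc m)) \<longrightarrow> z \<in> bd ` frags (simplices K (Suc m)))"

definition link_of :: "'v set set \<Rightarrow> 'v \<Rightarrow> 'v set set"
  where "link_of K v = {t. v \<notin> t \<and> insert v t \<in> K}"

definition deletion :: "'v set set \<Rightarrow> 'v \<Rightarrow> 'v set set"
  where "deletion K v = {s \<in> K. v \<notin> s}"

text \<open>Adds the vertex \<open>v\<close> to every simplex, with the sign that makes \<open>v\<close> the first one.\<close>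
definition cone :: "'v \<Rightarrow> ('v set \<Rightarrow>\<^sub>0 int) \<Rightarrow> ('v set \<Rightarrow>\<^sub>0 int)"
  where "cone v = frag_extend (\<lambda>t. frag_cmul (face_sign t v) (frag_of (insert v t)))"

lemma cone_0 [simp]: "cone v 0 = 0" and cone_add: "cone v (a + b) = cone v a + cone v b"
  and cone_diff: "cone v (a - b) = cone v a - cone v b"
  and cone_cmul: "cone v (frag_cmul m a) = frag_cmul m (cone v a)"
  by (simp_all add: cone_def frag_extend_add frag_extend_diff frag_extend_cmul)

lemma cone_sum: "cone v (sum f A) = (\<Sum>x\<in>A. cone v (f x))"
  by (induction A rule: infinite_finite_induct) (auto simp: cone_add)

lemma cone_of: "cone v (frag_of t) = frag_cmul (face_sign t v) (frag_of (insert v t))"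
  by (simp add: cone_def)

text \<open>Either \<open>v\<close> is dropped, which gives back the simplex, or one of the other vertices is.\<close>
lemma bd_cone_of:
  assumes t: "finite t" "v \<notin> t"
  shows "bd (cone v (frag_of t)) = frag_of t - cone v (bd (frag_of t))"
proof -
  have 1: "face_sign (insert v t) v = face_sign t v"
    using t by (simp add: face_sign_insert)
  have 2: "face_sign t v * face_sign (insert v t) u = - (face_sign t u * face_sign (t - {u}) v)" if "u \<in> t" for u
  proof -
    have "face_sign t v = before_sign u v * face_sign (t - {u}) v"
      using t that by (simp add: face_sign_remove)
    moreover have "face_sign (insert v t) u = before_sign v u * face_sign t u"
      using t by (simp add: face_sign_insert)
    moreover have "before_sign u v = - before_sign v u"
      using that t by (intro before_sign_antisym) auto
    ultimately show ?thesis
      by (simp add: mult_ac)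
  qed
  have "bd (cone v (frag_of t)) = frag_of t
      + (\<Sum>u\<in>t. frag_cmul (face_sign t v * face_sign (insert v t) u) (frag_of (insert v t - {u})))"
    using t by (simp add: cone_of bd_cmul bd_of frag_cmul_distrib2 frag_cmul_sum 1)
  also have "(\<Sum>u\<in>t. frag_cmul (face_sign t v * face_sign (insert v t) u) (frag_of (insert v t - {u})))
      = (\<Sum>u\<in>t. - frag_cmul (face_sign t u * face_sign (t - {u}) v) (frag_of (insert v (t - {u}))))"
  proof (rule sum.cong)
    fix u assume u: "u \<in> t"
    then have "insert v t - {u} = insert v (t - {u})"
      using t by auto
    then show "frag_cmul (face_sign t v * face_sign (insert v t) u) (frag_of (insert v t - {u}))
        = - frag_cmul (face_sign t u * face_sign (t - {u}) v) (frag_of (insert v (t - {u})))"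
      by (simp only: 2[OF u] minus_frag_cmul)
  qed simp
  also have "\<dots> = - cone v (bd (frag_of t))"
    by (simp add: bd_of cone_sum cone_cmul cone_of sum_negf del: minus_frag_cmul)
  finally show ?thesis
    by simp
qed

lemma bd_cone:
  assumes "\<And>t. t \<in> Poly_Mapping.keys c \<Longrightarrow> finite t \<and> v \<notin> t"
  shows "bd (cone v c) = c - cone v (bd c)"
  by (rule frag_linear_ext[where F = "\<lambda>c. bd (cone v c)" and G = "\<lambda>c. c - cone v (bd c)"])
     (auto simp: bd_cone_of assms bd_diff cone_diff)

lemma frag_extend_frags:
  assumes "c \<in> frags F" "\<And>s. s \<in> F \<Longrightarrow> f s \<in> frags G"
  shows "frag_extend f c \<in> frags G"
  unfolding frag_extend_def using assms
  by (intro add_subgroup_sum add_subgroup_cmul add_subgroup_frags) (auto simp: frags_def)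

lemma frags_mono: "F \<subseteq> G \<Longrightarrow> c \<in> frags F \<Longrightarrow> c \<in> frags G"
  by (auto simp: frags_def)

lemma frag_split:
  fixes c :: "'a \<Rightarrow>\<^sub>0 int"
  obtains a b where "c = a + b" "a \<in> frags {s. P s}" "b \<in> frags {s. \<not> P s}"
    "Poly_Mapping.keys a \<subseteq> Poly_Mapping.keys c" "Poly_Mapping.keys b \<subseteq> Poly_Mapping.keys c"
proof -
  define a where "a = frag_extend (\<lambda>s. if P s then frag_of s else 0) c"
  define b where "b = frag_extend (\<lambda>s. if P s then 0 else frag_of s) c"
  have ck: "c \<in> frags (Poly_Mapping.keys c)"
    by (simp add: frags_def)
  have "c = a + b"
    unfolding a_def b_def
    by (rule frag_linear_ext[where F = "\<lambda>c. c" and G = "\<lambda>c. frag_extend (\<lambda>s. if P s then frag_of s else 0) c + frag_extend (\<lambda>s. if P s then 0 else frag_of s) c"])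
       (auto simp: frag_extend_diff)
  moreover have "a \<in> frags (Poly_Mapping.keys c \<inter> {s. P s})"
    unfolding a_def by (rule frag_extend_frags[OF ck]) (auto simp: frags_def)
  moreover have "b \<in> frags (Poly_Mapping.keys c \<inter> {s. \<not> P s})"
    unfolding b_def by (rule frag_extend_frags[OF ck]) (auto simp: frags_def)
  ultimately show thesis
    using that[of a b] by (auto simp: frags_def)
qed

lemma cone_in: "c \<in> frags (simplices (link_of K v) m) \<Longrightarrow> (\<And>t. t \<in> K \<Longrightarrow> finite t) \<Longrightarrow> cone v c \<in> frags (simplices K (Suc m))"
  unfolding cone_def
proof (rule frag_extend_frags, assumption)
  fix t assume "\<And>t. t \<in> K \<Longrightarrow> finite t" "t \<in> simplices (link_of K v) m"
  moreover from this have "finite t"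
    by (metis (no_types, lifting) finite_insert link_of_def mem_Collect_eq simplices_def)
  ultimately have "insert v t \<in> simplices K (Suc m)"
    by (auto simp: simplices_def link_of_def)
  then show "frag_cmul (face_sign t v) (frag_of (insert v t)) \<in> frags (simplices K (Suc m))"
    by (intro add_subgroup_cmul add_subgroup_frags) (simp add: frags_def)
qed

text \<open>Families that are closed under passing to all subsets, the empty one included. Links of
  vertices are of this kind, and with the empty simplex present the homology is the reduced one.\<close>
locale down_closed =
  fixes K :: "'v set set"
  assumes fin: "s \<in> K \<Longrightarrow> finite s" and sub: "s \<in> K \<Longrightarrow> t \<subseteq> s \<Longrightarrow> t \<in> K"
begin

lemma down_closed_link: "down_closed (link_of K v)"
proof
  fix s t assume s: "s \<in> link_of K v"
  then show "finite s"
    using fin by (force simp: link_of_def)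
  assume "t \<subseteq> s"
  then show "t \<in> link_of K v"
    using s sub[of "insert v s" "insert v t"] by (auto simp: link_of_def)
qed

lemma down_closed_deletion: "down_closed (deletion K v)"
proof
  fix s t assume s: "s \<in> deletion K v"
  then show "finite s"
    using fin by (simp add: deletion_def)
  assume "t \<subseteq> s"
  then show "t \<in> deletion K v"
    using s sub[of s t] by (auto simp: deletion_def)
qed

lemma chain_finite: "c \<in> frags (simplices K m) \<Longrightarrow> s \<in> Poly_Mapping.keys c \<Longrightarrow> finite s"
  unfolding frags_def simplices_def by (blast intro: fin)

lemma bd_in: "c \<in> frags (simplices K (Suc m)) \<Longrightarrow> bd c \<in> frags (simplices K m)"
  unfolding bd_def
proof (rule frag_extend_frags, assumption)
  fix s assume "s \<in> simplices K (Suc m)"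
  then have s: "s \<in> K" "card s = Suc m" "finite s"
    using fin by (auto simp: simplices_def)
  have "s - {v} \<in> simplices K m" if "v \<in> s" for v
    using s that sub[of s "s - {v}"] by (auto simp: simplices_def)
  then show "(\<Sum>v\<in>s. frag_cmul (face_sign s v) (frag_of (s - {v}))) \<in> frags (simplices K m)"
    by (intro add_subgroup_sum add_subgroup_cmul add_subgroup_frags) (simp add: frags_def)
qed

lemma bd_in0: "c \<in> frags (simplices K 0) \<Longrightarrow> bd c = 0"
  unfolding bd_def
proof (rule frag_extend_eq_0)
  fix s assume "c \<in> frags (simplices K 0)" "s \<in> Poly_Mapping.keys c"
  then have "s = {}"
    using chain_finite[of c 0 s] by (auto simp: frags_def simplices_def)
  then show "(\<Sum>v\<in>s. frag_cmul (face_sign s v) (frag_of (s - {v}))) = 0"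
    by simp
qed

lemma link_chain_cone:
  assumes "c \<in> frags (simplices (link_of K v) m)"
  shows "bd (cone v c) = c - cone v (bd c)"
proof (rule bd_cone)
  fix t assume "t \<in> Poly_Mapping.keys c"
  then have "t \<in> link_of K v"
    using assms by (auto simp: frags_def simplices_def)
  then show "finite t \<and> v \<notin> t"
    using down_closed.fin[OF down_closed_link] by (auto simp: link_of_def)
qed

text \<open>The simplices that contain \<open>v\<close> form a cone over the link.\<close>
lemma split_at_vertex:
  assumes "c \<in> frags (simplices K (Suc m))"
  obtains d e where "c = d + cone v e" "d \<in> frags (simplices (deletion K v) (Suc m))"
    "e \<in> frags (simplices (link_of K v) m)"
proof -
  obtain d b where db: "c = d + b" "d \<in> frags {s. v \<notin> s}" "b \<in> frags {s. \<not> v \<notin> s}"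
    "Poly_Mapping.keys d \<subseteq> Poly_Mapping.keys c" "Poly_Mapping.keys b \<subseteq> Poly_Mapping.keys c"
    using frag_split[of c "\<lambda>s. v \<notin> s"] by metis
  have d: "d \<in> frags (simplices (deletion K v) (Suc m))"
    using assms db by (auto simp: frags_def simplices_def deletion_def)
  have b: "b \<in> frags {s \<in> simplices K (Suc m). v \<in> s}"
    using assms db by (auto simp: frags_def)
  define e where "e = frag_extend (\<lambda>s. frag_cmul (face_sign (s - {v}) v) (frag_of (s - {v}))) b"
  have e: "e \<in> frags (simplices (link_of K v) m)"
    unfolding e_def using b
  proof (rule frag_extend_frags)
    fix s assume s: "s \<in> {s \<in> simplices K (Suc m). v \<in> s}"
    then have "finite s"
      using fin by (auto simp: simplices_def)
    then have "s - {v} \<in> simplices (link_of K v) m"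
      using s by (auto simp: simplices_def link_of_def insert_absorb)
    then show "frag_cmul (face_sign (s - {v}) v) (frag_of (s - {v})) \<in> frags (simplices (link_of K v) m)"
      by (intro add_subgroup_cmul add_subgroup_frags) (simp add: frags_def)
  qed
  have "cone v e = b"
    unfolding e_def
  proof (rule frag_linear_ext[where F = "\<lambda>b. cone v (frag_extend (\<lambda>s. frag_cmul (face_sign (s - {v}) v) (frag_of (s - {v}))) b)" and G = "\<lambda>b. b"])
    fix s assume "s \<in> Poly_Mapping.keys b"
    then have "v \<in> s"
      using b by (auto simp: frags_def)
    then show "cone v (frag_extend (\<lambda>s. frag_cmul (face_sign (s - {v}) v) (frag_of (s - {v}))) (frag_of s)) = frag_of s"
      by (simp add: cone_cmul cone_of insert_absorb)
  qed (simp_all add: frag_extend_diff cone_diff)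
  then show thesis
    using that[of d e] db d e by simp
qed

lemma cone_inject:
  assumes "d + cone v e = 0" "d \<in> frags (simplices (deletion K v) i)" "e \<in> frags (simplices (link_of K v) j)"
  shows "d = 0" "e = 0"
proof -
  let ?r = "frag_extend (\<lambda>s. if v \<in> s then frag_cmul (face_sign (s - {v}) v) (frag_of (s - {v})) else 0)"
  have "?r d = 0"
    using assms(2) by (intro frag_extend_eq_0) (auto simp: frags_def simplices_def deletion_def)
  moreover have "?r (cone v e) = e"
  proof (rule frag_linear_ext[where F = "\<lambda>e. ?r (cone v e)" and G = "\<lambda>e. e"])
    fix s assume "s \<in> Poly_Mapping.keys e"
    then have "v \<notin> s"
      using assms(3) by (auto simp: frags_def simplices_def link_of_def)
    then show "?r (cone v (frag_of s)) = frag_of s"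
      by (simp add: cone_of frag_extend_cmul)
  qed (simp_all add: frag_extend_diff cone_diff)
  moreover have "?r (d + cone v e) = ?r d + ?r (cone v e)"
    by (rule frag_extend_add)
  ultimately show "e = 0"
    using assms(1) by simp
  then show "d = 0"
    using assms(1) by simp
qed

lemma deletion_chain: "c \<in> frags (simplices (deletion K v) m) \<Longrightarrow> c \<in> frags (simplices K m)"
  by (erule frags_mono[rotated]) (auto simp: simplices_def deletion_def)

lemma link_chain: "c \<in> frags (simplices (link_of K v) m) \<Longrightarrow> c \<in> frags (simplices (deletion K v) m)"
proof (erule frags_mono[rotated], rule subsetI)
  fix t assume "t \<in> simplices (link_of K v) m"
  then show "t \<in> simplices (deletion K v) m"
    using sub[of "insert v t" t] by (auto simp: simplices_def deletion_def link_of_def)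
qed

lemma bd_split:
  assumes "d \<in> frags (simplices (deletion K v) (Suc m))" "e \<in> frags (simplices (link_of K v) m)"
    and x: "x \<in> frags (simplices (deletion K v) m)"
    and eq: "bd (d + cone v e) = x"
  shows "bd e = 0" "bd d + e = x"
proof -
  interpret L: down_closed "link_of K v"
    by (rule down_closed_link)
  interpret D: down_closed "deletion K v"
    by (rule down_closed_deletion)
  have be: "\<exists>j. bd e \<in> frags (simplices (link_of K v) j)"
  proof (cases m)
    case 0
    then have "bd e = 0"
      using assms(2) L.bd_in0 by simp
    then show ?thesis
      by (simp add: add_subgroup_0)
  next
    case (Suc j)
    then show ?thesis
      using L.bd_in[of e j] assms(2) by blast
  qed
  then obtain j where j: "- bd e \<in> frags (simplices (link_of K v) j)"
    using add_subgroup_minus[OF add_subgroup_frags] by blast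
  have "bd (d + cone v e) = bd d + e - cone v (bd e)"
    using link_chain_cone[OF assms(2)] by (simp add: bd_add)
  then have eq': "(bd d + e - x) + cone v (- bd e) = 0"
    using eq cone_diff[of v 0 "bd e"] by (simp add: algebra_simps)
  have "bd d + e - x \<in> frags (simplices (deletion K v) m)"
    by (intro add_subgroup_diff add_subgroup_add add_subgroup_frags D.bd_in assms x link_chain)
  from cone_inject[OF eq' this j] show "bd e = 0" "bd d + e = x"
    by auto
qed

text \<open>One step of the Mayer-Vietoris sequence for the deletion of \<open>v\<close> and the star of \<open>v\<close>, which
  meet in the link. Write a cycle as \<open>d + cone v e\<close>. Then \<open>e\<close> is a cycle of the link and bounds some
  \<open>w\<close> there; subtracting the boundary of \<open>- cone v w\<close> moves the cycle into the deletion.\<close>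
theorem acyclic_vertex_step:
  assumes link: "acyclic_at (link_of K v) m" and del: "acyclic_at (deletion K v) (Suc m)"
  shows "acyclic_at K (Suc m)"
  unfolding acyclic_at_def
proof (intro ballI impI)
  interpret D: down_closed "deletion K v"
    by (rule down_closed_deletion)
  fix z assume z: "z \<in> frags (simplices K (Suc m))" "bd z = 0"
  then obtain d e where de: "z = d + cone v e" "d \<in> frags (simplices (deletion K v) (Suc m))"
    "e \<in> frags (simplices (link_of K v) m)"
    using split_at_vertex by metis
  have be: "bd e = 0" and bde: "bd d + e = 0"
    using bd_split[OF de(2,3), of 0] z de(1) by (simp_all add: add_subgroup_0)
  then have "e \<in> bd ` frags (simplices (link_of K v) (Suc m))"
    using link de(3) unfolding acyclic_at_def by blast
  then obtain w where w: "w \<in> frags (simplices (link_of K v) (Suc m))" "bd w = e"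
    by auto
  have cw: "bd (cone v w) = w - cone v e"
    using link_chain_cone[OF w(1)] w(2) by simp
  have dw: "d + w \<in> frags (simplices (deletion K v) (Suc m))"
    by (intro add_subgroup_add add_subgroup_frags de link_chain w)
  moreover have "bd (d + w) = 0"
    using bde w(2) by (simp add: bd_add)
  ultimately have "d + w \<in> bd ` frags (simplices (deletion K v) (Suc (Suc m)))"
    using del unfolding acyclic_at_def by blast
  then obtain y where y: "y \<in> frags (simplices (deletion K v) (Suc (Suc m)))" "bd y = d + w"
    by auto
  have "bd (y - cone v w) = z"
    using y(2) cw de(1) by (simp add: bd_diff)
  moreover have "y - cone v w \<in> frags (simplices K (Suc (Suc m)))"
    by (rule add_subgroup_diff[OF add_subgroup_frags deletion_chain[OF y(1)] cone_in[OF w(1) fin]])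
  ultimately show "z \<in> bd ` frags (simplices K (Suc (Suc m)))"
    by blast
qed

text \<open>The same step for torsion. If a multiple of \<open>d + cone v e\<close> bounds, then the same multiple of \<open>e\<close>
  bounds in the link, hence so does \<open>e\<close>, and the cycle can be moved into the deletion as
  before. Acyclicity of the link one degree higher allows the chain that bounds the multiple
  to be moved into the deletion as well.\<close>
theorem torsion_free_vertex_step:
  assumes linkt: "torsion_free_at (link_of K v) m" and linka: "acyclic_at (link_of K v) (Suc m)"
    and del: "torsion_free_at (deletion K v) (Suc m)"
  shows "torsion_free_at K (Suc m)"
  unfolding torsion_free_at_def
proof (intro ballI allI impI)
  interpret D: down_closed "deletion K v"
    by (rule down_closed_deletion)
  interpret L: down_closed "link_of K v"
    by (rule down_closed_link)
  fix z and k :: int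
  assume z: "z \<in> frags (simplices K (Suc m))" and k: "k \<noteq> 0"
    and "frag_cmul k z \<in> bd ` frags (simplices K (Suc (Suc m)))"
  then obtain c where c: "c \<in> frags (simplices K (Suc (Suc m)))" "bd c = frag_cmul k z"
    by auto
  obtain d e where de: "z = d + cone v e" "d \<in> frags (simplices (deletion K v) (Suc m))"
    "e \<in> frags (simplices (link_of K v) m)"
    using split_at_vertex[OF z] by metis
  obtain f g where fg: "c = f + cone v g" "f \<in> frags (simplices (deletion K v) (Suc (Suc m)))"
    "g \<in> frags (simplices (link_of K v) (Suc m))"
    using split_at_vertex[OF c(1)] by metis
  have "bd c = bd f + g - cone v (bd g)"
    using link_chain_cone[OF fg(3)] fg(1) by (simp add: bd_add)
  then have eq: "(bd f + g - frag_cmul k d) + cone v (- bd g - frag_cmul k e) = 0"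
    using c(2) de(1) cone_diff[of v 0 "bd g"]
    by (simp add: frag_cmul_distrib2 cone_diff cone_cmul algebra_simps)
  have "bd f + g - frag_cmul k d \<in> frags (simplices (deletion K v) (Suc m))"
    by (intro add_subgroup_diff add_subgroup_add add_subgroup_frags D.bd_in fg link_chain add_subgroup_cmul de)
  moreover have "- bd g - frag_cmul k e \<in> frags (simplices (link_of K v) m)"
    by (intro add_subgroup_diff add_subgroup_minus add_subgroup_frags L.bd_in fg add_subgroup_cmul de)
  ultimately have g: "- bd g - frag_cmul k e = 0"
    using cone_inject(2)[OF eq] by blast
  then have "frag_cmul k e = bd (- g)"
    by (simp add: bd_minus)
  moreover have "- g \<in> frags (simplices (link_of K v) (Suc m))"
    by (intro add_subgroup_minus add_subgroup_frags fg)
  ultimately have "e \<in> bd ` frags (simplices (link_of K v) (Suc m))"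
    using linkt de(3) k unfolding torsion_free_at_def by blast
  then obtain w where w: "w \<in> frags (simplices (link_of K v) (Suc m))" "bd w = e"
    by auto
  have cw: "bd (cone v w) = w - cone v e"
    using link_chain_cone[OF w(1)] w(2) by simp
  have gw: "g + frag_cmul k w \<in> frags (simplices (link_of K v) (Suc m))"
    by (intro add_subgroup_add add_subgroup_frags add_subgroup_cmul fg w)
  have "frag_cmul k e = - bd g"
    using g by simp
  then have "bd (g + frag_cmul k w) = 0"
    by (simp add: bd_add bd_cmul w(2))
  then have "g + frag_cmul k w \<in> bd ` frags (simplices (link_of K v) (Suc (Suc m)))"
    using linka gw unfolding acyclic_at_def by blast
  then obtain u where u: "u \<in> frags (simplices (link_of K v) (Suc (Suc m)))" "bd u = g + frag_cmul k w"
    by auto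
  have cu: "bd (cone v u) = u - cone v (g + frag_cmul k w)"
    using link_chain_cone[OF u(1)] u(2) by simp
  have "bd (f + u) = frag_cmul k (d + w)"
  proof -
    have "bd (f + u) = bd f + (g + frag_cmul k w)"
      using u(2) by (simp add: bd_add)
    moreover have "bd f + g - frag_cmul k d = 0"
      using eq g by simp
    ultimately show ?thesis
      by (simp add: frag_cmul_distrib2 algebra_simps)
  qed
  moreover have "f + u \<in> frags (simplices (deletion K v) (Suc (Suc m)))"
    by (intro add_subgroup_add add_subgroup_frags fg link_chain u)
  moreover have "d + w \<in> frags (simplices (deletion K v) (Suc m))"
    by (intro add_subgroup_add add_subgroup_frags de link_chain w)
  ultimately have "d + w \<in> bd ` frags (simplices (deletion K v) (Suc (Suc m)))"
    using del k unfolding torsion_free_at_def by (metis imageI)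
  then obtain y where y: "y \<in> frags (simplices (deletion K v) (Suc (Suc m)))" "bd y = d + w"
    by auto
  have "bd (y - cone v w) = z"
    using y(2) cw de(1) by (simp add: bd_diff)
  moreover have "y - cone v w \<in> frags (simplices K (Suc (Suc m)))"
    by (rule add_subgroup_diff[OF add_subgroup_frags deletion_chain[OF y(1)] cone_in[OF w(1) fin]])
  ultimately show "z \<in> bd ` frags (simplices K (Suc (Suc m)))"
    by blast
qed

lemma acyclic_imp_torsion_free:
  assumes "acyclic_at K m" shows "torsion_free_at K m"
  unfolding torsion_free_at_def
proof (intro ballI allI impI)
  fix z and k :: int assume z: "z \<in> frags (simplices K m)" "k \<noteq> 0" "frag_cmul k z \<in> bd ` frags (simplices K (Suc m))"
  then have "bd (frag_cmul k z) = 0"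
    by auto
  then have "bd z = 0"
    using z(2) by (simp add: bd_cmul)
  then show "z \<in> bd ` frags (simplices K (Suc m))"
    using assms z(1) by (auto simp: acyclic_at_def)
qed

end

text \<open>A full simplex is a cone over any of its vertices.\<close>
lemma acyclic_full_simplex:
  assumes "finite P" "0 < m"
  shows "acyclic_at (Pow P) m"
proof (cases "P = {}")
  case True
  have "z = 0" if "z \<in> frags (simplices (Pow P) m)" for z
  proof -
    have "simplices (Pow P) m = {}"
      using True assms by (auto simp: simplices_def)
    then show ?thesis
      using that by (simp add: frags_def)
  qed
  then show ?thesis
    unfolding acyclic_at_def by (metis add_subgroup_0 add_subgroup_frags bd_0 image_eqI)
next
  case False
  then obtain p where p: "p \<in> P"
    by blast
  have "down_closed (Pow P)"
  proof
    show "finite s" if "s \<in> Pow P" for s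
      using that assms(1) by (metis PowD finite_subset)
  qed auto
  then interpret P: down_closed "Pow P" .
  from gr0_implies_Suc[OF assms(2)] obtain m' where m: "m = Suc m'"
    by blast
  show ?thesis
    unfolding acyclic_at_def
  proof (intro ballI impI)
    fix z assume z: "z \<in> frags (simplices (Pow P) m)" "bd z = 0"
    have z': "z \<in> frags (simplices (Pow P) (Suc m'))"
      using z(1) m by simp
    obtain d e where de: "z = d + cone p e" "d \<in> frags (simplices (deletion (Pow P) p) (Suc m'))"
      "e \<in> frags (simplices (link_of (Pow P) p) m')"
      by (rule P.split_at_vertex[OF z'])
    have "bd d + e = 0"
      using P.bd_split(2)[OF de(2,3) add_subgroup_0[OF add_subgroup_frags]] z(2) de(1) by simp
    then have e: "e = - bd d"
      by (simp add: eq_neg_iff_add_eq_0 add.commute)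
    have dl: "d \<in> frags (simplices (link_of (Pow P) p) m)"
      using de(2)
    proof (rule frags_mono[rotated])
      show "simplices (deletion (Pow P) p) (Suc m') \<subseteq> simplices (link_of (Pow P) p) m"
        using p m by (auto simp: simplices_def deletion_def link_of_def)
    qed
    have "bd (cone p d) = z"
      using P.link_chain_cone[OF dl] de(1) cone_diff[of p 0 "bd d"] by (simp add: e)
    moreover have "cone p d \<in> frags (simplices (Pow P) (Suc m))"
      by (rule cone_in[OF dl]) (rule P.fin)
    ultimately show "z \<in> bd ` frags (simplices (Pow P) (Suc m))"
      by blast
  qed
qed

lemma acyclic_no_simplices: "simplices K m = {} \<Longrightarrow> acyclic_at K m"
  unfolding acyclic_at_def
proof (intro ballI impI)
  fix z assume "simplices K m = {}" "z \<in> frags (simplices K m)"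
  then have "z = bd 0"
    by (simp add: frags_def)
  then show "z \<in> bd ` frags (simplices K (Suc m))"
    using add_subgroup_0[OF add_subgroup_frags] by blast
qed

section \<open>Complexes on the integer grid of the plane\<close>

lemma bd_vertex: "bd (frag_of {v}) = frag_of {}"
  by (simp add: bd_of face_sign_def)

lemma cone_vertex: "cone v (frag_of {}) = frag_of {v}"
  by (simp add: cone_of face_sign_def)

lemma bd_edge: "u \<noteq> v \<Longrightarrow> bd (cone u (frag_of {v})) = frag_of {v} - frag_of {u}"
  by (simp add: bd_cone_of bd_vertex cone_vertex)

lemma add_subgroup_bd_image: "add_subgroup (bd ` frags S)"
  unfolding add_subgroup_def
proof (intro conjI ballI)
  show "0 \<in> bd ` frags S"
    by (rule image_eqI[of _ _ 0]) (simp_all add: add_subgroup_0)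
  fix x y assume "x \<in> bd ` frags S" "y \<in> bd ` frags S"
  then obtain a b where "x = bd a" "y = bd b" "a \<in> frags S" "b \<in> frags S"
    by auto
  then show "x - y \<in> bd ` frags S"
    by (intro image_eqI[of _ _ "a - b"]) (simp_all add: bd_diff add_subgroup_diff)
qed

text \<open>The endpoints of a path differ by the boundary of the sum of its edges.\<close>
lemma path_boundary:
  assumes "(u, v) \<in> {(x, y). x \<noteq> y \<and> {x, y} \<in> K}\<^sup>*"
  shows "frag_of {v} - frag_of {u} \<in> bd ` frags (simplices K 2)"
  using assms
proof (induction rule: rtrancl_induct)
  case base
  then show ?case
    using add_subgroup_0[OF add_subgroup_bd_image] by simp
next
  case (step v w)
  have "cone v (frag_of {w}) \<in> frags (simplices K 2)"
    unfolding cone_of using step.hyps(2)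
    by (intro add_subgroup_cmul add_subgroup_frags) (auto simp: frags_def simplices_def)
  then have "frag_of {w} - frag_of {v} \<in> bd ` frags (simplices K 2)"
    using step.hyps(2) bd_edge[of v w] by (intro image_eqI[of _ _ "cone v (frag_of {w})"]) auto
  from add_subgroup_add[OF add_subgroup_bd_image step.IH this] show ?case
    by simp
qed

text \<open>Sending every vertex to a chosen representative of its component kills boundaries and
  changes a chain by a boundary only. So a chain of vertices bounds iff its image vanishes,
  which is insensitive to nonzero factors.\<close>
theorem torsion_free_at_1: "torsion_free_at K 1"
proof -
  define R where "R = {(x, y). x \<noteq> y \<and> {x, y} \<in> K}"
  have symR: "sym (R\<^sup>*)"
    by (rule sym_rtrancl) (auto simp: R_def sym_def insert_commute)
  define rep where "rep v = (SOME u. (v, u) \<in> R\<^sup>*)" for v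
  have rep: "(v, rep v) \<in> R\<^sup>*" for v
    unfolding rep_def by (rule someI[of _ v]) simp
  have rep_eq: "rep u = rep v" if "(u, v) \<in> R" for u v
  proof -
    have "(u, w) \<in> R\<^sup>* \<longleftrightarrow> (v, w) \<in> R\<^sup>*" for w
      using that symR by (meson r_into_rtrancl rtrancl_trans symD)
    then show ?thesis
      by (simp add: rep_def)
  qed
  define f where "f = frag_extend (\<lambda>s. frag_of (rep ` s))"
  have f_bd: "f (bd c) = 0" if "c \<in> frags (simplices K 2)" for c
  proof (rule frag_linear_ext[where F = "\<lambda>c. f (bd c)" and G = "\<lambda>_. 0"])
    fix s assume "s \<in> Poly_Mapping.keys c"
    then have s: "s \<in> K" "card s = 2"
      using that by (auto simp: frags_def simplices_def)
    then obtain u v where uv: "s = {u, v}" "u \<noteq> v"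
      by (auto simp: card_2_iff)
    have "s - {u} = {v}" "s - {v} = {u}"
      using uv by auto
    moreover have "face_sign s u = before_sign v u" "face_sign s v = before_sign u v"
      using uv by (auto simp: face_sign_def)
    ultimately have "bd (frag_of s) = frag_cmul (before_sign v u) (frag_of {v}) + frag_cmul (before_sign u v) (frag_of {u})"
      using uv by (simp add: bd_of)
    moreover have "rep u = rep v"
      using uv s by (intro rep_eq) (simp add: R_def)
    ultimately show "f (bd (frag_of s)) = 0"
      using before_sign_antisym[OF uv(2)]
      by (simp add: f_def frag_extend_add frag_extend_cmul flip: frag_cmul_distrib)
  qed (simp_all add: f_def frag_extend_diff bd_diff)
  have z_f: "z - f z \<in> bd ` frags (simplices K 2)" if "z \<in> frags (simplices K 1)" for z
  proof -
    have "z = frag_extend frag_of z"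
      by (rule frag_expansion)
    then have "z - f z = frag_extend (\<lambda>s. frag_of s - frag_of (rep ` s)) z"
      unfolding f_def
      by (rule_tac frag_linear_ext[where F = "\<lambda>z. z - frag_extend (\<lambda>s. frag_of (rep ` s)) z" and G = "frag_extend (\<lambda>s. frag_of s - frag_of (rep ` s))"])
         (simp_all add: frag_extend_diff)
    also have "\<dots> \<in> bd ` frags (simplices K 2)"
      unfolding frag_extend_def
    proof (intro add_subgroup_sum add_subgroup_cmul add_subgroup_bd_image)
      fix s assume "s \<in> Poly_Mapping.keys z"
      then have "card s = 1"
        using that by (auto simp: frags_def simplices_def)
      then obtain v where v: "s = {v}"
        by (auto simp: card_1_singleton_iff)
      have "(rep v, v) \<in> R\<^sup>*"
        using rep symR by (blast dest: symD)
      then show "frag_of s - frag_of (rep ` s) \<in> bd ` frags (simplices K 2)"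
        using path_boundary[of "rep v" v K] by (simp add: v R_def)
    qed
    finally show ?thesis .
  qed
  show ?thesis
    unfolding torsion_free_at_def
  proof (intro ballI allI impI)
    fix z and k :: int
    assume z: "z \<in> frags (simplices K 1)" "k \<noteq> 0" "frag_cmul k z \<in> bd ` frags (simplices K (Suc 1))"
    then obtain c where c: "c \<in> frags (simplices K 2)" "frag_cmul k z = bd c"
      by (auto simp: numeral_2_eq_2)
    have "frag_cmul k (f z) = f (frag_cmul k z)"
      by (simp add: f_def frag_extend_cmul)
    also have "\<dots> = 0"
      unfolding c(2) by (rule f_bd[OF c(1)])
    finally have "f z = 0"
      using z(2) by simp
    then show "z \<in> bd ` frags (simplices K (Suc 1))"
      using z_f[OF z(1)] by (simp add: numeral_2_eq_2)
  qed
qed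

lemma acyclic_at_most_point:
  assumes "\<And>s. s \<in> M \<Longrightarrow> s \<subseteq> {a}" "0 < m" "down_closed M"
  shows "acyclic_at M m"
proof (cases "{a} \<in> M")
  case True
  then have "M = Pow {a}"
    using assms(1) down_closed.sub[OF assms(3) True] by auto
  then show ?thesis
    using acyclic_full_simplex[of "{a}" m] assms(2) by simp
next
  case False
  have "simplices M m = {}"
  proof -
    have "card s = 0" if "s \<in> M" for s
    proof -
      have "s = {}"
        using assms(1)[OF that] that False by (metis subset_singleton_iff)
      then show ?thesis
        by simp
    qed
    then show ?thesis
      using assms(2) by (auto simp: simplices_def)
  qed
  then show ?thesis
    by (rule acyclic_no_simplices)
qed

text \<open>Since \<open>r\<close> is joined to \<open>b\<close> only, a loop would have to run through \<open>l\<close>, \<open>c\<close> and \<open>b\<close>, and then the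
  triangle that they span is present.\<close>
lemma acyclic_link_shape:
  assumes L: "down_closed L" and sub: "\<And>s. s \<in> L \<Longrightarrow> s \<subseteq> {l, c, b, r}"
    and r: "\<And>s. s \<in> L \<Longrightarrow> r \<in> s \<Longrightarrow> s \<subseteq> {b, r}"
    and fill: "{l, c} \<in> L \<Longrightarrow> {c, b} \<in> L \<Longrightarrow> {l, c, b} \<in> L"
    and m: "2 \<le> m"
  shows "acyclic_at L m"
proof -
  obtain k where k: "m = Suc k" "0 < k"
    using m by (cases m) auto
  interpret L: down_closed L
    by (rule L)
  define L1 where "L1 = deletion L r"
  interpret L1: down_closed L1
    unfolding L1_def by (rule L.down_closed_deletion)
  define L2 where "L2 = deletion L1 c"
  interpret L2: down_closed L2
    unfolding L2_def by (rule L1.down_closed_deletion)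
  have "acyclic_at (link_of L r) k"
    by (rule acyclic_at_most_point[where a = b]) (use r k L.down_closed_link in \<open>force simp: link_of_def\<close>)+
  moreover have "acyclic_at L1 (Suc k)"
  proof (rule L1.acyclic_vertex_step)
    define M where "M = link_of L1 c"
    interpret M: down_closed M
      unfolding M_def by (rule L1.down_closed_link)
    define P where "P = {x. {x} \<in> M}"
    have P_sub: "P \<subseteq> {l, b}"
      using sub by (auto simp: P_def M_def L1_def link_of_def deletion_def)
    have M_Pow: "M \<subseteq> Pow P"
      using M.sub by (auto simp: P_def)
    have P_M: "P \<in> M" if "M \<noteq> {}"
    proof -
      consider "P = {}" | x where "P = {x}" | "P = {l, b}" "l \<noteq> b"
        using P_sub by blast
      then show ?thesis
      proof cases
        case 1
        then show ?thesis
          using that M.sub by blast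
      next
        case 2
        then show ?thesis
          by (auto simp: P_def)
      next
        case 3
        then have "{l} \<in> M" "{b} \<in> M"
          by (auto simp: P_def)
        then have *: "l \<noteq> c" "b \<noteq> c" "{c, l} \<in> L" "r \<notin> {c, l}" "{c, b} \<in> L" "r \<notin> {c, b}"
          by (auto simp: M_def link_of_def L1_def deletion_def)
        then have "{l, c, b} \<in> L"
          using fill by (simp add: insert_commute)
        then show ?thesis
          using * 3 by (auto simp: M_def link_of_def L1_def deletion_def insert_commute)
      qed
    qed
    have "M = {} \<or> M = Pow P"
      using P_M M_Pow M.sub by blast
    then show "acyclic_at (link_of L1 c) k"
    proof
      assume "M = {}"
      then show ?thesis
        unfolding M_def[symmetric] by (intro acyclic_no_simplices) (simp add: simplices_def)
    next
      assume "M = Pow P"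
      moreover have "finite P"
        using P_sub by (rule finite_subset) simp
      ultimately show ?thesis
        unfolding M_def[symmetric] using k(2) by (simp add: acyclic_full_simplex)
    qed
    have L2_sub: "s \<subseteq> {l, b}" if "s \<in> L2" for s
      using sub that by (auto simp: L2_def L1_def deletion_def)
    have "acyclic_at L2 (Suc k)"
    proof (rule L2.acyclic_vertex_step)
      show "acyclic_at (link_of L2 l) k"
        by (rule acyclic_at_most_point[where a = b]) (use L2_sub k L2.down_closed_link in \<open>force simp: link_of_def\<close>)+
      show "acyclic_at (deletion L2 l) (Suc k)"
        by (rule acyclic_at_most_point[where a = b]) (use L2_sub L2.down_closed_deletion in \<open>force simp: deletion_def\<close>)+
    qed
    then show "acyclic_at (deletion L1 c) (Suc k)"
      by (simp add: L2_def)
  qed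
  ultimately show ?thesis
    unfolding k(1) L1_def by (rule L.acyclic_vertex_step)
qed

text \<open>What the proof uses of the cells of a planar grid: \<open>(p, q)\<close> is the position of a
  cell, cells of a simplex are equal or neighbours, and (\<open>fill\<close>) two triangles that share the
  diagonal from \<open>v\<close> to its lower left neighbour \<open>c\<close> span a tetrahedron.\<close>
locale planar_complex = down_closed K for K :: "'v set set" +
  fixes p q :: "'v \<Rightarrow> int" and W :: "'v set"
  assumes finite_W: "finite W" and simplex_W: "s \<in> K \<Longrightarrow> s \<subseteq> W"
    and inj_pq: "u \<in> W \<Longrightarrow> v \<in> W \<Longrightarrow> p u = p v \<Longrightarrow> q u = q v \<Longrightarrow> u = v"
    and near: "s \<in> K \<Longrightarrow> u \<in> s \<Longrightarrow> v \<in> s \<Longrightarrow> \<bar>p u - p v\<bar> \<le> 1 \<and> \<bar>q u - q v\<bar> \<le> 1"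
    and fill: "{v, l, c} \<in> K \<Longrightarrow> {v, c, b} \<in> K \<Longrightarrow> p l = p v - 1 \<Longrightarrow> q l = q v \<Longrightarrow>
      p c = p v - 1 \<Longrightarrow> q c = q v - 1 \<Longrightarrow> p b = p v \<Longrightarrow> q b = q v - 1 \<Longrightarrow> {v, l, c, b} \<in> K"
begin

lemma planar_complex_deletion: "planar_complex (deletion K v) p q (W - {v})"
proof -
  interpret D: down_closed "deletion K v"
    by (rule down_closed_deletion)
  show ?thesis
  proof
    fix x l c b
    assume "{x, l, c} \<in> deletion K v" "{x, c, b} \<in> deletion K v" "p l = p x - 1" "q l = q x"
      "p c = p x - 1" "q c = q x - 1" "p b = p x" "q b = q x - 1"
    then show "{x, l, c, b} \<in> deletion K v"
      using fill[of x l c b] by (auto simp: deletion_def)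
  next
    fix s assume "s \<in> deletion K v"
    then show "s \<subseteq> W - {v}"
      using simplex_W[of s] by (auto simp: deletion_def)
  next
    fix s u w assume "s \<in> deletion K v" "u \<in> s" "w \<in> s"
    then show "\<bar>p u - p w\<bar> \<le> 1 \<and> \<bar>q u - q w\<bar> \<le> 1"
      using near[of s u w] by (auto simp: deletion_def)
  qed (use finite_W inj_pq in auto)
qed

text \<open>A neighbour of the last cell in reading order is its left, lower left, lower or lower
  right neighbour. The lower right one is near only to the lower one.\<close>
lemma acyclic_link_last:
  assumes v: "v \<in> W" and last: "\<And>u. u \<in> W \<Longrightarrow> q u < q v \<or> q u = q v \<and> p u \<le> p v" and m: "2 \<le> m"
  shows "acyclic_at (link_of K v) m"
proof -
  let ?L = "link_of K v"
  (* v itself is the default for positions without a vertex: it never lies in its own link *)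
  define vertex_at where "vertex_at i j = (if \<exists>u\<in>W. p u = i \<and> q u = j then THE u. u \<in> W \<and> p u = i \<and> q u = j else v)" for i j
  have at_pos: "vertex_at i j \<in> W \<and> p (vertex_at i j) = i \<and> q (vertex_at i j) = j" if "vertex_at i j \<noteq> v" for i j
  proof -
    have ex: "\<exists>u\<in>W. p u = i \<and> q u = j"
      using that by (auto simp: vertex_at_def split: if_splits)
    then obtain u where u: "u \<in> W" "p u = i" "q u = j"
      by blast
    have "\<exists>!u. u \<in> W \<and> p u = i \<and> q u = j"
      by (rule ex1I[of _ u]) (use u in \<open>auto intro: inj_pq\<close>)
    from theI'[OF this] show ?thesis
      using ex by (simp add: vertex_at_def)
  qed
  have at_eq: "vertex_at (p u) (q u) = u" if "u \<in> W" for u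
  proof -
    have "(THE w. w \<in> W \<and> p w = p u \<and> q w = q u) = u"
      by (rule the_equality) (use that in \<open>auto intro: inj_pq\<close>)
    then show ?thesis
      using that by (auto simp: vertex_at_def)
  qed
  define l where "l = vertex_at (p v - 1) (q v)"
  define c where "c = vertex_at (p v - 1) (q v - 1)"
  define b where "b = vertex_at (p v) (q v - 1)"
  define r where "r = vertex_at (p v + 1) (q v - 1)"
  have L_notin: "v \<notin> s" if "s \<in> ?L" for s
    using that by (simp add: link_of_def)
  have L_mem: "u = l \<or> u = c \<or> u = b \<or> u = r" if s: "s \<in> ?L" "u \<in> s" for s u
  proof -
    have K: "insert v s \<in> K" and uv: "u \<noteq> v"
      using s by (auto simp: link_of_def)
    have u: "u \<in> W"
      using simplex_W[OF K] s by auto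
    have n: "\<bar>p u - p v\<bar> \<le> 1" "\<bar>q u - q v\<bar> \<le> 1"
      using near[OF K, of u v] s by auto
    have "p u \<noteq> p v \<or> q u \<noteq> q v"
      using inj_pq u v uv by blast
    then have "(p u = p v - 1 \<and> q u = q v) \<or> (p u = p v - 1 \<and> q u = q v - 1) \<or> (p u = p v \<and> q u = q v - 1)
        \<or> (p u = p v + 1 \<and> q u = q v - 1)"
    proof -
      have p3: "p u = p v - 1 \<or> p u = p v \<or> p u = p v + 1" and q2: "q v - 1 \<le> q u"
        using n by linarith+
      show ?thesis
      proof (cases "q u = q v")
        case True
        then show ?thesis
          using last[OF u] p3 \<open>p u \<noteq> p v \<or> q u \<noteq> q v\<close> by auto
      next
        case False
        then have "q u = q v - 1"
          using last[OF u] q2 by linarith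
        then show ?thesis
          using p3 by auto
      qed
    qed
    then show ?thesis
      using at_eq[OF u] by (auto simp: l_def c_def b_def r_def)
  qed
  show ?thesis
  proof (rule acyclic_link_shape[where l = l and c = c and b = b and r = r])
    show "s \<subseteq> {l, c, b, r}" if "s \<in> ?L" for s
      using L_mem[OF that] by blast
    show "s \<subseteq> {b, r}" if s: "s \<in> ?L" "r \<in> s" for s
    proof
      fix u assume u: "u \<in> s"
      have K: "insert v s \<in> K"
        using s by (auto simp: link_of_def)
      have "r \<noteq> v" "u \<noteq> v"
        using L_notin[OF s(1)] s u by auto
      moreover have "\<bar>p u - p r\<bar> \<le> 1"
        using near[OF K, of u r] u s by auto
      moreover have "u = l \<or> u = c \<or> u = b \<or> u = r"
        by (rule L_mem[OF s(1) u])
      ultimately show "u \<in> {b, r}"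
        using at_pos[of "p v + 1" "q v - 1"] at_pos[of "p v - 1" "q v"] at_pos[of "p v - 1" "q v - 1"]
        by (auto simp: r_def l_def c_def)
    qed
    show "{l, c, b} \<in> ?L" if lc: "{l, c} \<in> ?L" and cb: "{c, b} \<in> ?L"
    proof -
      have ne: "l \<noteq> v" "c \<noteq> v" "b \<noteq> v"
        using L_notin[OF lc] L_notin[OF cb] by auto
      have "{v, l, c} \<in> K" "{v, c, b} \<in> K"
        using lc cb by (auto simp: link_of_def)
      then have "{v, l, c, b} \<in> K"
        using at_pos[of "p v - 1" "q v"] at_pos[of "p v - 1" "q v - 1"] at_pos[of "p v" "q v - 1"] ne
        by (intro fill) (auto simp: l_def c_def b_def)
      then show ?thesis
        using ne by (auto simp: link_of_def)
    qed
  qed (use m down_closed_link in auto)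
qed

end

text \<open>Removing the lexicographically last vertex reduces \<open>W\<close>. Only the torsion of the
  link in degree 0 enters for the torsion of \<open>K\<close> in degree 1, and the former is always zero.\<close>
theorem planar_complex_homology:
  assumes "planar_complex K p q W"
  shows "(\<forall>m\<ge>3. acyclic_at K m) \<and> torsion_free_at K 2"
  using assms
proof (induction "card W" arbitrary: K W)
  case 0
  interpret planar_complex K p q W
    by (rule 0)
  have "W = {}"
    using 0 finite_W by simp
  then have E: "s = {}" if "s \<in> K" for s
    using simplex_W[OF that] by simp
  have "simplices K m = {}" if "m \<noteq> 0" for m
    using that by (auto simp: simplices_def dest!: E)
  then have "acyclic_at K m" if "m \<noteq> 0" for m
    using that by (simp add: acyclic_no_simplices)
  then show ?case
    using acyclic_imp_torsion_free[of 2] by auto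
next
  case (Suc n)
  interpret planar_complex K p q W
    by (rule Suc)
  have ne: "W \<noteq> {}"
    using Suc.hyps(2) by auto
  define y where "y = Max (q ` W)"
  have y: "\<And>u. u \<in> W \<Longrightarrow> q u \<le> y" "y \<in> q ` W"
    unfolding y_def using finite_W ne by auto
  define x where "x = Max (p ` {u \<in> W. q u = y})"
  have x: "\<And>u. u \<in> W \<Longrightarrow> q u = y \<Longrightarrow> p u \<le> x"
    unfolding x_def using finite_W by auto
  have "x \<in> p ` {u \<in> W. q u = y}"
    unfolding x_def using finite_W y(2) by (intro Max_in) auto
  then obtain v where v: "v \<in> W" "q v = y" "p v = x"
    by auto
  have last: "q u < q v \<or> q u = q v \<and> p u \<le> p v" if "u \<in> W" for u
    using y(1)[OF that] x[OF that] v by fastforce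
  have link: "acyclic_at (link_of K v) m" if "2 \<le> m" for m
    by (rule acyclic_link_last[OF v(1) last that])
  have "n = card (W - {v})"
    using Suc.hyps(2) v(1) finite_W by simp
  from Suc.hyps(1)[OF this planar_complex_deletion]
  have IH: "\<And>m. 3 \<le> m \<Longrightarrow> acyclic_at (deletion K v) m" "torsion_free_at (deletion K v) (Suc 1)"
    by (auto simp: numeral_2_eq_2)
  have "torsion_free_at K (Suc 1)"
    by (rule torsion_free_vertex_step[OF torsion_free_at_1 _ IH(2)]) (rule link, simp)
  moreover have "acyclic_at K m" if m: "3 \<le> m" for m
  proof -
    have "acyclic_at K (Suc (m - 1))"
      by (rule acyclic_vertex_step[OF link IH(1)]) (use m in auto)
    moreover have "Suc (m - 1) = m"
      using m by simp
    ultimately show ?thesis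
      by simp
  qed
  ultimately show ?case
    by (simp add: numeral_2_eq_2)
qed

section \<open>Words, cells and limit sets\<close>

definition words :: "(nat \<Rightarrow> 'a set) \<Rightarrow> nat \<Rightarrow> 'a list set"
  where "words S k = listset (map S [Suc 0..<Suc k])"

text \<open>The integer coordinates of the lower corner of a cell, measured in multiples of the side
  length of the cell; the digits of the word are the expansion of these integers in base
  \<open>n $ l\<close>.\<close>
fun corner :: "nat^'d \<Rightarrow> (nat^'d) list \<Rightarrow> 'd \<Rightarrow> nat"
  where "corner n [] l = 0"
  | "corner n (i # w) l = i $ l * n $ l ^ length w + corner n w l"

text \<open>Unlike the images of the coding map these sets are obviously compact and nested.\<close>
fun prefractal :: "nat^'d \<Rightarrow> (nat \<Rightarrow> (nat^'d) set) \<Rightarrow> nat \<Rightarrow> (real^'d) set"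
  where "prefractal n S 0 = cbox 0 1"
  | "prefractal n S (Suc m) = (\<Union>i\<in>S 1. cube_map n i ` prefractal n (\<lambda>j. S (Suc j)) m)"

lemma words_0 [simp]: "words S 0 = {[]}"
  by (simp add: words_def)

lemma map_upt_Cons: "map f [Suc 0..<Suc (Suc k)] = f (Suc 0) # map (\<lambda>j. f (Suc j)) [Suc 0..<Suc k]"
proof -
  have "[Suc 0..<Suc (Suc k)] = Suc 0 # map Suc [Suc 0..<Suc k]"
    by (simp add: map_Suc_upt upt_conv_Cons)
  then show ?thesis
    by (simp del: upt_Suc)
qed

lemma words_Suc: "words S (Suc k) = {i # w |i w. i \<in> S (Suc 0) \<and> w \<in> words (\<lambda>j. S (Suc j)) k}"
  unfolding words_def map_upt_Cons by (auto simp: set_Cons_def simp del: upt_Suc)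

lemma words_snoc: "words S (Suc k) = {w @ [i] |w i. w \<in> words S k \<and> i \<in> S (Suc k)}"
proof (induction k arbitrary: S)
  case 0
  then show ?case
    by (auto simp: words_Suc)
next
  case (Suc k)
  have "words S (Suc (Suc k)) = {i # v |i v. i \<in> S (Suc 0) \<and> v \<in> words (\<lambda>j. S (Suc j)) (Suc k)}"
    by (rule words_Suc)
  also have "\<dots> = {i # (w @ [j]) |i w j. i \<in> S (Suc 0) \<and> w \<in> words (\<lambda>j. S (Suc j)) k \<and> j \<in> S (Suc (Suc k))}"
    unfolding Suc[of "\<lambda>j. S (Suc j)"] by blast
  also have "\<dots> = {w @ [i] |w i. w \<in> words S (Suc k) \<and> i \<in> S (Suc (Suc k))}"
  proof (intro equalityI subsetI)
    fix x assume "x \<in> {i # (w @ [j]) |i w j. i \<in> S (Suc 0) \<and> w \<in> words (\<lambda>j. S (Suc j)) k \<and> j \<in> S (Suc (Suc k))}"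
    then obtain i w j where "x = (i # w) @ [j]" "i \<in> S (Suc 0)" "w \<in> words (\<lambda>j. S (Suc j)) k" "j \<in> S (Suc (Suc k))"
      by auto
    then show "x \<in> {w @ [i] |w i. w \<in> words S (Suc k) \<and> i \<in> S (Suc (Suc k))}"
      unfolding words_Suc by blast
  next
    fix x assume "x \<in> {w @ [i] |w i. w \<in> words S (Suc k) \<and> i \<in> S (Suc (Suc k))}"
    then obtain i w j where "x = i # (w @ [j])" "i \<in> S (Suc 0)" "w \<in> words (\<lambda>j. S (Suc j)) k" "j \<in> S (Suc (Suc k))"
      unfolding words_Suc by auto
    then show "x \<in> {i # (w @ [j]) |i w j. i \<in> S (Suc 0) \<and> w \<in> words (\<lambda>j. S (Suc j)) k \<and> j \<in> S (Suc (Suc k))}"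
      by blast
  qed
  finally show ?case .
qed

lemma length_words: "w \<in> words S k \<Longrightarrow> length w = k"
  by (induction k arbitrary: S w) (auto simp: words_Suc)

lemma finite_words: "(\<And>j. 1 \<le> j \<Longrightarrow> finite (S j)) \<Longrightarrow> finite (words S k)"
proof (induction k arbitrary: S)
  case (Suc k)
  have "words S (Suc k) = (\<lambda>(i, w). i # w) ` (S (Suc 0) \<times> words (\<lambda>j. S (Suc j)) k)"
    by (auto simp: words_Suc)
  then show ?case
    using Suc by simp
qed simp

lemma word_map_Nil [simp]: "word_map n [] = id"
  and word_map_Cons: "word_map n (i # w) = cube_map n i \<circ> word_map n w"
  by (simp_all add: word_map_def)

lemma word_map_append: "word_map n (u @ v) = word_map n u \<circ> word_map n v"
  by (induction u) (simp_all add: word_map_Cons comp_assoc)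

lemma corner_append: "corner n (u @ v) l = corner n u l * n $ l ^ length v + corner n v l"
  by (induction u) (simp_all add: algebra_simps power_add)

lemma corner_snoc: "corner n (w @ [i]) l = corner n w l * n $ l + i $ l"
  by (simp add: corner_append)

lemma corner_less:
  assumes "set w \<subseteq> digit_set n" shows "corner n w l < n $ l ^ length w"
  using assms
proof (induction w rule: rev_induct)
  case (snoc i w)
  have "corner n w l * n $ l + i $ l < corner n w l * n $ l + n $ l"
    using snoc.prems by (simp add: digit_set_def)
  also have "\<dots> = (corner n w l + 1) * n $ l"
    by simp
  also have "\<dots> \<le> n $ l ^ length w * n $ l"
    using snoc by (intro mult_right_mono) auto
  finally show ?case
    by (simp add: corner_snoc mult.commute)
qed simp

text \<open>Expansions with respect to a base are unique.\<close>
lemma corner_inj: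
  assumes "length u = length v" "set u \<subseteq> digit_set n" "set v \<subseteq> digit_set n" "\<And>l. corner n u l = corner n v l"
  shows "u = v"
  using assms
proof (induction u v rule: rev_induct2)
  case (4 i u j v)
  have "corner n (u @ [i]) l = corner n (v @ [j]) l" for l
    using 4 by blast
  then have eq: "corner n u l * n $ l + i $ l = corner n v l * n $ l + j $ l" for l
    by (simp add: corner_snoc)
  have lt: "i $ l < n $ l" "j $ l < n $ l" for l
    using 4 by (auto simp: digit_set_def)
  have "i $ l = j $ l" for l
    using arg_cong[OF eq[of l], of "\<lambda>x. x mod n $ l"] lt[of l] by simp
  moreover have "corner n u l = corner n v l" for l
    using arg_cong[OF eq[of l], of "\<lambda>x. x div n $ l"] lt[of l] by simp
  ultimately show ?case
    using 4 by (auto simp: vec_eq_iff)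
qed auto

lemma cube_map_nth: "cube_map n i x $ l = (x $ l + real (i $ l)) / real (n $ l)"
  by (simp add: cube_map_def)

lemma continuous_cube_map: "continuous_on A (cube_map n i)"
  unfolding cube_map_def divide_inverse by (intro continuous_intros)

lemma continuous_word_map: "continuous_on A (word_map n w)"
proof (induction w)
  case (Cons i w)
  then show ?case
    unfolding word_map_Cons by (intro continuous_on_compose continuous_cube_map)
qed (simp add: continuous_on_id')

lemma mem_unit_cube: "x \<in> cbox 0 (1::real^'d) \<longleftrightarrow> (\<forall>l. 0 \<le> x $ l \<and> x $ l \<le> 1)"
  by (simp add: mem_box_cart)

locale fractal =
  fixes n :: "nat^'d"
  assumes n_ge2: "2 \<le> n $ k"
begin

definition valid :: "(nat \<Rightarrow> (nat^'d) set) \<Rightarrow> bool"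
  where "valid S \<longleftrightarrow> (\<forall>j\<ge>1. S j \<subseteq> digit_set n \<and> S j \<noteq> {})"

lemma n_pos [simp]: "0 < n $ k" and n_nonzero [simp]: "n $ k \<noteq> 0"
  using n_ge2[of k] by auto

lemma word_map_nth: "word_map n w x $ l = (x $ l + real (corner n w l)) / real (n $ l) ^ length w"
  by (induction w arbitrary: x) (simp_all add: word_map_Cons cube_map_nth field_simps)

lemma cube_map_inj: "cube_map n i x = cube_map n i y \<Longrightarrow> x = y"
  by (simp add: vec_eq_iff cube_map_nth)

lemma finite_digit_set: "finite (digit_set n)"
proof -
  have "digit_set n \<subseteq> vec_lambda ` {f. \<forall>k. f k \<in> {..<n $ k}}"
  proof
    fix i assume "i \<in> digit_set n"
    then show "i \<in> vec_lambda ` {f. \<forall>k. f k \<in> {..<n $ k}}"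
      by (intro image_eqI[of _ _ "\<lambda>k. i $ k"]) (auto simp: digit_set_def)
  qed
  moreover have "finite {f. \<forall>k::'d. f k \<in> {..<n $ k}}"
    using finite_PiE[of UNIV "\<lambda>k. {..<n $ k}"] by (simp add: PiE_def extensional_def Pi_def)
  ultimately show ?thesis
    using finite_surj by blast
qed

lemma valid_shift: "valid S \<Longrightarrow> valid (\<lambda>j. S (Suc j))"
  by (auto simp: valid_def)

lemma valid_plus: "valid S \<Longrightarrow> valid (\<lambda>j. S (k + j))"
  by (auto simp: valid_def)

lemma valid_finite: "valid S \<Longrightarrow> 1 \<le> j \<Longrightarrow> finite (S j)"
  unfolding valid_def by (meson finite_digit_set finite_subset)

lemma cube_map_unit: "i \<in> digit_set n \<Longrightarrow> x \<in> cbox 0 1 \<Longrightarrow> cube_map n i x \<in> cbox 0 1"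
proof -
  assume i: "i \<in> digit_set n" and x: "x \<in> cbox 0 1"
  have "0 \<le> (x $ l + real (i $ l)) / real (n $ l) \<and> (x $ l + real (i $ l)) / real (n $ l) \<le> 1" for l
  proof -
    have "Suc (i $ l) \<le> n $ l"
      using i by (simp add: digit_set_def Suc_le_eq)
    then have "real (i $ l) + 1 \<le> real (n $ l)"
      by linarith
    moreover have "0 \<le> x $ l" "x $ l \<le> 1"
      using x by (auto simp: mem_unit_cube)
    ultimately show ?thesis
      by (simp add: divide_simps)
  qed
  then show ?thesis
    by (simp add: mem_unit_cube cube_map_nth)
qed

lemma words_digits: "valid S \<Longrightarrow> w \<in> words S k \<Longrightarrow> set w \<subseteq> digit_set n"
proof (induction k arbitrary: S w)
  case (Suc k)
  then obtain i v where "w = i # v" "i \<in> S (Suc 0)" "v \<in> words (\<lambda>j. S (Suc j)) k"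
    by (auto simp: words_Suc)
  then show ?case
    using Suc.IH[OF valid_shift[OF Suc.prems(1)]] Suc.prems(1) by (auto simp: valid_def)
qed simp

lemma word_map_dist:
  assumes "x \<in> cbox 0 1" "y \<in> cbox 0 1"
  shows "dist (word_map n w x) (word_map n w y) \<le> real CARD('d) * (1/2) ^ length w"
proof -
  have "\<bar>(word_map n w x - word_map n w y) $ l\<bar> \<le> (1/2) ^ length w" for l
  proof -
    have "\<bar>x $ l - y $ l\<bar> \<le> 1"
      using assms by (auto simp: mem_unit_cube abs_le_iff) (smt (verit))+
    moreover have "(word_map n w x - word_map n w y) $ l = (x $ l - y $ l) / real (n $ l) ^ length w"
      by (simp add: word_map_nth flip: diff_divide_distrib)
    ultimately have "\<bar>(word_map n w x - word_map n w y) $ l\<bar> \<le> 1 / real (n $ l) ^ length w"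
      by (simp add: divide_right_mono)
    also have "\<dots> \<le> 1 / 2 ^ length w"
      using n_ge2[of l] by (intro divide_left_mono power_mono mult_pos_pos) auto
    finally show ?thesis
      by (simp add: power_one_over)
  qed
  then have "(\<Sum>l\<in>UNIV. \<bar>(word_map n w x - word_map n w y) $ l\<bar>) \<le> (\<Sum>l\<in>(UNIV::'d set). (1/2) ^ length w)"
    by (intro sum_mono) auto
  then show ?thesis
    using norm_le_l1_cart[of "word_map n w x - word_map n w y"] by (simp add: dist_norm)
qed

lemma pow_half_small: "0 < e \<Longrightarrow> \<exists>j. real CARD('d) * (1/2) ^ j < e"
proof -
  assume e: "0 < e"
  obtain j where "(1/2::real) ^ j < e / real CARD('d)"
    using real_arch_pow_inv[of "e / real CARD('d)" "1/2"] e by auto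
  then show ?thesis
    by (intro exI[of _ j]) (simp add: field_simps)
qed

text \<open>The cells of the prefixes are nested, compact and shrink to a point.\<close>
lemma coding_map_cells:
  assumes i: "\<And>j. 1 \<le> j \<Longrightarrow> i j \<in> digit_set n"
  shows "(\<Inter>j. word_map n (map i [Suc 0..<Suc j]) ` cbox 0 1) = {coding_map n i}"
proof -
  let ?F = "\<lambda>j. word_map n (map i [Suc 0..<Suc j]) ` cbox 0 1"
  have digits: "set (map i [Suc 0..<Suc j]) \<subseteq> digit_set n" for j
    using i by auto
  have step: "?F (Suc j) \<subseteq> ?F j" for j
  proof -
    have "map i [Suc 0..<Suc (Suc j)] = map i [Suc 0..<Suc j] @ [i (Suc j)]"
      by simp
    then have "?F (Suc j) = word_map n (map i [Suc 0..<Suc j]) ` (cube_map n (i (Suc j)) ` cbox 0 1)"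
      by (simp only: word_map_append word_map_Cons word_map_Nil image_comp[symmetric] image_id comp_id id_apply)
    then show ?thesis
      using cube_map_unit[OF i[of "Suc j"]] by auto
  qed
  have anti: "?F k \<subseteq> ?F j" if "j \<le> k" for j k
    using that
  proof (induction rule: dec_induct)
    case (step m)
    then show ?case
      using \<open>?F (Suc m) \<subseteq> ?F m\<close> by blast
  qed simp
  have "\<exists>a. \<Inter>(range ?F) = {a}"
  proof (rule decreasing_closed_nest_sing)
    show "closed (?F j)" for j
      by (intro compact_imp_closed compact_continuous_image continuous_word_map compact_cbox)
    show "?F j \<noteq> {}" for j
      using mem_unit_cube[of "0 :: real^'d"] by force
    show "?F k \<subseteq> ?F j" if "j \<le> k" for j k
      by (rule anti[OF that])
    fix e :: real assume "e > 0"
    then obtain j where j: "real CARD('d) * (1/2) ^ j < e"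
      using pow_half_small by blast
    have "dist x y < e" if xy: "x \<in> ?F j" "y \<in> ?F j" for x y
    proof -
      obtain a b where "a \<in> cbox 0 1" "x = word_map n (map i [Suc 0..<Suc j]) a"
        "b \<in> cbox 0 1" "y = word_map n (map i [Suc 0..<Suc j]) b"
        using xy by blast
      moreover have "length (map i [Suc 0..<Suc j]) = j"
        by simp
      ultimately show ?thesis
        using word_map_dist[of a b "map i [Suc 0..<Suc j]"] j by (simp del: upt_Suc)
    qed
    then show "\<exists>j. \<forall>x\<in>?F j. \<forall>y\<in>?F j. dist x y < e"
      by blast
  qed
  then obtain a where a: "(\<Inter>j. ?F j) = {a}"
    by blast
  moreover have "(\<Inter>j. ?F j) = (\<Inter>j\<in>{1..}. ?F j)"
  proof (intro equalityI subsetI INT_I)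
    fix x j assume x: "x \<in> (\<Inter>j\<in>{1..}. ?F j)"
    then have "x \<in> ?F (Suc j)"
      by (simp del: upt_Suc)
    then show "x \<in> ?F j"
      using step by blast
  qed blast
  ultimately have eq: "(\<Inter>j\<in>{1..}. ?F j) = {a}"
    by simp
  have "coding_map n i = a"
    unfolding coding_map_def One_nat_def[symmetric]
  proof (rule the_equality)
    show "(\<Inter>j\<in>{1..}. word_map n (map i [1..<Suc j]) ` cbox 0 1) = {a}"
      using eq by simp
    fix x assume "(\<Inter>j\<in>{1..}. word_map n (map i [1..<Suc j]) ` cbox 0 1) = {x}"
    then show "x = a"
      using eq by simp
  qed
  then show ?thesis
    using a by simp
qed

lemma coding_map_unit:
  assumes "\<And>j. 1 \<le> j \<Longrightarrow> i j \<in> digit_set n"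
  shows "coding_map n i \<in> cbox 0 1"
proof -
  have "coding_map n i \<in> (\<Inter>j. word_map n (map i [Suc 0..<Suc j]) ` cbox 0 1)"
    using coding_map_cells[OF assms] by (simp del: upt_Suc)
  then have "coding_map n i \<in> word_map n (map i [Suc 0..<Suc 0]) ` cbox 0 1"
    by blast
  then show ?thesis
    by simp
qed

lemma coding_map_step:
  assumes i: "\<And>j. 1 \<le> j \<Longrightarrow> i j \<in> digit_set n"
  shows "coding_map n i = cube_map n (i 1) (coding_map n (\<lambda>j. i (Suc j)))"
proof -
  let ?y = "coding_map n (\<lambda>j. i (Suc j))"
  have y: "?y \<in> (\<Inter>j. word_map n (map (\<lambda>j. i (Suc j)) [Suc 0..<Suc j]) ` cbox 0 1)"
    using coding_map_cells[of "\<lambda>j. i (Suc j)"] i by simp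
  have "cube_map n (i 1) ?y \<in> word_map n (map i [Suc 0..<Suc j]) ` cbox 0 1" for j
  proof (cases j)
    case 0
    then show ?thesis
      using cube_map_unit[OF i[of 1] coding_map_unit[of "\<lambda>j. i (Suc j)"]] i by simp
  next
    case (Suc k)
    have "map i [Suc 0..<Suc j] = i 1 # map (\<lambda>j. i (Suc j)) [Suc 0..<Suc k]"
      using map_upt_Cons[of i k] by (simp only: Suc One_nat_def)
    then have "word_map n (map i [Suc 0..<Suc j]) = cube_map n (i 1) \<circ> word_map n (map (\<lambda>j. i (Suc j)) [Suc 0..<Suc k])"
      by (simp only: word_map_Cons)
    moreover have "?y \<in> word_map n (map (\<lambda>j. i (Suc j)) [Suc 0..<Suc k]) ` cbox 0 1"
      using y by blast
    ultimately show ?thesis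
      by auto
  qed
  moreover have "(\<Inter>j. word_map n (map i [Suc 0..<Suc j]) ` cbox 0 1) = {coding_map n i}"
    by (rule coding_map_cells) (rule i)
  ultimately have "cube_map n (i 1) ?y \<in> {coding_map n i}"
    by blast
  then show ?thesis
    by simp
qed

lemma coding_map_cong: "(\<And>j. 1 \<le> j \<Longrightarrow> i j = i' j) \<Longrightarrow> coding_map n i = coding_map n i'"
proof -
  assume eq: "\<And>j. 1 \<le> j \<Longrightarrow> i j = i' j"
  have "map i [1..<Suc j] = map i' [1..<Suc j]" for j
    by (rule map_cong) (use eq in auto)
  then show ?thesis
    unfolding coding_map_def by (simp only:)
qed

lemma prefractal_antimono: "valid S \<Longrightarrow> prefractal n S (Suc m) \<subseteq> prefractal n S m"
proof (induction m arbitrary: S)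
  case 0
  then show ?case
    using cube_map_unit by (fastforce simp: valid_def)
next
  case (Suc m)
  show ?case
    using Suc.IH[OF valid_shift[OF Suc.prems]] unfolding prefractal.simps(2) by blast
qed

lemma prefractal_mono: "valid S \<Longrightarrow> m \<le> m' \<Longrightarrow> prefractal n S m' \<subseteq> prefractal n S m"
  using lift_Suc_antimono_le[of "prefractal n S" m m'] prefractal_antimono by blast

lemma compact_prefractal: "valid S \<Longrightarrow> compact (prefractal n S m)"
proof (induction m arbitrary: S)
  case (Suc m)
  then show ?case
    unfolding prefractal.simps
    by (intro compact_UN compact_continuous_image continuous_cube_map Suc.IH valid_shift)
       (use Suc.prems valid_finite in auto)
qed (simp add: compact_cbox)

text \<open>Some first digit works for infinitely many, hence by nestedness for all depths, since there
  are only finitely many digits.\<close>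
lemma prefractal_descent:
  assumes S: "valid S" and x: "\<And>m. x \<in> prefractal n S m"
  obtains i y where "i \<in> S 1" "x = cube_map n i y" "\<And>m. y \<in> prefractal n (\<lambda>j. S (Suc j)) m"
proof -
  have "\<exists>i\<in>S 1. \<forall>m. x \<in> cube_map n i ` prefractal n (\<lambda>j. S (Suc j)) m"
  proof (rule ccontr)
    assume "\<not> (\<exists>i\<in>S 1. \<forall>m. x \<in> cube_map n i ` prefractal n (\<lambda>j. S (Suc j)) m)"
    then obtain f where f: "\<And>i. i \<in> S 1 \<Longrightarrow> x \<notin> cube_map n i ` prefractal n (\<lambda>j. S (Suc j)) (f i)"
      by metis
    define m where "m = Max (f ` S 1)"
    have "f i \<le> m" if "i \<in> S 1" for i
      using that valid_finite[OF S] by (simp add: m_def)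
    then have "x \<notin> cube_map n i ` prefractal n (\<lambda>j. S (Suc j)) m" if "i \<in> S 1" for i
      using f[OF that] prefractal_mono[OF valid_shift[OF S], of "f i" m] that by blast
    moreover have "x \<in> prefractal n S (Suc m)"
      by (rule x)
    ultimately show False
      by auto
  qed
  then obtain i where i: "i \<in> S 1" "\<And>m. x \<in> cube_map n i ` prefractal n (\<lambda>j. S (Suc j)) m"
    by blast
  obtain y where y: "x = cube_map n i y"
    using i(2) by blast
  have "y \<in> prefractal n (\<lambda>j. S (Suc j)) m" for m
  proof -
    obtain z where "z \<in> prefractal n (\<lambda>j. S (Suc j)) m" "x = cube_map n i z"
      using i(2)[of m] by blast
    then show ?thesis
      using y cube_map_inj by metis
  qed
  then show thesis
    using that i(1) y by blast
qed

text \<open>A point of all the approximations determines, digit by digit, an infinite word: apply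
  the descent to it, then to the point of which it is the image, and so on.\<close>
theorem limit_set_eq_prefractal:
  assumes S: "valid S" shows "limit_set n S = (\<Inter>m. prefractal n S m)"
proof (intro equalityI subsetI)
  fix x assume "x \<in> limit_set n S"
  then obtain i where x: "x = coding_map n i" and i: "\<And>j. 1 \<le> j \<Longrightarrow> i j \<in> S j"
    by (auto simp: limit_set_def PiE_def Pi_def)
  have "coding_map n i \<in> prefractal n S m" if "\<And>j. 1 \<le> j \<Longrightarrow> i j \<in> S j" "valid S" for m i S
    using that
  proof (induction m arbitrary: i S)
    case 0
    then have "coding_map n i \<in> cbox 0 1"
      by (intro coding_map_unit) (auto simp: valid_def)
    then show ?case
      by simp
  next
    case (Suc m)
    have "coding_map n (\<lambda>j. i (Suc j)) \<in> prefractal n (\<lambda>j. S (Suc j)) m"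
      using Suc.prems by (intro Suc.IH valid_shift) auto
    moreover have "coding_map n i = cube_map n (i 1) (coding_map n (\<lambda>j. i (Suc j)))"
      using Suc.prems by (intro coding_map_step) (auto simp: valid_def)
    ultimately show ?case
      using Suc.prems(1)[of 1] unfolding prefractal.simps by blast
  qed
  then show "x \<in> (\<Inter>m. prefractal n S m)"
    using x i S by blast
next
  fix x assume x: "x \<in> (\<Inter>m. prefractal n S m)"
  let ?P = "\<lambda>k (iy :: (nat^'d) \<times> (real^'d)). (\<forall>m. snd iy \<in> prefractal n (\<lambda>j. S (k + j)) m) \<and> (k = 0 \<longrightarrow> snd iy = x)"
  let ?Q = "\<lambda>k iy iy'. fst iy' \<in> S (Suc k) \<and> snd iy = cube_map n (fst iy') (snd iy')"
  have "\<exists>f. \<forall>k. ?P k (f k) \<and> ?Q k (f k) (f (Suc k))"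
  proof (rule dependent_nat_choice)
    show "\<exists>iy. ?P 0 iy"
      using x by (intro exI[of _ "(undefined, x)"]) auto
    fix iy k assume "?P k iy"
    then have P: "\<And>m. snd iy \<in> prefractal n (\<lambda>j. S (k + j)) m"
      by blast
    obtain i y where "i \<in> S (k + 1)" "snd iy = cube_map n i y" "\<And>m. y \<in> prefractal n (\<lambda>j. S (k + Suc j)) m"
      using prefractal_descent[OF valid_plus[OF S] P] by blast
    then show "\<exists>iy'. ?P (Suc k) iy' \<and> ?Q k iy iy'"
      by (intro exI[of _ "(i, y)"]) auto
  qed
  then obtain f where P: "\<And>k. ?P k (f k)" and Q: "\<And>k. ?Q k (f k) (f (Suc k))"
    by blast
  define i where "i j = fst (f j)" for j
  have iS: "i j \<in> S j" if "1 \<le> j" for j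
    using Q[of "j - 1"] that by (simp add: i_def)
  have x_eq: "x = word_map n (map i [Suc 0..<Suc k]) (snd (f k))" for k
  proof (induction k)
    case 0
    then show ?case
      using P[of 0] by simp
  next
    case (Suc k)
    have "map i [Suc 0..<Suc (Suc k)] = map i [Suc 0..<Suc k] @ [i (Suc k)]"
      by simp
    then have "word_map n (map i [Suc 0..<Suc (Suc k)]) (snd (f (Suc k)))
        = word_map n (map i [Suc 0..<Suc k]) (cube_map n (i (Suc k)) (snd (f (Suc k))))"
      by (simp only: word_map_append word_map_Cons word_map_Nil comp_apply id_apply)
    also have "cube_map n (i (Suc k)) (snd (f (Suc k))) = snd (f k)"
      using Q[of k] by (simp add: i_def)
    also have "word_map n (map i [Suc 0..<Suc k]) (snd (f k)) = x"
      using Suc by simp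
    finally show ?case
      by simp
  qed
  have "x \<in> word_map n (map i [Suc 0..<Suc k]) ` cbox 0 1" for k
  proof -
    have "snd (f k) \<in> prefractal n (\<lambda>j. S (k + j)) 0"
      using P by blast
    then show ?thesis
      using x_eq[of k] by (auto simp del: upt_Suc)
  qed
  then have "x \<in> (\<Inter>j. word_map n (map i [Suc 0..<Suc j]) ` cbox 0 1)"
    by blast
  also have "\<dots> = {coding_map n i}"
    using iS S by (intro coding_map_cells) (auto simp: valid_def)
  finally have "x = coding_map n (restrict i {1..})"
    using coding_map_cong[of i "restrict i {1..}"] by simp
  moreover have "restrict i {1..} \<in> (\<Pi>\<^sub>E j\<in>{1..}. S j)"
    using iS by auto
  ultimately show "x \<in> limit_set n S"
    unfolding limit_set_def by blast
qed

lemma limit_set_step: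
  assumes S: "valid S" shows "limit_set n S = (\<Union>i\<in>S 1. cube_map n i ` limit_set n (\<lambda>j. S (Suc j)))"
proof (intro equalityI subsetI)
  fix x assume "x \<in> limit_set n S"
  then have "\<And>m. x \<in> prefractal n S m"
    using limit_set_eq_prefractal[OF S] by blast
  from prefractal_descent[OF S this] obtain i y
    where iy: "i \<in> S 1" "x = cube_map n i y" "\<And>m. y \<in> prefractal n (\<lambda>j. S (Suc j)) m"
    by blast
  then have "y \<in> limit_set n (\<lambda>j. S (Suc j))"
    using limit_set_eq_prefractal[OF valid_shift[OF S]] by blast
  then show "x \<in> (\<Union>i\<in>S 1. cube_map n i ` limit_set n (\<lambda>j. S (Suc j)))"
    using iy by blast
next
  fix x assume "x \<in> (\<Union>i\<in>S 1. cube_map n i ` limit_set n (\<lambda>j. S (Suc j)))"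
  then have "x \<in> prefractal n S (Suc m)" for m
    using limit_set_eq_prefractal[OF valid_shift[OF S]] unfolding prefractal.simps by blast
  then have "x \<in> prefractal n S m" for m
    using prefractal_antimono[OF S] by blast
  then show "x \<in> limit_set n S"
    using limit_set_eq_prefractal[OF S] by blast
qed

lemma limit_set_words:
  "valid S \<Longrightarrow> limit_set n S = (\<Union>w\<in>words S k. word_map n w ` shifted_limit_set n S k)"
proof (induction k arbitrary: S)
  case 0
  then show ?case
    by (simp add: shifted_limit_set_def)
next
  case (Suc k)
  have "limit_set n S = (\<Union>i\<in>S 1. cube_map n i ` limit_set n (\<lambda>j. S (Suc j)))"
    by (rule limit_set_step[OF Suc.prems])
  also have "\<dots> = (\<Union>i\<in>S 1. cube_map n i ` (\<Union>w\<in>words (\<lambda>j. S (Suc j)) k. word_map n w ` shifted_limit_set n S (Suc k)))"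
    using Suc.IH[OF valid_shift[OF Suc.prems]] by (simp add: shifted_limit_set_def)
  also have "\<dots> = (\<Union>w\<in>words S (Suc k). word_map n w ` shifted_limit_set n S (Suc k))"
    unfolding words_Suc One_nat_def
  proof (intro equalityI subsetI)
    fix x assume "x \<in> (\<Union>i\<in>S (Suc 0). cube_map n i ` (\<Union>w\<in>words (\<lambda>j. S (Suc j)) k. word_map n w ` shifted_limit_set n S (Suc k)))"
    then obtain i w y where *: "i \<in> S (Suc 0)" "w \<in> words (\<lambda>j. S (Suc j)) k" "y \<in> shifted_limit_set n S (Suc k)"
      "x = cube_map n i (word_map n w y)"
      by blast
    then have "x = word_map n (i # w) y"
      by (simp add: word_map_Cons)
    then show "x \<in> (\<Union>w\<in>{i # w |i w. i \<in> S (Suc 0) \<and> w \<in> words (\<lambda>j. S (Suc j)) k}. word_map n w ` shifted_limit_set n S (Suc k))"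
      using * by blast
  next
    fix x assume "x \<in> (\<Union>w\<in>{i # w |i w. i \<in> S (Suc 0) \<and> w \<in> words (\<lambda>j. S (Suc j)) k}. word_map n w ` shifted_limit_set n S (Suc k))"
    then obtain i w y where *: "i \<in> S (Suc 0)" "w \<in> words (\<lambda>j. S (Suc j)) k" "y \<in> shifted_limit_set n S (Suc k)"
      "x = word_map n (i # w) y"
      by blast
    then have "x = cube_map n i (word_map n w y)"
      by (simp add: word_map_Cons)
    then show "x \<in> (\<Union>i\<in>S (Suc 0). cube_map n i ` (\<Union>w\<in>words (\<lambda>j. S (Suc j)) k. word_map n w ` shifted_limit_set n S (Suc k)))"
      using * by blast
  qed
  finally show ?case .
qed

lemma limit_set_unit: "valid S \<Longrightarrow> limit_set n S \<subseteq> cbox 0 1"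
  using limit_set_eq_prefractal[of S] prefractal.simps(1)[of n S] by blast

lemma compact_limit_set: "valid S \<Longrightarrow> compact (limit_set n S)"
  unfolding limit_set_eq_prefractal by (rule compact_Inter) (use compact_prefractal in auto)

lemma limit_set_nonempty:
  assumes "valid S" shows "limit_set n S \<noteq> {}"
proof -
  define i where "i = (\<lambda>j\<in>{1::nat..}. SOME a. a \<in> S j)"
  have "i j \<in> S j" if "1 \<le> j" for j
    using that assms unfolding valid_def i_def by (simp add: some_in_eq)
  then have "i \<in> (\<Pi>\<^sub>E j\<in>{1..}. S j)"
    by (auto simp: i_def)
  then show ?thesis
    by (auto simp: limit_set_def)
qed

lemma shifted_limit_set_facts:
  assumes "valid S"
  shows "compact (shifted_limit_set n S k)" "shifted_limit_set n S k \<noteq> {}" "shifted_limit_set n S k \<subseteq> cbox 0 1"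
  unfolding shifted_limit_set_def
  using compact_limit_set limit_set_nonempty limit_set_unit valid_plus[OF assms] by auto

end

section \<open>Few removed digits: connectedness and line segments\<close>

lemma card_vec_box:
  assumes "\<And>l. finite (B l)"
  shows "card {i::'a^'d. \<forall>l. i $ l \<in> B l} = (\<Prod>l\<in>UNIV. card (B l))"
proof -
  have "bij_betw vec_nth {i::'a^'d. \<forall>l. i $ l \<in> B l} (\<Pi>\<^sub>E l\<in>UNIV. B l)"
    by (rule bij_betw_byWitness[where f' = vec_lambda]) (auto simp: vec_eq_iff PiE_def Pi_def)
  then have "card {i::'a^'d. \<forall>l. i $ l \<in> B l} = card (\<Pi>\<^sub>E l\<in>(UNIV::'d set). B l)"
    by (rule bij_betw_same_card)
  then show ?thesis
    by (simp add: card_PiE)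
qed

definition vec_upd :: "'a^'d \<Rightarrow> 'd \<Rightarrow> 'a \<Rightarrow> 'a^'d"
  where "vec_upd x k t = (\<chi> l. if l = k then t else x $ l)"

lemma vec_upd_nth [simp]: "vec_upd x k t $ l = (if l = k then t else x $ l)"
  by (simp add: vec_upd_def)

definition grid_adjacent :: "nat^'d \<Rightarrow> nat^'d \<Rightarrow> bool"
  where "grid_adjacent u v \<longleftrightarrow> (\<exists>k. v = vec_upd u k (u $ k + 1) \<or> u = vec_upd v k (v $ k + 1))"

definition grid_paths :: "(nat^'d) set \<Rightarrow> ((nat^'d) \<times> (nat^'d)) set"
  where "grid_paths A = {(u, v). u \<in> A \<and> v \<in> A \<and> grid_adjacent u v}\<^sup>*"

lemma grid_paths_sym: "(u, v) \<in> grid_paths A \<Longrightarrow> (v, u) \<in> grid_paths A"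
proof -
  have "sym {(u, v). u \<in> A \<and> v \<in> A \<and> grid_adjacent u v}"
    by (auto simp: sym_def grid_adjacent_def)
  then have "sym (grid_paths A)"
    unfolding grid_paths_def by (rule sym_rtrancl)
  then show "(u, v) \<in> grid_paths A \<Longrightarrow> (v, u) \<in> grid_paths A"
    by (rule symD)
qed

lemma grid_paths_trans: "(u, v) \<in> grid_paths A \<Longrightarrow> (v, w) \<in> grid_paths A \<Longrightarrow> (u, w) \<in> grid_paths A"
  unfolding grid_paths_def by (rule rtrancl_trans)

lemma grid_paths_mono: "A \<subseteq> B \<Longrightarrow> (u, v) \<in> grid_paths A \<Longrightarrow> (u, v) \<in> grid_paths B"
  unfolding grid_paths_def
  using rtrancl_mono[of "{(u, v). u \<in> A \<and> v \<in> A \<and> grid_adjacent u v}" "{(u, v). u \<in> B \<and> v \<in> B \<and> grid_adjacent u v}"]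
  by blast

lemma grid_paths_refl [simp]: "(u, u) \<in> grid_paths A"
  by (simp add: grid_paths_def)

lemma grid_paths_step: "u \<in> A \<Longrightarrow> v \<in> A \<Longrightarrow> grid_adjacent u v \<Longrightarrow> (u, v) \<in> grid_paths A"
  unfolding grid_paths_def by (rule r_into_rtrancl) simp

context fractal begin

text \<open>The face of the grid through \<open>b\<close> in which the coordinates in \<open>K\<close> are free.\<close>
definition subgrid :: "'d set \<Rightarrow> nat^'d \<Rightarrow> (nat^'d) set"
  where "subgrid K b = {i \<in> digit_set n. \<forall>l. l \<notin> K \<longrightarrow> i $ l = b $ l}"

lemma card_subgrid: "b \<in> digit_set n \<Longrightarrow> card (subgrid K b) = (\<Prod>l\<in>K. n $ l)"
proof -
  assume b: "b \<in> digit_set n"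
  have "subgrid K b = {i. \<forall>l. i $ l \<in> (if l \<in> K then {..<n $ l} else {b $ l})}"
    using b by (auto simp: subgrid_def digit_set_def split: if_splits) metis+
  moreover have "finite (if l \<in> K then {..<n $ l} else {b $ l})" for l
    by simp
  ultimately have "card (subgrid K b) = (\<Prod>l\<in>UNIV. card (if l \<in> K then {..<n $ l} else {b $ l}))"
    using card_vec_box[of "\<lambda>l. if l \<in> K then {..<n $ l} else {b $ l}"] by simp
  also have "\<dots> = (\<Prod>l\<in>UNIV. if l \<in> K then n $ l else 1)"
    by (rule prod.cong) auto
  also have "\<dots> = (\<Prod>l\<in>K. n $ l)"
    by (simp add: prod.If_cases)
  finally show ?thesis .
qed

lemma prod_ge_pow2: "2 ^ card K \<le> (\<Prod>l\<in>K. n $ l)"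
proof -
  have "(\<Prod>l\<in>K. 2) \<le> (\<Prod>l\<in>K. n $ l)"
    by (rule prod_mono) (use n_ge2 in auto)
  then show ?thesis
    by simp
qed

lemma zero_digit: "0 \<in> digit_set n"
  by (simp add: digit_set_def)

lemma card_digit_set: "card (digit_set n) = (\<Prod>l\<in>UNIV. n $ l)"
  using card_subgrid[OF zero_digit, of UNIV] by (simp add: subgrid_def)

text \<open>There are as many parallel lines in direction \<open>k\<close> as points in the base, and every removed
  point lies on only one of them.\<close>
lemma free_column:
  assumes b: "b \<in> digit_set n" and k: "k \<notin> K" and R: "finite R" "card (R \<inter> subgrid (insert k K) b) < (\<Prod>l\<in>K. n $ l)"
  obtains c where "c \<in> subgrid K (vec_upd b k 0)" "\<And>t. t < n $ k \<Longrightarrow> vec_upd c k t \<in> subgrid (insert k K) b - R"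
proof -
  have b0: "vec_upd b k 0 \<in> digit_set n"
    using b by (simp add: digit_set_def)
  have in_grid: "vec_upd c k t \<in> subgrid (insert k K) b" if "c \<in> subgrid K (vec_upd b k 0)" "t < n $ k" for c t
    using that by (auto simp: subgrid_def digit_set_def)
  have "\<exists>c\<in>subgrid K (vec_upd b k 0). \<forall>t<n $ k. vec_upd c k t \<notin> R"
  proof (rule ccontr)
    assume "\<not> (\<exists>c\<in>subgrid K (vec_upd b k 0). \<forall>t<n $ k. vec_upd c k t \<notin> R)"
    then obtain t where t: "\<And>c. c \<in> subgrid K (vec_upd b k 0) \<Longrightarrow> t c < n $ k \<and> vec_upd c k (t c) \<in> R"
      by metis
    have "inj_on (\<lambda>c. vec_upd c k (t c)) (subgrid K (vec_upd b k 0))"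
    proof (rule inj_onI)
      fix c d assume cd: "c \<in> subgrid K (vec_upd b k 0)" "d \<in> subgrid K (vec_upd b k 0)"
        and eq: "vec_upd c k (t c) = vec_upd d k (t d)"
      have "c $ l = d $ l" for l
      proof (cases "l = k")
        case True
        then show ?thesis
          using cd k by (simp add: subgrid_def)
      next
        case False
        then show ?thesis
          using arg_cong[OF eq, of "\<lambda>v. v $ l"] by simp
      qed
      then show "c = d"
        by (simp add: vec_eq_iff)
    qed
    then have "card (subgrid K (vec_upd b k 0)) \<le> card (R \<inter> subgrid (insert k K) b)"
      by (rule card_inj_on_le) (use t in_grid R(1) in auto)
    then show False
      using R(2) by (simp add: card_subgrid[OF b0])
  qed
  then show thesis
    using that in_grid by blast
qed

text \<open>Induction on the set of free coordinates. Some column in the new direction \<open>k\<close> is untouched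
  and connects all layers, so each point has only to reach this column. Inside its layer this
  is the induction hypothesis unless the layer contains all removed points; in that
  case the adjacent layer is intact, and one steps there first.\<close>
lemma subgrid_connected:
  assumes "finite K" "b \<in> digit_set n" "finite R" "card (R \<inter> subgrid K b) < card K"
    and "u \<in> subgrid K b - R" "v \<in> subgrid K b - R"
  shows "(u, v) \<in> grid_paths (subgrid K b - R)"
  using assms
proof (induction K arbitrary: b u v rule: finite_induct)
  case (insert k K)
  let ?G = "subgrid (insert k K) b"
  let ?L = "\<lambda>c. subgrid K (vec_upd b k c)"
  have le: "card (R \<inter> ?G) \<le> card K"
    using insert.prems insert.hyps by simp
  also have "card K < 2 ^ card K"
    by (rule less_exp)
  also have "\<dots> \<le> (\<Prod>l\<in>K. n $ l)"
    by (rule prod_ge_pow2)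
  finally obtain y where y: "y \<in> ?L 0" and yG: "\<And>t. t < n $ k \<Longrightarrow> vec_upd y k t \<in> ?G - R"
    using free_column[OF insert.prems(1) insert.hyps(2) insert.prems(2)] by metis
  have bc: "vec_upd b k c \<in> digit_set n" if "c < n $ k" for c
    using insert.prems(1) that by (simp add: digit_set_def)
  have LG: "?L c \<subseteq> ?G" for c
    using insert.hyps(2) by (auto simp: subgrid_def split: if_splits)
  have inL: "w \<in> ?L (w $ k)" "w $ k < n $ k" if "w \<in> ?G" for w
    using that by (auto simp: subgrid_def digit_set_def)
  have yL: "vec_upd y k c \<in> ?L c" if "c < n $ k" for c
    using y that insert.hyps(2) by (auto simp: subgrid_def digit_set_def split: if_splits)
  have layer: "(w, vec_upd y k c) \<in> grid_paths (?G - R)"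
    if w: "w \<in> ?L c - R" and c: "c < n $ k" and small: "card (R \<inter> ?L c) < card K" for w c
  proof -
    have "(w, vec_upd y k c) \<in> grid_paths (?L c - R)"
      by (rule insert.IH[OF bc[OF c] insert.prems(2) small w]) (use yL[OF c] yG[OF c] in auto)
    then show ?thesis
      by (rule grid_paths_mono[rotated]) (use LG in auto)
  qed
  have to_column: "(w, vec_upd y k (w $ k)) \<in> grid_paths (?G - R)" if w: "w \<in> ?G - R" for w
  proof (cases "card (R \<inter> ?L (w $ k)) < card K")
    case True
    then show ?thesis
      using layer[of w "w $ k"] w inL[of w] by auto
  next
    case False
    have sub: "R \<inter> ?L (w $ k) \<subseteq> R \<inter> ?G"
      using LG by auto
    have eq: "R \<inter> ?L (w $ k) = R \<inter> ?G"
      by (rule card_seteq[OF _ sub]) (use insert.prems(2) le False in auto)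
    show ?thesis
    proof (cases "K = {}")
      case True
      have "w = vec_upd y k (w $ k)"
        using w y True by (auto simp: subgrid_def vec_eq_iff)
      then show ?thesis
        by (metis grid_paths_refl)
    next
      case K: False
      (* any layer next to that of w; it exists because every side has at least two layers *)
      define c where "c = (if w $ k = 0 then 1 else w $ k - 1)"
      have c: "c < n $ k" "c \<noteq> w $ k" "c = w $ k + 1 \<or> w $ k = c + 1"
        using inL(2)[of w] w n_ge2[of k] by (auto simp: c_def)
      have "R \<inter> ?L c = {}"
      proof -
        have "R \<inter> ?L c \<subseteq> ?L (w $ k)"
          using eq LG[of c] by blast
        moreover have "?L c \<inter> ?L (w $ k) = {}"
          using c(2) insert.hyps(2) by (auto simp: subgrid_def)
        ultimately show ?thesis
          by blast
      qed
      then have small: "card (R \<inter> ?L c) < card K"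
        using K insert.hyps(1) by (simp add: card_gt_0_iff)
      have wc: "vec_upd w k c \<in> ?L c"
        using w c(1) insert.hyps(2) by (auto simp: subgrid_def digit_set_def)
      then have wcR: "vec_upd w k c \<in> ?L c - R"
        using \<open>R \<inter> ?L c = {}\<close> by blast
      have adj: "grid_adjacent x (vec_upd x k c)" "grid_adjacent (vec_upd x k c) x" if "x $ k = w $ k" for x
        unfolding grid_adjacent_def using c(3) that by (auto intro!: exI[of _ k] simp: vec_eq_iff)
      have 1: "(w, vec_upd w k c) \<in> grid_paths (?G - R)"
        by (rule grid_paths_step) (use w wcR LG adj in auto)
      have 2: "(vec_upd w k c, vec_upd y k c) \<in> grid_paths (?G - R)"
        by (rule layer[OF wcR c(1) small])
      have "vec_upd (vec_upd y k (w $ k)) k c = vec_upd y k c"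
        by (simp add: vec_eq_iff)
      then have "(vec_upd y k c, vec_upd y k (w $ k)) \<in> grid_paths (?G - R)"
        using adj(2)[of "vec_upd y k (w $ k)"] yG[OF c(1)] yG[of "w $ k"] inL(2)[of w] w
        by (intro grid_paths_step) auto
      with 1 2 show ?thesis
        by (meson grid_paths_trans)
    qed
  qed
  have column: "(vec_upd y k 0, vec_upd y k t) \<in> grid_paths (?G - R)" if "t < n $ k" for t
    using that
  proof (induction t)
    case (Suc t)
    have "grid_adjacent (vec_upd y k t) (vec_upd y k (Suc t))"
      unfolding grid_adjacent_def by (auto intro!: exI[of _ k] simp: vec_eq_iff)
    then have "(vec_upd y k t, vec_upd y k (Suc t)) \<in> grid_paths (?G - R)"
      by (rule grid_paths_step[rotated 2]) (use yG Suc.prems in auto)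
    then show ?case
      using Suc by (auto intro: grid_paths_trans)
  qed simp
  have "(vec_upd y k (u $ k), vec_upd y k (v $ k)) \<in> grid_paths (?G - R)"
    using column[of "u $ k"] column[of "v $ k"] inL(2)[of u] inL(2)[of v] insert.prems
    by (auto intro: grid_paths_trans dest: grid_paths_sym)
  then show ?case
    using to_column[OF insert.prems(4)] to_column[OF insert.prems(5)]
    by (meson grid_paths_sym grid_paths_trans)
qed simp

theorem removed_grid_connected:
  assumes A: "A \<in> digit_subsets n r" and r: "r < CARD('d)" and uv: "u \<in> A" "v \<in> A"
  shows "(u, v) \<in> grid_paths A"
proof -
  let ?R = "digit_set n - A"
  have "subgrid UNIV 0 = digit_set n"
    by (simp add: subgrid_def)
  moreover have "digit_set n - ?R = A" "?R \<inter> digit_set n = ?R" "card ?R = r"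
    using A by (auto simp: digit_subsets_def)
  ultimately show ?thesis
    using subgrid_connected[of UNIV 0 ?R u v] zero_digit finite_digit_set r uv by simp
qed

lemma digit_subset_full_line:
  assumes A: "A \<in> digit_subsets n r" and r: "r < (\<Prod>l\<in>UNIV - {k}. n $ l)"
  obtains c where "c \<in> digit_set n" "c $ k = 0" "\<And>t. t < n $ k \<Longrightarrow> vec_upd c k t \<in> A"
proof -
  let ?R = "digit_set n - A"
  have U: "insert k (UNIV - {k}) = UNIV" "subgrid UNIV 0 = digit_set n"
    by (auto simp: subgrid_def)
  have "card (?R \<inter> subgrid (insert k (UNIV - {k})) 0) < (\<Prod>l\<in>UNIV - {k}. n $ l)"
    unfolding U using A r by (simp add: digit_subsets_def Int_absorb2)
  from free_column[OF zero_digit _ _ this] obtain c where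
    c: "c \<in> subgrid (UNIV - {k}) (vec_upd 0 k 0)" "\<And>t. t < n $ k \<Longrightarrow> vec_upd c k t \<in> digit_set n - ?R"
    using finite_digit_set U by auto
  then show thesis
    by (intro that[of c]) (auto simp: subgrid_def)
qed

lemma axis_nth: "axis k t $ l = (if l = k then t else 0)"
  by (simp add: axis_def)

text \<open>Choose at every level a complete line in direction \<open>k\<close>. The digits \<open>c j\<close> at the feet of these lines
  code the starting point, and by moving along the lines, the \<open>k\<close>th coordinate can be given any
  expansion, hence any value \<open>t\<close>.\<close>
theorem limit_set_contains_segment:
  assumes S: "valid S" and full: "\<And>j. 1 \<le> j \<Longrightarrow> c j \<in> digit_set n \<and> c j $ k = 0 \<and> (\<forall>t<n $ k. vec_upd (c j) k t \<in> S j)"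
  shows "coding_map n c $ k = 0" "\<And>t. 0 \<le> t \<Longrightarrow> t \<le> 1 \<Longrightarrow> coding_map n c + axis k t \<in> limit_set n S"
proof -
  have pre: "coding_map n c + axis k t \<in> prefractal n S m"
    if "0 \<le> t" "t \<le> 1" "valid S" "\<And>j. 1 \<le> j \<Longrightarrow> c j \<in> digit_set n \<and> c j $ k = 0 \<and> (\<forall>t<n $ k. vec_upd (c j) k t \<in> S j)"
      "coding_map n c $ k = 0" for c S t m
    using that
  proof (induction m arbitrary: c S t)
    case 0
    have "coding_map n c \<in> cbox 0 1"
      by (rule coding_map_unit) (use 0 in blast)
    then show ?case
      using 0 by (simp add: mem_unit_cube axis_nth)
  next
    case (Suc m)
    let ?c = "\<lambda>j. c (Suc j)"
    have step: "coding_map n c = cube_map n (c 1) (coding_map n ?c)"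
      by (rule coding_map_step) (use Suc.prems in blast)
    have y0: "coding_map n ?c $ k = 0"
      using arg_cong[OF step, of "\<lambda>v. v $ k"] Suc.prems(4)[of 1] Suc.prems(5) by (simp add: cube_map_nth)
    (* the first digit of t in base n $ k; the minimum treats t = 1 *)
    define d where "d = min (nat \<lfloor>real (n $ k) * t\<rfloor>) (n $ k - 1)"
    define t' where "t' = real (n $ k) * t - real d"
    have "d \<le> n $ k - 1"
      by (simp add: d_def)
    then have d: "d < n $ k"
      using n_pos[of k] by linarith
    have nt: "0 \<le> real (n $ k) * t" "real (n $ k) * t \<le> real (n $ k)"
      using Suc.prems by (auto simp: mult_left_le)
    have t': "0 \<le> t'" "t' \<le> 1"
    proof -
      have "real d \<le> real (nat \<lfloor>real (n $ k) * t\<rfloor>)"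
        by (simp add: d_def)
      also have "\<dots> \<le> real (n $ k) * t"
        using nt by simp
      finally show "0 \<le> t'"
        by (simp add: t'_def)
      show "t' \<le> 1"
      proof (cases "nat \<lfloor>real (n $ k) * t\<rfloor> \<le> n $ k - 1")
        case True
        then have "d = nat \<lfloor>real (n $ k) * t\<rfloor>"
          by (simp add: d_def)
        then show ?thesis
          using nt unfolding t'_def by linarith
      next
        case False
        then have "d = n $ k - 1"
          by (simp add: d_def)
        then have "d + 1 = n $ k"
          using n_pos[of k] by linarith
        then have "real d = real (n $ k) - 1"
          by linarith
        then show ?thesis
          using nt by (simp add: t'_def)
      qed
    qed
    have "coding_map n ?c + axis k t' \<in> prefractal n (\<lambda>j. S (Suc j)) m"
      by (rule Suc.IH[OF t' valid_shift[OF Suc.prems(3)] _ y0]) (use Suc.prems(4) in auto)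
    moreover have "vec_upd (c 1) k d \<in> S 1"
      using Suc.prems(4)[of 1] d by simp
    moreover have "coding_map n c + axis k t = cube_map n (vec_upd (c 1) k d) (coding_map n ?c + axis k t')"
      using y0 Suc.prems(5)
      by (simp add: vec_eq_iff step cube_map_nth axis_nth t'_def)
    ultimately show ?case
      unfolding prefractal.simps by (metis UN_I imageI)
  qed
  have zero: "coding_map n c $ k = 0"
  proof -
    have small: "0 \<le> coding_map n c $ k \<and> coding_map n c $ k \<le> (1/2) ^ m"
      if "\<And>j. 1 \<le> j \<Longrightarrow> c j \<in> digit_set n \<and> c j $ k = 0" for m c
      using that
    proof (induction m arbitrary: c)
      case 0
      have "coding_map n c \<in> cbox 0 1"
        by (rule coding_map_unit) (use 0 in blast)
      then show ?case
        by (simp add: mem_unit_cube)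
    next
      case (Suc m)
      have "coding_map n c = cube_map n (c 1) (coding_map n (\<lambda>j. c (Suc j)))"
        by (rule coding_map_step) (use Suc.prems in blast)
      then have eq: "coding_map n c $ k = coding_map n (\<lambda>j. c (Suc j)) $ k / real (n $ k)"
        using Suc.prems[of 1] by (simp add: cube_map_nth)
      have IH: "0 \<le> coding_map n (\<lambda>j. c (Suc j)) $ k \<and> coding_map n (\<lambda>j. c (Suc j)) $ k \<le> (1/2) ^ m"
        by (rule Suc.IH) (use Suc.prems in auto)
      then have "coding_map n (\<lambda>j. c (Suc j)) $ k / real (n $ k) \<le> (1/2) ^ m / 2"
        using n_ge2[of k] by (intro frac_le) auto
      then show ?case
        using IH by (simp add: eq)
    qed
    have "(\<lambda>m. (1/2::real) ^ m) \<longlonglongrightarrow> 0"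
      by (rule LIMSEQ_realpow_zero) auto
    then have "coding_map n c $ k \<le> 0"
      by (rule LIMSEQ_le_const) (use small[of c] full in blast)
    then show ?thesis
      using small[of c 0] full by force
  qed
  then show "coding_map n c $ k = 0" .
  show "coding_map n c + axis k t \<in> limit_set n S" if "0 \<le> t" "t \<le> 1" for t
    unfolding limit_set_eq_prefractal[OF S] using pre[OF that S full zero] by blast
qed

definition regular :: "nat \<Rightarrow> (nat \<Rightarrow> (nat^'d) set) \<Rightarrow> bool"
  where "regular r S \<longleftrightarrow> r < (\<Prod>l\<in>UNIV. n $ l) \<and> (\<forall>j\<ge>1. S j \<in> digit_subsets n r)"

lemma regular_valid: "regular r S \<Longrightarrow> valid S"
  unfolding regular_def valid_def digit_subsets_def
  using card_digit_set by (fastforce)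

lemma regular_shift: "regular r S \<Longrightarrow> regular r (\<lambda>j. S (Suc j))"
  and regular_plus: "regular r S \<Longrightarrow> regular r (\<lambda>j. S (k + j))"
  by (auto simp: regular_def)

theorem regular_segment:
  assumes S: "regular r S" and r: "r < (\<Prod>l\<in>UNIV - {k}. n $ l)"
  obtains y where "y $ k = 0" "\<And>t. 0 \<le> t \<Longrightarrow> t \<le> 1 \<Longrightarrow> y + axis k t \<in> limit_set n S"
proof -
  have "\<exists>c. c \<in> digit_set n \<and> c $ k = 0 \<and> (\<forall>t<n $ k. vec_upd c k t \<in> S j)" if "1 \<le> j" for j
    using digit_subset_full_line[OF _ r, of "S j"] S that unfolding regular_def by metis
  then obtain c where c: "\<And>j. 1 \<le> j \<Longrightarrow> c j \<in> digit_set n \<and> c j $ k = 0 \<and> (\<forall>t<n $ k. vec_upd (c j) k t \<in> S j)"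
    by metis
  show thesis
    using that[of "coding_map n c"] limit_set_contains_segment[OF regular_valid[OF S] c] by blast
qed

text \<open>Each factor is at least 2, and \<open>d \<le> 2 ^ (d - 1)\<close>.\<close>
lemma less_card_imp_less_prod:
  assumes "r < CARD('d)" shows "r < (\<Prod>l\<in>UNIV - {k::'d}. n $ l)"
proof -
  have "r \<le> card (UNIV - {k})"
    using assms by simp
  also have "\<dots> < 2 ^ card (UNIV - {k})"
    by (rule less_exp)
  also have "\<dots> \<le> (\<Prod>l\<in>UNIV - {k}. n $ l)"
    by (rule prod_ge_pow2)
  finally show ?thesis .
qed

end

lemma connected_chain_Union:
  assumes con: "\<And>i. i \<in> A \<Longrightarrow> connected (F i)"
    and chain: "\<And>u v. u \<in> A \<Longrightarrow> v \<in> A \<Longrightarrow> (u, v) \<in> E\<^sup>*"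
    and meet: "\<And>u v. (u, v) \<in> E \<Longrightarrow> u \<in> A \<and> v \<in> A \<and> F u \<inter> F v \<noteq> {}"
  shows "connected (\<Union>i\<in>A. F i)"
proof -
  let ?U = "\<Union>i\<in>A. F i"
  have piece: "connected_component ?U x y" if "u \<in> A" "x \<in> F u" "y \<in> F u" for u x y
    unfolding connected_component_def using con that by blast
  have reach: "\<forall>y\<in>F v. connected_component ?U x y" if "(u, v) \<in> E\<^sup>*" "u \<in> A" "x \<in> F u" for u v x
    using that(1)
  proof (induction rule: rtrancl_induct)
    case base
    then show ?case
      using piece that by blast
  next
    case (step v w)
    then obtain z where "z \<in> F v" "z \<in> F w" "w \<in> A"
      using meet by blast
    then show ?case
      using step.IH piece connected_component_trans by meson
  qed
  show ?thesis
    unfolding connected_iff_connected_component using reach chain by blast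
qed

context fractal begin

lemma cube_map_adjacent: "cube_map n u (y + axis k 1) = cube_map n (vec_upd u k (u $ k + 1)) y"
  by (simp add: vec_eq_iff cube_map_nth axis_nth algebra_simps)

text \<open>The copies at adjacent digits \<open>u\<close> and \<open>vec_upd u k (u $ k + 1)\<close> meet: a segment of the limit
  set in direction \<open>k\<close> joins opposite faces of the cube, so the end of its copy at \<open>u\<close> is the
  beginning of its copy at the other digit.\<close>
lemma connected_prefractal:
  assumes r: "r < CARD('d)"
  shows "regular r S \<Longrightarrow> connected (prefractal n S m)"
proof (induction m arbitrary: S)
  case 0
  then show ?case
    by (simp add: convex_connected convex_box)
next
  case (Suc m)
  let ?S = "\<lambda>j. S (Suc j)"
  let ?E = "{(u, v). u \<in> S 1 \<and> v \<in> S 1 \<and> grid_adjacent u v}"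
  have S1: "S 1 \<in> digit_subsets n r"
    using Suc.prems by (simp add: regular_def)
  have meet: "cube_map n u ` prefractal n ?S m \<inter> cube_map n (vec_upd u k (u $ k + 1)) ` prefractal n ?S m \<noteq> {}" for u k
  proof -
    obtain y where y: "\<And>t. 0 \<le> t \<Longrightarrow> t \<le> 1 \<Longrightarrow> y + axis k t \<in> limit_set n ?S"
      using regular_segment[OF regular_shift[OF Suc.prems] less_card_imp_less_prod[OF r]] by metis
    have y0: "y + axis k 0 = y"
      by (simp add: vec_eq_iff axis_nth)
    have "y \<in> prefractal n ?S m" "y + axis k 1 \<in> prefractal n ?S m"
      using y[of 0, unfolded y0] y[of 1] limit_set_eq_prefractal[OF regular_valid[OF regular_shift[OF Suc.prems]]] by auto
    then show ?thesis
      using cube_map_adjacent[of u y k] by (metis IntI empty_iff imageI)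
  qed
  show ?case
    unfolding prefractal.simps
  proof (rule connected_chain_Union[where E = ?E])
    show "connected (cube_map n i ` prefractal n ?S m)" for i
      by (intro connected_continuous_image continuous_cube_map Suc.IH regular_shift Suc.prems)
    show "(u, v) \<in> ?E\<^sup>*" if "u \<in> S 1" "v \<in> S 1" for u v
      using removed_grid_connected[OF S1 r that] by (simp add: grid_paths_def)
    fix u v assume "(u, v) \<in> ?E"
    then show "u \<in> S 1 \<and> v \<in> S 1 \<and> cube_map n u ` prefractal n ?S m \<inter> cube_map n v ` prefractal n ?S m \<noteq> {}"
      using meet by (auto simp: grid_adjacent_def Int_commute)
  qed
qed

text \<open>A nested intersection of compact connected sets is connected.\<close>
theorem connected_limit_set:
  assumes "regular r S" "r < CARD('d)"
  shows "connected (limit_set n S)"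
  unfolding limit_set_eq_prefractal[OF regular_valid[OF assms(1)]]
  by (rule connected_nest)
     (use assms compact_prefractal connected_prefractal prefractal_mono regular_valid in auto)

lemma word_piece_small:
  assumes S: "valid S" and "w \<in> words S k" "x \<in> word_map n w ` shifted_limit_set n S k" "y \<in> word_map n w ` shifted_limit_set n S k"
  shows "dist x y \<le> real CARD('d) * (1/2) ^ k"
  using assms word_map_dist[of _ _ w] shifted_limit_set_facts(3)[OF S, of k] length_words[of w S k] by blast

text \<open>The pieces of level \<open>k\<close> are small and connected. Those that contain \<open>x\<close> cover a
  neighbourhood of \<open>x\<close>, as the others form a closed set.\<close>
theorem locally_connected_limit_set:
  assumes S: "regular r S" and r: "r < CARD('d)"
  shows "locally connected (limit_set n S)"
  unfolding locally_connected_im_kleinen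
proof (intro allI impI)
  fix v x assume vx: "openin (top_of_set (limit_set n S)) v \<and> x \<in> v"
  let ?J = "limit_set n S"
  have V: "valid S"
    by (rule regular_valid[OF S])
  have xJ: "x \<in> ?J" "v \<subseteq> ?J"
    using vx openin_subset by fastforce+
  obtain e where e: "e > 0" "\<And>y. y \<in> ?J \<Longrightarrow> dist y x < e \<Longrightarrow> y \<in> v"
    using vx unfolding openin_euclidean_subtopology_iff by blast
  obtain k where k: "real CARD('d) * (1/2) ^ k < e"
    using pow_half_small[OF e(1)] by blast
  define P where "P w = word_map n w ` shifted_limit_set n S k" for w
  have J: "?J = (\<Union>w\<in>words S k. P w)"
    unfolding P_def by (rule limit_set_words[OF V])
  have fin: "finite (words S k)"
    using valid_finite[OF V] by (intro finite_words) auto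
  have closedP: "closed (P w)" for w
    unfolding P_def
    by (intro compact_imp_closed compact_continuous_image continuous_word_map shifted_limit_set_facts V)
  have conP: "connected (P w)" for w
    unfolding P_def shifted_limit_set_def
    by (intro connected_continuous_image continuous_word_map connected_limit_set[OF regular_plus[OF S] r])
  have small: "P w \<subseteq> v" if "w \<in> words S k" "x \<in> P w" for w
  proof
    fix y assume "y \<in> P w"
    then have "dist y x \<le> real CARD('d) * (1/2) ^ k"
      using word_piece_small[OF V that(1), of y x] that(2) by (simp add: P_def)
    moreover have "y \<in> ?J"
      using J that \<open>y \<in> P w\<close> by blast
    ultimately show "y \<in> v"
      using e(2) k by force
  qed
  define u where "u = ?J - (\<Union>w\<in>{w \<in> words S k. x \<notin> P w}. P w)"
  have "closed (\<Union>w\<in>{w \<in> words S k. x \<notin> P w}. P w)"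
    using fin closedP by (intro closed_UN) auto
  then have "openin (top_of_set ?J) u"
    unfolding u_def Diff_eq by (intro openin_open_Int open_Compl)
  moreover have "x \<in> u"
    using xJ by (auto simp: u_def)
  moreover have reach: "\<exists>w\<in>words S k. x \<in> P w \<and> y \<in> P w" if "y \<in> u" for y
    using that J by (auto simp: u_def)
  moreover have "u \<subseteq> v"
    using reach small by blast
  moreover have "\<exists>c. connected c \<and> c \<subseteq> v \<and> x \<in> c \<and> y \<in> c" if "y \<in> u" for y
    using reach[OF that] conP small by blast
  ultimately show "\<exists>u. openin (top_of_set ?J) u \<and> x \<in> u \<and> u \<subseteq> v \<and>
      (\<forall>y. y \<in> u \<longrightarrow> (\<exists>c. connected c \<and> c \<subseteq> v \<and> x \<in> c \<and> y \<in> c))"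
    by blast
qed

end

section \<open>Recurrence of digit patterns and its consequences\<close>

lemma summable_power_div:
  fixes c :: real
  assumes c: "0 \<le> c" "c < 1" and m: "0 < m"
  shows "summable (\<lambda>k. c ^ (k div m))"
proof -
  define b where "b = max c (1/2)"
  have b: "0 < b" "b < 1" "c \<le> b"
    using c by (auto simp: b_def)
  define q where "q = b powr (1 / real m)"
  have "q < b powr 0"
    unfolding q_def using b m by (intro powr_less_mono') auto
  then have q: "0 < q" "q < 1"
    using b by (auto simp: q_def)
  have "norm (c ^ (k div m)) \<le> (1 / b) * q ^ k" for k
  proof -
    have "norm (c ^ (k div m)) \<le> b ^ (k div m)"
      using c b by (simp add: power_mono)
    also have "\<dots> = b powr real (k div m)"
      using b by (simp add: powr_realpow)
    also have "\<dots> \<le> b powr (real k / real m - 1)"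
    proof (rule powr_mono')
      have "k < m * (k div m + 1)"
        using m by (metis Suc_eq_plus1 dividend_less_times_div mult.commute mult_Suc_right add.commute)
      then have "real k < real m * (real (k div m) + 1)"
        by (metis of_nat_1 of_nat_add of_nat_less_iff of_nat_mult)
      then show "real k / real m - 1 \<le> real (k div m)"
        using m by (simp add: field_simps)
    qed (use b in auto)
    also have "\<dots> = (1 / b) * q ^ k"
      using b q by (simp add: powr_diff q_def powr_powr flip: powr_realpow)
    finally show ?thesis .
  qed
  moreover have "summable (\<lambda>k. (1 / b) * q ^ k)"
    using q by (intro summable_mult summable_geometric) auto
  ultimately show ?thesis
    by (rule summable_comparison_test'[where N = 0, rotated])
qed

context fractal begin

text \<open>Consecutive occurrences are asked for because the isolation of a cell takes two levels. The
  window \<open>k div m\<close> is short compared with \<open>k\<close> but long compared with \<open>ln k\<close>.\<close>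
definition recurrent :: "nat \<Rightarrow> (nat \<Rightarrow> (nat^'d) set) \<Rightarrow> bool"
  where "recurrent r S \<longleftrightarrow> (\<forall>A\<in>digit_subsets n r. \<forall>B\<in>digit_subsets n r. \<forall>m\<ge>1.
    eventually (\<lambda>k. \<exists>j\<ge>1. j + 1 \<le> k \<and> k \<le> j + 1 + k div m \<and> S j = A \<and> S (j + 1) = B) sequentially)"

lemma finite_digit_subsets: "finite (digit_subsets n r)"
  by (rule finite_subset[of _ "Pow (digit_set n)"]) (auto simp: digit_subsets_def finite_digit_set)

end

locale random_digits = fractal n + prob_space M
  for n :: "nat^'d" and M :: "'w measure" +
  fixes r :: nat and S :: "'w \<Rightarrow> nat \<Rightarrow> (nat^'d) set"
  assumes r_less: "r < (\<Prod>l\<in>UNIV. n $ l)"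
    and indep: "indep_vars (\<lambda>_. count_space (digit_subsets n r)) (\<lambda>j \<omega>. S \<omega> j) {1..}"
    and dist: "1 \<le> j \<Longrightarrow> distr M (count_space (digit_subsets n r)) (\<lambda>\<omega>. S \<omega> j) = uniform_count_measure (digit_subsets n r)"
begin

lemma S_measurable: "1 \<le> j \<Longrightarrow> (\<lambda>\<omega>. S \<omega> j) \<in> measurable M (count_space (digit_subsets n r))"
  using indep by (auto simp: indep_vars_def2)

lemma S_regular: "\<omega> \<in> space M \<Longrightarrow> regular r (S \<omega>)"
  using r_less measurable_space[OF S_measurable] by (auto simp: regular_def)

definition level_prob :: real
  where "level_prob = 1 / card (digit_subsets n r)"

lemma prob_level:
  assumes "1 \<le> j" "A \<in> digit_subsets n r"
  shows "prob ((\<lambda>\<omega>. S \<omega> j) -` {A} \<inter> space M) = level_prob"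
proof -
  have "prob ((\<lambda>\<omega>. S \<omega> j) -` {A} \<inter> space M)
      = measure (distr M (count_space (digit_subsets n r)) (\<lambda>\<omega>. S \<omega> j)) {A}"
    using assms by (subst measure_distr[OF S_measurable]) auto
  also have "\<dots> = level_prob"
    using assms by (simp add: dist measure_uniform_count_measure finite_digit_subsets level_prob_def)
  finally show ?thesis .
qed

text \<open>Disjoint pairs of levels are independent; this is why only the pairs \<open>2 * i + 1, 2 * i + 2\<close>
  are looked at.\<close>
lemma prob_no_pattern:
  assumes A: "A \<in> digit_subsets n r" and B: "B \<in> digit_subsets n r" and T: "finite T"
  shows "prob {\<omega> \<in> space M. \<forall>i\<in>T. \<not> (S \<omega> (2 * i + 1) = A \<and> S \<omega> (2 * i + 2) = B)} = (1 - level_prob\<^sup>2) ^ card T"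
    and "{\<omega> \<in> space M. \<forall>i\<in>T. \<not> (S \<omega> (2 * i + 1) = A \<and> S \<omega> (2 * i + 2) = B)} \<in> events"
proof -
  let ?D = "count_space (digit_subsets n r)"
  define K where "K i = {2 * i + 1, 2 * i + 2}" for i :: nat
  let ?Y = "\<lambda>i \<omega>. restrict (\<lambda>j. S \<omega> j) (K i)"
  have ind: "indep_vars (\<lambda>i. PiM (K i) (\<lambda>_. ?D)) ?Y (UNIV :: nat set)"
  proof (rule indep_vars_restrict[OF indep])
    have "K i \<inter> K j = {}" if "i \<noteq> j" for i j
      unfolding K_def using that by (auto; presburger)
    then show "disjoint_family K"
      by (auto simp: disjoint_family_on_def)
  qed (auto simp: K_def)
  define G where "G i = {f \<in> space (PiM (K i) (\<lambda>_. ?D)). \<not> (f (2 * i + 1) = A \<and> f (2 * i + 2) = B)}" for i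
  have G: "G i \<in> sets (PiM (K i) (\<lambda>_. ?D))" for i
  proof -
    have [measurable]: "(\<lambda>f. f (2 * i + 1)) \<in> measurable (PiM (K i) (\<lambda>_. ?D)) ?D"
      "(\<lambda>f. f (2 * i + 2)) \<in> measurable (PiM (K i) (\<lambda>_. ?D)) ?D"
      by (auto intro!: measurable_component_singleton simp: K_def)
    have [measurable]: "Measurable.pred ?D (\<lambda>x. x = A)" "Measurable.pred ?D (\<lambda>x. x = B)"
      by auto
    show ?thesis
      unfolding G_def by measurable
  qed
  define V where "V i = {\<omega> \<in> space M. \<not> (S \<omega> (2 * i + 1) = A \<and> S \<omega> (2 * i + 2) = B)}" for i
  have vim: "?Y i -` G i \<inter> space M = V i" for i
  proof -
    have "?Y i \<omega> \<in> space (PiM (K i) (\<lambda>_. ?D))" if "\<omega> \<in> space M" for \<omega>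
      using S_regular[OF that] by (auto simp: space_PiM K_def regular_def)
    then show ?thesis
      by (auto simp: G_def V_def K_def)
  qed
  have Vev: "V i \<in> events" for i
    unfolding vim[symmetric] using G ind by (auto simp: indep_vars_def2 intro: measurable_sets)
  have "prob (V i) = 1 - level_prob\<^sup>2" for i
  proof -
    let ?A = "\<lambda>j. if j = 2 * i + 1 then {A} else {B}"
    have "prob (\<Inter>j\<in>K i. (\<lambda>\<omega>. S \<omega> j) -` ?A j \<inter> space M) = (\<Prod>j\<in>K i. prob ((\<lambda>\<omega>. S \<omega> j) -` ?A j \<inter> space M))"
      by (rule indep_varsD[OF indep]) (use A B in \<open>auto simp: K_def\<close>)
    also have "\<dots> = level_prob\<^sup>2"
      using A B prob_level[of "2 * i + 1" A] prob_level[of "2 * i + 2" B] by (simp add: K_def power2_eq_square)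
    also have "(\<Inter>j\<in>K i. (\<lambda>\<omega>. S \<omega> j) -` ?A j \<inter> space M) = space M - V i"
      by (auto simp: K_def V_def)
    finally show ?thesis
      using prob_compl[OF Vev[of i]] by simp
  qed
  moreover have eq: "{\<omega> \<in> space M. \<forall>i\<in>T. \<not> (S \<omega> (2 * i + 1) = A \<and> S \<omega> (2 * i + 2) = B)} = (if T = {} then space M else (\<Inter>i\<in>T. V i))"
    by (auto simp: V_def)
  moreover have "prob (\<Inter>i\<in>T. V i) = (\<Prod>i\<in>T. prob (V i))" if "T \<noteq> {}"
    using indep_varsD[OF ind that T, of G] G unfolding vim by auto
  ultimately show "prob {\<omega> \<in> space M. \<forall>i\<in>T. \<not> (S \<omega> (2 * i + 1) = A \<and> S \<omega> (2 * i + 2) = B)} = (1 - level_prob\<^sup>2) ^ card T"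
    by (simp add: prob_space)
  show "{\<omega> \<in> space M. \<forall>i\<in>T. \<not> (S \<omega> (2 * i + 1) = A \<and> S \<omega> (2 * i + 2) = B)} \<in> events"
    unfolding eq using T Vev by auto
qed

text \<open>The probability that the last \<open>k div (2 * m)\<close> pairs below \<open>k\<close> all fail is summable over
  \<open>k\<close>, so the lemma of Borel and Cantelli applies.\<close>
lemma pattern_recurs:
  assumes A: "A \<in> digit_subsets n r" and B: "B \<in> digit_subsets n r" and m: "1 \<le> m"
  shows "AE \<omega> in M. eventually (\<lambda>k. \<exists>j\<ge>1. j + 1 \<le> k \<and> k \<le> j + 1 + k div m \<and> S \<omega> j = A \<and> S \<omega> (j + 1) = B) sequentially"
proof -
  define T where "T k = {k div 2 - (k div m) div 2..<k div 2}" for k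
  have "(k div m) div 2 \<le> k div 2" for k
    by (intro div_le_mono) simp
  then have card_T: "card (T k) = k div (m * 2)" for k
    by (simp add: T_def div_mult2_eq)
  define E where "E k = {\<omega> \<in> space M. \<forall>i\<in>T k. \<not> (S \<omega> (2 * i + 1) = A \<and> S \<omega> (2 * i + 2) = B)}" for k
  have E: "E k \<in> events" "prob (E k) = (1 - level_prob\<^sup>2) ^ (k div (m * 2))" for k
    unfolding E_def using prob_no_pattern[OF A B, of "T k"] by (auto simp: T_def[of k] card_T[symmetric])
  have "card (digit_subsets n r) > 0"
    using A finite_digit_subsets by (auto simp: card_gt_0_iff)
  then have p: "0 < level_prob" "level_prob \<le> 1"
    by (auto simp: level_prob_def)
  then have "summable (\<lambda>k. (1 - level_prob\<^sup>2) ^ (k div (m * 2)))"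
    using m by (intro summable_power_div) (auto simp: power_le_one)
  then have "AE \<omega> in M. eventually (\<lambda>k. \<omega> \<in> space M - E k) sequentially"
    using E by (intro borel_cantelli_AE1) (auto simp: emeasure_eq_measure)
  then show ?thesis
  proof (rule AE_mp, intro AE_I2 impI)
    fix \<omega> assume "eventually (\<lambda>k. \<omega> \<in> space M - E k) sequentially"
    then show "eventually (\<lambda>k. \<exists>j\<ge>1. j + 1 \<le> k \<and> k \<le> j + 1 + k div m \<and> S \<omega> j = A \<and> S \<omega> (j + 1) = B) sequentially"
    proof (rule eventually_mono)
      fix k assume "\<omega> \<in> space M - E k"
      then obtain i where i: "i \<in> T k" "S \<omega> (2 * i + 1) = A" "S \<omega> (2 * i + 2) = B"
        by (auto simp: E_def)
      have "2 * i + 1 + 1 \<le> k" "k \<le> 2 * i + 1 + 1 + k div m"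
      proof -
        have "2 * i + 2 \<le> k \<and> k \<le> 2 * i + 2 + q" if "k div 2 - q div 2 \<le> i" "i < k div 2" for q :: nat
        proof -
          have "2 * (k div 2) \<le> k" "k \<le> 2 * (k div 2) + 1" "2 * (q div 2) \<le> q"
            by linarith+
          then show ?thesis
            using that by linarith
        qed
        from this[of "k div m"] show "2 * i + 1 + 1 \<le> k" "k \<le> 2 * i + 1 + 1 + k div m"
          using i(1) by (auto simp: T_def)
      qed
      then show "\<exists>j\<ge>1. j + 1 \<le> k \<and> k \<le> j + 1 + k div m \<and> S \<omega> j = A \<and> S \<omega> (j + 1) = B"
        using i by (intro exI[of _ "2 * i + 1"]) auto
    qed
  qed
qed

theorem AE_recurrent: "AE \<omega> in M. recurrent r (S \<omega>)"
proof -
  have "AE \<omega> in M. \<forall>A\<in>digit_subsets n r. \<forall>B\<in>digit_subsets n r. \<forall>m. 1 \<le> m \<longrightarrow>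
      eventually (\<lambda>k. \<exists>j\<ge>1. j + 1 \<le> k \<and> k \<le> j + 1 + k div m \<and> S \<omega> j = A \<and> S \<omega> (j + 1) = B) sequentially"
  proof (intro AE_finite_allI finite_digit_subsets)
    fix A B assume AB: "A \<in> digit_subsets n r" "B \<in> digit_subsets n r"
    have "AE \<omega> in M. 1 \<le> m \<longrightarrow> eventually (\<lambda>k. \<exists>j\<ge>1. j + 1 \<le> k \<and> k \<le> j + 1 + k div m \<and> S \<omega> j = A \<and> S \<omega> (j + 1) = B) sequentially" for m
      using pattern_recurs[OF AB, of m] by (cases "1 \<le> m") auto
    then show "AE \<omega> in M. \<forall>m. 1 \<le> m \<longrightarrow> eventually (\<lambda>k. \<exists>j\<ge>1. j + 1 \<le> k \<and> k \<le> j + 1 + k div m \<and> S \<omega> j = A \<and> S \<omega> (j + 1) = B) sequentially"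
      by (simp only: AE_all_countable) blast
  qed
  then show ?thesis
    by (simp only: recurrent_def)
qed

end

context fractal begin

lemma recurrent_infinitely_often:
  assumes "recurrent r S" "A \<in> digit_subsets n r"
  shows "\<exists>j\<ge>N. 1 \<le> j \<and> S j = A"
proof -
  have "eventually (\<lambda>k. \<exists>j\<ge>1. j + 1 \<le> k \<and> k \<le> j + 1 + k div 2 \<and> S j = A \<and> S (j + 1) = A) sequentially"
    using assms unfolding recurrent_def by simp
  then obtain k0 where k0: "\<And>k. k \<ge> k0 \<Longrightarrow> \<exists>j\<ge>1. j + 1 \<le> k \<and> k \<le> j + 1 + k div 2 \<and> S j = A \<and> S (j + 1) = A"
    unfolding eventually_sequentially by blast
  obtain j where "1 \<le> j" "k0 + 2 * N + 2 \<le> j + 1 + (k0 + 2 * N + 2) div 2" "S j = A"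
    using k0[of "k0 + 2 * N + 2"] by auto
  then show ?thesis
    by (intro exI[of _ j]) auto
qed

text \<open>Remove \<open>X\<close> and, if this is not enough, further digits outside \<open>Y\<close>.\<close>
lemma digit_subset_avoiding:
  assumes X: "X \<subseteq> digit_set n" "card X \<le> r" and Y: "Y \<subseteq> digit_set n" "X \<inter> Y = {}" "r + card Y \<le> card (digit_set n)"
  obtains A where "A \<in> digit_subsets n r" "A \<inter> X = {}" "Y \<subseteq> A"
proof -
  have fY: "finite Y"
    using Y finite_digit_set finite_subset by blast
  have "card (digit_set n - Y) = card (digit_set n) - card Y"
    using Y fY by (simp add: card_Diff_subset)
  then obtain R where R: "X \<subseteq> R" "R \<subseteq> digit_set n - Y" "card R = r"
  proof -
    have "X \<subseteq> digit_set n - Y" "r \<le> card (digit_set n - Y)" "finite (digit_set n - Y)"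
      using X Y finite_digit_set \<open>card (digit_set n - Y) = card (digit_set n) - card Y\<close> by auto
    then show ?thesis
      using exists_subset_between[of X r "digit_set n - Y"] X(2) that by blast
  qed
  have "digit_set n - (digit_set n - R) = R"
    using R by blast
  then show thesis
    using R Y(1) by (intro that[of "digit_set n - R"]) (auto simp: digit_subsets_def)
qed

text \<open>If \<open>x $ k < y $ k\<close>, then some cell of level \<open>j - 1\<close> has its lower end in direction \<open>k\<close>
  strictly between them for all late levels \<open>j\<close>. When all digits of level \<open>j\<close> have nonzero
  \<open>k\<close>th entry, no point of the limit set lies just above that end; by the intermediate
  value theorem a connected set cannot jump across this gap.\<close>
lemma projection_constant:
  assumes S: "valid S" and often: "\<And>N. \<exists>j\<ge>N. 1 \<le> j \<and> (\<forall>i\<in>S j. i $ k \<noteq> 0)"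
    and C: "connected C" "C \<subseteq> limit_set n S" and xy: "x \<in> C" "y \<in> C"
  shows "x $ k = y $ k"
proof -
  have False if xy: "x \<in> C" "y \<in> C" "x $ k < y $ k" for x y
  proof -
    obtain N where N: "(1/2::real) ^ N < (y $ k - x $ k) / 2"
      using real_arch_pow_inv[of "(y $ k - x $ k) / 2" "1/2"] xy by auto
    obtain j where j: "j \<ge> N + 1" "\<forall>i\<in>S j. i $ k \<noteq> 0"
      using often[of "N + 1"] by auto
    then obtain p where p: "j = Suc p" "N \<le> p"
      by (cases j) auto
    define b where "b = real (n $ k) ^ p"
    have b: "b > 0"
      by (simp add: b_def)
    have "1 / b \<le> 1 / 2 ^ N"
    proof (intro divide_left_mono)
      have "(2::real) ^ N \<le> 2 ^ p"
        using p by (simp add: power_increasing)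
      also have "\<dots> \<le> b"
        unfolding b_def using n_ge2[of k] by (intro power_mono) auto
      finally show "2 ^ N \<le> b" .
    qed (use b in auto)
    then have b2: "2 / b < y $ k - x $ k"
      using N by (simp add: power_one_over)
    have x0: "0 \<le> x $ k"
      using limit_set_unit[OF S] C(2) xy(1) by (auto simp: mem_unit_cube subset_iff)
    (* a corner coordinate m of level p just above x, and a height t inside the
       first layer of subcells above it, which is empty *)
    define m where "m = nat \<lfloor>x $ k * b\<rfloor> + 1"
    define t where "t = (real m + 1 / (2 * real (n $ k))) / b"
    have m: "x $ k * b < real m" "real m \<le> x $ k * b + 1"
      using x0 b by (auto simp: m_def) linarith+
    have half: "0 < 1 / (2 * real (n $ k))" "1 / (2 * real (n $ k)) \<le> 1"
      using n_ge2[of k] by (auto simp: divide_simps)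
    have "x $ k < t"
    proof -
      have "x $ k * b < real m + 1 / (2 * real (n $ k))"
        using m(1) half(1) by linarith
      then show ?thesis
        unfolding t_def using b by (simp only: pos_less_divide_eq)
    qed
    moreover have "t \<le> y $ k"
    proof -
      have "t \<le> (x $ k * b + 2) / b"
      proof -
        have "real m + 1 / (2 * real (n $ k)) \<le> x $ k * b + 2"
          using m(2) half(2) by linarith
        then show ?thesis
          unfolding t_def using b by (intro divide_right_mono) linarith+
      qed
      also have "\<dots> = x $ k + 2 / b"
        using b by (simp add: field_simps)
      finally show ?thesis
        using b2 by simp
    qed
    ultimately obtain z where z: "z \<in> C" "z $ k = t"
      using connected_ivt_component_cart[OF C(1) xy(1,2), of k t] by auto
    then have "z \<in> (\<Union>w\<in>words S j. word_map n w ` shifted_limit_set n S j)"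
      using C(2) unfolding limit_set_words[OF S, of j] by blast
    then obtain w z' where w: "w \<in> words S j" "z' \<in> shifted_limit_set n S j" "z = word_map n w z'"
      by blast
    then obtain v i where v: "w = v @ [i]" "v \<in> words S p" "i \<in> S j"
      unfolding p(1) words_snoc by blast
    have len: "length w = Suc p"
      using length_words[OF w(1)] p(1) by simp
    have z': "0 \<le> z' $ k" "z' $ k \<le> 1"
      using shifted_limit_set_facts(3)[OF S, of j] w(2) by (auto simp: mem_unit_cube subset_iff)
    have "t * (b * real (n $ k)) = z' $ k + real (corner n v k * n $ k + i $ k)"
      using z(2) w(3) len v(1) unfolding b_def
      by (simp add: word_map_nth corner_snoc field_simps)
    moreover have "t * (b * real (n $ k)) = real (m * n $ k) + 1 / 2"
      using b by (simp add: t_def field_simps)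
    ultimately have "z' $ k + real (corner n v k * n $ k + i $ k) = real (m * n $ k) + 1 / 2"
      by simp
    then have "corner n v k * n $ k + i $ k = m * n $ k"
      using z' by linarith
    then have "(corner n v k * n $ k + i $ k) mod n $ k = 0"
      by simp
    moreover have "i $ k < n $ k"
      using words_digits[OF S w(1)] v(1) by (auto simp: digit_set_def)
    ultimately have "i $ k = 0"
      by simp
    then show False
      using j(2) v(3) by blast
  qed
  then show ?thesis
    using xy by (metis linorder_neqE_linordered_idom)
qed

text \<open>The digits with \<open>k\<close>th entry 0 number at most \<open>r\<close>, so some admissible digit set contains
  none of them, and it recurs.\<close>
theorem recurrent_projection:
  assumes S: "regular r S" "recurrent r S" and r: "(\<Prod>l\<in>UNIV - {k}. n $ l) \<le> r"
    and C: "C \<in> components (limit_set n S)"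
  shows "\<exists>c. (\<lambda>x. x $ k) ` C = {c}"
proof -
  have V: "valid S"
    by (rule regular_valid[OF S(1)])
  have "card (subgrid (UNIV - {k}) 0) \<le> r" "subgrid (UNIV - {k}) 0 \<subseteq> digit_set n"
    using r card_subgrid[OF zero_digit, of "UNIV - {k}"] by (simp, auto simp: subgrid_def)
  moreover have "r + card {} \<le> card (digit_set n)"
    using S(1) by (simp add: regular_def card_digit_set)
  ultimately obtain A where A: "A \<in> digit_subsets n r" "A \<inter> subgrid (UNIV - {k}) 0 = {}"
    using digit_subset_avoiding[of "subgrid (UNIV - {k}) 0" r "{}"] by auto
  have A0: "i $ k \<noteq> 0" if "i \<in> A" for i
    using A that by (auto simp: subgrid_def digit_subsets_def)
  have often: "\<exists>j\<ge>N. 1 \<le> j \<and> (\<forall>i\<in>S j. i $ k \<noteq> 0)" for N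
    using recurrent_infinitely_often[OF S(2) A(1), of N] A0 by blast
  obtain x where x: "x \<in> C"
    using in_components_nonempty[OF C] by blast
  have const: "y $ k = x $ k" if "y \<in> C" for y
    using projection_constant[OF V often in_components_connected[OF C] in_components_subset[OF C] that x] .
  have "(\<lambda>y. y $ k) ` C = {x $ k}"
  proof
    show "(\<lambda>y. y $ k) ` C \<subseteq> {x $ k}"
      using const by blast
    show "{x $ k} \<subseteq> (\<lambda>y. y $ k) ` C"
      using x by blast
  qed
  then show ?thesis
    by blast
qed

theorem recurrent_totally_disconnected:
  assumes S: "regular r S" "recurrent r S" and r: "\<And>k. (\<Prod>l\<in>UNIV - {k}. n $ l) \<le> r"
  shows "totally_disconnected (limit_set n S)"
  unfolding totally_disconnected_def
proof
  fix C assume C: "C \<in> components (limit_set n S)"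
  obtain x where x: "x \<in> C"
    using in_components_nonempty[OF C] by blast
  have "y = x" if "y \<in> C" for y
  proof -
    have "y $ k = x $ k" for k
    proof -
      obtain c where c: "(\<lambda>x. x $ k) ` C = {c}"
        using recurrent_projection[OF S r C] by blast
      have "y $ k \<in> {c}" "x $ k \<in> {c}"
        unfolding c[symmetric] using x that by auto
      then show ?thesis
        by simp
    qed
    then show ?thesis
      by (simp add: vec_eq_iff)
  qed
  then show "\<exists>x. C = {x}"
    using x by blast
qed

text \<open>In the plane, pieces that meet then belong to cells with a common side.\<close>
definition corner_free :: "(nat \<Rightarrow> (nat^'d) set) \<Rightarrow> bool"
  where "corner_free S \<longleftrightarrow> (\<forall>k. \<forall>x\<in>shifted_limit_set n S k. \<exists>l. x $ l \<noteq> 0 \<and> x $ l \<noteq> 1)"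

text \<open>A corner of the cube is covered by the cell in that corner only, in which it is the
  same corner again.\<close>
lemma corner_digit:
  assumes S: "valid S" and x: "x \<in> limit_set n S" "\<And>l. x $ l = 0 \<or> x $ l = 1"
  shows "(\<chi> l. if x $ l = 0 then 0 else n $ l - 1) \<in> S 1 \<and> x \<in> limit_set n (\<lambda>j. S (Suc j))"
proof -
  obtain i y where iy: "i \<in> S 1" "y \<in> limit_set n (\<lambda>j. S (Suc j))" "x = cube_map n i y"
    using x(1) limit_set_step[OF S] by blast
  have y: "0 \<le> y $ l" "y $ l \<le> 1" for l
    using limit_set_unit[OF valid_shift[OF S]] iy(2) by (auto simp: mem_unit_cube subset_iff)
  have il: "i $ l < n $ l" for l
    using S iy(1) by (auto simp: valid_def digit_set_def)
  have eq: "x $ l * real (n $ l) = y $ l + real (i $ l)" for l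
    using iy(3) by (simp add: cube_map_nth)
  have main: "y $ l = x $ l \<and> i $ l = (if x $ l = 0 then 0 else n $ l - 1)" for l
  proof (cases "x $ l = 0")
    case True
    then have "y $ l + real (i $ l) = 0"
      using eq[of l] by simp
    then have "y $ l = 0 \<and> i $ l = 0"
      using y[of l] by linarith
    then show ?thesis
      using True by simp
  next
    case False
    then have x1: "x $ l = 1"
      using x(2) by blast
    then have "real (n $ l) = y $ l + real (i $ l)"
      using eq[of l] by simp
    moreover have "i $ l + 1 \<le> n $ l"
      using il[of l] by simp
    ultimately have "y $ l = 1" "i $ l + 1 = n $ l"
      using y[of l] by linarith+
    then show ?thesis
      using x1 by auto
  qed
  have "i = (\<chi> l. if x $ l = 0 then 0 else n $ l - 1)" and "y = x"
    using main by (auto simp: vec_eq_iff)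
  then show ?thesis
    using iy(1,2) by metis
qed

text \<open>A corner in the limit set would require the corresponding extreme digit at every later level, but a
  digit set without it recurs.\<close>
theorem recurrent_corner_free:
  assumes S: "regular r S" "recurrent r S" and r: "1 \<le> r"
  shows "corner_free S"
  unfolding corner_free_def
proof (intro allI ballI, rule ccontr)
  fix k x assume x: "x \<in> shifted_limit_set n S k" and "\<not> (\<exists>l. x $ l \<noteq> 0 \<and> x $ l \<noteq> 1)"
  then have x01: "x $ l = 0 \<or> x $ l = 1" for l
    by blast
  define d where "d = (\<chi> l. if x $ l = 0 then 0 else n $ l - 1)"
  have V: "valid S"
    by (rule regular_valid[OF S(1)])
  have step: "d \<in> S (k + m + 1) \<and> x \<in> limit_set n (\<lambda>j. S (k + Suc m + j))" if "x \<in> limit_set n (\<lambda>j. S (k + m + j))" for m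
    using corner_digit[OF valid_plus[OF V, of "k + m"] that x01] unfolding d_def by simp
  have all: "x \<in> limit_set n (\<lambda>j. S (k + m + j))" for m
  proof (induction m)
    case 0
    then show ?case
      using x by (simp add: shifted_limit_set_def)
  qed (use step in blast)
  have "d \<in> digit_set n"
    by (simp add: d_def digit_set_def)
  then obtain A where A: "A \<in> digit_subsets n r" "A \<inter> {d} = {}"
    using digit_subset_avoiding[of "{d}" r "{}"] r S(1) by (auto simp: regular_def card_digit_set)
  obtain j where "j \<ge> k + 1" "S j = A"
    using recurrent_infinitely_often[OF S(2) A(1)] by blast
  then show False
    using step[OF all, of "j - k - 1"] A(2) by auto
qed

end

section \<open>Nerves of fractal cubes\<close>

lemma down_closed_nerve: "down_closed (insert {} (nerve_complex A F))"
proof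
  fix s t assume s: "s \<in> insert {} (nerve_complex A F)" and t: "t \<subseteq> s"
  show "t \<in> insert {} (nerve_complex A F)"
  proof (cases "t = {}")
    case False
    then have s': "s \<subseteq> A" "finite s" "(\<Inter>v\<in>s. F v) \<noteq> {}"
      using s t by (auto simp: nerve_complex_def)
    have "(\<Inter>v\<in>s. F v) \<subseteq> (\<Inter>v\<in>t. F v)"
      using t by blast
    moreover have "finite t"
      by (rule finite_subset[OF t s'(2)])
    ultimately show ?thesis
      using False t s' unfolding nerve_complex_def by blast
  qed simp
qed (auto simp: nerve_complex_def)

lemma finite_complex_nerve:
  assumes "finite A" shows "finite_complex (nerve_complex A F)"
proof
  show "finite (nerve_complex A F)"
    by (rule finite_subset[of _ "Pow A"]) (use assms in \<open>auto simp: nerve_complex_def\<close>)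
  fix s t assume "s \<in> nerve_complex A F" "t \<subseteq> s" "t \<noteq> {}"
  then show "t \<in> nerve_complex A F"
    using down_closed.sub[OF down_closed_nerve, of s A F t] by simp
qed (simp add: nerve_complex_def)

lemma simplices_insert_empty: "simplices (insert {} K) (Suc m) = simplices K (Suc m)"
  by (auto simp: simplices_def)

context finite_complex begin

lemma acyclic_boundaries: "acyclic_at K (Suc q) \<Longrightarrow> 0 < q \<Longrightarrow> cycles K q \<subseteq> boundaries K q"
  unfolding acyclic_at_def boundaries_eq cycles_def
  by (auto simp: gr0_conv_Suc boundary_map_Suc)

lemma torsion_free_pure:
  assumes "torsion_free_at K (Suc q)" shows "pure_in (boundaries K q) (cycles K q)"
  using assms unfolding pure_in_def torsion_free_at_def boundaries_eq cycles_def by blast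

end

text \<open>The cells of \<open>u\<close> and \<open>v\<close> have a common face of codimension one.\<close>
definition axis_adjacent :: "nat^'d \<Rightarrow> (nat^'d) list \<Rightarrow> (nat^'d) list \<Rightarrow> bool"
  where "axis_adjacent n u v \<longleftrightarrow> (\<exists>l. (\<forall>l'. l' \<noteq> l \<longrightarrow> corner n u l' = corner n v l') \<and>
    (corner n v l = corner n u l + 1 \<or> corner n u l = corner n v l + 1))"

lemma axis_adjacent_sym: "axis_adjacent n u v \<Longrightarrow> axis_adjacent n v u"
  unfolding axis_adjacent_def by metis

lemma axis_adjacent_irrefl: "\<not> axis_adjacent n u u"
  by (simp add: axis_adjacent_def)

lemma bd_pair:
  assumes "u \<noteq> v"
  shows "bd (frag_of {u, v}) = frag_cmul (before_sign v u) (frag_of {v} - frag_of {u})"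
proof -
  have "{u, v} - {u} = {v}" "{u, v} - {v} = {u}"
    using assms by auto
  moreover have "face_sign {u, v} u = before_sign v u" "face_sign {u, v} v = before_sign u v"
    using assms by (auto simp: face_sign_def)
  ultimately have "bd (frag_of {u, v}) = frag_cmul (before_sign v u) (frag_of {v}) + frag_cmul (before_sign u v) (frag_of {u})"
    using assms by (simp add: bd_of)
  also have "before_sign u v = - before_sign v u"
    using assms by (intro before_sign_antisym) auto
  finally show ?thesis
    by (simp add: frag_cmul_distrib2 flip: minus_frag_cmul)
       (metis (no_types, opaque_lifting) add_uminus_conv_diff frag_cmul_distrib2 frag_cmul_minus_one frag_cmul_cmul mult.commute)
qed

context fractal begin

definition piece :: "(nat \<Rightarrow> (nat^'d) set) \<Rightarrow> nat \<Rightarrow> (nat^'d) list \<Rightarrow> (real^'d) set"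
  where "piece S k w = word_map n w ` shifted_limit_set n S k"

lemma nerve_eq: "fractal_nerve n S 0 k = nerve_complex (words S k) (piece S k)"
  unfolding fractal_nerve_def words_def piece_def by simp

lemma finite_words_valid: "valid S \<Longrightarrow> finite (words S k)"
  using valid_finite by (intro finite_words) auto

lemma words_inj: "valid S \<Longrightarrow> u \<in> words S k \<Longrightarrow> v \<in> words S k \<Longrightarrow> (\<And>l. corner n u l = corner n v l) \<Longrightarrow> u = v"
  by (rule corner_inj[of u v n]) (auto simp: length_words words_digits)

lemma piece_coordinate:
  assumes S: "valid S" and u: "u \<in> words S k" and x: "x \<in> piece S k u"
  obtains y where "y \<in> shifted_limit_set n S k"
    "\<And>l. x $ l * real (n $ l) ^ k = y $ l + real (corner n u l)" "\<And>l. 0 \<le> y $ l \<and> y $ l \<le> 1"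
proof -
  obtain y where y: "y \<in> shifted_limit_set n S k" "x = word_map n u y"
    using x by (auto simp: piece_def)
  have "x $ l * real (n $ l) ^ k = y $ l + real (corner n u l)" for l
    using y(2) length_words[OF u] by (simp add: word_map_nth)
  moreover have "0 \<le> y $ l \<and> y $ l \<le> 1" for l
    using shifted_limit_set_facts(3)[OF S, of k] y(1) by (auto simp: mem_unit_cube subset_iff)
  ultimately show thesis
    using that y(1) by blast
qed

lemma piece_bounds:
  assumes S: "valid S" and u: "u \<in> words S k" and x: "x \<in> piece S k u"
  shows "real (corner n u l) \<le> x $ l * real (n $ l) ^ k" "x $ l * real (n $ l) ^ k \<le> real (corner n u l) + 1"
  by (rule piece_coordinate[OF assms]; smt (verit))+

lemma nerve_common:
  assumes "s \<in> fractal_nerve n S 0 k"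
  obtains x where "\<And>w. w \<in> s \<Longrightarrow> x \<in> piece S k w" "s \<subseteq> words S k"
  using assms unfolding nerve_eq nerve_complex_def by blast

lemma nerve_memI:
  assumes "s \<subseteq> words S k" "s \<noteq> {}" "\<And>w. w \<in> s \<Longrightarrow> x \<in> piece S k w" "valid S"
  shows "s \<in> fractal_nerve n S 0 k"
  using assms finite_subset[OF assms(1) finite_words_valid[OF assms(4)]]
  unfolding nerve_eq nerve_complex_def by blast

text \<open>A common point of two pieces has, seen from the first one, a coordinate strictly
  between 0 and 1. In that coordinate the cells agree, so in the plane they can only differ
  in the other one.\<close>
lemma corner_free_adjacent:
  assumes S: "valid S" "corner_free S" and s: "s \<in> fractal_nerve n S 0 k" "u \<in> s" "v \<in> s" "u \<noteq> v" and d: "CARD('d) = 2"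
  shows "axis_adjacent n u v"
proof -
  obtain x where x: "\<And>w. w \<in> s \<Longrightarrow> x \<in> piece S k w" and sub: "s \<subseteq> words S k"
    using nerve_common[OF s(1)] by blast
  have uv: "u \<in> words S k" "v \<in> words S k"
    using s sub by auto
  obtain y where y: "y \<in> shifted_limit_set n S k" "\<And>l. x $ l * real (n $ l) ^ k = y $ l + real (corner n u l)"
    and y01: "\<And>l. 0 \<le> y $ l \<and> y $ l \<le> 1"
    using piece_coordinate[OF S(1) uv(1) x[OF s(2)]] by blast
  have b: "real (corner n v l) \<le> y $ l + real (corner n u l)" "y $ l + real (corner n u l) \<le> real (corner n v l) + 1" for l
    using piece_bounds[OF S(1) uv(2) x[OF s(3)], of l] y(2)[of l] by auto
  obtain l where l: "y $ l \<noteq> 0" "y $ l \<noteq> 1"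
    using S(2) y(1) unfolding corner_free_def by blast
  have strict: "0 < y $ l" "y $ l < 1"
    using l y01[of l] by auto
  have same: "corner n u l = corner n v l"
    using b[of l] strict by linarith
  obtain l' where l': "corner n u l' \<noteq> corner n v l'"
    using words_inj[OF S(1) uv] s(4) by blast
  have "corner n v l' = corner n u l' + 1 \<or> corner n u l' = corner n v l' + 1"
    using b[of l'] y01[of l'] l' by linarith
  moreover have "l'' = l" if "l'' \<noteq> l'" for l''
  proof (rule ccontr)
    assume "l'' \<noteq> l"
    moreover have "l \<noteq> l'"
      using l' same by metis
    ultimately have "card {l, l', l''} = 3"
      using that by simp
    moreover have "card {l, l', l''} \<le> CARD('d)"
      by (rule card_mono) auto
    ultimately show False
      using d by simp
  qed
  ultimately show ?thesis
    unfolding axis_adjacent_def using same by blast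
qed

text \<open>The segment in direction \<open>l\<close> that every limit set of a tail contains ends in both
  cells on the common face, at the same place.\<close>
lemma adjacent_in_nerve:
  assumes S: "regular r S" and uv: "u \<in> words S k" "v \<in> words S k"
    and adj: "\<And>l'. l' \<noteq> l \<Longrightarrow> corner n u l' = corner n v l'" "corner n v l = corner n u l + 1"
    and r: "r < (\<Prod>l'\<in>UNIV - {l}. n $ l')"
  shows "{u, v} \<in> fractal_nerve n S 0 k"
proof -
  obtain y where y: "\<And>t. 0 \<le> t \<Longrightarrow> t \<le> 1 \<Longrightarrow> y + axis l t \<in> limit_set n (\<lambda>j. S (k + j))"
    using regular_segment[OF regular_plus[OF S] r] by metis
  have y0: "y + axis l 0 = y"
    by (simp add: vec_eq_iff axis_nth)
  have T: "y \<in> shifted_limit_set n S k" "y + axis l 1 \<in> shifted_limit_set n S k"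
    using y[of 0, unfolded y0] y[of 1] by (simp_all add: shifted_limit_set_def)
  have "word_map n u (y + axis l 1) = word_map n v y"
    using adj length_words[OF uv(1)] length_words[OF uv(2)] by (auto simp: vec_eq_iff word_map_nth axis_nth)
  then have "word_map n v y \<in> piece S k w" if "w \<in> {u, v}" for w
    using that T by (auto simp: piece_def intro: image_eqI[of _ _ "y + axis l 1"])
  then show ?thesis
    using uv regular_valid[OF S] by (intro nerve_memI) auto
qed

lemma card_words:
  assumes "regular r S" shows "card (words S k) = ((\<Prod>l\<in>UNIV. n $ l) - r) ^ k"
proof (induction k)
  case (Suc k)
  have "words S (Suc k) = (\<lambda>(w, i). w @ [i]) ` (words S k \<times> S (Suc k))"
    by (auto simp: words_snoc)
  moreover have "inj_on (\<lambda>(w, i). w @ [i]) (words S k \<times> S (Suc k))"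
    by (auto simp: inj_on_def)
  ultimately have "card (words S (Suc k)) = card (words S k) * card (S (Suc k))"
    by (simp add: card_image card_cartesian_product)
  moreover have "card (S (Suc k)) = (\<Prod>l\<in>UNIV. n $ l) - r"
  proof -
    have "S (Suc k) \<in> digit_subsets n r"
      using assms by (simp add: regular_def)
    then have D: "S (Suc k) \<subseteq> digit_set n" "card (digit_set n - S (Suc k)) = r"
      by (auto simp: digit_subsets_def)
    then have "card (digit_set n) - card (S (Suc k)) = r" "card (S (Suc k)) \<le> card (digit_set n)"
      using finite_digit_set by (auto simp: card_Diff_subset finite_subset card_mono)
    then show ?thesis
      by (simp add: card_digit_set)
  qed
  ultimately show ?case
    using Suc by simp
qed simp

text \<open>Dropping the last digits is integer division of the corner coordinates.\<close>
lemma corner_prefix: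
  assumes S: "valid S" and w: "w \<in> words S k" and j: "j \<le> k"
  shows "corner n (take j w) l = corner n w l div n $ l ^ (k - j)"
proof -
  have len: "length w = k"
    by (rule length_words[OF w])
  have "set (drop j w) \<subseteq> digit_set n"
    using set_drop_subset[of j w] words_digits[OF S w] by (rule order_trans)
  then have "corner n (drop j w) l < n $ l ^ (k - j)"
    using corner_less[of "drop j w" n l] len by simp
  moreover have "corner n w l = corner n (take j w) l * n $ l ^ (k - j) + corner n (drop j w) l"
    using corner_append[of n "take j w" "drop j w" l] len by simp
  ultimately show ?thesis
    by simp
qed

lemma take_words: "w \<in> words S k \<Longrightarrow> j \<le> k \<Longrightarrow> take j w \<in> words S j"
proof (induction k arbitrary: w)
  case (Suc k)
  then obtain v i where v: "w = v @ [i]" "v \<in> words S k"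
    by (auto simp: words_snoc)
  show ?case
  proof (cases "j = Suc k")
    case True
    then show ?thesis
      using Suc.prems length_words[OF Suc.prems(1)] by simp
  next
    case False
    then show ?thesis
      using Suc v length_words[OF v(2)] by simp
  qed
qed simp

lemma extend_word:
  assumes "valid S" "P \<in> words S j" "j \<le> k"
  obtains w where "w \<in> words S k" "take j w = P"
proof -
  have "\<exists>w\<in>words S k. take j w = P"
    using assms(3)
  proof (induction rule: dec_induct)
    case base
    then show ?case
      using assms(2) length_words[OF assms(2)] by (intro bexI[of _ P]) auto
  next
    case (step m)
    then obtain w where w: "w \<in> words S m" "take j w = P"
      by blast
    have "S (Suc m) \<noteq> {}"
      using assms(1) by (simp add: valid_def)
    then obtain i where "i \<in> S (Suc m)"
      by blast
    then have "w @ [i] \<in> words S (Suc m)" "take j (w @ [i]) = P"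
      using w step.hyps length_words[OF w(1)] \<open>i \<in> S (Suc m)\<close> by (auto simp: words_snoc)
    then show ?case
      by blast
  qed
  then show thesis
    using that by blast
qed

lemma div_Suc_cases: "(x + 1) div (m::nat) = x div m \<or> (x + 1) div m = x div m + 1"
  by (simp add: div_Suc)

text \<open>A step of 1 in a coordinate changes the quotient by at most 1.\<close>
lemma prefix_adjacent:
  assumes S: "valid S" and uv: "u \<in> words S k" "v \<in> words S k" "axis_adjacent n u v" and j: "j \<le> k"
    and ne: "take j u \<noteq> take j v"
  shows "axis_adjacent n (take j u) (take j v)"
proof -
  obtain l where l: "\<And>l'. l' \<noteq> l \<Longrightarrow> corner n u l' = corner n v l'"
    "corner n v l = corner n u l + 1 \<or> corner n u l = corner n v l + 1"
    using uv(3) unfolding axis_adjacent_def by blast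
  have other: "corner n (take j u) l' = corner n (take j v) l'" if "l' \<noteq> l" for l'
    using l(1)[OF that] corner_prefix[OF S uv(1) j] corner_prefix[OF S uv(2) j] by simp
  have "corner n (take j u) l \<noteq> corner n (take j v) l"
  proof
    assume "corner n (take j u) l = corner n (take j v) l"
    then have "corner n (take j u) l' = corner n (take j v) l'" for l'
      using other[of l'] by (cases "l' = l") auto
    then show False
      using words_inj[OF S take_words[OF uv(1) j] take_words[OF uv(2) j]] ne by blast
  qed
  moreover have "corner n (take j u) l = corner n u l div n $ l ^ (k - j)" "corner n (take j v) l = corner n v l div n $ l ^ (k - j)"
    using corner_prefix[OF S uv(1) j] corner_prefix[OF S uv(2) j] by auto
  ultimately have "corner n (take j v) l = corner n (take j u) l + 1 \<or> corner n (take j u) l = corner n (take j v) l + 1"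
    using l(2) div_Suc_cases[of "corner n u l" "n $ l ^ (k - j)"] div_Suc_cases[of "corner n v l" "n $ l ^ (k - j)"] by auto
  then show ?thesis
    unfolding axis_adjacent_def using other by blast
qed

end

locale planar_fractal = fractal n for n :: "nat^'d" +
  fixes a b :: 'd
  assumes ab: "a \<noteq> b" and card_d: "CARD('d) = 2"
begin

lemma UNIV_ab: "UNIV = {a, b}"
proof -
  have "{a, b} = (UNIV :: 'd set)"
    by (rule card_subset_eq) (use ab card_d in auto)
  then show ?thesis ..
qed

lemma all_ab: "(\<forall>l. P l) \<longleftrightarrow> P a \<and> P b"
  using UNIV_ab by (metis UNIV_I insertE singletonD)

lemma prod_other: "(\<Prod>l\<in>UNIV - {a}. n $ l) = n $ b" "(\<Prod>l\<in>UNIV - {b}. n $ l) = n $ a"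
  and prod_all: "(\<Prod>l\<in>UNIV. n $ l) = n $ a * n $ b"
proof -
  have "UNIV - {a} = {b}" "UNIV - {b} = {a}"
    using UNIV_ab ab by auto
  then show "(\<Prod>l\<in>UNIV - {a}. n $ l) = n $ b" "(\<Prod>l\<in>UNIV - {b}. n $ l) = n $ a"
    by auto
  show "(\<Prod>l\<in>UNIV. n $ l) = n $ a * n $ b"
    unfolding UNIV_ab using ab by simp
qed

text \<open>For the filling condition: diagonally opposite cells meet in a single point at most,
  so two simplices that contain both have the same common point.\<close>
lemma nerve_planar_complex:
  assumes S: "valid S"
  shows "planar_complex (insert {} (fractal_nerve n S 0 k)) (\<lambda>w. int (corner n w a)) (\<lambda>w. int (corner n w b)) (words S k)"
proof -
  let ?N = "fractal_nerve n S 0 k"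
  interpret down_closed "insert {} ?N"
    unfolding nerve_eq by (rule down_closed_nerve)
  show ?thesis
  proof
    show "finite (words S k)"
      by (rule finite_words_valid[OF S])
    show "s \<subseteq> words S k" if "s \<in> insert {} ?N" for s
      using that by (auto simp: nerve_eq nerve_complex_def)
    show "u = v" if "u \<in> words S k" "v \<in> words S k" "int (corner n u a) = int (corner n v a)"
      "int (corner n u b) = int (corner n v b)" for u v
    proof -
      have "\<forall>l. corner n u l = corner n v l"
        unfolding all_ab using that by simp
      then show ?thesis
        using words_inj[OF S that(1,2)] by blast
    qed
    show "\<bar>int (corner n u a) - int (corner n v a)\<bar> \<le> 1 \<and> \<bar>int (corner n u b) - int (corner n v b)\<bar> \<le> 1"
      if s: "s \<in> insert {} ?N" "u \<in> s" "v \<in> s" for s u v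
    proof -
      have "s \<in> ?N"
        using s by auto
      then obtain x where x: "\<And>w. w \<in> s \<Longrightarrow> x \<in> piece S k w" and sub: "s \<subseteq> words S k"
        using nerve_common by blast
      have "\<bar>int (corner n u l) - int (corner n v l)\<bar> \<le> 1" for l
      proof -
        have "u \<in> words S k" "v \<in> words S k"
          using sub s by auto
        then show ?thesis
          using piece_bounds[OF S _ x[OF s(2)], of l] piece_bounds[OF S _ x[OF s(3)], of l] by linarith
      qed
      then show ?thesis
        by blast
    qed
    fix v l c t
    assume K: "{v, l, c} \<in> insert {} ?N" "{v, c, t} \<in> insert {} ?N"
      and pos: "int (corner n l a) = int (corner n v a) - 1" "int (corner n l b) = int (corner n v b)"
      "int (corner n c a) = int (corner n v a) - 1" "int (corner n c b) = int (corner n v b) - 1"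
      "int (corner n t a) = int (corner n v a)" "int (corner n t b) = int (corner n v b) - 1"
    obtain x where x: "\<And>w. w \<in> {v, l, c} \<Longrightarrow> x \<in> piece S k w" and sx: "{v, l, c} \<subseteq> words S k"
      using nerve_common K(1) by blast
    obtain y where y: "\<And>w. w \<in> {v, c, t} \<Longrightarrow> y \<in> piece S k w" and sy: "{v, c, t} \<subseteq> words S k"
      using nerve_common K(2) by blast
    have determined: "z $ m * real (n $ m) ^ k = real (corner n v m)" if "z \<in> piece S k v" "z \<in> piece S k c" for z m
    proof -
      have "\<forall>m. int (corner n v m) = int (corner n c m) + 1"
        unfolding all_ab using pos by simp
      then have "int (corner n v m) = int (corner n c m) + 1"
        by blast
      moreover have "v \<in> words S k" "c \<in> words S k"
        using sx by auto
      ultimately show ?thesis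
        using piece_bounds[OF S _ that(1), of m] piece_bounds[OF S _ that(2), of m] by linarith
    qed
    have "x $ m = y $ m" for m
    proof -
      have "x $ m * real (n $ m) ^ k = y $ m * real (n $ m) ^ k"
        using determined[of x m] determined[of y m] x y by simp
      then show ?thesis
        by simp
    qed
    then have "x = y"
      by (simp add: vec_eq_iff)
    then have "{v, l, c, t} \<in> ?N"
      using x y sx sy S by (intro nerve_memI[of _ S k x]) auto
    then show "{v, l, c, t} \<in> insert {} ?N"
      by simp
  qed
qed

lemma nerve_acyclic: "valid S \<Longrightarrow> 3 \<le> m \<Longrightarrow> acyclic_at (fractal_nerve n S 0 k) m"
proof -
  assume S: "valid S" and m: "3 \<le> m"
  obtain m' where m': "m = Suc m'"
    using m by (cases m) auto
  have "acyclic_at (insert {} (fractal_nerve n S 0 k)) m"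
    using planar_complex_homology[OF nerve_planar_complex[OF S]] m by blast
  then show ?thesis
    unfolding acyclic_at_def m' simplices_insert_empty .
qed

lemma nerve_torsion_free: "valid S \<Longrightarrow> torsion_free_at (fractal_nerve n S 0 k) (Suc q)"
proof -
  assume S: "valid S"
  let ?K = "insert {} (fractal_nerve n S 0 k)"
  interpret planar_complex ?K "\<lambda>w. int (corner n w a)" "\<lambda>w. int (corner n w b)" "words S k"
    by (rule nerve_planar_complex[OF S])
  have hom: "(\<forall>m\<ge>3. acyclic_at ?K m) \<and> torsion_free_at ?K 2"
    by (rule planar_complex_homology[OF nerve_planar_complex[OF S]])
  have "torsion_free_at ?K (Suc q)"
  proof -
    consider "q = 0" | "q = 1" | "3 \<le> Suc q"
      by linarith
    then show ?thesis
    proof cases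
      case 1
      then show ?thesis
        using torsion_free_at_1[of ?K] by simp
    next
      case 2
      then show ?thesis
        using hom by (simp add: numeral_2_eq_2)
    next
      case 3
      then show ?thesis
        using hom acyclic_imp_torsion_free by blast
    qed
  qed
  then show ?thesis
    unfolding torsion_free_at_def simplices_insert_empty .
qed

lemma finite_complex_fractal_nerve: "valid S \<Longrightarrow> finite_complex (fractal_nerve n S 0 k)"
  unfolding nerve_eq by (rule finite_complex_nerve[OF finite_words_valid])

text \<open>The homology is torsion-free in degrees 0 and 1, and zero above.\<close>
theorem nerve_homology_free:
  assumes S: "valid S"
  shows "free_abelian (simplicial_homology q (fractal_nerve n S 0 k))"
    and "simplicial_homology q (fractal_nerve n S 0 k) \<cong> simplicial_cohomology q (fractal_nerve n S 0 k)"
proof -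
  interpret finite_complex "fractal_nerve n S 0 k"
    by (rule finite_complex_fractal_nerve[OF S])
  show "free_abelian (simplicial_homology q (fractal_nerve n S 0 k))"
    and "simplicial_homology q (fractal_nerve n S 0 k) \<cong> simplicial_cohomology q (fractal_nerve n S 0 k)"
    using torsion_free_homology[OF torsion_free_pure[OF nerve_torsion_free[OF S]]] by blast+
qed

end

section \<open>Bounds on the ranks of the homology of the nerves\<close>

lemma lookup_frag_cmul_of: "Poly_Mapping.lookup (frag_cmul c (frag_of s)) t = (if t = s then c else 0)"
  by simp

text \<open>The bounds \<open>v ^ (k - k / m - 2) \<le> f k \<le> 2 * v ^ k\<close> give \<open>ln v\<close> up to an error of \<open>ln v / m\<close> in
  the limit, for every \<open>m\<close>.\<close>
lemma growth_limit:
  fixes f :: "nat \<Rightarrow> nat" and v :: nat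
  assumes v: "2 \<le> v" and up: "\<And>k. f k \<le> 2 * v ^ k"
    and low: "\<And>m. 1 \<le> m \<Longrightarrow> eventually (\<lambda>k. \<exists>e. k \<le> e + k div m + 2 \<and> v ^ e \<le> f k) sequentially"
  shows "(\<lambda>k. 1 / real k * ln (real (f k))) \<longlonglongrightarrow> ln (real v)"
proof (rule tendstoI)
  fix \<epsilon> :: real assume \<epsilon>: "\<epsilon> > 0"
  have lv: "0 < ln (real v)"
    using v by simp
  (* 1 / m absorbs one half of the error, large k the other half *)
  obtain m :: nat where m: "2 * ln (real v) / \<epsilon> < real m"
    using reals_Archimedean2 by blast
  have m_pos: "0 < real m"
    using m lv \<epsilon> by (smt (verit) divide_pos_pos)
  then have m1: "1 \<le> m"
    by simp
  have mb: "ln (real v) / real m < \<epsilon> / 2"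
    using m m_pos \<epsilon> by (simp add: field_simps)
  obtain K :: nat where K: "(4 * ln (real v) + 2 * ln 2) / \<epsilon> < real K"
    using reals_Archimedean2 by blast
  have "eventually (\<lambda>k. \<exists>e. k \<le> e + k div m + 2 \<and> v ^ e \<le> f k) sequentially"
    by (rule low[OF m1])
  then show "eventually (\<lambda>k. dist (1 / real k * ln (real (f k))) (ln (real v)) < \<epsilon>) sequentially"
    using eventually_ge_at_top[of "max K 1"]
  proof eventually_elim
    case (elim k)
    then obtain e where e: "k \<le> e + k div m + 2" "v ^ e \<le> f k" and kK: "K \<le> k" "1 \<le> k"
      by auto
    have k: "0 < real k"
      using kK by simp
    have pe: "1 \<le> v ^ e"
      using v by simp
    then have f1: "1 \<le> f k"
      using e by linarith
    have big: "4 * ln (real v) + 2 * ln 2 < \<epsilon> * real k"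
    proof -
      have "(4 * ln (real v) + 2 * ln 2) / \<epsilon> < real k"
        using K kK by linarith
      then show ?thesis
        using \<epsilon> by (simp add: field_simps)
    qed
    have upper: "ln (real (f k)) \<le> ln 2 + real k * ln (real v)"
    proof -
      have "ln (real (f k)) \<le> ln (real (2 * v ^ k))"
      proof -
        have "real (f k) \<le> real (2 * v ^ k)"
          using up[of k] by (rule of_nat_mono)
        moreover have "0 < real (f k)"
          using f1 by simp
        ultimately show ?thesis
          by (rule ln_mono)
      qed
      also have "\<dots> = ln 2 + real k * ln (real v)"
        using v by (simp add: ln_mult ln_realpow)
      finally show ?thesis .
    qed
    have lower: "real e * ln (real v) \<le> ln (real (f k))"
    proof -
      have "ln (real (v ^ e)) \<le> ln (real (f k))"
      proof (rule ln_mono)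
        show "real (v ^ e) \<le> real (f k)"
          using e(2) by (rule of_nat_mono)
        show "0 < real (v ^ e)"
          using v by simp
      qed
      then show ?thesis
        using v by (simp add: ln_realpow)
    qed
    have "real (k div m) \<le> real k / real m"
    proof -
      have "real (k div m * m) \<le> real k"
        by (intro of_nat_mono) simp
      then show ?thesis
        using m_pos by (simp add: field_simps)
    qed
    then have "real k - real k / real m - 2 \<le> real e"
      using e(1) by linarith
    then have "(real k - real k / real m - 2) * ln (real v) \<le> ln (real (f k))"
      using lower lv mult_right_mono[of "real k - real k / real m - 2" "real e" "ln (real v)"] by linarith
    then have low': "real k * ln (real v) - real k * (ln (real v) / real m) - 2 * ln (real v) \<le> ln (real (f k))"
      by (simp add: algebra_simps)
    have "real k * (ln (real v) / real m) \<le> real k * (\<epsilon> / 2)"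
      using mb k by (intro mult_left_mono) auto
    also have "\<dots> = \<epsilon> * real k / 2"
      by simp
    finally have "real k * (ln (real v) / real m) \<le> \<epsilon> * real k / 2" .
    moreover have "ln (2::real) > 0"
      by simp
    ultimately have "\<bar>ln (real (f k)) - real k * ln (real v)\<bar> < \<epsilon> * real k"
      unfolding abs_less_iff using low' upper big lv by (intro conjI; linarith)
    moreover have "1 / real k * ln (real (f k)) - ln (real v) = (ln (real (f k)) - real k * ln (real v)) / real k"
      using k by (simp add: field_simps)
    ultimately show ?case
      using k by (simp add: dist_real_def abs_divide pos_divide_less_eq)
  qed
qed

context fractal begin

lemma edge_form:
  assumes S: "valid S" "corner_free S" "CARD('d) = 2" and s: "s \<in> simplices (fractal_nerve n S 0 k) 2"
  obtains u v where "s = {u, v}" "u \<noteq> v" "u \<in> words S k" "v \<in> words S k" "axis_adjacent n u v"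
proof -
  have sN: "s \<in> fractal_nerve n S 0 k" "card s = 2"
    using s by (auto simp: simplices_def)
  obtain u v where uv: "s = {u, v}" "u \<noteq> v"
    using sN(2) by (auto simp: card_2_iff)
  have "axis_adjacent n u v"
    by (rule corner_free_adjacent[OF S(1,2) sN(1) _ _ uv(2) S(3)]) (use uv in auto)
  moreover have "s \<subseteq> words S k"
    using sN(1) by (auto simp: nerve_eq nerve_complex_def)
  ultimately show thesis
    using that uv by blast
qed

text \<open>Adjacent cells have opposite colours on the chessboard.\<close>
lemma axis_adjacent_parity:
  assumes "axis_adjacent n u v"
  shows "odd (\<Sum>l\<in>UNIV. corner n u l) \<noteq> odd (\<Sum>l\<in>UNIV. corner n v l)"
proof -
  obtain l where l: "\<And>l'. l' \<noteq> l \<Longrightarrow> corner n u l' = corner n v l'"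
    "corner n v l = corner n u l + 1 \<or> corner n u l = corner n v l + 1"
    using assms unfolding axis_adjacent_def by blast
  define X where "X = (\<Sum>l'\<in>UNIV - {l}. corner n v l')"
  have "(\<Sum>l'\<in>UNIV - {l}. corner n u l') = X"
    unfolding X_def by (rule sum.cong) (use l(1) in auto)
  then have u: "(\<Sum>l\<in>UNIV. corner n u l) = corner n u l + X"
    by (simp add: sum.remove[of UNIV l])
  have v: "(\<Sum>l\<in>UNIV. corner n v l) = corner n v l + X"
    by (simp add: sum.remove[of UNIV l] X_def)
  show ?thesis
    unfolding u v using l(2) by (elim disjE) simp_all
qed

text \<open>The graph of adjacent cells is bipartite.\<close>
lemma no_triangles:
  assumes S: "valid S" "corner_free S" "CARD('d) = 2"
  shows "simplices (fractal_nerve n S 0 k) 3 = {}"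
proof -
  have False if s: "s \<in> fractal_nerve n S 0 k" "card s = 3" for s
  proof -
    obtain u v w where uvw: "s = {u, v, w}" "u \<noteq> v" "u \<noteq> w" "v \<noteq> w"
      using s(2) by (auto simp: card_3_iff)
    have "axis_adjacent n u v" "axis_adjacent n u w" "axis_adjacent n v w"
      by (rule corner_free_adjacent[OF S(1,2) s(1) _ _ _ S(3)]; simp add: uvw)+
    then show False
      using axis_adjacent_parity by blast
  qed
  then show ?thesis
    by (auto simp: simplices_def)
qed

lemma rank_H0_le:
  assumes S: "regular r S"
  shows "abelian_rank (simplicial_homology 0 (fractal_nerve n S 0 k)) \<le> ((\<Prod>l\<in>UNIV. n $ l) - r) ^ k"
proof -
  have V: "valid S"
    by (rule regular_valid[OF S])
  interpret finite_complex "fractal_nerve n S 0 k"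
    unfolding nerve_eq by (rule finite_complex_nerve[OF finite_words_valid[OF V]])
  have "simplices (fractal_nerve n S 0 k) (Suc 0) \<subseteq> (\<lambda>w. {w}) ` words S k"
  proof
    fix s assume "s \<in> simplices (fractal_nerve n S 0 k) (Suc 0)"
    then have s: "s \<subseteq> words S k" "card s = 1"
      by (auto simp: simplices_def nerve_eq nerve_complex_def)
    then obtain w where "s = {w}"
      by (auto simp: card_1_singleton_iff)
    then show "s \<in> (\<lambda>w. {w}) ` words S k"
      using s by blast
  qed
  then have "card (simplices (fractal_nerve n S 0 k) (Suc 0)) \<le> card (words S k)"
    by (rule surj_card_le[OF finite_words_valid[OF V]])
  then show ?thesis
    unfolding card_words[OF S] using homology_rank_le[of 0] by (rule order_trans[rotated])
qed

text \<open>An edge is determined by its lower endpoint and its direction, so there are at most two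
  edges per cell.\<close>
lemma rank_H1_le:
  assumes S: "regular r S" "corner_free S" and d: "CARD('d) = 2"
  shows "abelian_rank (simplicial_homology 1 (fractal_nerve n S 0 k)) \<le> 2 * ((\<Prod>l\<in>UNIV. n $ l) - r) ^ k"
proof -
  have V: "valid S"
    by (rule regular_valid[OF S(1)])
  interpret finite_complex "fractal_nerve n S 0 k"
    unfolding nerve_eq by (rule finite_complex_nerve[OF finite_words_valid[OF V]])
  (* the neighbour above u in direction l *)
  define up where "up = (\<lambda>(u, l). SOME v. v \<in> words S k \<and> (\<forall>l'. l' \<noteq> l \<longrightarrow> corner n u l' = corner n v l') \<and> corner n v l = corner n u l + 1)"
  have up: "up (u, l) = v" if "v \<in> words S k" "\<And>l'. l' \<noteq> l \<Longrightarrow> corner n u l' = corner n v l'" "corner n v l = corner n u l + 1" for u v l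
  proof -
    have "\<exists>v. v \<in> words S k \<and> (\<forall>l'. l' \<noteq> l \<longrightarrow> corner n u l' = corner n v l') \<and> corner n v l = corner n u l + 1"
      using that by blast
    from someI_ex[OF this] have w: "up (u, l) \<in> words S k" "\<And>l'. l' \<noteq> l \<Longrightarrow> corner n u l' = corner n (up (u, l)) l'"
      "corner n (up (u, l)) l = corner n u l + 1"
      by (auto simp: up_def)
    have "corner n (up (u, l)) l' = corner n v l'" for l'
      using w(2)[of l'] w(3) that(2)[of l'] that(3) by (cases "l' = l") simp_all
    then show ?thesis
      using words_inj[OF V w(1) that(1)] by blast
  qed
  have "simplices (fractal_nerve n S 0 k) 2 \<subseteq> (\<lambda>p. {fst p, up p}) ` (words S k \<times> UNIV)"
  proof
    fix s assume "s \<in> simplices (fractal_nerve n S 0 k) 2"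
    then obtain u v where uv: "s = {u, v}" "u \<in> words S k" "v \<in> words S k" "axis_adjacent n u v"
      using edge_form[OF V S(2) d] by metis
    then obtain l where l: "\<And>l'. l' \<noteq> l \<Longrightarrow> corner n u l' = corner n v l'"
      "corner n v l = corner n u l + 1 \<or> corner n u l = corner n v l + 1"
      unfolding axis_adjacent_def by blast
    from l(2) show "s \<in> (\<lambda>p. {fst p, up p}) ` (words S k \<times> UNIV)"
    proof
      assume "corner n v l = corner n u l + 1"
      then have "up (u, l) = v"
        using up[OF uv(3) l(1)] by blast
      then show ?thesis
        using uv by (intro image_eqI[of _ _ "(u, l)"]) auto
    next
      assume "corner n u l = corner n v l + 1"
      then have "up (v, l) = u"
        using up[OF uv(2), of l v] l(1) by metis
      then show ?thesis
        using uv by (intro image_eqI[of _ _ "(v, l)"]) auto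
    qed
  qed
  then have "card (simplices (fractal_nerve n S 0 k) 2) \<le> card (words S k \<times> (UNIV :: 'd set))"
    using finite_words_valid[OF V] by (intro surj_card_le[of _ _ "\<lambda>p. {fst p, up p}"]) auto
  also have "\<dots> = 2 * ((\<Prod>l\<in>UNIV. n $ l) - r) ^ k"
    using card_words[OF S(1)] d by (simp add: card_cartesian_product)
  finally show ?thesis
    using homology_rank_le[of 1] by (simp add: numeral_2_eq_2)
qed

definition isolated :: "(nat \<Rightarrow> (nat^'d) set) \<Rightarrow> nat \<Rightarrow> (nat^'d) list \<Rightarrow> bool"
  where "isolated S j P \<longleftrightarrow> P \<in> words S j \<and> (\<forall>Q\<in>words S j. \<not> axis_adjacent n P Q)"

text \<open>Choose a cell of level \<open>k\<close> inside each isolated cell. Cells that meet at level \<open>k\<close> lie in equal or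
  adjacent cells of level \<open>j\<close>, so no edge leaves an isolated one, and the sum of the
  coefficients of a chain inside it is a homology invariant.\<close>
theorem rank_H0_ge:
  assumes S: "valid S" "corner_free S" "CARD('d) = 2" and j: "j \<le> k"
    and I: "finite I" "\<And>P. P \<in> I \<Longrightarrow> isolated S j P"
  shows "card I \<le> abelian_rank (simplicial_homology 0 (fractal_nerve n S 0 k))"
proof -
  interpret finite_complex "fractal_nerve n S 0 k"
    unfolding nerve_eq by (rule finite_complex_nerve[OF finite_words_valid[OF S(1)]])
  have "\<exists>w\<in>words S k. take j w = P" if "P \<in> I" for P
    using extend_word[OF S(1) _ j, of P] I(2)[OF that] unfolding isolated_def by blast
  then obtain w where w: "\<And>P. P \<in> I \<Longrightarrow> w P \<in> words S k \<and> take j (w P) = P"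
    by metis
  have in_nerve: "{w P} \<in> fractal_nerve n S 0 k" if "P \<in> I" for P
  proof -
    obtain y where "y \<in> shifted_limit_set n S k"
      using shifted_limit_set_facts(2)[OF S(1)] by blast
    then show ?thesis
      using w[OF that] S(1) by (intro nerve_memI[of _ S k "word_map n (w P) y"]) (auto simp: piece_def)
  qed
  show ?thesis
  proof (rule homology_rank_ge[OF I(1), of "\<lambda>P. frag_of {w P}"])
    show "frag_of {w P} \<in> cycles (fractal_nerve n S 0 k) 0" if "P \<in> I" for P
      using in_nerve[OF that] by (simp add: cycles_def frags_def simplices_def boundary_map_def)
    fix a P assume bnd: "(\<Sum>P\<in>I. frag_cmul (a P) (frag_of {w P})) \<in> boundaries (fractal_nerve n S 0 k) 0" and P: "P \<in> I"
    define \<phi> where "\<phi> = frag_extend (\<lambda>s. if take j ` s = {P} then frag_of () else 0)"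
    have edge: "\<phi> (bd (frag_of s)) = 0" if s: "s \<in> simplices (fractal_nerve n S 0 k) 2" for s
    proof -
      obtain u v where uv: "s = {u, v}" "u \<noteq> v" "u \<in> words S k" "v \<in> words S k" "axis_adjacent n u v"
        using edge_form[OF S s] by blast
      have "take j u = P \<longleftrightarrow> take j v = P"
      proof (cases "take j u = take j v")
        case False
        have "axis_adjacent n (take j u) (take j v)"
          by (rule prefix_adjacent[OF S(1) uv(3-5) j False])
        then show ?thesis
          using I(2)[OF P] take_words[OF uv(3) j] take_words[OF uv(4) j] axis_adjacent_sym
          unfolding isolated_def by blast
      qed simp
      then show ?thesis
        unfolding uv(1) bd_pair[OF uv(2)] by (simp add: \<phi>_def frag_extend_cmul frag_extend_diff)
    qed
    obtain c where c: "c \<in> frags (simplices (fractal_nerve n S 0 k) 2)"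
      "(\<Sum>P\<in>I. frag_cmul (a P) (frag_of {w P})) = bd c"
      using bnd unfolding boundaries_eq by (auto simp: numeral_2_eq_2)
    have "\<phi> (bd c) = 0"
    proof (rule frag_linear_ext[where F = "\<lambda>c. \<phi> (bd c)" and G = "\<lambda>_. 0"])
      fix s assume "s \<in> Poly_Mapping.keys c"
      then show "\<phi> (bd (frag_of s)) = 0"
        using c(1) by (intro edge) (auto simp: frags_def)
    qed (simp_all add: \<phi>_def frag_extend_diff bd_diff)
    moreover have "\<phi> (\<Sum>P\<in>I. frag_cmul (a P) (frag_of {w P})) = (\<Sum>Q\<in>I. if Q = P then frag_cmul (a P) (frag_of ()) else 0)"
      unfolding \<phi>_def frag_extend_sum[OF I(1)] comp_def
      by (rule sum.cong) (use w in \<open>auto simp: frag_extend_cmul\<close>)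
    ultimately have "frag_cmul (a P) (frag_of ()) = 0"
      using c(2) I(1) P by simp
    then show "a P = 0"
      by simp
  qed
qed

text \<open>Inside the cell of \<open>W\<close> there are \<open>2 ^ d\<close> cells of level \<open>k\<close> around a common corner: \<open>c\<close> is the
  position of the lowest one, and \<open>\<delta>\<close> runs through the offsets in \<open>{0, 1}\<close>.\<close>
definition has_block :: "(nat \<Rightarrow> (nat^'d) set) \<Rightarrow> nat \<Rightarrow> (nat^'d) list \<Rightarrow> bool"
  where "has_block S k W \<longleftrightarrow> (\<exists>w c. \<forall>\<delta>. (\<forall>l. \<delta> l \<le> (1::nat)) \<longrightarrow>
    w \<delta> \<in> words S k \<and> take (length W) (w \<delta>) = W \<and> (\<forall>l. corner n (w \<delta>) l = c l + \<delta> l))"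

lemma has_block_base:
  assumes W: "W \<in> words S j" and small: "\<And>i. (\<And>l. i $ l \<le> 1) \<Longrightarrow> i \<in> S (Suc j)"
  shows "has_block S (Suc j) W"
  unfolding has_block_def
proof (intro exI allI impI)
  fix \<delta> :: "'d \<Rightarrow> nat" assume "\<forall>l. \<delta> l \<le> 1"
  then have "vec_lambda \<delta> \<in> S (Suc j)"
    by (intro small) simp
  then show "W @ [vec_lambda \<delta>] \<in> words S (Suc j) \<and> take (length W) (W @ [vec_lambda \<delta>]) = W
      \<and> (\<forall>l. corner n (W @ [vec_lambda \<delta>]) l = corner n W l * n $ l + \<delta> l)"
    using W by (auto simp: words_snoc corner_snoc)
qed

text \<open>A block of cells of one level is a box of size \<open>2 * n $ l\<close> in the grid of the next one. Among
  its positions for a block of next-level cells, look at those with lower corner \<open>i\<close> in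
  the lowest cell. Reduced modulo the grid, the cell at offset \<open>\<delta>\<close> has the digit \<open>i + \<delta>\<close>. For each \<open>\<delta>\<close>
  at most \<open>r\<close> choices of \<open>i\<close> hit a missing digit, so if \<open>2 ^ d * r\<close> is less than the
  number of digits, some \<open>i\<close> is good for all offsets.\<close>
lemma has_block_step:
  assumes S: "regular r S" and r: "2 ^ CARD('d) * r < (\<Prod>l\<in>UNIV. n $ l)" and len: "length W \<le> k" and B: "has_block S k W"
  shows "has_block S (Suc k) W"
proof -
  obtain w c where w: "\<And>\<delta>. (\<And>l. \<delta> l \<le> 1) \<Longrightarrow> w \<delta> \<in> words S k \<and> take (length W) (w \<delta>) = W \<and> (\<forall>l. corner n (w \<delta>) l = c l + \<delta> l)"
    using B unfolding has_block_def by metis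
  (* the last digit of the cell at offset \<delta> from the subcell i; the carry tells
     in which parent cell of the block it lies *)
  define shift where "shift \<delta> i = (\<chi> l. (i $ l + \<delta> l) mod n $ l)" for \<delta> :: "'d \<Rightarrow> nat" and i :: "nat^'d"
  define R where "R = digit_set n - S (Suc k)"
  define \<Delta> where "\<Delta> = {\<delta> :: 'd \<Rightarrow> nat. \<forall>l. \<delta> l \<le> 1}"
  have \<Delta>: "finite \<Delta>" "card \<Delta> = 2 ^ CARD('d)"
  proof -
    have eq: "\<Delta> = (\<Pi>\<^sub>E l\<in>UNIV. {0, 1})"
      by (auto simp: \<Delta>_def PiE_def Pi_def le_Suc_eq)
    show "finite \<Delta>"
      unfolding eq by (intro finite_PiE) auto
    show "card \<Delta> = 2 ^ CARD('d)"
      unfolding eq by (simp add: card_PiE numeral_2_eq_2)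
  qed
  have R: "finite R" "card R = r"
    using S finite_digit_set by (auto simp: R_def regular_def digit_subsets_def)
  have shift_digit: "shift \<delta> i \<in> digit_set n" for \<delta> i
    by (simp add: shift_def digit_set_def)
  have shift_inj: "inj_on (shift \<delta>) (digit_set n)" for \<delta>
  proof (rule inj_onI)
    fix i j assume ij: "i \<in> digit_set n" "j \<in> digit_set n" "shift \<delta> i = shift \<delta> j"
    have "i $ l = j $ l" for l
    proof -
      have "(i $ l + \<delta> l) mod n $ l = (j $ l + \<delta> l) mod n $ l"
        using arg_cong[OF ij(3), of "\<lambda>v. v $ l"] by (simp add: shift_def)
      then have "i $ l mod n $ l = j $ l mod n $ l"
        by (simp add: nat_mod_eq_iff)
      then show ?thesis
        using ij by (simp add: digit_set_def)
    qed
    then show "i = j"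
      by (simp add: vec_eq_iff)
  qed
  define bad where "bad = (\<Union>\<delta>\<in>\<Delta>. {i \<in> digit_set n. shift \<delta> i \<in> R})"
  have "card bad \<le> (\<Sum>\<delta>\<in>\<Delta>. card {i \<in> digit_set n. shift \<delta> i \<in> R})"
    unfolding bad_def by (rule card_UN_le[OF \<Delta>(1)])
  also have "\<dots> \<le> (\<Sum>\<delta>\<in>\<Delta>. r)"
  proof (rule sum_mono)
    fix \<delta>
    have "card {i \<in> digit_set n. shift \<delta> i \<in> R} \<le> card R"
      by (rule card_inj_on_le[of "shift \<delta>"]) (use R shift_inj in \<open>auto intro: inj_on_subset\<close>)
    then show "card {i \<in> digit_set n. shift \<delta> i \<in> R} \<le> r"
      by (simp add: R)
  qed
  also have "\<dots> < card (digit_set n)"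
    using r by (simp add: \<Delta> card_digit_set)
  finally have "\<not> digit_set n \<subseteq> bad"
    using card_mono[of bad "digit_set n"] finite_subset[of bad "digit_set n"] finite_digit_set by (auto simp: bad_def)
  then obtain i where i: "i \<in> digit_set n" "i \<notin> bad"
    by blast
  have good: "shift \<delta> i \<in> S (Suc k)" if "\<delta> \<in> \<Delta>" for \<delta>
    using i that shift_digit[of \<delta> i] by (auto simp: bad_def R_def)
  define carry where "carry \<delta> l = (i $ l + \<delta> l) div n $ l" for \<delta> :: "'d \<Rightarrow> nat" and l
  have carry: "carry \<delta> l \<le> 1" if "\<delta> \<in> \<Delta>" for \<delta> l
  proof -
    have "i $ l < n $ l" "\<delta> l \<le> 1"
      using i(1) that by (auto simp: digit_set_def \<Delta>_def)
    then have "i $ l + \<delta> l < 2 * n $ l"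
      by linarith
    then have "carry \<delta> l < 2"
      unfolding carry_def by (simp add: less_mult_imp_div_less)
    then show ?thesis
      by simp
  qed
  show ?thesis
    unfolding has_block_def
  proof (intro exI allI impI)
    fix \<delta> :: "'d \<Rightarrow> nat" assume "\<forall>l. \<delta> l \<le> 1"
    then have \<delta>: "\<delta> \<in> \<Delta>"
      by (simp add: \<Delta>_def)
    have wc: "w (carry \<delta>) \<in> words S k" "take (length W) (w (carry \<delta>)) = W" "\<And>l. corner n (w (carry \<delta>)) l = c l + carry \<delta> l"
      using w[OF carry[OF \<delta>]] by auto
    have "corner n (w (carry \<delta>) @ [shift \<delta> i]) l = (c l * n $ l + i $ l) + \<delta> l" for l
    proof -
      have "corner n (w (carry \<delta>) @ [shift \<delta> i]) l = c l * n $ l + (carry \<delta> l * n $ l + (i $ l + \<delta> l) mod n $ l)"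
        by (simp add: corner_snoc wc(3) shift_def algebra_simps)
      then show ?thesis
        unfolding carry_def div_mult_mod_eq by simp
    qed
    moreover have "length W \<le> length (w (carry \<delta>))"
      using length_words[OF wc(1)] len by simp
    ultimately show "w (carry \<delta>) @ [shift \<delta> i] \<in> words S (Suc k) \<and> take (length W) (w (carry \<delta>) @ [shift \<delta> i]) = W
        \<and> (\<forall>l. corner n (w (carry \<delta>) @ [shift \<delta> i]) l = (c l * n $ l + i $ l) + \<delta> l)"
      using wc good[OF \<delta>] by (auto simp: words_snoc)
  qed
qed

lemma has_block_mono:
  assumes S: "regular r S" and r: "2 ^ CARD('d) * r < (\<Prod>l\<in>UNIV. n $ l)" and jk: "j \<le> k" and len: "length W \<le> j" and B: "has_block S j W"
  shows "has_block S k W"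
  using jk
proof (induction rule: dec_induct)
  case (step m)
  then show ?case
    using has_block_step[OF S r, of W m] len by simp
qed (rule B)

end

context planar_fractal begin

text \<open>Go around the four cells of the block. The restriction on \<open>r\<close> makes adjacent cells meet.\<close>
lemma block_cycle:
  assumes S: "regular r S" "corner_free S" and r: "r < n $ a" "r < n $ b" and B: "has_block S k W"
  obtains z s where "z \<in> cycles (fractal_nerve n S 0 k) 1"
    "\<And>t. t \<in> Poly_Mapping.keys z \<Longrightarrow> take (length W) ` t = {W}" "Poly_Mapping.lookup z s \<noteq> 0"
proof -
  let ?N = "fractal_nerve n S 0 k"
  have V: "valid S"
    by (rule regular_valid[OF S(1)])
  interpret finite_complex ?N
    by (rule finite_complex_fractal_nerve[OF V])
  obtain w c where w: "\<And>\<delta>. (\<And>l. \<delta> l \<le> 1) \<Longrightarrow> w \<delta> \<in> words S k \<and> take (length W) (w \<delta>) = W \<and> (\<forall>l. corner n (w \<delta>) l = c l + \<delta> l)"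
    using B unfolding has_block_def by metis
  define \<delta> where "\<delta> x y = (\<lambda>l. if l = a then x else y)" for x y :: nat
  define p where "p x y = w (\<delta> x y)" for x y
  have p: "p x y \<in> words S k" "take (length W) (p x y) = W" "corner n (p x y) a = c a + x" "corner n (p x y) b = c b + y"
    if "x \<le> 1" "y \<le> 1" for x y
    using w[of "\<delta> x y"] that ab by (auto simp: p_def \<delta>_def)
  have other: "l' = b" if "l' \<noteq> a" for l'
    using that UNIV_ab by blast
  have other': "l' = a" if "l' \<noteq> b" for l'
    using that UNIV_ab by blast
  have h: "{p 0 y, p 1 y} \<in> ?N" if "y \<le> 1" for y
    by (rule adjacent_in_nerve[OF S(1), of _ k _ a]) (use p that r prod_other in \<open>auto dest: other\<close>)
  have v: "{p x 0, p x 1} \<in> ?N" if "x \<le> 1" for x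
    by (rule adjacent_in_nerve[OF S(1), of _ k _ b]) (use p that r prod_other in \<open>auto dest: other'\<close>)
  have ne: "p x y \<noteq> p x' y'" if "x \<le> 1" "y \<le> 1" "x' \<le> 1" "y' \<le> 1" "x \<noteq> x' \<or> y \<noteq> y'" for x y x' y'
    using p(3,4)[OF that(1,2)] p(3,4)[OF that(3,4)] that(5) by (metis add_left_cancel)
  have n1: "p 0 0 \<noteq> p 1 0" and n2: "p 1 0 \<noteq> p 1 1" and n3: "p 1 1 \<noteq> p 0 1" and n4: "p 0 1 \<noteq> p 0 0"
    and n5: "p 0 0 \<noteq> p 1 1" and n6: "p 1 0 \<noteq> p 0 1"
    by (rule ne; simp)+
  define z where "z = cone (p 0 0) (frag_of {p 1 0}) + cone (p 1 0) (frag_of {p 1 1})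
    + cone (p 1 1) (frag_of {p 0 1}) + cone (p 0 1) (frag_of {p 0 0})"
  have edge: "cone u (frag_of {v}) \<in> frags (simplices ?N (Suc 1))" if "{u, v} \<in> ?N" "u \<noteq> v" for u v
    unfolding cone_of using that by (intro add_subgroup_cmul add_subgroup_frags) (simp add: frags_def simplices_def)
  have z_chain: "z \<in> frags (simplices ?N (Suc 1))"
    unfolding z_def
    by (intro add_subgroup_add add_subgroup_frags edge n1 n2 n3 n4)
       (use h[of 0] h[of 1] v[of 0] v[of 1] in \<open>auto simp: insert_commute\<close>)
  have "bd z = 0"
    unfolding z_def bd_add bd_edge[OF n1] bd_edge[OF n2] bd_edge[OF n3] bd_edge[OF n4] by simp
  then have cyc: "z \<in> cycles ?N 1"
    using z_chain boundary_map_Suc[OF z_chain, of 0] by (simp add: cycles_def)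
  have keys: "take (length W) ` t = {W}" if "t \<in> Poly_Mapping.keys z" for t
  proof -
    have "z \<in> frags {t. take (length W) ` t = {W}}"
      unfolding z_def cone_of
      by (intro add_subgroup_add add_subgroup_cmul add_subgroup_frags) (simp_all add: frags_def p)
    then show ?thesis
      using that by (auto simp: frags_def)
  qed
  have "Poly_Mapping.lookup z {p 0 0, p 1 0} = face_sign {p 1 0} (p 0 0)"
  proof -
    have "{p 1 0, p 1 1} \<noteq> {p 0 0, p 1 0}" "{p 1 1, p 0 1} \<noteq> {p 0 0, p 1 0}" "{p 0 1, p 0 0} \<noteq> {p 0 0, p 1 0}"
      using n1 n2 n3 n4 n5 n6 by (auto simp: doubleton_eq_iff)
    then show ?thesis
      unfolding z_def cone_of lookup_add lookup_frag_cmul_of by (simp add: eq_commute[of "{p 0 0, p 1 0}"])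
  qed
  also have "\<dots> \<noteq> 0"
    by (metis face_sign_sq mult_zero_left zero_neq_one)
  finally show thesis
    using that[OF cyc keys] by blast
qed

text \<open>Blocks in different cells of level \<open>j\<close> have cycles with disjoint supports, and without
  triangles there are no boundaries in degree 1.\<close>
theorem rank_H1_ge:
  assumes S: "regular r S" "corner_free S" and r: "r < n $ a" "r < n $ b"
    and I: "finite I" "\<And>W. W \<in> I \<Longrightarrow> has_block S k W \<and> length W = j"
  shows "card I \<le> abelian_rank (simplicial_homology 1 (fractal_nerve n S 0 k))"
proof -
  let ?N = "fractal_nerve n S 0 k"
  have V: "valid S"
    by (rule regular_valid[OF S(1)])
  interpret finite_complex ?N
    by (rule finite_complex_fractal_nerve[OF V])
  have "\<exists>z s. z \<in> cycles ?N 1 \<and> (\<forall>t\<in>Poly_Mapping.keys z. take j ` t = {W}) \<and> Poly_Mapping.lookup z s \<noteq> 0"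
    if W: "W \<in> I" for W
  proof -
    obtain z s where "z \<in> cycles ?N 1" "\<And>t. t \<in> Poly_Mapping.keys z \<Longrightarrow> take (length W) ` t = {W}"
      "Poly_Mapping.lookup z s \<noteq> 0"
      using block_cycle[OF S r, of k W] I(2)[OF W] by blast
    then show ?thesis
      using I(2)[OF W] by blast
  qed
  then obtain z s where z: "\<And>W. W \<in> I \<Longrightarrow> z W \<in> cycles ?N 1"
    "\<And>W t. W \<in> I \<Longrightarrow> t \<in> Poly_Mapping.keys (z W) \<Longrightarrow> take j ` t = {W}"
    "\<And>W. W \<in> I \<Longrightarrow> Poly_Mapping.lookup (z W) (s W) \<noteq> 0"
    by metis
  have B0: "boundaries ?N 1 = {0}"
  proof -
    have "simplices ?N (Suc (Suc 1)) = {}"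
      using no_triangles[OF V S(2) card_d, of k] by (simp add: numeral_3_eq_3)
    then show ?thesis
      unfolding boundaries_eq by (auto simp: frags_def)
  qed
  show ?thesis
  proof (rule homology_rank_ge[OF I(1), of z])
    fix c W assume sum: "(\<Sum>W\<in>I. frag_cmul (c W) (z W)) \<in> boundaries ?N 1" and W: "W \<in> I"
    have "Poly_Mapping.lookup (\<Sum>W\<in>I. frag_cmul (c W) (z W)) (s W) = 0"
      using sum B0 by simp
    then have "(\<Sum>W'\<in>I. c W' * Poly_Mapping.lookup (z W') (s W)) = 0"
      by (simp add: lookup_sum)
    moreover have "Poly_Mapping.lookup (z W') (s W) = 0" if "W' \<in> I" "W' \<noteq> W" for W'
    proof (rule ccontr)
      assume "Poly_Mapping.lookup (z W') (s W) \<noteq> 0"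
      then have "take j ` s W = {W'}"
        using z(2)[OF that(1)] by (simp add: in_keys_iff)
      moreover have "take j ` s W = {W}"
        using z(2)[OF W] z(3)[OF W] by (simp add: in_keys_iff)
      ultimately show False
        using that by simp
    qed
    then have "(\<Sum>W'\<in>I. c W' * Poly_Mapping.lookup (z W') (s W)) = (\<Sum>W'\<in>I. if W' = W then c W * Poly_Mapping.lookup (z W) (s W) else 0)"
      by (intro sum.cong) auto
    ultimately show "c W = 0"
      using z(3)[OF W] W I(1) by simp
  qed (rule z(1))
qed

end

section \<open>Growth rates in the plane\<close>

context planar_fractal begin

lemma planar_cases:
  fixes l :: 'd
  obtains l' where "l' \<noteq> l" "\<And>x. x = l \<or> x = l'"
proof (cases "l = a")
  case True
  then show thesis
    using that[of b] ab UNIV_ab by blast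
next
  case False
  then have "l = b"
    using UNIV_ab by blast
  then show thesis
    using that[of a] ab UNIV_ab by blast
qed

lemma vec_eq_two:
  fixes i j :: "nat^'d"
  assumes "\<And>x. x = l \<or> x = l'" "i $ l = j $ l" "i $ l' = j $ l'"
  shows "i = j"
  unfolding vec_eq_iff
proof
  fix x
  show "i $ x = j $ x"
    using assms(1)[of x] assms(2,3) by (elim disjE) simp_all
qed

definition unit_digit :: "'d \<Rightarrow> nat^'d"
  where "unit_digit l = (\<chi> l'. if l' = l then 1 else 0)"

text \<open>With \<open>m\<close> the smaller side, \<open>4 * r \<le> 4 * (m - 1) < m\<^sup>2\<close>, because \<open>(m - 2)\<^sup>2\<close> is positive.\<close>
lemma growth_assumptions:
  assumes "2 \<le> r" "r < min (n $ a) (n $ b)"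
  shows "4 * r < n $ a * n $ b"
proof -
  define m where "m = min (n $ a) (n $ b)"
  have m: "r + 1 \<le> m" "3 \<le> m"
    using assms by (auto simp: m_def)
  obtain x where x: "m = x + 3"
    using m(2) by (metis add.commute le_Suc_ex)
  have "4 * r \<le> 4 * (x + 2)"
    using m(1) x by simp
  also have "\<dots> < (x + 3) * (x + 3)"
    by (simp add: algebra_simps)
  also have "\<dots> \<le> n $ a * n $ b"
    unfolding x[symmetric] m_def by (intro mult_mono) auto
  finally show ?thesis .
qed

text \<open>Recurrence turns a bound at every occurrence of a convenient digit set \<open>A\<close> into a bound
  along all large \<open>k\<close>.\<close>
lemma recurrent_rank_bound:
  assumes S: "regular r S" "recurrent r S" and A: "A \<in> digit_subsets n r"
    and bound: "\<And>j k. 1 \<le> j \<Longrightarrow> j + 1 \<le> k \<Longrightarrow> S j = A \<Longrightarrow> S (j + 1) = A \<Longrightarrow> ((\<Prod>l\<in>UNIV. n $ l) - r) ^ (j - 1) \<le> f k"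
    and m: "1 \<le> m"
  shows "eventually (\<lambda>k. \<exists>e. k \<le> e + k div m + 2 \<and> ((\<Prod>l\<in>UNIV. n $ l) - r) ^ e \<le> f k) sequentially"
proof -
  have "eventually (\<lambda>k. \<exists>j\<ge>1. j + 1 \<le> k \<and> k \<le> j + 1 + k div m \<and> S j = A \<and> S (j + 1) = A) sequentially"
    using S(2) A m unfolding recurrent_def by blast
  then show ?thesis
  proof (rule eventually_mono)
    fix k assume "\<exists>j\<ge>1. j + 1 \<le> k \<and> k \<le> j + 1 + k div m \<and> S j = A \<and> S (j + 1) = A"
    then obtain j where j: "1 \<le> j" "j + 1 \<le> k" "k \<le> j + 1 + k div m" "S j = A" "S (j + 1) = A"
      by blast
    then have "k \<le> (j - 1) + k div m + 2"
      by linarith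
    then show "\<exists>e. k \<le> e + k div m + 2 \<and> ((\<Prod>l\<in>UNIV. n $ l) - r) ^ e \<le> f k"
      using bound[OF j(1,2,4,5)] by blast
  qed
qed

text \<open>Let the convenient digit set contain the four digits with entries in \<open>{0, 1}\<close>: every word in front of it
  acquires a block.\<close>
theorem growth_H1:
  assumes S: "regular r S" "recurrent r S" and r: "1 \<le> r" "r < n $ a" "r < n $ b" "4 * r < n $ a * n $ b"
  shows "(\<lambda>k. 1 / real k * ln (real (abelian_rank (simplicial_homology 1 (fractal_nerve n S 0 k)))))
    \<longlonglongrightarrow> ln (real (n $ a) * real (n $ b) - real r)"
proof -
  let ?v = "(\<Prod>l\<in>UNIV. n $ l) - r"
  let ?f = "\<lambda>k. abelian_rank (simplicial_homology 1 (fractal_nerve n S 0 k))"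
  have V: "valid S"
    by (rule regular_valid[OF S(1)])
  have cf: "corner_free S"
    by (rule recurrent_corner_free[OF S r(1)])
  define Y where "Y = {i::nat^'d. \<forall>l. i $ l \<in> {0, 1}}"
  have Y: "Y \<subseteq> digit_set n" "card Y = 4"
  proof -
    have "i $ l < n $ l" if "i \<in> Y" for i l
    proof -
      have "i $ l \<in> {0, 1}"
        using that unfolding Y_def by blast
      then have "i $ l \<le> 1"
        by auto
      then show ?thesis
        using n_ge2[of l] by linarith
    qed
    then show "Y \<subseteq> digit_set n"
      by (auto simp: digit_set_def)
    show "card Y = 4"
      unfolding Y_def by (subst card_vec_box) (simp_all add: card_d power2_eq_square)
  qed
  have "r + card Y \<le> card (digit_set n)"
    using r Y(2) by (simp add: card_digit_set prod_all)
  then obtain A where A: "A \<in> digit_subsets n r" "Y \<subseteq> A"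
    using digit_subset_avoiding[of "{}" r Y] Y(1) by auto
  have "?v ^ (j - 1) \<le> ?f k" if j: "1 \<le> j" "j + 1 \<le> k" "S j = A" for j k
  proof -
    have base: "has_block S (Suc (j - 1)) W" if W: "W \<in> words S (j - 1)" for W
    proof (rule has_block_base[OF W])
      fix i :: "nat^'d" assume "\<And>l. i $ l \<le> 1"
      then have "i \<in> Y"
        by (auto simp: Y_def le_Suc_eq)
      then show "i \<in> S (Suc (j - 1))"
        using A(2) j by auto
    qed
    have "has_block S k W \<and> length W = j - 1" if W: "W \<in> words S (j - 1)" for W
    proof
      show len: "length W = j - 1"
        by (rule length_words[OF W])
      show "has_block S k W"
        by (rule has_block_mono[OF S(1) _ _ _ base[OF W]]) (use r(4) j len in \<open>auto simp: card_d prod_all\<close>)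
    qed
    then have "card (words S (j - 1)) \<le> ?f k"
      by (rule rank_H1_ge[OF S(1) cf r(2,3) finite_words_valid[OF V]])
    then show ?thesis
      by (simp add: card_words[OF S(1)])
  qed
  then have low: "eventually (\<lambda>k. \<exists>e. k \<le> e + k div m + 2 \<and> ?v ^ e \<le> ?f k) sequentially" if "1 \<le> m" for m
    using recurrent_rank_bound[OF S A(1) _ that, of ?f] by blast
  have "2 \<le> ?v"
    using r by (simp add: prod_all)
  then have "(\<lambda>k. 1 / real k * ln (real (?f k))) \<longlonglongrightarrow> ln (real ?v)"
    by (rule growth_limit) (use rank_H1_le[OF S(1) cf card_d] low in auto)
  moreover have "real ?v = real (n $ a) * real (n $ b) - real r"
    using r by (simp add: prod_all of_nat_diff)
  ultimately show ?thesis
    by simp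
qed

text \<open>The cell \<open>[1, 0]\<close> lies at the lower corner of the cell with digit 1 in both directions.
  Its upper and right neighbours have the last digit \<open>unit_digit l\<close>, and are missing. Its lower and
  left neighbours belong to the cells next to the one with digit \<open>1\<close>, which have one entry 0 and
  one entry 1, so their digits are again of the form \<open>unit_digit l\<close>, and are missing one level earlier.\<close>
lemma isolated_corner_cell:
  assumes V: "valid S" and W: "W \<in> words S j"
    and in1: "1 \<in> S (Suc j)" and in2: "0 \<in> S (Suc (Suc j))"
    and out: "\<And>l. unit_digit l \<notin> S (Suc j)" "\<And>l. unit_digit l \<notin> S (Suc (Suc j))"
  shows "isolated S (Suc (Suc j)) (W @ [1, 0])"
  unfolding isolated_def
proof (intro conjI ballI notI)
  let ?P = "W @ [1, 0]"
  have "(W @ [1]) @ [0] \<in> words S (Suc (Suc j))"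
    using W in1 in2 unfolding words_snoc by blast
  then show "?P \<in> words S (Suc (Suc j))"
    by simp
  fix Q assume Q: "Q \<in> words S (Suc (Suc j))" "axis_adjacent n ?P Q"
  then obtain U i' i where U: "Q = (U @ [i']) @ [i]" "U \<in> words S j" "i' \<in> S (Suc j)" "i \<in> S (Suc (Suc j))"
    unfolding words_snoc by blast
  have dig: "i' $ l < n $ l" "i $ l < n $ l" for l
    using V U by (auto simp: valid_def digit_set_def)
  have cP: "corner n ?P l = (corner n W l * n $ l + 1) * n $ l" for l
    using corner_snoc[of n "W @ [1]" 0 l] corner_snoc[of n W 1 l] by simp
  have cQ: "corner n Q l = (corner n U l * n $ l + i' $ l) * n $ l + i $ l" for l
    unfolding U(1) by (simp only: corner_snoc)
  (* a digit smaller than the base and the remaining number are determined by their sum *)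
  have decode: "x = y \<and> d = e" if "x * m + d = y * m + e" "d < m" "e < m" for x y d e m :: nat
  proof -
    have "(x * m + d) mod m = d" "(y * m + e) mod m = e" "(x * m + d) div m = x" "(y * m + e) div m = y"
      using that(2,3) by auto
    then show ?thesis
      using that(1) by metis
  qed
  have same: "i $ l = 0 \<and> i' $ l = 1" if "corner n ?P l = corner n Q l" for l
  proof -
    have "(corner n U l * n $ l + i' $ l) * n $ l + i $ l = (corner n W l * n $ l + 1) * n $ l + 0"
      using that cP cQ by simp
    then have "corner n U l * n $ l + i' $ l = corner n W l * n $ l + 1 \<and> i $ l = 0"
      by (rule decode) (use dig in auto)
    then show ?thesis
      using decode[of "corner n U l" "n $ l" "i' $ l" "corner n W l" 1] dig n_ge2[of l] by auto
  qed
  obtain l where l: "\<And>l'. l' \<noteq> l \<Longrightarrow> corner n ?P l' = corner n Q l'"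
    "corner n Q l = corner n ?P l + 1 \<or> corner n ?P l = corner n Q l + 1"
    using Q(2) unfolding axis_adjacent_def by blast
  from l(2) show False
  proof
    assume "corner n Q l = corner n ?P l + 1"
    then have "(corner n U l * n $ l + i' $ l) * n $ l + i $ l = (corner n W l * n $ l + 1) * n $ l + 1"
      using cP cQ by simp
    then have "i $ l = 1"
      using decode dig n_ge2[of l] by (metis Suc_1 Suc_le_lessD)
    then have "i = unit_digit l"
      using same l(1) by (auto simp: vec_eq_iff unit_digit_def)
    then show False
      using out(2) U(4) by simp
  next
    assume "corner n ?P l = corner n Q l + 1"
    then have "(corner n U l * n $ l + i' $ l) * n $ l + i $ l + 1 = (corner n W l * n $ l) * n $ l + n $ l"
      unfolding cP cQ by (simp only: distrib_right mult_1)
    then have "(corner n U l * n $ l + i' $ l) * n $ l + i $ l = (corner n W l * n $ l) * n $ l + (n $ l - 1)"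
      using n_pos[of l] by linarith
    then have "corner n U l * n $ l + i' $ l = corner n W l * n $ l + 0"
      using decode[of "corner n U l * n $ l + i' $ l" "n $ l" "i $ l" "corner n W l * n $ l" "n $ l - 1"] dig[of l] by simp
    then have "i' $ l = 0"
      using decode[of "corner n U l" "n $ l" "i' $ l" "corner n W l" 0] dig[of l] by simp
    obtain l' where l': "l' \<noteq> l" "\<And>x. x = l \<or> x = l'"
      using planar_cases by blast
    have "i' $ x = unit_digit l' $ x" for x
    proof (cases "x = l'")
      case True
      then show ?thesis
        using same[OF l(1)[OF l'(1)]] by (simp add: unit_digit_def)
    next
      case False
      then have "x = l"
        using l'(2)[of x] by blast
      then show ?thesis
        using \<open>i' $ l = 0\<close> l'(1) by (simp add: unit_digit_def)
    qed
    then have "i' = unit_digit l'"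
      by (simp add: vec_eq_iff)
    then show False
      using out(1) U(3) by simp
  qed
qed

text \<open>Since \<open>r \<ge> 2\<close>, there is a digit set that misses both digits \<open>unit_digit l\<close> but contains \<open>0\<close>
  and \<open>1\<close>; twice in a row it isolates a cell.\<close>
theorem growth_H0:
  assumes S: "regular r S" "recurrent r S" and r: "2 \<le> r" "r < n $ a" "r < n $ b"
  shows "(\<lambda>k. 1 / real k * ln (real (abelian_rank (simplicial_homology 0 (fractal_nerve n S 0 k)))))
    \<longlonglongrightarrow> ln (real (n $ a) * real (n $ b) - real r)"
proof -
  let ?v = "(\<Prod>l\<in>UNIV. n $ l) - r"
  let ?f = "\<lambda>k. abelian_rank (simplicial_homology 0 (fractal_nerve n S 0 k))"
  have V: "valid S"
    by (rule regular_valid[OF S(1)])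
  have cf: "corner_free S"
    by (rule recurrent_corner_free[OF S]) (use r in simp)
  have four: "4 * r < n $ a * n $ b"
    using r by (intro growth_assumptions) auto
  have n2: "1 < n $ l" for l
    using n_ge2[of l] by simp
  have X: "range unit_digit \<subseteq> digit_set n" "card (range unit_digit) \<le> r"
  proof -
    show "range unit_digit \<subseteq> digit_set n"
      using n2 by (auto simp: unit_digit_def digit_set_def)
    have "card (range unit_digit) \<le> CARD('d)"
      by (rule card_image_le) simp
    then show "card (range unit_digit) \<le> r"
      using r card_d by simp
  qed
  define Y where "Y = {0, 1 :: nat^'d}"
  have Y: "Y \<subseteq> digit_set n" "range unit_digit \<inter> Y = {}" "card Y \<le> 2"
  proof -
    show "Y \<subseteq> digit_set n"
      using n2 by (auto simp: Y_def digit_set_def)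
    have "unit_digit l \<noteq> 0" for l
      by (auto simp: vec_eq_iff unit_digit_def intro!: exI[of _ l])
    moreover have "unit_digit l \<noteq> 1" for l
    proof -
      obtain l' where "l' \<noteq> l"
        using ab by metis
      then show ?thesis
        by (auto simp: vec_eq_iff unit_digit_def)
    qed
    ultimately show "range unit_digit \<inter> Y = {}"
      by (auto simp: Y_def)
    show "card Y \<le> 2"
      unfolding Y_def by (simp add: card_insert_if)
  qed
  have "r + card Y \<le> card (digit_set n)"
    using four Y(3) r by (simp add: card_digit_set prod_all)
  then obtain A where A: "A \<in> digit_subsets n r" "A \<inter> range unit_digit = {}" "Y \<subseteq> A"
    using digit_subset_avoiding[OF X Y(1,2)] by blast
  have "?v ^ (j - 1) \<le> ?f k" if j: "1 \<le> j" "j + 1 \<le> k" "S j = A" "S (j + 1) = A" for j k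
  proof -
    have S12: "S (Suc (j - 1)) = A" "S (Suc (Suc (j - 1))) = A"
      using j by auto
    let ?I = "(\<lambda>W. W @ [1, 0]) ` words S (j - 1)"
    have "isolated S (Suc (Suc (j - 1))) P" if P: "P \<in> ?I" for P
    proof -
      obtain W where W: "P = W @ [1, 0]" "W \<in> words S (j - 1)"
        using P by blast
      show ?thesis
        unfolding W(1) by (rule isolated_corner_cell[OF V W(2)]) (use A(2,3) S12 in \<open>auto simp: Y_def\<close>)
    qed
    then have "card ?I \<le> ?f k"
      using j by (intro rank_H0_ge[OF V cf card_d, of "Suc (Suc (j - 1))" k ?I] finite_imageI finite_words_valid[OF V]) auto
    moreover have "card ?I = card (words S (j - 1))"
      by (rule card_image) (simp add: inj_on_def)
    ultimately show ?thesis
      by (simp add: card_words[OF S(1)])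
  qed
  then have low: "eventually (\<lambda>k. \<exists>e. k \<le> e + k div m + 2 \<and> ?v ^ e \<le> ?f k) sequentially" if "1 \<le> m" for m
    using recurrent_rank_bound[OF S A(1) _ that, of ?f] by blast
  have up: "?f k \<le> 2 * ?v ^ k" for k
    using rank_H0_le[OF S(1), of k] by simp
  have "2 \<le> ?v"
    using four r by (simp add: prod_all)
  then have "(\<lambda>k. 1 / real k * ln (real (?f k))) \<longlonglongrightarrow> ln (real ?v)"
    by (rule growth_limit) (use up low in auto)
  moreover have "real ?v = real (n $ a) * real (n $ b) - real r"
    using four by (simp add: prod_all of_nat_diff)
  ultimately show ?thesis
    by simp
qed

subsection \<open>Forests of cells when every side is halved\<close>

text \<open>The edges between cells with a common side, whether or not the pieces inside meet.\<close>
definition cell_graph :: "(nat \<Rightarrow> (nat^'d) set) \<Rightarrow> nat \<Rightarrow> (nat^'d) list set set"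
  where "cell_graph S k = {{u, v} |u v. u \<in> words S k \<and> v \<in> words S k \<and> axis_adjacent n u v}"

lemma lookup_bd_leaf:
  assumes z: "finite e" "v \<in> e" and only: "\<And>s. s \<in> Poly_Mapping.keys z \<Longrightarrow> s \<noteq> e \<Longrightarrow> \<not> e - {v} \<subseteq> s"
  shows "Poly_Mapping.lookup (bd z) (e - {v}) = Poly_Mapping.lookup z e * Poly_Mapping.lookup (bd (frag_of e)) (e - {v})"
proof -
  have zero: "Poly_Mapping.lookup (bd (frag_of s)) (e - {v}) = 0" if "s \<in> Poly_Mapping.keys z" "s \<noteq> e" for s
    using only[OF that] by (auto simp: bd_of lookup_sum intro!: sum.neutral)
  have "bd z = (\<Sum>s\<in>Poly_Mapping.keys z. frag_cmul (Poly_Mapping.lookup z s) (bd (frag_of s)))"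
    unfolding bd_def frag_extend_def[of _ z] by simp
  then have "Poly_Mapping.lookup (bd z) (e - {v})
      = (\<Sum>s\<in>Poly_Mapping.keys z. Poly_Mapping.lookup z s * Poly_Mapping.lookup (bd (frag_of s)) (e - {v}))"
    by (simp add: lookup_sum)
  also have "\<dots> = (\<Sum>s\<in>Poly_Mapping.keys z. if s = e then Poly_Mapping.lookup z e * Poly_Mapping.lookup (bd (frag_of e)) (e - {v}) else 0)"
    by (rule sum.cong) (use zero in auto)
  finally show ?thesis
    by (simp add: in_keys_iff)
qed

text \<open>In a cycle, the boundary at a vertex of degree 1 has nothing to cancel with.\<close>
lemma leaf_edge_zero:
  assumes "bd z = 0" "u \<noteq> v" and only: "\<And>s. s \<in> Poly_Mapping.keys z \<Longrightarrow> u \<in> s \<Longrightarrow> s = {u, v}"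
  shows "Poly_Mapping.lookup z {u, v} = 0"
proof -
  have e: "{u, v} - {v} = {u}"
    using assms(2) by auto
  have "Poly_Mapping.lookup (bd z) {u} = Poly_Mapping.lookup z {u, v} * Poly_Mapping.lookup (bd (frag_of {u, v})) {u}"
    using lookup_bd_leaf[of "{u, v}" v z] only unfolding e by auto
  moreover have "Poly_Mapping.lookup (bd (frag_of {u, v})) {u} \<noteq> 0"
    using assms(2) before_sign_sq[of v u] unfolding bd_pair[OF assms(2)] by (auto simp: lookup_minus before_sign_def)
  ultimately show ?thesis
    using assms(1) by simp
qed

lemma last_digit_missing:
  assumes S: "regular 1 S"
  obtains \<rho> where "\<rho> \<in> digit_set n" "\<And>i. i \<in> S (Suc k) \<longleftrightarrow> i \<in> digit_set n \<and> i \<noteq> \<rho>"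
proof -
  have "S (Suc k) \<subseteq> digit_set n" "card (digit_set n - S (Suc k)) = 1"
    using S by (auto simp: regular_def digit_subsets_def)
  moreover from this obtain \<rho> where "digit_set n - S (Suc k) = {\<rho>}"
    by (auto simp: card_1_singleton_iff)
  ultimately show thesis
    by (intro that[of \<rho>]) auto
qed

text \<open>Two adjacent two-by-two cells, one quarter being removed in each at the same position:
  of the two pairs of quarters along the common side one is destroyed, so at most one edge joins the
  remaining quarters. The formula says which.\<close>
lemma cross_edge_determined:
  assumes n2: "\<And>l. n $ l = 2" and S: "valid S" and mem: "\<And>i. i \<in> D \<longleftrightarrow> i \<in> digit_set n \<and> i \<noteq> \<rho>"
    and \<rho>: "\<rho> \<in> digit_set n"
    and PQ: "P \<in> words S k" "Q \<in> words S k" "P \<noteq> Q" and ij: "i \<in> D" "j \<in> D"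
    and adj: "axis_adjacent n (P @ [i]) (Q @ [j])"
  shows "i $ x = (if corner n P x = corner n Q x then 1 - \<rho> $ x else if corner n P x < corner n Q x then 1 else 0)
    \<and> j $ x = (if corner n P x = corner n Q x then 1 - \<rho> $ x else if corner n P x < corner n Q x then 0 else 1)"
proof -
  have dig: "i $ l < 2" "j $ l < 2" "\<rho> $ l < 2" for l
    using ij mem \<rho> n2 by (auto simp: digit_set_def)
  obtain l where l: "\<And>l'. l' \<noteq> l \<Longrightarrow> corner n P l' * 2 + i $ l' = corner n Q l' * 2 + j $ l'"
    "corner n Q l * 2 + j $ l = corner n P l * 2 + i $ l + 1 \<or> corner n P l * 2 + i $ l = corner n Q l * 2 + j $ l + 1"
    using adj unfolding axis_adjacent_def corner_snoc n2 by blast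
  obtain l' where l': "l' \<noteq> l" "\<And>x. x = l \<or> x = l'"
    using planar_cases by blast
  have eq': "corner n P l' = corner n Q l'" "i $ l' = j $ l'"
    using l(1)[OF l'(1)] dig(1,2)[of l'] by presburger+
  have ne: "corner n P l \<noteq> corner n Q l"
  proof
    assume "corner n P l = corner n Q l"
    then have "corner n P x = corner n Q x" for x
      using eq'(1) l'(2)[of x] by (elim disjE) simp_all
    then show False
      using words_inj[OF S PQ(1,2)] PQ(3) by blast
  qed
  have dir: "(corner n P l < corner n Q l \<and> i $ l = 1 \<and> j $ l = 0) \<or> (corner n Q l < corner n P l \<and> i $ l = 0 \<and> j $ l = 1)"
    using l(2) dig(1,2)[of l] ne by linarith
  have "i $ l' \<noteq> \<rho> $ l'"
  proof
    assume e: "i $ l' = \<rho> $ l'"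
    have "\<rho> $ l = i $ l \<or> \<rho> $ l = j $ l"
      using dir dig(3)[of l] by linarith
    then have "\<rho> = i \<or> \<rho> = j"
    proof
      assume "\<rho> $ l = i $ l"
      then have "\<rho> = i"
        by (rule vec_eq_two[OF l'(2)]) (simp add: e)
      then show ?thesis ..
    next
      assume "\<rho> $ l = j $ l"
      then have "\<rho> = j"
        by (rule vec_eq_two[OF l'(2)]) (simp add: e flip: eq'(2))
      then show ?thesis ..
    qed
    then show False
      using ij mem by blast
  qed
  then have "i $ l' = 1 - \<rho> $ l'"
    using dig(1,3)[of l'] by linarith
  from l'(2)[of x] show ?thesis
  proof
    assume "x = l"
    then show ?thesis
      using dir by auto
  next
    assume "x = l'"
    then show ?thesis
      using \<open>i $ l' = 1 - \<rho> $ l'\<close> eq' by simp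
  qed
qed

text \<open>The three quarters that remain of a cell form a path whose middle is opposite to the
  missing one.\<close>
lemma fibre_neighbour:
  assumes n2: "\<And>l. n $ l = 2" and mem: "\<And>i. i \<in> D \<longleftrightarrow> i \<in> digit_set n \<and> i \<noteq> \<rho>" and \<rho>: "\<rho> \<in> digit_set n"
    and ij: "i \<in> D" "j \<in> D" "axis_adjacent n (P @ [i]) (P @ [j])" and no: "i \<noteq> (\<chi> l. 1 - \<rho> $ l)"
  shows "j = (\<chi> l. 1 - \<rho> $ l)"
proof -
  have dig: "i $ l < 2" "j $ l < 2" "\<rho> $ l < 2" for l
    using ij mem \<rho> n2 by (auto simp: digit_set_def)
  obtain l where l: "\<And>l'. l' \<noteq> l \<Longrightarrow> i $ l' = j $ l'" "j $ l = i $ l + 1 \<or> i $ l = j $ l + 1"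
    using ij(3) unfolding axis_adjacent_def corner_snoc n2 by auto
  obtain l' where l': "l' \<noteq> l" "\<And>x. x = l \<or> x = l'"
    using planar_cases by blast
  have e': "i $ l' = j $ l'"
    by (rule l(1)[OF l'(1)])
  have neq: "(\<rho> $ l \<noteq> i $ l \<or> \<rho> $ l' \<noteq> i $ l') \<and> (\<rho> $ l \<noteq> j $ l \<or> \<rho> $ l' \<noteq> j $ l') \<and> (i $ l \<noteq> 1 - \<rho> $ l \<or> i $ l' \<noteq> 1 - \<rho> $ l')"
  proof (intro conjI)
    show "\<rho> $ l \<noteq> i $ l \<or> \<rho> $ l' \<noteq> i $ l'"
      using ij(1) mem[of i] vec_eq_two[OF l'(2), of \<rho> i] by blast
    show "\<rho> $ l \<noteq> j $ l \<or> \<rho> $ l' \<noteq> j $ l'"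
      using ij(2) mem[of j] vec_eq_two[OF l'(2), of \<rho> j] by blast
    show "i $ l \<noteq> 1 - \<rho> $ l \<or> i $ l' \<noteq> 1 - \<rho> $ l'"
    proof (rule ccontr)
      assume "\<not> ?thesis"
      then have "i = (\<chi> l. 1 - \<rho> $ l)"
        by (intro vec_eq_two[OF l'(2)]) simp_all
      then show False
        using no by blast
    qed
  qed
  have bit: "m = 0 \<or> m = 1" if "m < 2" for m :: nat
    using that by linarith
  have "\<rho> $ l = i $ l \<or> \<rho> $ l = j $ l"
    using l(2) bit[OF dig(1)[of l]] bit[OF dig(2)[of l]] bit[OF dig(3)[of l]] by (elim disjE) simp_all
  then have "\<rho> $ l' \<noteq> i $ l'"
    using neq e' by auto
  then have il': "i $ l' = 1 - \<rho> $ l'"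
    using bit[OF dig(1)[of l']] bit[OF dig(3)[of l']] by (elim disjE) simp_all
  then have "i $ l \<noteq> 1 - \<rho> $ l"
    using neq by blast
  then have "j $ l = 1 - \<rho> $ l"
    using l(2) bit[OF dig(1)[of l]] bit[OF dig(2)[of l]] bit[OF dig(3)[of l]] by (elim disjE) simp_all
  then have "j $ l = 1 - \<rho> $ l \<and> j $ l' = 1 - \<rho> $ l'"
    using il' e' by simp
  then show ?thesis
    by (intro vec_eq_two[OF l'(2)]) simp_all
qed

lemma frag_of_mem: "s \<in> F \<Longrightarrow> frag_of s \<in> frags F"
  by (simp add: frags_def)

text \<open>Induction on the level. Forgetting the last digit maps a cycle to a cycle of the
  previous level, which vanishes by the induction hypothesis. As an edge between two different
  parent cells is the only one between them, it has coefficient zero. The edges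
  within a parent cell form a path of three cells, whose ends are now leaves.\<close>
theorem cell_graph_acyclic:
  assumes n2: "\<And>l. n $ l = 2" and S: "regular 1 S" and z: "z \<in> frags (cell_graph S k)" "bd z = 0"
  shows "z = 0"
  using z
proof (induction k arbitrary: z)
  case 0
  have "cell_graph S 0 = {}"
    by (simp add: cell_graph_def axis_adjacent_irrefl)
  then show ?case
    using 0 by (simp add: frags_def)
next
  case (Suc k)
  have V: "valid S"
    by (rule regular_valid[OF S])
  obtain \<rho> where \<rho>: "\<rho> \<in> digit_set n" and mem: "\<And>i. i \<in> S (Suc k) \<longleftrightarrow> i \<in> digit_set n \<and> i \<noteq> \<rho>"
    using last_digit_missing[OF S] by blast
  have split: "w = butlast w @ [last w] \<and> butlast w \<in> words S k \<and> last w \<in> S (Suc k)" if "w \<in> words S (Suc k)" for w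
    using that by (auto simp: words_snoc)
  have keys: "s \<in> cell_graph S (Suc k)" if "s \<in> Poly_Mapping.keys z" for s
    using Suc.prems(1) that by (auto simp: frags_def)
  have fin: "finite s" if "s \<in> cell_graph S m" for s m
    using that by (auto simp: cell_graph_def)
  have push: "pushforward butlast (frag_of s) \<in> frags (cell_graph S k)" if s: "s \<in> cell_graph S (Suc k)" for s
  proof (cases "inj_on butlast s")
    case True
    obtain u v where uv: "s = {u, v}" "u \<in> words S (Suc k)" "v \<in> words S (Suc k)" "axis_adjacent n u v"
      using s by (auto simp: cell_graph_def)
    have tk: "butlast u = take k u" "butlast v = take k v"
      using length_words[OF uv(2)] length_words[OF uv(3)] by (simp_all add: butlast_conv_take)
    have "u \<noteq> v"
      using uv(4) axis_adjacent_irrefl by blast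
    then have "take k u \<noteq> take k v"
      using True uv(1) tk by (auto simp: inj_on_def)
    then have "axis_adjacent n (take k u) (take k v)"
      using prefix_adjacent[OF V uv(2-4)] by simp
    then have "butlast ` s \<in> cell_graph S k"
      using split[OF uv(2)] split[OF uv(3)] tk unfolding cell_graph_def uv(1) by auto
    then show ?thesis
      using True fin[OF s] add_subgroup_cmul[OF add_subgroup_frags frag_of_mem] by (simp add: pushforward_of)
  next
    case False
    then show ?thesis
      using fin[OF s] by (simp add: pushforward_of add_subgroup_0)
  qed
  have expand: "pushforward butlast z = (\<Sum>s\<in>Poly_Mapping.keys z. frag_cmul (Poly_Mapping.lookup z s) (pushforward butlast (frag_of s)))"
    unfolding simplicial_chain_map_def frag_extend_def[of _ z] by simp
  have "pushforward butlast z \<in> frags (cell_graph S k)"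
    unfolding expand by (intro add_subgroup_sum add_subgroup_cmul add_subgroup_frags push keys)
  moreover have "bd (pushforward butlast z) = 0"
    using bd_pushforward[of z butlast] fin keys Suc.prems(2) by auto
  ultimately have push0: "pushforward butlast z = 0"
    by (rule Suc.IH)
  have fibre: "butlast u = butlast v" if e: "{u, v} \<in> Poly_Mapping.keys z" "axis_adjacent n u v"
      "u \<in> words S (Suc k)" "v \<in> words S (Suc k)" for u v
  proof (rule ccontr)
    assume ne: "butlast u \<noteq> butlast v"
    have inj: "inj_on butlast {u, v}"
      using ne by (auto simp: inj_on_def)
    have uniq: "s = {u, v}" if s: "s \<in> cell_graph S (Suc k)" "butlast ` s = butlast ` {u, v}" for s
    proof -
      obtain u' v' where s': "s = {u', v'}" "u' \<in> words S (Suc k)" "v' \<in> words S (Suc k)" "axis_adjacent n u' v'"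
        using s(1) by (auto simp: cell_graph_def)
      have main: "x = u \<and> y = v" if xy: "x \<in> words S (Suc k)" "y \<in> words S (Suc k)" "axis_adjacent n x y"
        "butlast x = butlast u" "butlast y = butlast v" for x y
      proof -
        have ax: "axis_adjacent n (butlast u @ [last x]) (butlast v @ [last y])"
          using split[OF xy(1)] split[OF xy(2)] xy(3-5) by metis
        have au: "axis_adjacent n (butlast u @ [last u]) (butlast v @ [last v])"
          using split[OF e(3)] split[OF e(4)] e(2) by metis
        have bu: "butlast u \<in> words S k" "butlast v \<in> words S k"
          using split[OF e(3)] split[OF e(4)] by auto
        have "last x $ l = last u $ l \<and> last y $ l = last v $ l" for l
          using cross_edge_determined[OF n2 V mem \<rho> bu ne _ _ ax, of l]
            cross_edge_determined[OF n2 V mem \<rho> bu ne _ _ au, of l]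
            split[OF xy(1)] split[OF xy(2)] split[OF e(3)] split[OF e(4)] by simp
        then have "last x = last u" "last y = last v"
          by (simp_all add: vec_eq_iff)
        then show ?thesis
          using split[OF xy(1)] split[OF xy(2)] split[OF e(3)] split[OF e(4)] xy(4,5) by metis
      qed
      have "{butlast u', butlast v'} = {butlast u, butlast v}"
        using s(2) s'(1) by simp
      then consider "butlast u' = butlast u" "butlast v' = butlast v" | "butlast v' = butlast u" "butlast u' = butlast v"
        by (auto simp: doubleton_eq_iff)
      then show ?thesis
      proof cases
        case 1
        then show ?thesis
          using main[OF s'(2,3,4)] s'(1) by simp
      next
        case 2
        then show ?thesis
          using main[OF s'(3,2) axis_adjacent_sym[OF s'(4)]] s'(1) by (simp add: insert_commute)
      qed
    qed
    have "Poly_Mapping.lookup (pushforward butlast z) (butlast ` {u, v})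
        = (\<Sum>s\<in>Poly_Mapping.keys z. Poly_Mapping.lookup z s * Poly_Mapping.lookup (pushforward butlast (frag_of s)) (butlast ` {u, v}))"
      unfolding expand by (simp add: lookup_sum)
    also have "\<dots> = (\<Sum>s\<in>Poly_Mapping.keys z. if s = {u, v} then Poly_Mapping.lookup z {u, v} * inversion_sign butlast {u, v} else 0)"
    proof (rule sum.cong)
      fix s assume s: "s \<in> Poly_Mapping.keys z"
      show "Poly_Mapping.lookup z s * Poly_Mapping.lookup (pushforward butlast (frag_of s)) (butlast ` {u, v})
          = (if s = {u, v} then Poly_Mapping.lookup z {u, v} * inversion_sign butlast {u, v} else 0)"
      proof (cases "s = {u, v}")
        case True
        then show ?thesis
          using inj by (simp add: pushforward_of)
      next
        case False
        then have "butlast ` s \<noteq> butlast ` {u, v}"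
          using uniq keys[OF s] by blast
        then show ?thesis
          using False fin[OF keys[OF s]] by (auto simp: pushforward_of)
      qed
    qed simp
    also have "\<dots> = Poly_Mapping.lookup z {u, v} * inversion_sign butlast {u, v}"
      using e(1) by simp
    finally have "Poly_Mapping.lookup z {u, v} * inversion_sign butlast {u, v} = 0"
      by (simp add: push0)
    moreover have "inversion_sign butlast {u, v} \<noteq> 0"
      by (metis inversion_sign_sq mult_zero_left zero_neq_one)
    ultimately show False
      using e(1) by (simp add: in_keys_iff)
  qed
  (* the middle one of the three remaining quarters, opposite to the missing one *)
  let ?o = "(\<chi> l. 1 - \<rho> $ l) :: nat^'d"
  have leaf: False if e: "{u, v} \<in> Poly_Mapping.keys z" "axis_adjacent n u v" "u \<in> words S (Suc k)" "v \<in> words S (Suc k)"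
    and lu: "last u \<noteq> ?o" for u v
  proof -
    have other: "w = butlast u @ [?o]" if w: "w \<in> words S (Suc k)" "axis_adjacent n u w" "{u, w} \<in> Poly_Mapping.keys z" for w
    proof -
      have b: "butlast u = butlast w"
        by (rule fibre[OF w(3,2) e(3) w(1)])
      have "axis_adjacent n (butlast u @ [last u]) (butlast u @ [last w])"
        using split[OF e(3)] split[OF w(1)] w(2) b by metis
      then have "last w = ?o"
        using fibre_neighbour[OF n2 mem \<rho> _ _ _ lu] split[OF e(3)] split[OF w(1)] by blast
      then show ?thesis
        using split[OF w(1)] b by metis
    qed
    have "Poly_Mapping.lookup z {u, v} = 0"
    proof (rule leaf_edge_zero[OF Suc.prems(2)])
      show "u \<noteq> v"
        using e(2) axis_adjacent_irrefl by blast
      fix s assume s: "s \<in> Poly_Mapping.keys z" "u \<in> s"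
      obtain x y where xy: "s = {x, y}" "x \<in> words S (Suc k)" "y \<in> words S (Suc k)" "axis_adjacent n x y"
        using keys[OF s(1)] by (auto simp: cell_graph_def)
      obtain w where w: "s = {u, w}" "w \<in> words S (Suc k)" "axis_adjacent n u w"
      proof (cases "u = x")
        case True
        then show ?thesis
          using that[of y] xy by simp
      next
        case False
        then show ?thesis
          using that[of x] xy s(2) axis_adjacent_sym[OF xy(4)] by (auto simp: insert_commute)
      qed
      have "w = butlast u @ [?o]"
        using other[OF w(2,3)] s(1) w(1) by simp
      moreover have "v = butlast u @ [?o]"
        by (rule other[OF e(4,2,1)])
      ultimately show "s = {u, v}"
        using w(1) by simp
    qed
    then show False
      using e(1) by (simp add: in_keys_iff)
  qed
  have "Poly_Mapping.keys z = {}"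
  proof (rule ccontr)
    assume "Poly_Mapping.keys z \<noteq> {}"
    then obtain s where s: "s \<in> Poly_Mapping.keys z"
      by blast
    obtain u v where uv: "s = {u, v}" "u \<in> words S (Suc k)" "v \<in> words S (Suc k)" "axis_adjacent n u v"
      using keys[OF s] by (auto simp: cell_graph_def)
    have lu: "last u = ?o"
      using leaf[of u v] s uv by blast
    have lv: "last v = ?o"
      using leaf[of v u] s uv axis_adjacent_sym[OF uv(4)] by (auto simp: insert_commute)
    have "butlast u = butlast v"
      using fibre[of u v] s uv by blast
    then have "u = v"
      using split[OF uv(2)] split[OF uv(3)] lu lv by metis
    then show False
      using uv(4) axis_adjacent_irrefl by blast
  qed
  then show ?case
    by simp
qed

text \<open>All edges of the nerve belong to the graph of adjacent cells, which is a forest.\<close>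
theorem nerve_acyclic_two_by_two:
  assumes n2: "\<And>l. n $ l = 2" and S: "regular 1 S" "corner_free S"
  shows "acyclic_at (fractal_nerve n S 0 k) 2"
  unfolding acyclic_at_def
proof (intro ballI impI)
  fix z assume z: "z \<in> frags (simplices (fractal_nerve n S 0 k) 2)" "bd z = 0"
  have "simplices (fractal_nerve n S 0 k) 2 \<subseteq> cell_graph S k"
  proof
    fix s assume "s \<in> simplices (fractal_nerve n S 0 k) 2"
    then show "s \<in> cell_graph S k"
      using edge_form[OF regular_valid[OF S(1)] S(2) card_d] unfolding cell_graph_def by blast
  qed
  then have "z \<in> frags (cell_graph S k)"
    using z(1) frags_mono by blast
  then have "z = bd 0"
    using cell_graph_acyclic[OF n2 S(1) _ z(2)] by simp
  then show "z \<in> bd ` frags (simplices (fractal_nerve n S 0 k) (Suc 2))"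
    using add_subgroup_0[OF add_subgroup_frags] by blast
qed

end

section \<open>Cech homology and fine coverings\<close>

definition simplicial_map :: "('v \<Rightarrow> 'w) \<Rightarrow> 'v set set \<Rightarrow> 'w set set \<Rightarrow> bool"
  where "simplicial_map f K L \<longleftrightarrow> (\<forall>s\<in>K. f ` s \<in> L)"

lemma pushforward_chain:
  assumes K: "finite_complex K" and f: "simplicial_map f K L" and c: "c \<in> frags (simplices K m)"
  shows "pushforward f c \<in> frags (simplices L m)"
  unfolding simplicial_chain_map_def
proof (rule frag_extend_frags[OF c])
  fix s assume s: "s \<in> simplices K m"
  then have "f ` s \<in> L" "card s = m"
    using f by (auto simp: simplices_def simplicial_map_def)
  then have "f ` s \<in> simplices L m" if "inj_on f s"
    using that by (simp add: simplices_def card_image)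
  then show "(if inj_on f s then frag_cmul ((- 1) ^ card {(u, v) \<in> s \<times> s. vertex_less u v \<and> vertex_less (f v) (f u)}) (frag_of (f ` s)) else 0)
      \<in> frags (simplices L m)"
    by (auto simp: frags_def)
qed

lemma pushforward_bd:
  assumes K: "finite_complex K" and c: "c \<in> frags (simplices K m)"
  shows "bd (pushforward f c) = pushforward f (bd c)"
  by (rule bd_pushforward) (rule finite_complex.chain_finite[OF K c])

lemma pushforward_boundaries:
  assumes K: "finite_complex K" and L: "finite_complex L" and f: "simplicial_map f K L" and c: "c \<in> boundaries K q"
  shows "pushforward f c \<in> boundaries L q"
proof -
  obtain d where d: "d \<in> frags (simplices K (Suc (Suc q)))" "c = bd d"
    using c unfolding finite_complex.boundaries_eq[OF K] by blast
  then have "pushforward f c = bd (pushforward f d)"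
    by (simp add: pushforward_bd[OF K d(1)])
  then show ?thesis
    using pushforward_chain[OF K f d(1)] unfolding finite_complex.boundaries_eq[OF L] by blast
qed

lemma pushforward_cycles:
  assumes K: "finite_complex K" and L: "finite_complex L" and f: "simplicial_map f K L" and c: "c \<in> cycles K q"
  shows "pushforward f c \<in> cycles L q"
proof -
  have ck: "c \<in> frags (simplices K (Suc q))" "boundary_map q c = 0"
    using c by (auto simp: cycles_def)
  have pk: "pushforward f c \<in> frags (simplices L (Suc q))"
    by (rule pushforward_chain[OF K f ck(1)])
  have "boundary_map q (pushforward f c) = 0"
  proof (cases q)
    case 0
    then show ?thesis
      by (simp add: boundary_map_def)
  next
    case (Suc p)
    have "bd c = 0"
      using ck finite_complex.boundary_map_Suc[OF K ck(1), of p] Suc by simp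
    then have "bd (pushforward f c) = 0"
      using pushforward_bd[OF K ck(1), of f] by simp
    then show ?thesis
      using finite_complex.boundary_map_Suc[OF L pk, of p] Suc by simp
  qed
  then show ?thesis
    using pk by (simp add: cycles_def)
qed

text \<open>The induced map is defined on cosets as sets of cycles; the boundaries of the target
  absorb the image of the boundaries of the source.\<close>
lemma hom_induced_coset:
  assumes K: "finite_complex K" and L: "finite_complex L" and f: "simplicial_map f K L"
  shows "simplicial_hom_induced q L f (coset_of (boundaries K q) z) = coset_of (boundaries L q) (pushforward f z)"
proof -
  have eq: "boundaries L q #>\<^bsub>cycle_group L q\<^esub> pushforward f c = coset_of (boundaries L q) (pushforward f z)"
    if "c \<in> coset_of (boundaries K q) z" for c
  proof -
    have "c - z \<in> boundaries K q"
      using that by (simp add: mem_coset_of)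
    then have "pushforward f c - pushforward f z \<in> boundaries L q"
      using pushforward_boundaries[OF K L f] by (metis pushforward_diff)
    then show ?thesis
      unfolding finite_complex.cycle_group_eq[OF L] r_coset_frag_group
      by (simp add: coset_of_eq_iff[OF finite_complex.add_subgroup_boundaries[OF L]])
  qed
  have "z \<in> coset_of (boundaries K q) z"
    using add_subgroup_0[OF finite_complex.add_subgroup_boundaries[OF K]] by (simp add: mem_coset_of)
  then have "(\<lambda>c. boundaries L q #>\<^bsub>cycle_group L q\<^esub> pushforward f c) ` coset_of (boundaries K q) z
      = {coset_of (boundaries L q) (pushforward f z)}"
    using eq by (auto intro!: image_eqI[of _ _ z])
  then show ?thesis
    by (simp add: simplicial_hom_induced_def)
qed

text \<open>Sorting the images and sorting back undo each other.\<close>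
lemma inversion_sign_inverse:
  assumes "\<And>v. v \<in> s \<Longrightarrow> f (g v) = v"
  shows "inversion_sign f (g ` s) = inversion_sign g s"
proof -
  have inj: "inj_on g s"
    using assms by (metis inj_onI)
  have "inversion_sign f (g ` s) = (\<Prod>u\<in>s. \<Prod>v\<in>s. if vertex_less (g u) (g v) \<and> vertex_less (f (g v)) (f (g u)) then - 1 else 1)"
    unfolding inversion_sign_def by (simp add: prod.reindex[OF inj])
  also have "\<dots> = (\<Prod>u\<in>s. \<Prod>v\<in>s. if vertex_less v u \<and> vertex_less (g u) (g v) then - 1 else 1)"
    by (intro prod.cong refl if_cong) (auto simp: assms)
  also have "\<dots> = inversion_sign g s"
    unfolding inversion_sign_def by (rule prod.swap)
  finally show ?thesis .
qed

lemma pushforward_inverse: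
  assumes "\<And>s v. s \<in> Poly_Mapping.keys c \<Longrightarrow> v \<in> s \<Longrightarrow> f (g v) = v" "\<And>s. s \<in> Poly_Mapping.keys c \<Longrightarrow> finite s"
  shows "pushforward f (pushforward g c) = c"
proof (rule frag_linear_ext[where F = "\<lambda>c. pushforward f (pushforward g c)" and G = "\<lambda>c. c"])
  fix s assume s: "s \<in> Poly_Mapping.keys c"
  have fg: "\<And>v. v \<in> s \<Longrightarrow> f (g v) = v" and fin: "finite s"
    using assms s by blast+
  have inj: "inj_on g s" "inj_on f (g ` s)"
    using fg by (metis inj_onI, auto simp: inj_on_def)
  have sign: "inversion_sign f (g ` s) = inversion_sign g s"
    by (rule inversion_sign_inverse) (rule fg)
  have "f ` g ` s = s"
    using fg by force
  then show "pushforward f (pushforward g (frag_of s)) = frag_of s"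
    using fin inj sign by (simp add: pushforward_of pushforward_cmul)
qed (simp_all add: pushforward_diff)

lemma nerve_cover_complex: "\<U> \<in> finite_open_covers X \<Longrightarrow> finite_complex (nerve_complex \<U> id)"
  by (rule finite_complex_nerve) (simp add: finite_open_covers_def)

lemma refinement_simplicial:
  assumes p: "refinement_projection p \<V> \<U>"
  shows "simplicial_map p (nerve_complex \<V> id) (nerve_complex \<U> id)"
  unfolding simplicial_map_def
proof
  fix s assume s: "s \<in> nerve_complex \<V> id"
  then obtain x where "\<And>V. V \<in> s \<Longrightarrow> x \<in> V" "s \<subseteq> \<V>" "finite s" "s \<noteq> {}"
    by (auto simp: nerve_complex_def)
  moreover from this have "x \<in> p V" if "V \<in> s" for V
    using p that unfolding refinement_projection_def by blast
  then have "x \<in> (\<Inter>V\<in>p ` s. id V)"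
    by simp
  then have "(\<Inter>V\<in>p ` s. id V) \<noteq> {}"
    by blast
  moreover have "p ` s \<subseteq> \<U>"
    using p \<open>s \<subseteq> \<V>\<close> by (auto simp: refinement_projection_def)
  ultimately show "p ` s \<in> nerve_complex \<U> id"
    unfolding nerve_complex_def by blast
qed

lemma cover_homology_carrier:
  assumes "\<U> \<in> finite_open_covers X"
  shows "carrier (simplicial_homology q (nerve_complex \<U> id)) = coset_of (boundaries (nerve_complex \<U> id) q) ` cycles (nerve_complex \<U> id) q"
    and "\<one>\<^bsub>simplicial_homology q (nerve_complex \<U> id)\<^esub> = boundaries (nerve_complex \<U> id) q"
    and "x \<in> cycles (nerve_complex \<U> id) q \<Longrightarrow> y \<in> cycles (nerve_complex \<U> id) q \<Longrightarrow>
      coset_of (boundaries (nerve_complex \<U> id) q) x \<otimes>\<^bsub>simplicial_homology q (nerve_complex \<U> id)\<^esub> coset_of (boundaries (nerve_complex \<U> id) q) y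
      = coset_of (boundaries (nerve_complex \<U> id) q) (x + y)"
proof -
  interpret finite_complex "nerve_complex \<U> id"
    by (rule nerve_cover_complex[OF assms])
  interpret quotient_pair "boundaries (nerve_complex \<U> id) q" "cycles (nerve_complex \<U> id) q"
    by (rule quotient_pair_homology)
  show "carrier (simplicial_homology q (nerve_complex \<U> id)) = coset_of (boundaries (nerve_complex \<U> id) q) ` cycles (nerve_complex \<U> id) q"
    unfolding homology_eq by (rule carrier_quotient)
  show "\<one>\<^bsub>simplicial_homology q (nerve_complex \<U> id)\<^esub> = boundaries (nerve_complex \<U> id) q"
    unfolding homology_eq by (rule one_quotient)
  show "coset_of (boundaries (nerve_complex \<U> id) q) x \<otimes>\<^bsub>simplicial_homology q (nerve_complex \<U> id)\<^esub> coset_of (boundaries (nerve_complex \<U> id) q) y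
      = coset_of (boundaries (nerve_complex \<U> id) q) (x + y)"
    if "x \<in> cycles (nerve_complex \<U> id) q" "y \<in> cycles (nerve_complex \<U> id) q"
    unfolding homology_eq by (rule mult_quotient[OF that])
qed

lemma cech_carrier: "x \<in> carrier (cech_homology q X) \<longleftrightarrow>
    x \<in> (\<Pi>\<^sub>E \<U>\<in>finite_open_covers X. carrier (simplicial_homology q (nerve_complex \<U> id))) \<and>
    (\<forall>\<U>\<in>finite_open_covers X. \<forall>\<V>\<in>finite_open_covers X. \<forall>p. refinement_projection p \<V> \<U> \<longrightarrow>
      simplicial_hom_induced q (nerve_complex \<U> id) p (x \<V>) = x \<U>)"
  by (simp add: cech_homology_def Let_def)

lemma cech_mult: "x \<otimes>\<^bsub>cech_homology q X\<^esub> y = (\<lambda>\<U>\<in>finite_open_covers X. x \<U> \<otimes>\<^bsub>simplicial_homology q (nerve_complex \<U> id)\<^esub> y \<U>)"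
  and cech_one: "\<one>\<^bsub>cech_homology q X\<^esub> = (\<lambda>\<U>\<in>finite_open_covers X. \<one>\<^bsub>simplicial_homology q (nerve_complex \<U> id)\<^esub>)"
  by (simp_all add: cech_homology_def Let_def)

text \<open>A compatible family is determined at \<open>\<U>\<close> by its value at any refinement, and the value at a
  refinement with vanishing homology is zero.\<close>
theorem cech_homology_trivial:
  assumes refine: "\<And>\<U>. \<U> \<in> finite_open_covers X \<Longrightarrow> \<exists>\<V>\<in>finite_open_covers X. \<exists>p. refinement_projection p \<V> \<U>
      \<and> cycles (nerve_complex \<V> id) q \<subseteq> boundaries (nerve_complex \<V> id) q"
  shows "trivial_group (cech_homology q X)"
proof -
  let ?C = "cech_homology q X"
  let ?B = "\<lambda>\<U>. boundaries (nerve_complex \<U> id) q"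
  have one: "\<one>\<^bsub>?C\<^esub> = (\<lambda>\<U>\<in>finite_open_covers X. ?B \<U>)"
    unfolding cech_one by (rule restrict_ext) (simp add: cover_homology_carrier)
  have zero_cycle: "0 \<in> cycles (nerve_complex \<U> id) q" if "\<U> \<in> finite_open_covers X" for \<U>
    by (rule add_subgroup_0[OF finite_complex.add_subgroup_cycles[OF nerve_cover_complex[OF that]]])
  have B_carrier: "?B \<U> \<in> carrier (simplicial_homology q (nerve_complex \<U> id))" if "\<U> \<in> finite_open_covers X" for \<U>
    unfolding cover_homology_carrier(1)[OF that] using zero_cycle[OF that] by (intro image_eqI[of _ _ 0]) auto
  have B_induced: "simplicial_hom_induced q (nerve_complex \<U> id) p (?B \<V>) = ?B \<U>"
    if "\<U> \<in> finite_open_covers X" "\<V> \<in> finite_open_covers X" "refinement_projection p \<V> \<U>" for \<U> \<V> p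
    using hom_induced_coset[OF nerve_cover_complex[OF that(2)] nerve_cover_complex[OF that(1)] refinement_simplicial[OF that(3)], of q 0]
    by simp
  have "x \<U> = ?B \<U>" if x: "x \<in> carrier ?C" and U: "\<U> \<in> finite_open_covers X" for x \<U>
  proof -
    obtain \<V> p where V: "\<V> \<in> finite_open_covers X" and p: "refinement_projection p \<V> \<U>"
      and acyc: "cycles (nerve_complex \<V> id) q \<subseteq> ?B \<V>"
      using refine[OF U] by blast
    have "x \<V> \<in> carrier (simplicial_homology q (nerve_complex \<V> id))"
      using x V unfolding cech_carrier by (auto simp: PiE_def Pi_def)
    then obtain z where "z \<in> ?B \<V>" "x \<V> = coset_of (?B \<V>) z"
      unfolding cover_homology_carrier(1)[OF V] using acyc by blast
    then have "x \<V> = ?B \<V>"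
      using coset_of_eq_iff[OF finite_complex.add_subgroup_boundaries[OF nerve_cover_complex[OF V]], of q z 0] by simp
    moreover have "simplicial_hom_induced q (nerve_complex \<U> id) p (x \<V>) = x \<U>"
      using x U V p unfolding cech_carrier by blast
    ultimately show ?thesis
      using B_induced[OF U V p] by simp
  qed
  then have sub: "x = \<one>\<^bsub>?C\<^esub>" if "x \<in> carrier ?C" for x
    unfolding one using that by (intro extensionalityI[of _ "finite_open_covers X"]) (auto simp: cech_carrier PiE_def)
  have mem: "\<one>\<^bsub>?C\<^esub> \<in> carrier ?C"
    unfolding cech_carrier one using B_carrier B_induced by auto
  have mult: "\<one>\<^bsub>?C\<^esub> \<otimes>\<^bsub>?C\<^esub> \<one>\<^bsub>?C\<^esub> = \<one>\<^bsub>?C\<^esub>"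
    unfolding cech_mult one
  proof (rule restrict_ext)
    fix \<U> assume U: "\<U> \<in> finite_open_covers X"
    show "(\<lambda>\<U>\<in>finite_open_covers X. ?B \<U>) \<U> \<otimes>\<^bsub>simplicial_homology q (nerve_complex \<U> id)\<^esub> (\<lambda>\<U>\<in>finite_open_covers X. ?B \<U>) \<U> = ?B \<U>"
      using cover_homology_carrier(3)[OF U zero_cycle[OF U] zero_cycle[OF U]] U by simp
  qed
  have carr: "carrier ?C = {\<one>\<^bsub>?C\<^esub>}"
    using sub mem by blast
  moreover have "Group.group ?C"
  proof (rule groupI)
    show "\<one>\<^bsub>?C\<^esub> \<in> carrier ?C"
      by (rule mem)
  qed (simp_all add: carr mult)
  ultimately show ?thesis
    by (simp add: trivial_group_def)
qed

subsection \<open>Thickening closed coverings\<close>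

text \<open>The distance to a closed set attains a positive minimum on a disjoint compact set.\<close>
lemma infdist_positive_margin:
  fixes F :: "'a::metric_space set"
  assumes K: "compact K" and F: "closed F" "F \<noteq> {}" and disj: "K \<inter> F = {}"
  shows "eventually (\<lambda>e. \<forall>x\<in>K. \<not> infdist x F < e) (at_right 0)"
proof (cases "K = {}")
  case False
  have "continuous_on K (\<lambda>x. infdist x F)"
    by (intro continuous_on_infdist continuous_on_id)
  from continuous_attains_inf[OF K False this]
  obtain x where x: "x \<in> K" "\<And>y. y \<in> K \<Longrightarrow> infdist x F \<le> infdist y F"
    by blast
  have "0 < infdist x F"
    using x(1) disj infdist_pos_not_in_closed[OF F] by blast
  then have "eventually (\<lambda>e. e < infdist x F) (at_right 0)"
    by (auto simp: eventually_at_right_field)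
  then show ?thesis
    by (rule eventually_mono) (use x(2) in force)
qed simp

text \<open>The sum of the distances to the sets \<open>F w\<close> has a positive minimum on \<open>J\<close>, as they have no
  common point. A point close to all of them would make this sum smaller.\<close>
lemma thickening_common_point:
  fixes F :: "'i \<Rightarrow> 'a::metric_space set"
  assumes J: "compact J" and s: "finite s" "s \<noteq> {}" and F: "\<And>w. w \<in> s \<Longrightarrow> closed (F w) \<and> F w \<noteq> {} \<and> F w \<subseteq> J"
    and disj: "(\<Inter>w\<in>s. F w) = {}"
  shows "eventually (\<lambda>e. (\<Inter>w\<in>s. {x \<in> J. infdist x (F w) < e}) = {}) (at_right 0)"
proof (cases "J = {}")
  case True
  then show ?thesis
    using s by auto
next
  case False
  define g where "g x = (\<Sum>w\<in>s. infdist x (F w))" for x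
  have "continuous_on J g"
    unfolding g_def by (intro continuous_on_sum continuous_on_infdist continuous_on_id)
  then obtain x where x: "x \<in> J" "\<And>y. y \<in> J \<Longrightarrow> g x \<le> g y"
    using continuous_attains_inf[OF J False] by blast
  obtain w where w: "w \<in> s" "x \<notin> F w"
    using disj by blast
  then have "0 < infdist x (F w)"
    using F[OF w(1)] infdist_pos_not_in_closed by blast
  also have "\<dots> \<le> g x"
    unfolding g_def using w(1) s(1) by (intro member_le_sum) (auto simp: infdist_nonneg)
  finally have pos: "0 < g x / card s"
    using s by (simp add: card_gt_0_iff)
  have "eventually (\<lambda>e. e < g x / card s) (at_right 0)"
    using pos by (auto simp: eventually_at_right_field)
  then show ?thesis
  proof (rule eventually_mono)
    fix e assume e: "e < g x / card s"
    show "(\<Inter>w\<in>s. {x \<in> J. infdist x (F w) < e}) = {}"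
    proof (rule ccontr)
      assume "(\<Inter>w\<in>s. {x \<in> J. infdist x (F w) < e}) \<noteq> {}"
      then obtain y where y: "\<And>w. w \<in> s \<Longrightarrow> y \<in> J \<and> infdist y (F w) < e"
        by blast
      have "g x \<le> g y"
        using y s(2) x(2) by blast
      also have "g y \<le> (\<Sum>w\<in>s. e)"
        unfolding g_def using y by (intro sum_mono) force
      also have "\<dots> < g x"
        using e s by (simp add: field_simps card_gt_0_iff)
      finally show False
        by simp
    qed
  qed
qed

text \<open>Replace every set of a finite closed covering by a small metric neighbourhood. For small
  radii it stays in the given open set, no new intersections arise, and distinct sets stay
  distinct, so that the nerve is unchanged.\<close>
lemma open_thickening:
  fixes F :: "'i \<Rightarrow> 'a::metric_space set"
  assumes J: "compact J" and A: "finite A" and F: "\<And>w. w \<in> A \<Longrightarrow> closed (F w) \<and> F w \<noteq> {} \<and> F w \<subseteq> J"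
    and inj: "inj_on F A" and small: "\<And>w. w \<in> A \<Longrightarrow> openin (top_of_set J) (U w) \<and> F w \<subseteq> U w"
  obtains V where "inj_on V A" "\<And>w. w \<in> A \<Longrightarrow> openin (top_of_set J) (V w) \<and> F w \<subseteq> V w \<and> V w \<subseteq> U w"
    "\<And>s. s \<subseteq> A \<Longrightarrow> s \<noteq> {} \<Longrightarrow> (\<Inter>w\<in>s. V w) \<noteq> {} \<Longrightarrow> (\<Inter>w\<in>s. F w) \<noteq> {}"
proof -
  let ?G = "\<lambda>e w. {x \<in> J. infdist x (F w) < e}"
  have 1: "eventually (\<lambda>e. \<forall>w\<in>A. ?G e w \<subseteq> U w) (at_right 0)"
  proof (rule eventually_ball_finite[OF A], rule ballI)
    fix w assume w: "w \<in> A"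
    have "closedin (top_of_set J) (J - U w)"
      using small[OF w] by (metis closedin_diff closedin_topspace topspace_euclidean_subtopology)
    then have "compact (J - U w)"
      using J closedin_compact by blast
    from infdist_positive_margin[OF this, of "F w"] F[OF w] small[OF w]
    have "eventually (\<lambda>e. \<forall>x\<in>J - U w. \<not> infdist x (F w) < e) (at_right 0)"
      by blast
    then show "eventually (\<lambda>e. ?G e w \<subseteq> U w) (at_right 0)"
      by (rule eventually_mono) blast
  qed
  have 2: "eventually (\<lambda>e. \<forall>s\<in>{s \<in> Pow A. s \<noteq> {} \<and> (\<Inter>w\<in>s. F w) = {}}. (\<Inter>w\<in>s. ?G e w) = {}) (at_right 0)"
  proof (rule eventually_ball_finite, use A in simp, rule ballI)
    fix s assume "s \<in> {s \<in> Pow A. s \<noteq> {} \<and> (\<Inter>w\<in>s. F w) = {}}"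
    then show "eventually (\<lambda>e. (\<Inter>w\<in>s. ?G e w) = {}) (at_right 0)"
      using F A finite_subset by (intro thickening_common_point[OF J]) blast+
  qed
  have 3: "eventually (\<lambda>e. \<forall>p\<in>{p \<in> A \<times> A. \<not> F (fst p) \<subseteq> F (snd p)}. \<not> F (fst p) \<subseteq> ?G e (snd p)) (at_right 0)"
  proof (rule eventually_ball_finite, use A in simp, rule ballI)
    fix p assume "p \<in> {p \<in> A \<times> A. \<not> F (fst p) \<subseteq> F (snd p)}"
    then have "\<not> F (fst p) \<subseteq> F (snd p)" "snd p \<in> A"
      by auto
    then obtain y where y: "y \<in> F (fst p)" "y \<notin> F (snd p)" "snd p \<in> A"
      by blast
    have "eventually (\<lambda>e. \<forall>x\<in>{y}. \<not> infdist x (F (snd p)) < e) (at_right 0)"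
      using F[OF y(3)] y(2) by (intro infdist_positive_margin) auto
    then show "eventually (\<lambda>e. \<not> F (fst p) \<subseteq> ?G e (snd p)) (at_right 0)"
      by (rule eventually_mono) (use y(1) in auto)
  qed
  have 4: "eventually (\<lambda>e::real. 0 < e) (at_right 0)"
    by (rule eventually_at_right_less)
  obtain e where e: "\<forall>w\<in>A. ?G e w \<subseteq> U w" "0 < e"
    "\<forall>s\<in>{s \<in> Pow A. s \<noteq> {} \<and> (\<Inter>w\<in>s. F w) = {}}. (\<Inter>w\<in>s. ?G e w) = {}"
    "\<forall>p\<in>{p \<in> A \<times> A. \<not> F (fst p) \<subseteq> F (snd p)}. \<not> F (fst p) \<subseteq> ?G e (snd p)"
    using eventually_happens[OF eventually_conj[OF eventually_conj[OF 1 2] eventually_conj[OF 3 4]]] by auto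
  have sub: "F w \<subseteq> ?G e w" if "w \<in> A" for w
    using F[OF that] e(2) by auto
  show thesis
  proof (rule that[of "?G e"])
    show "inj_on (?G e) A"
    proof (rule inj_onI, rule ccontr)
      fix u v assume uv: "u \<in> A" "v \<in> A" "?G e u = ?G e v" "u \<noteq> v"
      have "F u \<subseteq> F v"
        using e(4) sub[OF uv(1)] uv by auto
      moreover have "F v \<subseteq> F u"
        using e(4) sub[OF uv(2)] uv by auto
      ultimately show False
        using inj uv by (auto simp: inj_on_def)
    qed
    show "openin (top_of_set J) (?G e w) \<and> F w \<subseteq> ?G e w \<and> ?G e w \<subseteq> U w" if w: "w \<in> A" for w
    proof (intro conjI)
      have "open {x. infdist x (F w) < e}"
        by (intro open_Collect_less continuous_on_infdist continuous_on_id continuous_on_const)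
      then have "openin (top_of_set J) (J \<inter> {x. infdist x (F w) < e})"
        by (rule openin_open_Int)
      then show "openin (top_of_set J) (?G e w)"
        by (simp add: Int_def)
    qed (use e(1) sub w in auto)
    show "(\<Inter>w\<in>s. F w) \<noteq> {}" if "s \<subseteq> A" "s \<noteq> {}" "(\<Inter>w\<in>s. ?G e w) \<noteq> {}" for s
      using e(3) that by blast
  qed
qed

text \<open>The two nerves are isomorphic, so a cycle is carried to the nerve of the closed covering, bounds
  there, and is carried back.\<close>
lemma thickening_acyclic:
  assumes A: "finite A" and inj: "inj_on V A" and FV: "\<And>w. w \<in> A \<Longrightarrow> F w \<subseteq> V w"
    and nerve: "\<And>s. s \<subseteq> A \<Longrightarrow> s \<noteq> {} \<Longrightarrow> (\<Inter>w\<in>s. V w) \<noteq> {} \<Longrightarrow> (\<Inter>w\<in>s. F w) \<noteq> {}"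
    and acyc: "acyclic_at (nerve_complex A F) (Suc q)" and q: "0 < q"
  shows "cycles (nerve_complex (V ` A) id) q \<subseteq> boundaries (nerve_complex (V ` A) id) q"
proof
  let ?K = "nerve_complex A F" and ?L = "nerve_complex (V ` A) id"
  have K: "finite_complex ?K" and L: "finite_complex ?L"
    using A by (auto intro: finite_complex_nerve)
  let ?g = "inv_into A V"
  have Vg: "V (?g v) = v" if "v \<in> V ` A" for v
    by (rule f_inv_into_f[OF that])
  have g: "simplicial_map ?g ?L ?K"
    unfolding simplicial_map_def
  proof
    fix s assume s: "s \<in> ?L"
    then have s': "s \<subseteq> V ` A" "finite s" "s \<noteq> {}" "(\<Inter>v\<in>s. v) \<noteq> {}"
      by (auto simp: nerve_complex_def)
    have sub: "?g ` s \<subseteq> A"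
      using s'(1) inv_into_into[of _ V A] by blast
    have "(\<Inter>w\<in>?g ` s. V w) = (\<Inter>v\<in>s. v)"
      using Vg s'(1) by (auto simp: subset_iff)
    then have "(\<Inter>w\<in>?g ` s. F w) \<noteq> {}"
      using nerve[OF sub] s' by simp
    then show "?g ` s \<in> ?K"
      using sub s' by (simp add: nerve_complex_def)
  qed
  have f: "simplicial_map V ?K ?L"
    unfolding simplicial_map_def
  proof
    fix s assume "s \<in> ?K"
    then obtain x where "s \<subseteq> A" "finite s" "s \<noteq> {}" "\<And>w. w \<in> s \<Longrightarrow> x \<in> F w"
      by (auto simp: nerve_complex_def)
    then show "V ` s \<in> ?L"
      using FV by (auto simp: nerve_complex_def) blast
  qed
  fix z assume z: "z \<in> cycles ?L q"
  have "pushforward ?g z \<in> cycles ?K q"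
    by (rule pushforward_cycles[OF L K g z])
  then have "pushforward ?g z \<in> boundaries ?K q"
    using finite_complex.acyclic_boundaries[OF K acyc q] by blast
  then have "pushforward V (pushforward ?g z) \<in> boundaries ?L q"
    by (rule pushforward_boundaries[OF K L f])
  moreover have "pushforward V (pushforward ?g z) = z"
  proof (rule pushforward_inverse)
    fix s assume "s \<in> Poly_Mapping.keys z"
    then have "s \<in> ?L"
      using z by (auto simp: cycles_def frags_def simplices_def)
    then show "finite s" "\<And>v. v \<in> s \<Longrightarrow> V (?g v) = v"
      using Vg by (auto simp: nerve_complex_def)
  qed
  ultimately show "z \<in> boundaries ?L q"
    by simp
qed

context fractal begin

lemma piece_facts:
  assumes S: "valid S" and w: "w \<in> words S k"
  shows "compact (piece S k w)" "piece S k w \<noteq> {}" "piece S k w \<subseteq> limit_set n S"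
proof -
  show "compact (piece S k w)"
    unfolding piece_def by (intro compact_continuous_image continuous_word_map shifted_limit_set_facts S)
  show "piece S k w \<noteq> {}"
    unfolding piece_def using shifted_limit_set_facts(2)[OF S] by blast
  show "piece S k w \<subseteq> limit_set n S"
    unfolding piece_def using limit_set_words[OF S, of k] w by blast
qed

text \<open>The largest value of a coordinate on a piece is that on the common shape of all pieces of the
  level, shifted by the corner of the cell; so the piece determines its cell.\<close>
lemma inj_piece:
  assumes S: "valid S" shows "inj_on (piece S k) (words S k)"
proof (rule inj_onI)
  fix u v assume uv: "u \<in> words S k" "v \<in> words S k" "piece S k u = piece S k v"
  let ?T = "shifted_limit_set n S k"
  have le: "corner n v l \<le> corner n u l" if uv: "u \<in> words S k" "v \<in> words S k" "piece S k u = piece S k v" for u v l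
  proof -
    obtain y where y: "y \<in> ?T" "\<And>x. x \<in> ?T \<Longrightarrow> x $ l \<le> y $ l"
    proof -
      have "continuous_on ?T (\<lambda>x. x $ l)"
        by (intro continuous_intros)
      from continuous_attains_sup[OF shifted_limit_set_facts(1,2)[OF S, of k] this] show ?thesis
        using that by blast
    qed
    have "word_map n v y \<in> piece S k v"
      unfolding piece_def using y(1) by blast
    then have "word_map n v y \<in> piece S k u"
      using uv(3) by simp
    then obtain x where x: "x \<in> ?T" "word_map n v y = word_map n u x"
      by (auto simp: piece_def)
    have "y $ l + real (corner n v l) = x $ l + real (corner n u l)"
      using arg_cong[OF x(2), of "\<lambda>p. p $ l"] length_words[OF uv(1)] length_words[OF uv(2)]
      by (simp add: word_map_nth)
    then show ?thesis
      using y(2)[OF x(1)] by linarith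
  qed
  show "u = v"
    using words_inj[OF S uv(1,2)] le[OF uv] le[OF uv(2,1) uv(3)[symmetric]] by (simp add: antisym)
qed

text \<open>Pieces of diameter less than the Lebesgue number of the covering are small enough.\<close>
lemma fine_pieces:
  assumes S: "valid S" and U: "\<U> \<in> finite_open_covers (top_of_set (limit_set n S))"
  obtains k where "\<And>w. w \<in> words S k \<Longrightarrow> \<exists>U\<in>\<U>. piece S k w \<subseteq> U"
proof -
  let ?J = "limit_set n S"
  have cov: "\<And>U. U \<in> \<U> \<Longrightarrow> openin (top_of_set ?J) U" "\<Union>\<U> = ?J"
    using U by (auto simp: finite_open_covers_def)
  define C where "C = {G. open G \<and> ?J \<inter> G \<in> \<U>}"
  have "?J \<subseteq> \<Union>C"
  proof
    fix x assume "x \<in> ?J"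
    then obtain V where V: "V \<in> \<U>" "x \<in> V"
      using cov(2) by blast
    then obtain G where "open G" "V = ?J \<inter> G"
      using cov(1) by (meson openin_open)
    then show "x \<in> \<Union>C"
      using V by (auto simp: C_def)
  qed
  note sub = this
  have ne: "C \<noteq> {}"
    using sub limit_set_nonempty[OF S] by blast
  have opn: "open B" if "B \<in> C" for B
    using that by (simp add: C_def)
  have "\<exists>\<delta>>0. \<forall>T. T \<subseteq> ?J \<longrightarrow> diameter T < \<delta> \<longrightarrow> (\<exists>B\<in>C. T \<subseteq> B)"
    by (rule Lebesgue_number_lemma[OF compact_limit_set[OF S] ne sub opn]) blast+
  then obtain \<delta> where \<delta>: "0 < \<delta>" "\<And>T. T \<subseteq> ?J \<Longrightarrow> diameter T < \<delta> \<Longrightarrow> \<exists>B\<in>C. T \<subseteq> B"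
    by blast
  obtain k where k: "real CARD('d) * (1/2) ^ k < \<delta>"
    using pow_half_small[OF \<delta>(1)] by blast
  have "\<exists>U\<in>\<U>. piece S k w \<subseteq> U" if w: "w \<in> words S k" for w
  proof -
    have "diameter (piece S k w) \<le> real CARD('d) * (1/2) ^ k"
    proof (rule diameter_le)
      show "piece S k w \<noteq> {} \<or> 0 \<le> real CARD('d) * (1/2) ^ k"
        by simp
      show "norm (x - y) \<le> real CARD('d) * (1/2) ^ k" if "x \<in> piece S k w" "y \<in> piece S k w" for x y
        using word_piece_small[OF S w that[unfolded piece_def]] by (simp add: dist_norm)
    qed
    then have small: "diameter (piece S k w) < \<delta>"
      using k by linarith
    obtain B where "B \<in> C" "piece S k w \<subseteq> B"
      using \<delta>(2)[OF piece_facts(3)[OF S w] small] by blast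
    then show ?thesis
      using piece_facts(3)[OF S w] by (intro bexI[of _ "?J \<inter> B"]) (auto simp: C_def)
  qed
  then show thesis
    using that by blast
qed

text \<open>Every open covering is refined by a thickening of the pieces of some level.\<close>
theorem cech_trivial_of_nerves:
  assumes S: "valid S" and q: "0 < q" and acyc: "\<And>k. acyclic_at (fractal_nerve n S 0 k) (Suc q)"
  shows "trivial_group (cech_homology q (top_of_set (limit_set n S)))"
proof (rule cech_homology_trivial)
  fix \<U> assume U: "\<U> \<in> finite_open_covers (top_of_set (limit_set n S))"
  let ?J = "limit_set n S"
  obtain k where k: "\<And>w. w \<in> words S k \<Longrightarrow> \<exists>U\<in>\<U>. piece S k w \<subseteq> U"
    using fine_pieces[OF S U] by blast
  then obtain f where f: "\<And>w. w \<in> words S k \<Longrightarrow> f w \<in> \<U> \<and> piece S k w \<subseteq> f w"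
    by metis
  have fo: "openin (top_of_set ?J) (f w) \<and> piece S k w \<subseteq> f w" if "w \<in> words S k" for w
    using f[OF that] U by (auto simp: finite_open_covers_def)
  have pc: "closed (piece S k w) \<and> piece S k w \<noteq> {} \<and> piece S k w \<subseteq> ?J" if "w \<in> words S k" for w
    using piece_facts[OF S that] compact_imp_closed by blast
  obtain V where V: "inj_on V (words S k)"
    "\<And>w. w \<in> words S k \<Longrightarrow> openin (top_of_set ?J) (V w) \<and> piece S k w \<subseteq> V w \<and> V w \<subseteq> f w"
    "\<And>s. s \<subseteq> words S k \<Longrightarrow> s \<noteq> {} \<Longrightarrow> (\<Inter>w\<in>s. V w) \<noteq> {} \<Longrightarrow> (\<Inter>w\<in>s. piece S k w) \<noteq> {}"
    using open_thickening[OF compact_limit_set[OF S] finite_words_valid[OF S] pc inj_piece[OF S] fo] by blast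
  let ?V = "V ` words S k"
  let ?p = "\<lambda>v. f (inv_into (words S k) V v)"
  have "\<Union>?V = ?J"
  proof
    show "\<Union>?V \<subseteq> ?J"
      using V(2) openin_imp_subset by blast
    show "?J \<subseteq> \<Union>?V"
      unfolding limit_set_words[OF S, of k] using V(2) by (auto simp: piece_def)
  qed
  then have cover: "?V \<in> finite_open_covers (top_of_set ?J)"
    using V(2) finite_words_valid[OF S] by (simp add: finite_open_covers_def)
  moreover have "refinement_projection ?p ?V \<U>"
    unfolding refinement_projection_def using V(1,2) f by (simp add: inv_into_f_f)
  moreover have "cycles (nerve_complex ?V id) q \<subseteq> boundaries (nerve_complex ?V id) q"
  proof (rule thickening_acyclic[where F = "piece S k", OF finite_words_valid[OF S] V(1) _ V(3) _ q])
    show "piece S k w \<subseteq> V w" if "w \<in> words S k" for w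
      using V(2)[OF that] by blast
    show "acyclic_at (nerve_complex (words S k) (piece S k)) (Suc q)"
      using acyc[of k] by (simp only: nerve_eq)
  qed
  ultimately show "\<exists>\<V>\<in>finite_open_covers (top_of_set ?J). \<exists>p. refinement_projection p \<V> \<U>
      \<and> cycles (nerve_complex \<V> id) q \<subseteq> boundaries (nerve_complex \<V> id) q"
    by blast
qed

end

subsection \<open>Degree zero\<close>

text \<open>The sum of the coefficients.\<close>
definition augmentation :: "('v set \<Rightarrow>\<^sub>0 int) \<Rightarrow> int"
  where "augmentation c = Poly_Mapping.lookup (frag_extend (\<lambda>_. frag_of ()) c) ()"

lemma augmentation_0 [simp]: "augmentation 0 = 0"
  and augmentation_diff: "augmentation (a - b) = augmentation a - augmentation b"
  and augmentation_add: "augmentation (a + b) = augmentation a + augmentation b"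
  and augmentation_cmul: "augmentation (frag_cmul m a) = m * augmentation a"
  and augmentation_of [simp]: "augmentation (frag_of s) = 1"
  by (simp_all add: augmentation_def frag_extend_diff frag_extend_add frag_extend_cmul lookup_minus lookup_add)

lemma augmentation_boundary:
  assumes K: "finite_complex K" and c: "c \<in> boundaries K 0"
  shows "augmentation c = 0"
proof -
  obtain d where d: "d \<in> frags (simplices K 2)" "c = bd d"
    using c unfolding finite_complex.boundaries_eq[OF K] by (auto simp: numeral_2_eq_2)
  have "augmentation (bd d) = 0"
  proof (rule frag_linear_ext[where F = "\<lambda>d. augmentation (bd d)" and G = "\<lambda>_. 0"])
    fix s assume "s \<in> Poly_Mapping.keys d"
    then have "card s = 2"
      using d(1) by (auto simp: frags_def simplices_def)
    then obtain u v where "s = {u, v}" "u \<noteq> v"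
      by (auto simp: card_2_iff)
    then show "augmentation (bd (frag_of s)) = 0"
      by (simp add: bd_pair augmentation_cmul augmentation_diff)
  qed (simp_all add: bd_diff augmentation_diff)
  then show ?thesis
    using d(2) by simp
qed

lemma pushforward_vertex: "pushforward f (frag_of {v}) = frag_of {f v}"
  by (simp add: pushforward_of inversion_sign_def)

lemma augmentation_pushforward:
  assumes "c \<in> frags (simplices K 1)"
  shows "augmentation (pushforward f c) = augmentation c"
proof (rule frag_linear_ext[where F = "\<lambda>c. augmentation (pushforward f c)" and G = augmentation])
  fix s assume "s \<in> Poly_Mapping.keys c"
  then have "card s = 1"
    using assms by (auto simp: frags_def simplices_def)
  then obtain v where "s = {v}"
    by (auto simp: card_1_singleton_iff)
  then show "augmentation (pushforward f (frag_of s)) = augmentation (frag_of s)"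
    by (simp add: pushforward_vertex)
qed (simp_all add: pushforward_diff augmentation_diff)

text \<open>In a connected complex every vertex is homologous to a fixed one.\<close>
lemma augmentation_zero_boundary:
  assumes K: "finite_complex K" and conn: "\<And>u v. {u} \<in> K \<Longrightarrow> {v} \<in> K \<Longrightarrow> (u, v) \<in> {(x, y). x \<noteq> y \<and> {x, y} \<in> K}\<^sup>*"
    and c: "c \<in> frags (simplices K 1)" "augmentation c = 0"
  shows "c \<in> boundaries K 0"
proof (cases "simplices K 1 = {}")
  case True
  then have "c = 0"
    using c by (simp add: frags_def)
  then show ?thesis
    using add_subgroup_0[OF finite_complex.add_subgroup_boundaries[OF K]] by simp
next
  case False
  then obtain v where v: "{v} \<in> K"
    by (auto simp: simplices_def card_1_singleton_iff)
  have B: "boundaries K 0 = bd ` frags (simplices K 2)"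
    unfolding finite_complex.boundaries_eq[OF K] by (simp add: numeral_2_eq_2)
  have "frag_extend (\<lambda>s. frag_of s - frag_of {v}) c \<in> boundaries K 0"
    unfolding frag_extend_def
  proof (intro add_subgroup_sum add_subgroup_cmul finite_complex.add_subgroup_boundaries[OF K])
    fix s assume "s \<in> Poly_Mapping.keys c"
    then have "s \<in> K" "card s = 1"
      using c(1) by (auto simp: frags_def simplices_def)
    then obtain u where u: "s = {u}" "{u} \<in> K"
      by (auto simp: card_1_singleton_iff)
    then show "frag_of s - frag_of {v} \<in> boundaries K 0"
      unfolding B using path_boundary[OF conn[OF v u(2)]] by simp
  qed
  moreover have "frag_extend (\<lambda>s. frag_of s - frag_of {v}) c = c - frag_cmul (augmentation c) (frag_of {v})"
    by (rule frag_linear_ext[where F = "frag_extend (\<lambda>s. frag_of s - frag_of {v})" and G = "\<lambda>c. c - frag_cmul (augmentation c) (frag_of {v})"])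
       (simp_all add: frag_extend_diff augmentation_diff frag_cmul_diff_distrib)
  ultimately show ?thesis
    using c(2) by simp
qed

text \<open>Otherwise the members that can be reached from \<open>u\<close> and the remaining ones would split the space
  into two disjoint nonempty open sets.\<close>
lemma connected_cover_nerve:
  assumes J: "connected J" and U: "\<U> \<in> finite_open_covers (top_of_set J)"
    and uv: "{u} \<in> nerve_complex \<U> id" "{v} \<in> nerve_complex \<U> id"
  shows "(u, v) \<in> {(x, y). x \<noteq> y \<and> {x, y} \<in> nerve_complex \<U> id}\<^sup>*"
proof (rule ccontr)
  let ?R = "{(x, y). x \<noteq> y \<and> {x, y} \<in> nerve_complex \<U> id}"
  assume nv: "(u, v) \<notin> ?R\<^sup>*"
  have mem: "u \<in> \<U>" "v \<in> \<U>" "u \<noteq> {}" "v \<noteq> {}"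
    using uv by (auto simp: nerve_complex_def)
  have op: "\<And>V. V \<in> \<U> \<Longrightarrow> openin (top_of_set J) V" and cov: "\<Union>\<U> = J"
    using U by (auto simp: finite_open_covers_def)
  define R where "R = {x \<in> \<U>. (u, x) \<in> ?R\<^sup>*}"
  have "\<Union>R \<inter> \<Union>(\<U> - R) = {}"
  proof (rule ccontr)
    assume "\<Union>R \<inter> \<Union>(\<U> - R) \<noteq> {}"
    then obtain z x y where z: "x \<in> R" "y \<in> \<U> - R" "z \<in> x" "z \<in> y"
      by blast
    then have "{x, y} \<in> nerve_complex \<U> id" "x \<noteq> y"
      by (auto simp: nerve_complex_def R_def)
    then have "(u, y) \<in> ?R\<^sup>*"
      using z(1) by (auto simp: R_def intro: rtrancl_into_rtrancl)
    then show False
      using z(2) by (auto simp: R_def)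
  qed
  moreover have "openin (top_of_set J) (\<Union>R)" "openin (top_of_set J) (\<Union>(\<U> - R))"
    using op by (auto intro!: openin_Union simp: R_def)
  moreover have "J \<subseteq> \<Union>R \<union> \<Union>(\<U> - R)"
    using cov by (auto simp: R_def)
  moreover have "\<Union>R \<noteq> {}"
    using mem by (auto simp: R_def)
  moreover have "\<Union>(\<U> - R) \<noteq> {}"
    using mem nv by (auto simp: R_def)
  ultimately show False
    using J unfolding connected_openin by blast
qed

text \<open>For each covering the augmentation identifies the homology in degree 0 with the
  integers, compatibly with refinement. Every covering refines the one by the single set
  \<open>J\<close>, so a compatible family is the same as its integer there.\<close>
theorem cech_homology_0_connected:
  assumes J: "connected J" "J \<noteq> {}"
  shows "cech_homology 0 (top_of_set J) \<cong> integer_group"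
proof -
  let ?X = "top_of_set J"
  let ?C = "cech_homology 0 ?X"
  let ?N = "\<lambda>\<U>. nerve_complex \<U> id"
  let ?B = "\<lambda>\<U>. boundaries (?N \<U>) 0"
  let ?cov = "finite_open_covers ?X"
  have fc: "finite_complex (?N \<U>)" if "\<U> \<in> ?cov" for \<U>
    by (rule nerve_cover_complex[OF that])
  have cyc: "cycles (?N \<U>) 0 = frags (simplices (?N \<U>) 1)" for \<U> :: "'a set set"
    by (auto simp: cycles_def boundary_map_def)
  have aug_eq: "coset_of (?B \<U>) x = coset_of (?B \<U>) y \<longleftrightarrow> augmentation x = augmentation y"
    if U: "\<U> \<in> ?cov" and xy: "x \<in> cycles (?N \<U>) 0" "y \<in> cycles (?N \<U>) 0" for \<U> x y
  proof -
    have "x - y \<in> ?B \<U> \<longleftrightarrow> augmentation (x - y) = 0"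
    proof
      assume "augmentation (x - y) = 0"
      then show "x - y \<in> ?B \<U>"
        using xy unfolding cyc
        by (intro augmentation_zero_boundary[OF fc[OF U] connected_cover_nerve[OF J(1) U]]) (auto intro: add_subgroup_diff)
    qed (rule augmentation_boundary[OF fc[OF U]])
    then show ?thesis
      by (simp add: coset_of_eq_iff[OF finite_complex.add_subgroup_boundaries[OF fc[OF U]]] augmentation_diff)
  qed
  define deg where "deg X = augmentation (SOME c. c \<in> X)" for X :: "('a set set \<Rightarrow>\<^sub>0 int) set"
  have deg: "deg (coset_of (?B \<U>) z) = augmentation z" if U: "\<U> \<in> ?cov" for \<U> z
  proof -
    let ?c = "SOME c. c \<in> coset_of (?B \<U>) z"
    have "z \<in> coset_of (?B \<U>) z"
      using add_subgroup_0[OF finite_complex.add_subgroup_boundaries[OF fc[OF U]]] by (simp add: mem_coset_of)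
    then have "?c \<in> coset_of (?B \<U>) z"
      by (rule someI)
    then have "augmentation (?c - z) = 0"
      using augmentation_boundary[OF fc[OF U]] by (simp add: mem_coset_of)
    then show ?thesis
      by (simp add: deg_def augmentation_diff)
  qed
  have one_cov: "{J} \<in> ?cov"
    by (simp add: finite_open_covers_def)
  have to_one: "refinement_projection (\<lambda>_. J) \<U> {J}" if "\<U> \<in> ?cov" for \<U>
    using that openin_imp_subset by (auto simp: refinement_projection_def finite_open_covers_def)
  have class_of: "\<exists>z\<in>cycles (?N \<U>) 0. x \<U> = coset_of (?B \<U>) z" if "x \<in> carrier ?C" "\<U> \<in> ?cov" for x \<U>
  proof -
    have "x \<U> \<in> carrier (simplicial_homology 0 (?N \<U>))"
      using that unfolding cech_carrier by (auto simp: PiE_def Pi_def)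
    then show ?thesis
      unfolding cover_homology_carrier(1)[OF that(2)] by blast
  qed
  have compat: "simplicial_hom_induced 0 (?N \<U>) p (x \<V>) = x \<U>"
    if "x \<in> carrier ?C" "\<U> \<in> ?cov" "\<V> \<in> ?cov" "refinement_projection p \<V> \<U>" for x \<U> \<V> p
    using that unfolding cech_carrier by blast
  have deg_const: "deg (x \<U>) = deg (x {J})" if x: "x \<in> carrier ?C" and U: "\<U> \<in> ?cov" for x \<U>
  proof -
    obtain z where z: "z \<in> cycles (?N \<U>) 0" "x \<U> = coset_of (?B \<U>) z"
      using class_of[OF x U] by blast
    have "x {J} = coset_of (?B {J}) (pushforward (\<lambda>_. J) z)"
      using compat[OF x one_cov U to_one[OF U]]
        hom_induced_coset[OF fc[OF U] fc[OF one_cov] refinement_simplicial[OF to_one[OF U]], of 0 z] z(2) by simp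
    then show ?thesis
      using z deg[OF one_cov] deg[OF U] augmentation_pushforward[of z "?N \<U>" "\<lambda>_. J"] unfolding cyc by simp
  qed
  define h where "h x = deg (x {J})" for x :: "'a set set \<Rightarrow> ('a set set \<Rightarrow>\<^sub>0 int) set"
  have "h \<in> iso ?C integer_group"
  proof (rule isoI)
    show "h \<in> hom ?C integer_group"
    proof (rule homI)
      fix x y assume x: "x \<in> carrier ?C" and y: "y \<in> carrier ?C"
      obtain u v where u: "u \<in> cycles (?N {J}) 0" "x {J} = coset_of (?B {J}) u"
        and v: "v \<in> cycles (?N {J}) 0" "y {J} = coset_of (?B {J}) v"
        using class_of[OF x one_cov] class_of[OF y one_cov] by blast
      have "(x \<otimes>\<^bsub>?C\<^esub> y) {J} = coset_of (?B {J}) (u + v)"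
        unfolding cech_mult using one_cov cover_homology_carrier(3)[OF one_cov u(1) v(1)] u(2) v(2) by simp
      then show "h (x \<otimes>\<^bsub>?C\<^esub> y) = h x \<otimes>\<^bsub>integer_group\<^esub> h y"
        by (simp add: h_def u v deg[OF one_cov] augmentation_add)
    qed simp
    show "bij_betw h (carrier ?C) (carrier integer_group)"
      unfolding bij_betw_def
    proof
      show "inj_on h (carrier ?C)"
      proof (rule inj_onI)
        fix x y assume x: "x \<in> carrier ?C" and y: "y \<in> carrier ?C" and "h x = h y"
        then have "deg (x \<U>) = deg (y \<U>)" if "\<U> \<in> ?cov" for \<U>
          using deg_const[OF x that] deg_const[OF y that] by (simp add: h_def)
        then have "x \<U> = y \<U>" if U: "\<U> \<in> ?cov" for \<U>
          using class_of[OF x U] class_of[OF y U] deg[OF U] aug_eq[OF U] U by metis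
        then show "x = y"
          using x y by (intro extensionalityI[of _ ?cov]) (auto simp: cech_carrier PiE_def)
      qed
      have "\<exists>x\<in>carrier ?C. h x = m" for m
      proof -
        have "\<exists>v. {v} \<in> ?N \<U>" if "\<U> \<in> ?cov" for \<U>
          using that J(2) by (auto simp: finite_open_covers_def nerve_complex_def)
        then obtain v where v: "\<And>\<U>. \<U> \<in> ?cov \<Longrightarrow> {v \<U>} \<in> ?N \<U>"
          by metis
        let ?z = "\<lambda>\<U>. frag_cmul m (frag_of {v \<U>})"
        have z: "?z \<U> \<in> cycles (?N \<U>) 0" if "\<U> \<in> ?cov" for \<U>
          unfolding cyc using v[OF that] by (intro add_subgroup_cmul add_subgroup_frags) (simp add: frags_def simplices_def)
        let ?x = "\<lambda>\<U>\<in>?cov. coset_of (?B \<U>) (?z \<U>)"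
        have "?x \<in> carrier ?C"
          unfolding cech_carrier
        proof (intro conjI ballI allI impI)
          show "?x \<in> (\<Pi>\<^sub>E \<U>\<in>?cov. carrier (simplicial_homology 0 (?N \<U>)))"
            using z by (auto simp: cover_homology_carrier(1))
          fix \<U> \<V> p assume U: "\<U> \<in> ?cov" and V: "\<V> \<in> ?cov" and p: "refinement_projection p \<V> \<U>"
          have "simplicial_hom_induced 0 (?N \<U>) p (?x \<V>) = coset_of (?B \<U>) (pushforward p (?z \<V>))"
            using V hom_induced_coset[OF fc[OF V] fc[OF U] refinement_simplicial[OF p], of 0 "?z \<V>"] by simp
          also have "\<dots> = coset_of (?B \<U>) (?z \<U>)"
            unfolding aug_eq[OF U pushforward_cycles[OF fc[OF V] fc[OF U] refinement_simplicial[OF p] z[OF V]] z[OF U]]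
            by (simp add: pushforward_cmul pushforward_vertex augmentation_cmul)
          finally show "simplicial_hom_induced 0 (?N \<U>) p (?x \<V>) = ?x \<U>"
            using U by simp
        qed
        moreover have "h ?x = m"
          using one_cov by (simp add: h_def deg augmentation_cmul)
        ultimately show ?thesis
          by blast
      qed
      then have "m \<in> h ` carrier ?C" for m
        by (metis imageI)
      then show "h ` carrier ?C = carrier integer_group"
        by (simp add: set_eq_iff)
    qed
  qed
  then show ?thesis
    by (rule is_isoI)
qed

section \<open>Components that are segments, and the theorem\<close>

lemma closed_segment_axis_subset:
  fixes p :: "real^'d"
  assumes "\<And>t. 0 \<le> t \<Longrightarrow> t \<le> 1 \<Longrightarrow> p + axis k t \<in> A"
  shows "closed_segment p (p + axis k 1) \<subseteq> A"
proof
  fix z assume "z \<in> closed_segment p (p + axis k 1)"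
  then obtain u where u: "0 \<le> u" "u \<le> 1" "z = (1 - u) *\<^sub>R p + u *\<^sub>R (p + axis k 1)"
    by (auto simp: closed_segment_def)
  have "z = p + axis k u"
    unfolding u(3) by (simp add: vec_eq_iff axis_def algebra_simps)
  then show "z \<in> A"
    using assms[OF u(1,2)] by simp
qed

context planar_fractal begin

lemma swapped: "planar_fractal n b a"
  by unfold_locales (use ab card_d in auto)

text \<open>A component is compact and connected with constant \<open>b\<close>-coordinate, and in the plane such a
  set is an interval.\<close>
lemma horizontal_component:
  assumes S: "regular r S" "recurrent r S" and r: "n $ a \<le> r"
    and C: "C \<in> components (limit_set n S)"
  obtains x y where "C = closed_segment x y" "x $ b = y $ b" "x \<in> C" "y \<in> C"
    "\<And>z. z \<in> C \<Longrightarrow> x $ a \<le> z $ a \<and> z $ a \<le> y $ a"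
proof -
  have V: "valid S"
    by (rule regular_valid[OF S(1)])
  obtain c where "(\<lambda>x. x $ b) ` C = {c}"
    using recurrent_projection[OF S _ C, of b] r prod_other(2) by auto
  then have c: "z $ b = c" if "z \<in> C" for z
    using that by blast
  have C': "C \<noteq> {}" "connected C" "compact C"
    using in_components_nonempty[OF C] in_components_connected[OF C] compact_components[OF compact_limit_set[OF V] C]
    by auto
  have cont: "continuous_on C (\<lambda>z. z $ a)"
    by (intro continuous_intros)
  obtain x where x: "x \<in> C" "\<And>z. z \<in> C \<Longrightarrow> x $ a \<le> z $ a"
    using continuous_attains_inf[OF C'(3,1) cont] by blast
  obtain y where y: "y \<in> C" "\<And>z. z \<in> C \<Longrightarrow> z $ a \<le> y $ a"
    using continuous_attains_sup[OF C'(3,1) cont] by blast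
  have interval: "is_interval ((\<lambda>z. z $ a) ` C)"
    using connected_continuous_image[OF cont C'(2)] by (simp add: is_interval_connected_1)
  have "closed_segment x y \<subseteq> C"
  proof
    fix z assume "z \<in> closed_segment x y"
    then obtain u where u: "0 \<le> u" "u \<le> 1" "z = (1 - u) *\<^sub>R x + u *\<^sub>R y"
      by (auto simp: closed_segment_def)
    have za: "z $ a \<in> closed_segment (x $ a) (y $ a)"
      unfolding u(3) closed_segment_def using u(1,2) by auto
    then have "x $ a \<le> z $ a" "z $ a \<le> y $ a"
      using x(2)[OF y(1)] by (auto simp: closed_segment_eq_real_ivl)
    then have "z $ a \<in> (\<lambda>z. z $ a) ` C"
      using interval x(1) y(1) unfolding is_interval_1 by blast
    then obtain w where w: "w \<in> C" "w $ a = z $ a"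
      by auto
    have "z $ b = c"
      unfolding u(3) using c[OF x(1)] c[OF y(1)] by (simp add: algebra_simps)
    then have "w = z"
      using w c[OF w(1)] by (simp add: vec_eq_iff all_ab)
    then show "z \<in> C"
      using w(1) by simp
  qed
  moreover have "C \<subseteq> closed_segment x y"
  proof
    fix z assume z: "z \<in> C"
    have "z $ a \<in> closed_segment (x $ a) (y $ a)"
      using x(2)[OF z] y(2)[OF z] by (simp add: closed_segment_eq_real_ivl)
    then obtain u where u: "0 \<le> u" "u \<le> 1" "z $ a = (1 - u) * x $ a + u * y $ a"
      by (auto simp: closed_segment_def)
    have "z $ b = ((1 - u) *\<^sub>R x + u *\<^sub>R y) $ b"
      using c[OF x(1)] c[OF y(1)] c[OF z] by (simp add: algebra_simps)
    then have "z = (1 - u) *\<^sub>R x + u *\<^sub>R y"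
      using u(3) by (simp add: vec_eq_iff all_ab)
    then show "z \<in> closed_segment x y"
      unfolding closed_segment_def using u(1,2) by blast
  qed
  ultimately show thesis
    using that[of x y] x y c[OF x(1)] c[OF y(1)] by auto
qed

text \<open>A component that contains a segment across the unit square equals this segment.\<close>
lemma unit_component:
  assumes S: "regular r S" "recurrent r S" and r: "n $ a \<le> r" "r < n $ b"
  shows "\<exists>x y. closed_segment x y \<in> components (limit_set n S) \<and> x $ b = y $ b \<and> dist x y = 1"
proof -
  have V: "valid S"
    by (rule regular_valid[OF S(1)])
  obtain p where p: "p $ a = 0" "\<And>t. 0 \<le> t \<Longrightarrow> t \<le> 1 \<Longrightarrow> p + axis a t \<in> limit_set n S"
    using regular_segment[OF S(1), of a] r(2) prod_other(1) by auto
  let ?L = "closed_segment p (p + axis a 1)"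
  have LJ: "?L \<subseteq> limit_set n S"
    by (rule closed_segment_axis_subset[OF p(2)])
  have pJ: "p \<in> limit_set n S"
    using LJ by auto
  let ?C = "connected_component_set (limit_set n S) p"
  have C: "?C \<in> components (limit_set n S)"
    using pJ by (auto simp: components_def)
  have LC: "?L \<subseteq> ?C"
    by (rule connected_component_maximal) (use LJ in auto)
  obtain x y where xy: "?C = closed_segment x y" "x $ b = y $ b" "x \<in> ?C" "y \<in> ?C"
    "\<And>z. z \<in> ?C \<Longrightarrow> x $ a \<le> z $ a \<and> z $ a \<le> y $ a"
    using horizontal_component[OF S r(1) C] by blast
  have "p \<in> ?C" "p + axis a 1 \<in> ?C"
    using LC by auto
  then have "x $ a \<le> 0" "1 \<le> y $ a"
    using xy(5)[of p] xy(5)[of "p + axis a 1"] p(1) by (auto simp: axis_def)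
  moreover have "0 \<le> x $ a" "y $ a \<le> 1"
    using xy(3,4) connected_component_subset[of "limit_set n S" p] limit_set_unit[OF V]
    by (auto simp: mem_unit_cube subset_iff)
  ultimately have "y = x + axis a 1"
    using xy(2) ab by (simp add: vec_eq_iff all_ab axis_def)
  then have "dist x y = 1"
    by (simp add: dist_norm norm_axis_1)
  then show ?thesis
    using C xy(1,2) by metis
qed

end

theorem theorem7:
  fixes n :: "nat^'d" and r :: nat
    and M :: "'w measure" and S :: "'w \<Rightarrow> nat \<Rightarrow> (nat^'d) set"
  assumes "\<forall>k. n $ k \<ge> 2"
    and "1 \<le> r" and "r \<le> (\<Prod>k\<in>UNIV. n $ k) - 1"
    and "prob_space M"
    and "prob_space.indep_vars M (\<lambda>_. count_space (digit_subsets n r)) (\<lambda>j \<omega>. S \<omega> j) {1..}"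
    and "\<forall>j\<ge>1. distr M (count_space (digit_subsets n r)) (\<lambda>\<omega>. S \<omega> j)
                 = uniform_count_measure (digit_subsets n r)"
  shows
    "(r < CARD('d) \<longrightarrow>
        (\<forall>\<omega>\<in>space M. connected (limit_set n (S \<omega>))
                      \<and> locally connected (limit_set n (S \<omega>)))) \<and>
     (\<forall>k. r < (\<Prod>l\<in>UNIV - {k}. n $ l) \<longrightarrow>
        (\<forall>\<omega>\<in>space M. \<exists>x y. x $ k = 0 \<and> y $ k = 1
                      \<and> closed_segment x y \<subseteq> limit_set n (S \<omega>))) \<and>
     (\<forall>k. r \<ge> (\<Prod>l\<in>UNIV - {k}. n $ l) \<longrightarrow>
        (AE \<omega> in M. \<forall>C\<in>components (limit_set n (S \<omega>)). \<exists>c. (\<lambda>x. x $ k) ` C = {c})) \<and>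
     ((\<forall>k. r \<ge> (\<Prod>l\<in>UNIV - {k}. n $ l)) \<longrightarrow>
        (AE \<omega> in M. totally_disconnected (limit_set n (S \<omega>)))) \<and>
     (CARD('d) = 2 \<longrightarrow> (\<forall>a b. a \<noteq> b \<longrightarrow>
        (\<forall>\<omega>\<in>space M. \<forall>q\<ge>2.
           trivial_group (cech_homology q (top_of_set (limit_set n (S \<omega>))))) \<and>
        (r = 1 \<longrightarrow>
           (\<forall>\<omega>\<in>space M. cech_homology 0 (top_of_set (limit_set n (S \<omega>))) \<cong> integer_group) \<and>
           (n $ a = 2 \<and> n $ b = 2 \<longrightarrow>
              (AE \<omega> in M. trivial_group (cech_homology 1 (top_of_set (limit_set n (S \<omega>)))))) \<and>
           ((n $ a, n $ b) \<noteq> (2, 2) \<longrightarrow>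
              (AE \<omega> in M.
                 (\<lambda>k. 1 / real k *
                    ln (real (abelian_rank (simplicial_homology 1 (fractal_nerve n (S \<omega>) 0 k)))))
                 \<longlonglongrightarrow> ln (real (n $ a) * real (n $ b) - real r)))) \<and>
        (2 \<le> r \<and> r < min (n $ a) (n $ b) \<longrightarrow>
           (AE \<omega> in M.
              (\<lambda>k. 1 / real k *
                 ln (real (abelian_rank (simplicial_homology 0 (fractal_nerve n (S \<omega>) 0 k)))))
              \<longlonglongrightarrow> ln (real (n $ a) * real (n $ b) - real r) \<and>
              (\<lambda>k. 1 / real k *
                 ln (real (abelian_rank (simplicial_homology 1 (fractal_nerve n (S \<omega>) 0 k)))))
              \<longlonglongrightarrow> ln (real (n $ a) * real (n $ b) - real r))) \<and>
        (n $ a \<le> r \<and> r < n $ b \<longrightarrow>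
           (AE \<omega> in M.
              (\<forall>C\<in>components (limit_set n (S \<omega>)).
                 \<exists>x y. C = closed_segment x y \<and> x $ b = y $ b) \<and>
              (\<exists>x y. closed_segment x y \<in> components (limit_set n (S \<omega>))
                 \<and> x $ b = y $ b \<and> dist x y = 1))) \<and>
        (n $ b \<le> r \<and> r < n $ a \<longrightarrow>
           (AE \<omega> in M.
              (\<forall>C\<in>components (limit_set n (S \<omega>)).
                 \<exists>x y. C = closed_segment x y \<and> x $ a = y $ a) \<and>
              (\<exists>x y. closed_segment x y \<in> components (limit_set n (S \<omega>))
                 \<and> x $ a = y $ a \<and> dist x y = 1))) \<and>
        (r \<ge> max (n $ a) (n $ b) \<longrightarrow>
           (AE \<omega> in M. totally_disconnected (limit_set n (S \<omega>)))) \<and>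
        (\<forall>\<omega>\<in>space M. \<forall>k>0. \<forall>q.
           free_abelian (simplicial_homology q (fractal_nerve n (S \<omega>) 0 k)) \<and>
           simplicial_homology q (fractal_nerve n (S \<omega>) 0 k)
             \<cong> simplicial_cohomology q (fractal_nerve n (S \<omega>) 0 k))))"
proof -
  have "1 \<le> (\<Prod>k\<in>UNIV. n $ k)"
    using assms(1) by (intro prod_ge_1) (metis one_le_numeral order_trans)
  then have r_less: "r < (\<Prod>k\<in>UNIV. n $ k)"
    using assms(3) by linarith
  interpret prob_space M
    by (rule assms(4))
  interpret random_digits n M r S
    by unfold_locales (use assms r_less in auto)
  have V: "valid (S \<omega>)" if "\<omega> \<in> space M" for \<omega>
    by (rule regular_valid[OF S_regular[OF that]])
  have almost: "AE \<omega> in M. P (S \<omega>)" if "\<And>T. regular r T \<Longrightarrow> recurrent r T \<Longrightarrow> P T" for P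
    using AE_recurrent AE_space by eventually_elim (use that S_regular in blast)
  have d1: "\<forall>\<omega>\<in>space M. connected (limit_set n (S \<omega>)) \<and> locally connected (limit_set n (S \<omega>))"
    if "r < CARD('d)"
    using connected_limit_set[OF S_regular that] locally_connected_limit_set[OF S_regular that] by blast
  have d2: "\<forall>\<omega>\<in>space M. \<exists>x y. x $ k = 0 \<and> y $ k = 1 \<and> closed_segment x y \<subseteq> limit_set n (S \<omega>)"
    if r: "r < (\<Prod>l\<in>UNIV - {k}. n $ l)" for k
  proof
    fix \<omega> assume w: "\<omega> \<in> space M"
    obtain p where p: "p $ k = 0" "\<And>t. 0 \<le> t \<Longrightarrow> t \<le> 1 \<Longrightarrow> p + axis k t \<in> limit_set n (S \<omega>)"
      using regular_segment[OF S_regular[OF w] r] by blast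
    have "closed_segment p (p + axis k 1) \<subseteq> limit_set n (S \<omega>)"
      by (rule closed_segment_axis_subset[OF p(2)])
    moreover have "(p + axis k 1) $ k = 1"
      using p(1) by (simp add: axis_def)
    ultimately show "\<exists>x y. x $ k = 0 \<and> y $ k = 1 \<and> closed_segment x y \<subseteq> limit_set n (S \<omega>)"
      using p(1) by blast
  qed
  have d3: "AE \<omega> in M. \<forall>C\<in>components (limit_set n (S \<omega>)). \<exists>c. (\<lambda>x. x $ k) ` C = {c}"
    if "r \<ge> (\<Prod>l\<in>UNIV - {k}. n $ l)" for k
    by (rule almost) (use that recurrent_projection in blast)
  have d4: "AE \<omega> in M. totally_disconnected (limit_set n (S \<omega>))"
    if "\<forall>k. r \<ge> (\<Prod>l\<in>UNIV - {k}. n $ l)"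
    by (rule almost) (use that recurrent_totally_disconnected in blast)
  have plane: "(\<forall>\<omega>\<in>space M. \<forall>q\<ge>2. trivial_group (cech_homology q (top_of_set (limit_set n (S \<omega>))))) \<and>
      (r = 1 \<longrightarrow>
         (\<forall>\<omega>\<in>space M. cech_homology 0 (top_of_set (limit_set n (S \<omega>))) \<cong> integer_group) \<and>
         (n $ a = 2 \<and> n $ b = 2 \<longrightarrow>
            (AE \<omega> in M. trivial_group (cech_homology 1 (top_of_set (limit_set n (S \<omega>)))))) \<and>
         ((n $ a, n $ b) \<noteq> (2, 2) \<longrightarrow>
            (AE \<omega> in M.
               (\<lambda>k. 1 / real k * ln (real (abelian_rank (simplicial_homology 1 (fractal_nerve n (S \<omega>) 0 k)))))
               \<longlonglongrightarrow> ln (real (n $ a) * real (n $ b) - real r)))) \<and>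
      (2 \<le> r \<and> r < min (n $ a) (n $ b) \<longrightarrow>
         (AE \<omega> in M.
            (\<lambda>k. 1 / real k * ln (real (abelian_rank (simplicial_homology 0 (fractal_nerve n (S \<omega>) 0 k)))))
            \<longlonglongrightarrow> ln (real (n $ a) * real (n $ b) - real r) \<and>
            (\<lambda>k. 1 / real k * ln (real (abelian_rank (simplicial_homology 1 (fractal_nerve n (S \<omega>) 0 k)))))
            \<longlonglongrightarrow> ln (real (n $ a) * real (n $ b) - real r))) \<and>
      (n $ a \<le> r \<and> r < n $ b \<longrightarrow>
         (AE \<omega> in M.
            (\<forall>C\<in>components (limit_set n (S \<omega>)). \<exists>x y. C = closed_segment x y \<and> x $ b = y $ b) \<and>
            (\<exists>x y. closed_segment x y \<in> components (limit_set n (S \<omega>)) \<and> x $ b = y $ b \<and> dist x y = 1))) \<and>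
      (n $ b \<le> r \<and> r < n $ a \<longrightarrow>
         (AE \<omega> in M.
            (\<forall>C\<in>components (limit_set n (S \<omega>)). \<exists>x y. C = closed_segment x y \<and> x $ a = y $ a) \<and>
            (\<exists>x y. closed_segment x y \<in> components (limit_set n (S \<omega>)) \<and> x $ a = y $ a \<and> dist x y = 1))) \<and>
      (r \<ge> max (n $ a) (n $ b) \<longrightarrow> (AE \<omega> in M. totally_disconnected (limit_set n (S \<omega>)))) \<and>
      (\<forall>\<omega>\<in>space M. \<forall>k>0. \<forall>q.
         free_abelian (simplicial_homology q (fractal_nerve n (S \<omega>) 0 k)) \<and>
         simplicial_homology q (fractal_nerve n (S \<omega>) 0 k) \<cong> simplicial_cohomology q (fractal_nerve n (S \<omega>) 0 k))"
    (is "?cech \<and> (r = 1 \<longrightarrow> ?h0 \<and> (_ \<longrightarrow> ?h1) \<and> (_ \<longrightarrow> ?grow)) \<and> (?mid \<longrightarrow> ?both) \<and> (?hor \<longrightarrow> ?H) \<and> (?ver \<longrightarrow> ?W) \<and> (?big \<longrightarrow> ?td) \<and> ?free")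
    if d: "CARD('d) = 2" and ab: "a \<noteq> b" for a b
  proof -
    interpret P: planar_fractal n a b
      by unfold_locales (use d ab in auto)
    interpret Q: planar_fractal n b a
      by (rule P.swapped)
    have ge2: "2 \<le> n $ a" "2 \<le> n $ b"
      using assms(1) by auto
    have cech: ?cech
      using P.nerve_acyclic V by (intro ballI allI impI cech_trivial_of_nerves) auto
    have h0: ?h0 if "r = 1"
    proof
      fix \<omega> assume w: "\<omega> \<in> space M"
      show "cech_homology 0 (top_of_set (limit_set n (S \<omega>))) \<cong> integer_group"
        by (rule cech_homology_0_connected[OF connected_limit_set[OF S_regular[OF w]] limit_set_nonempty[OF V[OF w]]])
           (use that d in simp)
    qed
    have h1: ?h1 if "r = 1" "n $ a = 2 \<and> n $ b = 2"
    proof (rule almost)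
      fix T assume T: "regular r T" "recurrent r T"
      have two: "n $ l = 2" for l
        using that(2) P.all_ab[of "\<lambda>l. n $ l = 2"] by blast
      have "acyclic_at (fractal_nerve n T 0 k) (Suc 1)" for k
        using P.nerve_acyclic_two_by_two[OF two, of T k] T(1) recurrent_corner_free[OF T assms(2)] that(1)
        by (simp add: numeral_2_eq_2)
      then show "trivial_group (cech_homology 1 (top_of_set (limit_set n T)))"
        by (intro cech_trivial_of_nerves regular_valid[OF T(1)]) auto
    qed
    have grow: ?grow if "r = 1" "(n $ a, n $ b) \<noteq> (2, 2)"
    proof -
      have "3 * 2 \<le> n $ a * n $ b"
      proof (cases "n $ a = 2")
        case True
        then show ?thesis
          using that(2) ge2 by simp
      next
        case False
        then show ?thesis
          using ge2 by (intro mult_le_mono) auto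
      qed
      then show ?thesis
        using that(1) ge2 by (intro almost P.growth_H1) auto
    qed
    have both: ?both if "?mid"
    proof (rule almost, rule conjI)
      fix T assume T: "regular r T" "recurrent r T"
      show "(\<lambda>k. 1 / real k * ln (real (abelian_rank (simplicial_homology 0 (fractal_nerve n T 0 k)))))
          \<longlonglongrightarrow> ln (real (n $ a) * real (n $ b) - real r)"
        using that by (intro P.growth_H0 T) auto
      show "(\<lambda>k. 1 / real k * ln (real (abelian_rank (simplicial_homology 1 (fractal_nerve n T 0 k)))))
          \<longlonglongrightarrow> ln (real (n $ a) * real (n $ b) - real r)"
        using that P.growth_assumptions[of r] by (intro P.growth_H1 T) auto
    qed
    have hor: ?H if ?hor
    proof (rule almost, intro conjI ballI)
      fix T assume T: "regular r T" "recurrent r T"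
      show "\<exists>x y. C = closed_segment x y \<and> x $ b = y $ b" if "C \<in> components (limit_set n T)" for C
        using P.horizontal_component[OF T _ that] \<open>?hor\<close> by metis
      show "\<exists>x y. closed_segment x y \<in> components (limit_set n T) \<and> x $ b = y $ b \<and> dist x y = 1"
        using P.unit_component[OF T] that by blast
    qed
    have ver: ?W if ?ver
    proof (rule almost, intro conjI ballI)
      fix T assume T: "regular r T" "recurrent r T"
      show "\<exists>x y. C = closed_segment x y \<and> x $ a = y $ a" if "C \<in> components (limit_set n T)" for C
        using Q.horizontal_component[OF T _ that] \<open>?ver\<close> by metis
      show "\<exists>x y. closed_segment x y \<in> components (limit_set n T) \<and> x $ a = y $ a \<and> dist x y = 1"
        using Q.unit_component[OF T] that by blast
    qed
    have td: ?td if ?big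
      by (rule d4) (use that P.prod_other P.all_ab[of "\<lambda>k. (\<Prod>l\<in>UNIV - {k}. n $ l) \<le> r"] in simp)
    have free: ?free
      using P.nerve_homology_free V by blast
    show ?thesis
      by (intro conjI impI) (rule cech h0 h1 grow both hor ver td free; assumption)+
  qed
  show ?thesis
    apply (rule conjI, intro impI, rule d1, assumption)
    apply (rule conjI, intro allI impI, rule d2, assumption)
    apply (rule conjI, intro allI impI, rule d3, assumption)
    apply (rule conjI, intro impI, rule d4, assumption)
    apply (rule impI, intro allI, rule impI, rule plane, assumption+)
    done
qed

end
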